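(* Let the mesh $\Omega_h$ satisfy the mesh regularity assumption and let $P\in\left(0,\frac{\widetilde{\alpha_*}\lambda_1}{2}\right)$. Then the fully discrete scheme (find $U_h^n\in\mathcal Z_h$, $n=2,\dots,N$, with $$m_h\!\left(\tfrac{U_h^{n}-2U_h^{n-1}+U_h^{n-2}}{\Delta t^2},v_h\right)+\delta\, m_h\!\left(\tfrac{U_h^{n}-U_h^{n-2}}{2\Delta t},v_h\right)+\mathcal A_h(U_h^n,v_h)+\Big[S\sum_{E\in\Omega_h}\int_E|\Pi_E^{k-1}D_xU_h^n|^2-P\Big]a_h^x(U_h^n,v_h)=(g_h^n,v_h)_h\quad\forall v_h\in\mathcal Z_h,$$ $U_h^0=I_hu_0$, $U_h^1=U_h^0+\Delta t\,I_h\omega_0$) has a solution. If, further, $S\in\left(0,\frac{\widetilde{\alpha_*}\lambda_1-P}{2d}\right]$, then the solution is unique, where $d$ is the radius of the ball $\mathcal B_d=\{v_h\in\mathcal Z_h:\|v_h\|_{2,\Omega}\le d\}$ and is defined as $$d:=\Big(C(\widetilde{\alpha_*},\widetilde{\alpha^*},m_0)\,\|u_0\|_{2,\Omega}^2+C(\widetilde{\gamma_*},\widetilde{\gamma^*})\,\|\omega_0\|_{2,\Omega}^2+\Delta t\,C(\delta,\widetilde{\gamma_*})\,\|g\|^2_{L^\infty(0,t_n;L^2(\Omega))}\Big)^{1/2},$$ the $C(\cdot)$ being positive constants depending on the displayed arguments.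
   Context: Continuous setting. $\Omega=(0,L)\times(-\ell,\ell)$, $0<\ell\ll L$, $\Gamma_s=\{0,L\}\times[-\ell,\ell]$, $\Gamma_f=[0,L]\times\{-\ell,\ell\}$; $H^2_*(\Omega)=\{\phi\in H^2(\Omega):\phi=0\text{ on }\Gamma_s\}$. $\sigma\in(0,1)$ is the Poisson ratio, $\delta>0$ the damping coefficient, $S>0$ the elasticity coefficient, $P$ the prestressing constant, $T>0$. Data: $g\in C^0([0,T],L^2(\Omega))$, $u_0,\omega_0\in H^2_*(\Omega)$. $\mathcal A(u,v)=\int_\Omega\big(\Delta u\Delta v-(1-\sigma)(u_{xx}v_{yy}+u_{yy}v_{xx}-2u_{xy}v_{xy})\big)$ is the inner product of $H^2_*(\Omega)$; on $H^2_*(\Omega)$, $\|v\|_{2,\Omega}^2$ is understood as $\mathcal A(v,v)$. $\|\cdot\|_{0,\Omega}$ is the $L^2$ norm; $D_x$ is the partial derivative in $x$. $\lambda_1>0$ is the lowest eigenvalue of $\Delta^2w=\lambda w$ in $\Omega$, $w=w_{xx}=0$ on $\Gamma_s$, $w_{yy}+\sigma w_{xx}=w_{yyy}+(2-\sigma)w_{xxy}=0$ on $\Gamma_f$. The following inequalities are taken as known for all $v\in H^2_*(\Omega)$: $\|v\|_{0,\Omega}\le\|D_xv\|_{0,\Omega}$, $\lambda_1\|v\|_{0,\Omega}^2\le\|v\|_{2,\Omega}^2$, $\lambda_1\|D_xv\|_{0,\Omega}^2\le\|v\|_{2,\Omega}^2$. Mesh and virtual element space. $\Omega_h$ is a decomposition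 of $\Omega$ into (possibly nonconvex) polygons $E$ of diameter $h_E$, centroid $\mathbf x_E$, with $N_E$ vertices; $h=\max h_E$. Mesh regularity assumption: for some constant $\gamma>0$ every $E$ is star-shaped with respect to a ball of radius greater than $\gamma h_E$, and every edge $e\subset\partial E$ has $|e|\ge\gamma h_E$. $\mathcal P_k$ denotes polynomials of degree $\le k$; $k\ge2$; $r=\max\{3,k\}$. $\mathcal M^{2,\star}_\alpha(E)$ is the set of scaled monomials $((\mathbf x-\mathbf x_E)/h_E)^s$ with $|s|=\alpha$ (empty for $\alpha=-1$). Let $\widetilde{\mathcal Z_h^E}=\{\phi\in H^2(E):\Delta^2\phi\in\mathcal P_k(E),\ \phi|_{\partial E}\in C^0(\partial E),\ \phi|_e\in\mathcal P_r(e)\ \forall e\subset\partial E,\ \nabla\phi|_{\partial E}\in C^0(\partial E)^2,\ \partial_{\mathbf n}\phi|_e\in\mathcal P_{k-1}(e)\ \forall e\subset\partial E\}$. With $\mathcal A^E$ the restriction of $\mathcal A$ to $E$, $\Pi_E^{k,\Delta}v\in\mathcal P_k(E)$ is defined by $\mathcal A^E(\Pi_E^{k,\Delta}v,q)=\mathcal A^E(v,q)$ for all $q\in\mathcal P_k(E)$ and equality of the vertex averages of $\Pi_E^{k,\Delta}v$ and $v$ and of their gradients. Then $\mathcal Z_h^E=\{\phi\in\widetilde{\mathcal Z_h^E}:\int_Em\,\Pi_E^{k,\Delta}\phi=\int_Em\,\phi\ \ \forall m\in\mathcal M_\alpha^{2,\star}(E),\ \alpha=k,k-1,k-2,k-3\}$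 and $\mathcal Z_h=\{\phi\in H^2_*(\Omega):\phi|_E\in\mathcal Z_h^E\ \forall E\in\Omega_h\}$. $\Pi_E^{j}$ is the $L^2(E)$-orthogonal projection onto $\mathcal P_j(E)$. $I_h$ is the interpolation operator into $\mathcal Z_h$, bounded in $\|\cdot\|_{2,\Omega}$ and satisfying $\|z-I_hz\|_{j,E}\le Ch_E^{s-j}|z|_{s,E}$ for $j=0,1,2$, $2\le s\le k+1$. Discrete forms (sums over $E\in\Omega_h$ of local forms): $\mathcal A_h^E(w,v)=\mathcal A^E(\Pi_E^{k,\Delta}w,\Pi_E^{k,\Delta}v)+\mathcal S_\Delta^E((I-\Pi_E^{k,\Delta})w,(I-\Pi_E^{k,\Delta})v)$, $m_h^E(w,v)=(\Pi_E^kw,\Pi_E^kv)_{0,E}+\mathcal S_m^E((I-\Pi_E^k)w,(I-\Pi_E^k)v)$, $a_h^{x,E}(w,v)=(\Pi_E^{k-1}D_xw,\Pi_E^{k-1}D_xv)_{0,E}$, where $\mathcal S_\Delta^E,\mathcal S_m^E$ are symmetric positive definite bilinear forms, uniformly equivalent to $\mathcal A^E$ on $\ker\Pi_E^{k,\Delta}$ and to $(\cdot,\cdot)_{0,E}$ on $\ker\Pi_E^k$, respectively. There are positive constants, independent of $E$, with $\widetilde{\alpha_*}\mathcal A^E(v,v)\le\mathcal A_h^E(v,v)\le\widetilde{\alpha^*}\mathcal A^E(v,v)$ and $\widetilde{\gamma_*}\|v\|_{0,E}^2\le m_h^E(v,v)\le\widetilde{\gamma^*}\|v\|_{0,E}^2$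 for all $v\in\mathcal Z_h^E$; these are the constants in the claim. Load: $(g_h^n,v_h)_h=\sum_E(\Pi_E^kg(t_n),v_h)_{0,E}$. Time grid: $\Delta t=T/N$, $t_n=n\Delta t$, $N\in\mathbb N$. $\mathcal C_h(q)=S\sum_E\|\Pi_E^{k-1}D_xq\|_{0,E}^2-P$, and $m_0$ is a constant with $|\mathcal C_h(q)|\le m_0$ for all $q\in\mathcal Z_h$. *)

theory Defs
  imports "HOL-Analysis.Analysis" "HOL-Probability.Essential_Supremum"
begin

type_synonym pt = "real \<times> real"
type_synonym fld = "pt \<Rightarrow> real"

section \<open>Classical derivatives and Sobolev spaces\<close>

definition pdx :: "fld \<Rightarrow> fld" where
  "pdx f p = deriv (\<lambda>s. f (s, snd p)) (fst p)"

definition pdy :: "fld \<Rightarrow> fld" where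
  "pdy f p = deriv (\<lambda>s. f (fst p, s)) (snd p)"

definition cD :: "nat \<Rightarrow> nat \<Rightarrow> fld \<Rightarrow> fld" where
  "cD i j f = (pdx ^^ i) ((pdy ^^ j) f)"

definition bilap :: "fld \<Rightarrow> fld" where
  "bilap f p = cD 4 0 f p + 2 * cD 2 2 f p + cD 0 4 f p"

fun Ck :: "nat \<Rightarrow> fld \<Rightarrow> bool" where
  "Ck 0 f \<longleftrightarrow> continuous_on UNIV f"
| "Ck (Suc n) f \<longleftrightarrow> (\<forall>p. f differentiable (at p)) \<and> Ck n (pdx f) \<and> Ck n (pdy f)"

definition smooth :: "fld \<Rightarrow> bool" where
  "smooth f \<longleftrightarrow> (\<forall>n. Ck n f)"

definition test_fun :: "pt set \<Rightarrow> fld set" where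
  "test_fun E = {\<psi>. smooth \<psi> \<and> compact (closure {x. \<psi> x \<noteq> 0}) \<and> closure {x. \<psi> x \<noteq> 0} \<subseteq> E}"

text \<open>Elements of \<open>L\<^sup>2(E)\<close> are represented by functions on the whole space whose values outside
  \<open>E\<close> are irrelevant; restriction to a subdomain is therefore silent, and equality of elements is
  equality almost everywhere on \<open>E\<close>.\<close>

definition L2 :: "'a::euclidean_space set \<Rightarrow> ('a \<Rightarrow> real) set" where
  "L2 E = {u \<in> borel_measurable (lebesgue_on E). integrable (lebesgue_on E) (\<lambda>x. (u x)^2)}"

definition l2ip :: "'a::euclidean_space set \<Rightarrow> ('a \<Rightarrow> real) \<Rightarrow> ('a \<Rightarrow> real) \<Rightarrow> real" where
  "l2ip E u v = integral\<^sup>L (lebesgue_on E) (\<lambda>x. u x * v x)"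

definition l2norm :: "'a::euclidean_space set \<Rightarrow> ('a \<Rightarrow> real) \<Rightarrow> real" where
  "l2norm E u = sqrt (l2ip E u u)"

definition eq_ae :: "pt set \<Rightarrow> fld \<Rightarrow> fld \<Rightarrow> bool" where
  "eq_ae E u v \<longleftrightarrow> (AE x in lebesgue_on E. u x = v x)"

definition is_wderiv :: "pt set \<Rightarrow> nat \<Rightarrow> nat \<Rightarrow> fld \<Rightarrow> fld \<Rightarrow> bool" where
  "is_wderiv E i j u v \<longleftrightarrow> v \<in> L2 E \<and>
     (\<forall>\<psi> \<in> test_fun E. l2ip E u (cD i j \<psi>) = (-1) ^ (i + j) * l2ip E v \<psi>)"

definition wD :: "pt set \<Rightarrow> nat \<Rightarrow> nat \<Rightarrow> fld \<Rightarrow> fld" where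
  "wD E i j u = (SOME v. is_wderiv E i j u v)"

definition Hs :: "nat \<Rightarrow> pt set \<Rightarrow> fld set" where
  "Hs s E = {u \<in> L2 E. \<forall>i j. i + j \<le> s \<longrightarrow> (\<exists>v. is_wderiv E i j u v)}"

definition hsemi :: "nat \<Rightarrow> pt set \<Rightarrow> fld \<Rightarrow> real" where
  "hsemi s E u = sqrt (\<Sum>i\<le>s. (l2norm E (wD E i (s - i) u))^2)"

definition hnorm :: "nat \<Rightarrow> pt set \<Rightarrow> fld \<Rightarrow> real" where
  "hnorm s E u = sqrt (\<Sum>m\<le>s. (hsemi m E u)^2)"

text \<open>\<open>t\<close> is the trace of \<open>w \<in> H\<^sup>1(E)\<close> on the boundary segment from \<open>a\<close> to \<open>b\<close>, obtained as usual
  as the limit of restrictions of functions smooth up to the boundary that converge to \<open>w\<close>.\<close>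

definition edge_trace :: "pt set \<Rightarrow> pt \<Rightarrow> pt \<Rightarrow> fld \<Rightarrow> fld \<Rightarrow> bool" where
  "edge_trace E a b w t \<longleftrightarrow> w \<in> Hs 1 E \<and> (\<lambda>s. t (linepath a b s)) \<in> L2 {0..1} \<and>
     (\<exists>\<psi>. (\<forall>n. smooth (\<psi> n)) \<and>
        (\<lambda>n. hnorm 1 E (\<lambda>x. \<psi> n x - w x)) \<longlonglongrightarrow> 0 \<and>
        (\<lambda>n. l2norm {0..1} (\<lambda>s. \<psi> n (linepath a b s) - t (linepath a b s))) \<longlonglongrightarrow> 0)"

section \<open>The plate\<close>

definition Omega :: "real \<Rightarrow> real \<Rightarrow> pt set" where
  "Omega L l = {0<..<L} \<times> {-l<..<l}"

definition H2star :: "real \<Rightarrow> real \<Rightarrow> fld set" where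
  "H2star L l = {\<phi> \<in> Hs 2 (Omega L l).
     edge_trace (Omega L l) (0, -l) (0, l) \<phi> (\<lambda>_. 0) \<and>
     edge_trace (Omega L l) (L, -l) (L, l) \<phi> (\<lambda>_. 0)}"

definition Aform :: "real \<Rightarrow> pt set \<Rightarrow> fld \<Rightarrow> fld \<Rightarrow> real" where
  "Aform \<sigma> E u v = integral\<^sup>L (lebesgue_on E) (\<lambda>x.
     (wD E 2 0 u x + wD E 0 2 u x) * (wD E 2 0 v x + wD E 0 2 v x)
     - (1 - \<sigma>) * (wD E 2 0 u x * wD E 0 2 v x + wD E 0 2 u x * wD E 2 0 v x
                  - 2 * wD E 1 1 u x * wD E 1 1 v x))"

definition enorm :: "real \<Rightarrow> real \<Rightarrow> real \<Rightarrow> fld \<Rightarrow> real" where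
  "enorm \<sigma> L l v = sqrt (Aform \<sigma> (Omega L l) v v)"

text \<open>Classical eigenvalues; \<open>C\<^sup>4\<close> up to the boundary is expressed through a \<open>C\<^sup>4\<close> extension to the
  plane.\<close>

definition plate_eigenvalue :: "real \<Rightarrow> real \<Rightarrow> real \<Rightarrow> real \<Rightarrow> bool" where
  "plate_eigenvalue \<sigma> L l lam \<longleftrightarrow> (\<exists>w. Ck 4 w \<and> (\<exists>p \<in> Omega L l. w p \<noteq> 0) \<and>
     (\<forall>p \<in> Omega L l. bilap w p = lam * w p) \<and>
     (\<forall>p \<in> {0, L} \<times> {-l..l}. w p = 0 \<and> cD 2 0 w p = 0) \<and>
     (\<forall>p \<in> {0..L} \<times> {-l, l}. cD 0 2 w p + \<sigma> * cD 2 0 w p = 0 \<and>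
                              cD 0 3 w p + (2 - \<sigma>) * cD 2 1 w p = 0))"

definition least_plate_eigenvalue :: "real \<Rightarrow> real \<Rightarrow> real \<Rightarrow> real \<Rightarrow> bool" where
  "least_plate_eigenvalue \<sigma> L l lam \<longleftrightarrow>
     plate_eigenvalue \<sigma> L l lam \<and> (\<forall>\<mu>. plate_eigenvalue \<sigma> L l \<mu> \<longrightarrow> lam \<le> \<mu>)"

definition C0_L2 :: "real \<Rightarrow> pt set \<Rightarrow> (real \<Rightarrow> fld) \<Rightarrow> bool" where
  "C0_L2 T E g \<longleftrightarrow> (\<forall>t \<in> {0..T}. g t \<in> L2 E \<and>
     ((\<lambda>s. l2norm E (\<lambda>x. g s x - g t x)) \<longlongrightarrow> 0) (at t within {0..T}))"

definition LinfL2 :: "real \<Rightarrow> pt set \<Rightarrow> (real \<Rightarrow> fld) \<Rightarrow> real" where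
  "LinfL2 t E g = real_of_ereal (esssup (lebesgue_on {0<..<t}) (\<lambda>s. ereal (l2norm E (g s))))"

section \<open>Polygonal meshes\<close>

text \<open>A polygon is given by the cyclic list of its vertices. Consecutive edges may be collinear, so
  hanging nodes count as vertices.\<close>

type_synonym poly2 = "pt list"

definition nxt :: "poly2 \<Rightarrow> nat \<Rightarrow> pt" where
  "nxt vs i = vs ! (Suc i mod length vs)"

definition edge :: "poly2 \<Rightarrow> nat \<Rightarrow> pt set" where
  "edge vs i = closed_segment (vs ! i) (nxt vs i)"

definition bdry :: "poly2 \<Rightarrow> pt set" where
  "bdry vs = (\<Union>i<length vs. edge vs i)"

definition region :: "poly2 \<Rightarrow> pt set" where
  "region vs = inside (bdry vs)"

definition polygon :: "poly2 \<Rightarrow> bool" where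
  "polygon vs \<longleftrightarrow> 3 \<le> length vs \<and> distinct vs \<and>
     (\<forall>i<length vs. \<forall>j<length vs. i \<noteq> j \<longrightarrow>
        edge vs i \<inter> edge vs j = {vs ! i, nxt vs i} \<inter> {vs ! j, nxt vs j})"

definition mesh :: "pt set \<Rightarrow> poly2 set \<Rightarrow> bool" where
  "mesh E M \<longleftrightarrow> finite M \<and> (\<forall>vs \<in> M. polygon vs) \<and>
     (\<forall>vs \<in> M. \<forall>ws \<in> M. vs \<noteq> ws \<longrightarrow> region vs \<inter> region ws = {}) \<and>
     (\<Union>vs\<in>M. closure (region vs)) = closure E"

definition diam :: "poly2 \<Rightarrow> real" where
  "diam vs = diameter (region vs)"

definition centroid :: "poly2 \<Rightarrow> pt" where
  "centroid vs = (1 / measure lebesgue (region vs)) *\<^sub>R integral\<^sup>L (lebesgue_on (region vs)) (\<lambda>x. x)"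

definition star_shaped_ball :: "pt set \<Rightarrow> pt \<Rightarrow> real \<Rightarrow> bool" where
  "star_shaped_ball E c \<rho> \<longleftrightarrow>
     ball c \<rho> \<subseteq> E \<and> (\<forall>z \<in> ball c \<rho>. \<forall>x \<in> E. closed_segment z x \<subseteq> E)"

definition mesh_regular :: "real \<Rightarrow> poly2 set \<Rightarrow> bool" where
  "mesh_regular \<gamma> M \<longleftrightarrow> (\<forall>vs \<in> M.
     (\<exists>c \<rho>. \<rho> > \<gamma> * diam vs \<and> star_shaped_ball (region vs) c \<rho>) \<and>
     (\<forall>i<length vs. dist (vs ! i) (nxt vs i) \<ge> \<gamma> * diam vs))"

section \<open>Virtual element space\<close>

definition Pk :: "nat \<Rightarrow> fld set" where
  "Pk k = {p. \<exists>c. \<forall>x y. p (x, y) = (\<Sum>i\<le>k. \<Sum>j\<le>k - i. c i j * x ^ i * y ^ j)}"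

definition scaled_monomials :: "poly2 \<Rightarrow> nat \<Rightarrow> fld set" where
  "scaled_monomials vs \<alpha> = {m. \<exists>i j. i + j = \<alpha> \<and>
     m = (\<lambda>(x, y). ((x - fst (centroid vs)) / diam vs) ^ i * ((y - snd (centroid vs)) / diam vs) ^ j)}"

text \<open>\<open>t\<close> is continuous on the boundary of the polygon and is the trace of \<open>w\<close>.\<close>

definition cont_trace :: "poly2 \<Rightarrow> fld \<Rightarrow> fld \<Rightarrow> bool" where
  "cont_trace vs w t \<longleftrightarrow> continuous_on (bdry vs) t \<and>
     (\<forall>i<length vs. edge_trace (region vs) (vs ! i) (nxt vs i) w t)"

definition bval :: "poly2 \<Rightarrow> fld \<Rightarrow> fld" where
  "bval vs w = (SOME t. cont_trace vs w t)"

definition enormal :: "poly2 \<Rightarrow> nat \<Rightarrow> pt" where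
  "enormal vs i = (let e = nxt vs i - vs ! i in (1 / norm e) *\<^sub>R (snd e, - fst e))"

text \<open>The condition on the bilaplacian is in the sense of distributions. The orientation of the
  normal is immaterial.\<close>

definition Ztilde :: "nat \<Rightarrow> poly2 \<Rightarrow> fld set" where
  "Ztilde k vs = {\<phi> \<in> Hs 2 (region vs).
     (\<exists>p \<in> Pk k. \<forall>\<psi> \<in> test_fun (region vs). l2ip (region vs) \<phi> (bilap \<psi>) = l2ip (region vs) p \<psi>) \<and>
     (\<exists>t gx gy. cont_trace vs \<phi> t \<and>
        cont_trace vs (wD (region vs) 1 0 \<phi>) gx \<and> cont_trace vs (wD (region vs) 0 1 \<phi>) gy \<and>
        (\<forall>i<length vs.
           (\<exists>q \<in> Pk (max 3 k). \<forall>x \<in> edge vs i. t x = q x) \<and>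
           (\<exists>q \<in> Pk (k - 1). \<forall>x \<in> edge vs i. (gx x, gy x) \<bullet> enormal vs i = q x)))}"

definition vavg :: "poly2 \<Rightarrow> fld \<Rightarrow> real" where
  "vavg vs f = (\<Sum>i<length vs. f (vs ! i)) / real (length vs)"

definition PiD :: "real \<Rightarrow> nat \<Rightarrow> poly2 \<Rightarrow> fld \<Rightarrow> fld" where
  "PiD \<sigma> k vs v = (THE p. p \<in> Pk k \<and>
     (\<forall>q \<in> Pk k. Aform \<sigma> (region vs) p q = Aform \<sigma> (region vs) v q) \<and>
     vavg vs p = vavg vs (bval vs v) \<and>
     vavg vs (pdx p) = vavg vs (bval vs (wD (region vs) 1 0 v)) \<and>
     vavg vs (pdy p) = vavg vs (bval vs (wD (region vs) 0 1 v)))"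

definition PiL :: "nat \<Rightarrow> pt set \<Rightarrow> fld \<Rightarrow> fld" where
  "PiL j E w = (THE p. p \<in> Pk j \<and> (\<forall>q \<in> Pk j. l2ip E p q = l2ip E w q))"

text \<open>The moment orders are \<open>k, k-1, k-2, k-3\<close>, negative orders being void.\<close>

definition ZE :: "real \<Rightarrow> nat \<Rightarrow> poly2 \<Rightarrow> fld set" where
  "ZE \<sigma> k vs = {\<phi> \<in> Ztilde k vs. \<forall>\<alpha>. k \<le> \<alpha> + 3 \<and> \<alpha> \<le> k \<longrightarrow>
     (\<forall>m \<in> scaled_monomials vs \<alpha>. l2ip (region vs) m (PiD \<sigma> k vs \<phi>) = l2ip (region vs) m \<phi>)}"

definition Zh :: "real \<Rightarrow> real \<Rightarrow> real \<Rightarrow> nat \<Rightarrow> poly2 set \<Rightarrow> fld set" where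
  "Zh \<sigma> L l k M = {\<phi> \<in> H2star L l. \<forall>vs \<in> M. \<phi> \<in> ZE \<sigma> k vs}"

text \<open>The interpolation estimate is required with the seminorm of \<open>z\<close> over all elements touching
  the given one, a weaker requirement than with its seminorm over that element alone; only integer
  orders \<open>s\<close> are required.\<close>

definition patch_semi :: "nat \<Rightarrow> poly2 set \<Rightarrow> poly2 \<Rightarrow> fld \<Rightarrow> real" where
  "patch_semi s M vs z = sqrt (\<Sum>ws \<in> {ws \<in> M. closure (region ws) \<inter> closure (region vs) \<noteq> {}}.
     (hsemi s (region ws) z)^2)"

definition interpolation_op ::
  "real \<Rightarrow> real \<Rightarrow> real \<Rightarrow> nat \<Rightarrow> poly2 set \<Rightarrow> (fld \<Rightarrow> fld) \<Rightarrow> bool" where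
  "interpolation_op \<sigma> L l k M I \<longleftrightarrow>
     (\<forall>z \<in> H2star L l. I z \<in> Zh \<sigma> L l k M) \<and>
     (\<exists>C. \<forall>z \<in> H2star L l. enorm \<sigma> L l (I z) \<le> C * enorm \<sigma> L l z) \<and>
     (\<exists>C. \<forall>s j. 2 \<le> s \<and> s \<le> k + 1 \<and> j \<le> 2 \<longrightarrow>
        (\<forall>z \<in> H2star L l \<inter> Hs s (Omega L l). \<forall>vs \<in> M.
           hnorm j (region vs) (\<lambda>x. z x - I z x) \<le> C * diam vs ^ (s - j) * patch_semi s M vs z))"

section \<open>Discrete forms and scheme\<close>

type_synonym stab = "poly2 \<Rightarrow> fld \<Rightarrow> fld \<Rightarrow> real"

text \<open>The last clause makes the form well defined on classes modulo equality almost everywhere.\<close>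

definition spd_form :: "pt set \<Rightarrow> fld set \<Rightarrow> (fld \<Rightarrow> fld \<Rightarrow> real) \<Rightarrow> bool" where
  "spd_form E V B \<longleftrightarrow>
     (\<forall>u \<in> V. \<forall>v \<in> V. B u v = B v u) \<and>
     (\<forall>u \<in> V. \<forall>v \<in> V. \<forall>w \<in> V. \<forall>a b. B (\<lambda>x. a * u x + b * v x) w = a * B u w + b * B v w) \<and>
     (\<forall>u \<in> V. B u u \<ge> 0 \<and> (B u u = 0 \<longleftrightarrow> eq_ae E u (\<lambda>_. 0)))"

definition stabilizers :: "real \<Rightarrow> nat \<Rightarrow> poly2 set \<Rightarrow> stab \<Rightarrow> stab \<Rightarrow> bool" where
  "stabilizers \<sigma> k M SD Sm \<longleftrightarrow>
     (\<forall>vs \<in> M. spd_form (region vs) (ZE \<sigma> k vs) (SD vs) \<and> spd_form (region vs) (ZE \<sigma> k vs) (Sm vs)) \<and>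
     (\<exists>c0 c1. 0 < c0 \<and> 0 < c1 \<and> (\<forall>vs \<in> M. \<forall>v \<in> ZE \<sigma> k vs. PiD \<sigma> k vs v = (\<lambda>_. 0) \<longrightarrow>
        c0 * Aform \<sigma> (region vs) v v \<le> SD vs v v \<and> SD vs v v \<le> c1 * Aform \<sigma> (region vs) v v)) \<and>
     (\<exists>c0 c1. 0 < c0 \<and> 0 < c1 \<and> (\<forall>vs \<in> M. \<forall>v \<in> ZE \<sigma> k vs. PiL k (region vs) v = (\<lambda>_. 0) \<longrightarrow>
        c0 * l2ip (region vs) v v \<le> Sm vs v v \<and> Sm vs v v \<le> c1 * l2ip (region vs) v v))"

definition AhE :: "real \<Rightarrow> nat \<Rightarrow> stab \<Rightarrow> poly2 \<Rightarrow> fld \<Rightarrow> fld \<Rightarrow> real" where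
  "AhE \<sigma> k SD vs w v = Aform \<sigma> (region vs) (PiD \<sigma> k vs w) (PiD \<sigma> k vs v)
     + SD vs (\<lambda>x. w x - PiD \<sigma> k vs w x) (\<lambda>x. v x - PiD \<sigma> k vs v x)"

definition mhE :: "nat \<Rightarrow> stab \<Rightarrow> poly2 \<Rightarrow> fld \<Rightarrow> fld \<Rightarrow> real" where
  "mhE k Sm vs w v = l2ip (region vs) (PiL k (region vs) w) (PiL k (region vs) v)
     + Sm vs (\<lambda>x. w x - PiL k (region vs) w x) (\<lambda>x. v x - PiL k (region vs) v x)"

definition PiDx :: "nat \<Rightarrow> poly2 \<Rightarrow> fld \<Rightarrow> fld" where
  "PiDx k vs w = PiL (k - 1) (region vs) (wD (region vs) 1 0 w)"

definition Ah :: "real \<Rightarrow> nat \<Rightarrow> poly2 set \<Rightarrow> stab \<Rightarrow> fld \<Rightarrow> fld \<Rightarrow> real" where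
  "Ah \<sigma> k M SD w v = (\<Sum>vs\<in>M. AhE \<sigma> k SD vs w v)"

definition mh :: "nat \<Rightarrow> poly2 set \<Rightarrow> stab \<Rightarrow> fld \<Rightarrow> fld \<Rightarrow> real" where
  "mh k M Sm w v = (\<Sum>vs\<in>M. mhE k Sm vs w v)"

definition axh :: "nat \<Rightarrow> poly2 set \<Rightarrow> fld \<Rightarrow> fld \<Rightarrow> real" where
  "axh k M w v = (\<Sum>vs\<in>M. l2ip (region vs) (PiDx k vs w) (PiDx k vs v))"

definition load :: "nat \<Rightarrow> poly2 set \<Rightarrow> fld \<Rightarrow> fld \<Rightarrow> real" where
  "load k M f v = (\<Sum>vs\<in>M. l2ip (region vs) (PiL k (region vs) f) v)"

definition Ch :: "real \<Rightarrow> real \<Rightarrow> nat \<Rightarrow> poly2 set \<Rightarrow> fld \<Rightarrow> real" where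
  "Ch S P k M q = S * (\<Sum>vs\<in>M. (l2norm (region vs) (PiDx k vs q))^2) - P"

definition scheme_solution ::
  "real \<Rightarrow> real \<Rightarrow> real \<Rightarrow> real \<Rightarrow> real \<Rightarrow> real \<Rightarrow> nat \<Rightarrow> poly2 set \<Rightarrow> stab \<Rightarrow> stab \<Rightarrow>
   (fld \<Rightarrow> fld) \<Rightarrow> fld \<Rightarrow> fld \<Rightarrow> (real \<Rightarrow> fld) \<Rightarrow> real \<Rightarrow> nat \<Rightarrow> (nat \<Rightarrow> fld) \<Rightarrow> bool" where
  "scheme_solution \<sigma> L l \<delta> S P k M SD Sm I u0 \<omega>0 g T N U \<longleftrightarrow> (let \<Delta>t = T / real N in
     eq_ae (Omega L l) (U 0) (I u0) \<and>
     eq_ae (Omega L l) (U 1) (\<lambda>x. U 0 x + \<Delta>t * I \<omega>0 x) \<and>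
     (\<forall>n \<in> {2..N}. U n \<in> Zh \<sigma> L l k M \<and>
        (\<forall>v \<in> Zh \<sigma> L l k M.
           mh k M Sm (\<lambda>x. (U n x - 2 * U (n - 1) x + U (n - 2) x) / \<Delta>t^2) v
           + \<delta> * mh k M Sm (\<lambda>x. (U n x - U (n - 2) x) / (2 * \<Delta>t)) v
           + Ah \<sigma> k M SD (U n) v
           + Ch S P k M (U n) * axh k M (U n) v
           = load k M (g (real n * \<Delta>t)) v)))"

end

theory Submission
  imports Defs
begin

text \<open>Every time step is a variational problem \<open>B(u, v) + S a(u, u) a(u, v) = F(v)\<close> on the space
  \<open>Z\<^sub>h\<close>, where \<open>B = \<kappa> m\<^sub>h + \<A>\<^sub>h - P a\<^sub>h\<^sup>x\<close> with \<open>\<kappa> = 1/\<Delta>t\<^sup>2 + \<delta>/(2 \<Delta>t)\<close> and \<open>a = a\<^sub>h\<^sup>x\<close>.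
  As the \<open>L\<^sup>2\<close> projections are contractions, \<open>a(v, v) \<le> \<parallel>v\<parallel>\<^sup>2 / \<lambda>\<^sub>1\<close>, so the bound on \<open>P\<close> makes \<open>B\<close>
  coercive. Solutions are the critical points of the strictly convex functional
  \<open>B(v, v)/2 + S a(v, v)\<^sup>2/4 - F(v)\<close>: a minimising sequence is Cauchy, which gives existence, and
  monotonicity of the cubic term gives uniqueness up to null sets.

  The minimiser must be found inside \<open>Z\<^sub>h\<close>, so the point is that \<open>Z\<^sub>h\<close> is complete. In the
  definition of the local spaces the polynomial bilaplacian, the edge polynomials of the traces and
  the moment conditions range over finite-dimensional data; each of these is shown to survive
  convergence in \<open>H\<^sup>2\<close>. For traces this uses Green's formula in a one-sided collar of an edge,
  which star-shapedness of the element provides and which also makes traces unique. On the plate,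
  \<open>D\<^sub>y v\<close> is recovered from \<open>v\<close> and \<open>D\<^sub>y\<^sub>y v\<close> by a one-dimensional integral kernel.\<close>

section \<open>Semi-inner products on sets of functions\<close>

text \<open>That \<open>Zh\<close> has finite dimension is never established: its elements solve
  biharmonic problems, and a dimension count would need their solvability theory. Closedness under
  H^2 convergence takes its place, and minimisation takes the place of a fixed-point argument.
  Functions are not identified almost everywhere, so the forms are semidefinite and uniqueness means
  a null difference. Traces and weak derivatives are existential or chosen, so they must be shown
  unique before a limit can be identified. The polynomial data of an element are existential too.
  For the bilaplacian and for the edges the pattern is: test with polynomials times a weight,
  represent the limit functional by a polynomial, and upgrade weak to strong convergence in a finite
  span. The local space prescribes only the normal part of the gradient on an edge, whereas both
  components must be continuous at vertices; hence the tangential derivative of a trace. The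
  coercive form controls v, D_x v and the second derivatives, hence the separate estimate for D_y
  v.\<close>

definition lin_on :: "('a => real) set => (('a => real) => real) => bool" where
  "lin_on V F \<longleftrightarrow> (\<forall>u\<in>V. \<forall>v\<in>V. \<forall>a b. F (\<lambda>x. a * u x + b * v x) = a * F u + b * F v)"

lemma lin_onD: "lin_on V F ==> u \<in> V ==> v \<in> V ==> F (\<lambda>x. a * u x + b * v x) = a * F u + b * F v"
  by (simp add: lin_on_def)

lemma lin_on_diff: "lin_on V F ==> u \<in> V ==> v \<in> V ==> F (\<lambda>x. u x - v x) = F u - F v"
  using lin_onD[of V F u v 1 "-1"] by simp

abbreviation lc :: "real => ('a => real) => real => ('a => real) => 'a => real" where
  "lc a u b v \<equiv> \<lambda>x. a * u x + b * v x"

locale lin_space =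
  fixes V :: "('a => real) set"
  assumes zero: "(\<lambda>_. 0) \<in> V"
    and comb: "u \<in> V ==> v \<in> V ==> (lc a u b v) \<in> V"
begin

lemma diff: "u \<in> V ==> v \<in> V ==> (\<lambda>x. u x - v x) \<in> V"
  using comb[of u v 1 "-1"] by simp

lemma add: "u \<in> V ==> v \<in> V ==> (\<lambda>x. u x + v x) \<in> V"
  using comb[of u v 1 1] by simp

lemma scale: "u \<in> V ==> (\<lambda>x. a * u x) \<in> V"
  using comb[of u u a 0] by simp

lemma sum: "finite I ==> (\<And>i. i \<in> I ==> e i \<in> V) ==> (\<lambda>x. \<Sum>i\<in>I. c i * e i x) \<in> V"
proof (induction I rule: finite_induct)
  case empty then show ?case by (simp add: zero)
next
  case (insert i I)
  then show ?case using comb[of "e i" "\<lambda>x. \<Sum>i\<in>I. c i * e i x" "c i" 1] by simp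
qed

lemma lin_on_zero: "lin_on V F ==> F (\<lambda>_. 0) = 0"
  using lin_onD[of V F "\<lambda>_. 0" "\<lambda>_. 0" 0 0] zero by simp

lemma lin_on_sum:
  assumes F: "lin_on V F"
  shows "finite I ==> (\<And>i. i \<in> I ==> e i \<in> V) ==> F (\<lambda>x. \<Sum>i\<in>I. c i * e i x) = (\<Sum>i\<in>I. c i * F (e i))"
proof (induction I rule: finite_induct)
  case empty then show ?case by (simp add: lin_on_zero[OF F])
next
  case (insert i I)
  then show ?case using lin_onD[OF F, of "e i" "\<lambda>x. \<Sum>i\<in>I. c i * e i x" "c i" 1] sum[of I e c] by simp
qed

end

text \<open>The carrier is a set of functions rather than a type, and only semidefiniteness is asked
  for: functions that vanish almost everywhere are null vectors of the forms on L^2 and on the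
  virtual element space. The same locale serves \<open>l2ip\<close>, \<open>Aform\<close> and the
  discrete forms.\<close>

locale psd_form = lin_space V for V :: "('a => real) set" +
  fixes B :: "('a => real) => ('a => real) => real"
  assumes sym: "u \<in> V ==> v \<in> V ==> B u v = B v u"
    and lin: "u \<in> V ==> v \<in> V ==> w \<in> V ==> B (lc a u b v) w = a * B u w + b * B v w"
    and nonneg: "u \<in> V ==> 0 \<le> B u u"
begin

lemma lin_on_left: "w \<in> V ==> lin_on V (\<lambda>u. B u w)"
  by (simp add: lin_on_def lin)

lemma lin_right: "u \<in> V ==> v \<in> V ==> w \<in> V ==> B w (lc a u b v) = a * B w u + b * B w v"
  using lin[of u v w a b] sym[of w] comb[of u v a b] by metis

lemma lin_on_right: "w \<in> V ==> lin_on V (B w)"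
  by (simp add: lin_on_def lin_right)

lemma quad: "u \<in> V ==> v \<in> V ==> B (lc a u b v) (lc a u b v)
    = a\<^sup>2 * B u u + 2 * a * b * B u v + b\<^sup>2 * B v v"
  using lin[of u v "\<lambda>x. a * u x + b * v x" a b] comb[of u v a b] sym[of u v]
  by (simp add: lin_right) (simp add: algebra_simps power2_eq_square)

lemma quad_diff: "u \<in> V ==> v \<in> V ==> B (\<lambda>x. u x - v x) (\<lambda>x. u x - v x) = B u u - 2 * B u v + B v v"
  using quad[of u v 1 "-1"] by simp

lemma cauchy_schwarz:
  assumes u: "u \<in> V" and v: "v \<in> V"
  shows "(B u v)\<^sup>2 \<le> B u u * B v v"
proof -
  have *: "0 \<le> a\<^sup>2 * B u u + 2 * a * b * B u v + b\<^sup>2 * B v v" for a b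
    using nonneg[OF comb[OF u v, of a b]] quad[OF u v, of a b] by simp
  show ?thesis
  proof (cases "B v v = 0")
    case True
    have "B u v = 0"
    proof (rule ccontr)
      assume "B u v \<noteq> 0"
      then show False
        using *[of 1 "- (B u u + 1) / (2 * B u v)"] True by (simp add: field_simps)
    qed
    then show ?thesis using True by simp
  next
    case False
    then have "0 < B v v" using nonneg[OF v] by simp
    moreover have "0 \<le> (B v v) * (B u u * B v v - (B u v)\<^sup>2)"
      using *[of "B v v" "- B u v"] by (simp add: algebra_simps power2_eq_square)
    ultimately show ?thesis by (simp add: zero_le_mult_iff)
  qed
qed

lemma cauchy_schwarz_abs:
  assumes u: "u \<in> V" and v: "v \<in> V"
  shows "\<bar>B u v\<bar> \<le> sqrt (B u u) * sqrt (B v v)"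
  using cauchy_schwarz[OF u v] by (metis real_sqrt_abs real_sqrt_le_mono real_sqrt_mult)

lemma null_left: "u \<in> V ==> v \<in> V ==> B u u = 0 ==> B u v = 0"
  using cauchy_schwarz[of u v] by simp

lemma triangle:
  assumes u: "u \<in> V" and v: "v \<in> V"
  shows "sqrt (B (\<lambda>x. u x + v x) (\<lambda>x. u x + v x)) \<le> sqrt (B u u) + sqrt (B v v)"
proof (rule real_le_lsqrt)
  show "0 \<le> sqrt (B u u) + sqrt (B v v)" by (simp add: nonneg u v)
  have "B u v \<le> sqrt (B u u) * sqrt (B v v)" using cauchy_schwarz_abs[OF u v] by simp
  then show "B (\<lambda>x. u x + v x) (\<lambda>x. u x + v x) \<le> (sqrt (B u u) + sqrt (B v v))\<^sup>2"
    using quad[OF u v, of 1 1] nonneg[OF u] nonneg[OF v] by (simp add: power2_sum)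
qed

lemma triangle_diff:
  assumes u: "u \<in> V" and v: "v \<in> V" and w: "w \<in> V"
  shows "sqrt (B (\<lambda>x. u x - w x) (\<lambda>x. u x - w x))
    \<le> sqrt (B (\<lambda>x. u x - v x) (\<lambda>x. u x - v x)) + sqrt (B (\<lambda>x. v x - w x) (\<lambda>x. v x - w x))"
  using triangle[OF diff[OF u v] diff[OF v w]] by simp

lemma conv_left:
  assumes u: "\<And>n. u n \<in> V" and v: "v \<in> V" and w: "w \<in> V"
    and lim: "(\<lambda>n. B (\<lambda>x. u n x - v x) (\<lambda>x. u n x - v x)) \<longlonglongrightarrow> 0"
  shows "(\<lambda>n. B (u n) w) \<longlonglongrightarrow> B v w"
proof -
  have "(\<lambda>n. sqrt (B (\<lambda>x. u n x - v x) (\<lambda>x. u n x - v x)) * sqrt (B w w)) \<longlonglongrightarrow> sqrt 0 * sqrt (B w w)"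
    by (intro tendsto_intros lim)
  then have "(\<lambda>n. B (u n) w - B v w) \<longlonglongrightarrow> 0"
  proof (rule Lim_null_comparison[rotated, OF tendsto_eq_rhs], goal_cases)
    case 1 then show ?case by simp
  next
    case 2
    show ?case
      using cauchy_schwarz_abs[OF diff[OF u v] w] lin_on_diff[OF lin_on_left[OF w] u v]
      by (intro always_eventually) simp
  qed
  then show ?thesis by (simp add: LIM_zero_iff)
qed

end

section \<open>Finite spans: Gram-Schmidt, Riesz representation, weak convergence\<close>

definition span_of :: "'i set => ('i => 'a => real) => ('a => real) set" where
  "span_of I b = {f. \<exists>c. \<forall>x. f x = (\<Sum>i\<in>I. c i * b i x)}"

lemma span_of_lin_space:
  fixes b :: "'i => 'b => real"
  shows "lin_space (span_of I b)"
proof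
  show "(\<lambda>_. 0) \<in> span_of I b" by (auto simp: span_of_def intro!: exI[of _ "\<lambda>_. 0"])
  fix u v :: "'b => real" and s t :: real
  assume "u \<in> span_of I b" "v \<in> span_of I b"
  then obtain c d where "\<forall>x. u x = (\<Sum>i\<in>I. c i * b i x)" "\<forall>x. v x = (\<Sum>i\<in>I. d i * b i x)"
    by (auto simp: span_of_def)
  then show "lc s u t v \<in> span_of I b"
    by (auto simp: span_of_def sum_distrib_left sum.distrib algebra_simps intro!: exI[of _ "\<lambda>i. s * c i + t * d i"])
qed

lemma span_of_mono: "finite J ==> I \<subseteq> J ==> span_of I b \<subseteq> span_of J b"
proof
  fix u assume J: "finite J" "I \<subseteq> J" and "u \<in> span_of I b"
  then obtain c where c: "\<forall>x. u x = (\<Sum>i\<in>I. c i * b i x)" by (auto simp: span_of_def)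
  have "(\<Sum>i\<in>I. c i * b i x) = (\<Sum>i\<in>J. (if i \<in> I then c i else 0) * b i x)" for x
    using J by (intro sum.mono_neutral_cong_left) auto
  then show "u \<in> span_of J b" using c by (auto simp: span_of_def)
qed

lemma span_of_base: "finite I ==> i \<in> I ==> b i \<in> span_of I b"
  by (auto simp: span_of_def if_distrib[of "\<lambda>c. c * _"] cong: if_cong intro!: exI[of _ "\<lambda>j. if j = i then 1 else 0"])

lemma psd_form_subset:
  assumes "psd_form V B" "lin_space W" "W \<subseteq> V" shows "psd_form W B"
proof -
  interpret psd_form V B by fact
  interpret W: lin_space W by fact
  show ?thesis using assms(3) sym lin nonneg by unfold_locales (auto simp: subset_iff)
qed

text \<open>Gram-Schmidt for a seminorm. The generators may be dependent or null, so the expansion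
  of q in the orthonormal system is only required to leave a remainder of seminorm zero, and a
  generator that adds nothing new up to null vectors is skipped.\<close>

lemma orthonormal_basis:
  assumes "finite I" "psd_form (span_of I b) G"
  shows "\<exists>(m::nat) e. (\<forall>i<m. e i \<in> span_of I b) \<and> (\<forall>i<m. \<forall>j<m. G (e i) (e j) = (if i = j then 1 else 0)) \<and>
    (\<forall>q\<in>span_of I b. G (\<lambda>x. q x - (\<Sum>i<m. G q (e i) * e i x)) (\<lambda>x. q x - (\<Sum>i<m. G q (e i) * e i x)) = 0)"
  using assms
proof (induction I rule: finite_induct)
  case empty
  then interpret psd_form "span_of {} b" G .
  have "G (\<lambda>x. 0) (\<lambda>x. 0) = 0" using lin_on_zero[OF lin_on_left[OF zero]] .
  then show ?case by (auto intro!: exI[of _ 0] simp: span_of_def)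
next
  case (insert k I)
  let ?W = "span_of (insert k I) b"
  interpret psd_form ?W G by fact
  have sub: "span_of I b \<subseteq> ?W" using insert by (intro span_of_mono) auto
  have "psd_form (span_of I b) G"
    using insert.prems span_of_lin_space sub by (rule psd_form_subset)
  from insert.IH[OF this] obtain m :: nat and e where e': "\<forall>i<m. e i \<in> span_of I b"
    and on': "\<forall>i<m. \<forall>j<m. G (e i) (e j) = (if i = j then 1 else 0)"
    and nul': "\<forall>q\<in>span_of I b. G (\<lambda>x. q x - (\<Sum>i<m. G q (e i) * e i x)) (\<lambda>x. q x - (\<Sum>i<m. G q (e i) * e i x)) = 0"
    by (elim exE conjE) (rule that)
  note e = e'[rule_format] and on = on'[rule_format] and nul = nul'[rule_format]
  have eW: "e i \<in> ?W" if "i < m" for i using e sub that by blast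
  have bW: "b k \<in> ?W" using insert by (intro span_of_base) auto
  define P where "P q x = (\<Sum>i<m. G q (e i) * e i x)" for q x
  have PW: "P q \<in> ?W" for q unfolding P_def using sum[of "{..<m}" e "\<lambda>i. G q (e i)"] eW by simp
  define f where "f x = b k x - P (b k) x" for x
  have fW: "f \<in> ?W" unfolding f_def using diff[OF bW PW] .
  have Pe: "G (P q) (e j) = G q (e j)" if "q \<in> ?W" "j < m" for q j
  proof -
    have "G (P q) (e j) = (\<Sum>i<m. G q (e i) * G (e i) (e j))"
      unfolding P_def using lin_on_sum[OF lin_on_left[OF eW[OF that(2)]], of "{..<m}" e "\<lambda>i. G q (e i)"] eW by simp
    also have "\<dots> = (\<Sum>i<m. if i = j then G q (e i) else 0)" by (intro sum.cong) (auto simp: on that)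
    finally show ?thesis using that by simp
  qed
  have fe: "G f (e j) = 0" if "j < m" for j
    unfolding f_def using lin_on_diff[OF lin_on_left[OF eW[OF that]] bW PW] Pe[OF bW that] by simp
  have fP: "G f (P q) = 0" for q
    unfolding P_def using lin_on_sum[OF lin_on_right[OF fW], of "{..<m}" e "\<lambda>i. G q (e i)"] eW fe by simp
  have fq: "G f q = 0" if q: "q \<in> span_of I b" for q
  proof -
    have qW: "q \<in> ?W" using q sub by auto
    have "G (\<lambda>x. q x - P q x) f = 0"
      by (rule null_left[OF diff[OF qW PW] fW]) (use nul[OF q] P_def in simp)
    then have "G q f - G (P q) f = 0" using lin_on_diff[OF lin_on_left[OF fW] qW PW] by simp
    then show ?thesis using fP[of q] sym[OF fW qW] sym[OF fW PW, of q] by simp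
  qed
  have decomp: "\<exists>c q0. q0 \<in> span_of I b \<and> q = (\<lambda>x. c * b k x + q0 x)" if qW: "q \<in> ?W" for q
  proof -
    obtain c where c: "\<forall>x. q x = (\<Sum>i\<in>insert k I. c i * b i x)" using qW by (auto simp: span_of_def)
    then have "q = (\<lambda>x. c k * b k x + (\<Sum>i\<in>I. c i * b i x))" using insert by auto
    then show ?thesis by (intro exI[of _ "c k"] exI[of _ "\<lambda>x. \<Sum>i\<in>I. c i * b i x"]) (auto simp: span_of_def)
  qed
  \<comment> \<open>Relative to the old system the error of any q is a multiple of the new direction
    f plus a null function, so everything depends on whether f itself is null.\<close>
  have qz: "\<exists>c z. z \<in> ?W \<and> G z z = 0 \<and> (\<lambda>x. q x - P q x) = (\<lambda>x. c * f x + z x) \<and> G q f = c * G f f" if qW: "q \<in> ?W" for q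
  proof -
    obtain c q0 where q0: "q0 \<in> span_of I b" and q: "q = (\<lambda>x. c * b k x + q0 x)" using decomp[OF qW] by blast
    have q0W: "q0 \<in> ?W" using q0 sub by auto
    have "G q (e i) = c * G (b k) (e i) + G q0 (e i)" if "i < m" for i
      unfolding q using lin[OF bW q0W eW[OF that], of c 1] by simp
    then have Pq: "P q x = c * P (b k) x + P q0 x" for x
      by (simp add: P_def sum_distrib_left algebra_simps sum.distrib)
    have "(\<lambda>x. q x - P q x) = (\<lambda>x. c * f x + (q0 x - P q0 x))"
      by (rule ext, simp only: Pq) (simp add: q f_def algebra_simps)
    moreover have "G (\<lambda>x. q0 x - P q0 x) (\<lambda>x. q0 x - P q0 x) = 0" using nul[OF q0] by (simp add: P_def)
    moreover have "G q f = c * G f f"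
    proof -
      have "G q f = c * G (b k) f + G q0 f" unfolding q using lin[OF bW q0W fW, of c 1] by simp
      moreover have "G f f = G (b k) f - G (P (b k)) f"
        using lin_on_diff[OF lin_on_left[OF fW] bW PW[of "b k"]] by (simp add: f_def[abs_def, symmetric])
      ultimately show ?thesis using fq[OF q0] fP sym[OF fW q0W] sym[OF fW PW] by simp
    qed
    moreover have "(\<lambda>x. q0 x - P q0 x) \<in> ?W" by (intro diff q0W PW)
    ultimately show ?thesis by blast
  qed
  show ?case
  proof (cases "G f f = 0")
    case True
    have "G (\<lambda>x. q x - P q x) (\<lambda>x. q x - P q x) = 0" if qW: "q \<in> ?W" for q
    proof -
      obtain c z where z: "z \<in> ?W" "G z z = 0" "(\<lambda>x. q x - P q x) = (\<lambda>x. c * f x + z x)" using qz[OF qW] by blast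
      show ?thesis using quad[OF fW z(1), of c 1] null_left[OF fW z(1) True] z True by simp
    qed
    then show ?thesis using on eW unfolding P_def by blast
  next
    case False
    then have pos: "0 < G f f" using nonneg[OF fW] by simp
    define r where "r = 1 / sqrt (G f f)"
    have r2: "r\<^sup>2 * G f f = 1" using pos by (simp add: r_def power_divide)
    define g where "g x = r * f x" for x
    have gW: "g \<in> ?W" unfolding g_def by (intro scale fW)
    have gl: "G g q = r * G f q" if "q \<in> ?W" for q
      unfolding g_def using lin[OF fW fW that, of r 0] by simp
    define e' where "e' = e(m := g)"
    have 1: "\<forall>i<Suc m. e' i \<in> ?W" using eW gW by (auto simp: e'_def less_Suc_eq)
    have ge: "G g (e i) = 0" if "i < m" for i using gl[OF eW[OF that]] fe[OF that] by simp
    have "G g g = r * (r * G f f)" using gl[OF gW] sym[OF gW fW] gl[OF fW] by simp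
    then have "G g g = 1" using r2 by (simp add: power2_eq_square)
    then have 2: "\<forall>i<Suc m. \<forall>j<Suc m. G (e' i) (e' j) = (if i = j then 1 else 0)"
      using on ge sym[OF gW eW] by (auto simp: e'_def less_Suc_eq)
    have 3: "G (\<lambda>x. q x - (\<Sum>i<Suc m. G q (e' i) * e' i x)) (\<lambda>x. q x - (\<Sum>i<Suc m. G q (e' i) * e' i x)) = 0"
      if qW: "q \<in> ?W" for q
    proof -
      obtain c z where z: "z \<in> ?W" "G z z = 0" and qc: "(\<lambda>x. q x - P q x) = (\<lambda>x. c * f x + z x)" "G q f = c * G f f" using qz[OF qW] by blast
      have "G q g = r * (c * G f f)" using gl[OF qW] sym[OF gW qW] sym[OF fW qW] qc(2) by simp
      then have "G q g * g x = c * f x" for x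
      proof -
        have "G q g * g x = (r\<^sup>2 * G f f) * (c * f x)"
          unfolding \<open>G q g = _\<close> g_def by (simp add: power2_eq_square)
        then show ?thesis by (simp add: r2)
      qed
      then have "(\<lambda>x. q x - (\<Sum>i<Suc m. G q (e' i) * e' i x)) = z"
        using qc(1) by (auto simp: e'_def P_def fun_eq_iff algebra_simps)
      then show ?thesis using z by simp
    qed
    show ?thesis using 1 2 3 by blast
  qed
qed

text \<open>Since G may be degenerate, F has to vanish on its null vectors; then F factors through
  the orthonormal system and the sum of \<open>F (e i)\<close> times \<open>e i\<close> represents
  it. Projections, point evaluations and limit functionals on polynomials are all obtained from this
  lemma.\<close>

lemma span_riesz:
  assumes I: "finite I" and G: "psd_form (span_of I b) G" and F: "lin_on (span_of I b) F"
    and null: "\<And>q. q \<in> span_of I b ==> G q q = 0 ==> F q = 0"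
  shows "\<exists>p\<in>span_of I b. \<forall>q\<in>span_of I b. F q = G p q"
proof -
  interpret psd_form "span_of I b" G by fact
  obtain m :: nat and e where e': "\<forall>i<m. e i \<in> span_of I b"
    and nul': "\<forall>q\<in>span_of I b. G (\<lambda>x. q x - (\<Sum>i<m. G q (e i) * e i x)) (\<lambda>x. q x - (\<Sum>i<m. G q (e i) * e i x)) = 0"
    using orthonormal_basis[OF I G] by (elim exE conjE) (rule that)
  note e = e'[rule_format] and nul = nul'[rule_format]
  define p where "p x = (\<Sum>i<m. F (e i) * e i x)" for x
  have p: "p \<in> span_of I b" unfolding p_def using sum[of "{..<m}" e "\<lambda>i. F (e i)"] e by simp
  have "F q = G p q" if q: "q \<in> span_of I b" for q
  proof -
    have Pq: "(\<lambda>x. \<Sum>i<m. G q (e i) * e i x) \<in> span_of I b" using sum[of "{..<m}" e] e by simp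
    have "F (\<lambda>x. q x - (\<Sum>i<m. G q (e i) * e i x)) = 0" by (intro null nul diff q Pq)
    then have "F q = (\<Sum>i<m. G q (e i) * F (e i))"
      using lin_on_diff[OF F q Pq] lin_on_sum[OF F, of "{..<m}" e "\<lambda>i. G q (e i)"] e by simp
    also have "\<dots> = (\<Sum>i<m. F (e i) * G (e i) q)"
      using sym[OF q e] by (intro sum.cong) auto
    also have "\<dots> = G p q"
      unfolding p_def using lin_on_sum[OF lin_on_left[OF q], of "{..<m}" e "\<lambda>i. F (e i)"] e by simp
    finally show ?thesis .
  qed
  then show ?thesis using p by blast
qed

text \<open>In finite dimension weak convergence is strong. Expanding one argument of H in a
  G-orthonormal system and replacing each \<open>H (e i)\<close> by its G-representative
  \<open>r i\<close> writes \<open>H (d n) (d n)\<close> as a finite sum of products of two null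
  sequences. The null-vector condition makes H well defined on the quotient by G.\<close>

lemma span_weak_conv:
  assumes I: "finite I" and G: "psd_form (span_of I b) G" and H: "psd_form (span_of I b) H"
    and null: "\<And>q. q \<in> span_of I b ==> G q q = 0 ==> H q q = 0"
    and d: "\<And>n. d n \<in> span_of I b"
    and lim: "\<And>q. q \<in> span_of I b ==> (\<lambda>n. G (d n) q) \<longlonglongrightarrow> 0"
  shows "(\<lambda>n. H (d n) (d n)) \<longlonglongrightarrow> 0"
proof -
  interpret psd_form "span_of I b" G by fact
  interpret H: psd_form "span_of I b" H by fact
  obtain m :: nat and e where e': "\<forall>i<m. e i \<in> span_of I b"
    and nul': "\<forall>q\<in>span_of I b. G (\<lambda>x. q x - (\<Sum>i<m. G q (e i) * e i x)) (\<lambda>x. q x - (\<Sum>i<m. G q (e i) * e i x)) = 0"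
    using orthonormal_basis[OF I G] by (elim exE conjE) (rule that)
  note e = e'[rule_format] and nul = nul'[rule_format]
  have nH: "H q u = 0" if "q \<in> span_of I b" "u \<in> span_of I b" "G q q = 0" for q u
    using H.null_left[OF that(1,2)] null that by simp
  have "\<exists>r\<in>span_of I b. \<forall>q\<in>span_of I b. H (e i) q = G r q" if "i < m" for i
    using nH[OF _ e[OF that]] H.sym[OF _ e[OF that]] by (intro span_riesz I G H.lin_on_right e that) metis
  then obtain r where r: "\<And>i. i < m ==> r i \<in> span_of I b" "\<And>i q. i < m ==> q \<in> span_of I b ==> H (e i) q = G (r i) q"
    by metis
  have "H (d n) (d n) = (\<Sum>i<m. G (d n) (e i) * G (d n) (r i))" for n
  proof -
    have P: "(\<lambda>x. \<Sum>i<m. G (d n) (e i) * e i x) \<in> span_of I b" using sum[of "{..<m}" e] e by simp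
    have "H (\<lambda>x. d n x - (\<Sum>i<m. G (d n) (e i) * e i x)) (d n) = 0"
      using nul[OF d] d P by (intro nH diff) auto
    then have "H (d n) (d n) = H (\<lambda>x. \<Sum>i<m. G (d n) (e i) * e i x) (d n)"
      using lin_on_diff[OF H.lin_on_left[OF d] d P] by simp
    also have "\<dots> = (\<Sum>i<m. G (d n) (e i) * H (e i) (d n))"
      using lin_on_sum[OF H.lin_on_left[OF d[of n]], of "{..<m}" e "\<lambda>i. G (d n) (e i)"] e by simp
    also have "\<dots> = (\<Sum>i<m. G (d n) (e i) * G (d n) (r i))"
      by (intro sum.cong) (use r sym[OF d r(1)] d in auto)
    finally show ?thesis .
  qed
  moreover have "(\<lambda>n. \<Sum>i<m. G (d n) (e i) * G (d n) (r i)) \<longlonglongrightarrow> (\<Sum>i<m. 0 * 0)"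
    by (intro tendsto_sum tendsto_mult lim) (auto simp: e r)
  ultimately show ?thesis by simp
qed

section \<open>The abstract quartic problem\<close>

text \<open>The polynomial is 0 at t = 0, so 0 is a minimum point and the derivative there, which is
  D, vanishes.\<close>

lemma quartic_min_linear_coeff:
  fixes D :: real
  assumes "\<And>t. 0 \<le> t * D + t^2 * c2 + t^3 * c3 + t^4 * c4"
  shows "D = 0"
proof -
  have "((\<lambda>t. t * D + t^2 * c2 + t^3 * c3 + t^4 * c4) has_real_derivative D) (at 0)"
    by (auto intro!: derivative_eq_intros)
  from DERIV_local_min[OF this, of 1] assms show ?thesis by simp
qed

lemma less_of_quarters:
  fixes c :: real
  assumes "r \<le> c" "s \<le> c" "b \<le> 4 * (r + s)" "c < e / 8"
  shows "b < e"
  using assms by argo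

text \<open>Scalar skeleton of the tangent inequality for the energy: \<open>bu\<close>,
  \<open>b\<close>, \<open>bz\<close> stand for \<open>B u u\<close>, \<open>B u z\<close>,
  \<open>B z z\<close>, likewise for a, and \<open>bd\<close>, \<open>ad\<close>, \<open>fd\<close>
  are the increments from u to z.\<close>

lemma convex_ineq:
  fixes S :: real
  assumes "bd = b - bu" "ad = a - au" "fd = f - fu" "2 * b \<le> bu + bz"
    and "S * (au * (a - au)) \<le> S * ((az\<^sup>2 - au\<^sup>2) / 4)"
  shows "bu / 2 + S / 4 * au\<^sup>2 - fu + (bd + S * au * ad - fd) \<le> bz / 2 + S / 4 * az\<^sup>2 - f"
proof -
  have "S * au * ad \<le> S / 4 * az\<^sup>2 - S / 4 * au\<^sup>2"
    using assms(5) by (simp add: assms(2) algebra_simps diff_divide_distrib)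
  then show ?thesis using assms(1,3,4) by linarith
qed

text \<open>Increment of the energy along the line w + t z. The coefficient of t is the residual of
  the variational equation tested with z.\<close>

lemma quartic_expand:
  fixes t :: real
  shows "(bw + 2 * t * b + t\<^sup>2 * bz) / 2 + S / 4 * (aw + 2 * t * a + t\<^sup>2 * az)\<^sup>2 - (fw + t * fz)
    - (bw / 2 + S / 4 * aw\<^sup>2 - fw) = t * (b + S * aw * a - fz) + t^2 * (bz / 2 + S / 4 * (4 * a\<^sup>2 + 2 * aw * az))
        + t^3 * (S * a * az) + t^4 * (S / 4 * az\<^sup>2)"
  by (simp add: power2_eq_square power3_eq_cube power4_eq_xxxx field_simps)

context psd_form
begin

text \<open>The bound of F by B makes the energy bounded below; the bound of A by B makes the
  derivative of the energy at the limit point continuous for B. Completeness is a hypothesis, to be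
  supplied by the virtual element space.\<close>

theorem quartic_problem:
  assumes A: "psd_form V A" and AB: "\<And>v. v \<in> V ==> A v v \<le> K * B v v"
    and F: "lin_on V F" and FB: "\<And>v. v \<in> V ==> (F v)\<^sup>2 \<le> K' * B v v" and S: "0 \<le> S"
    and complete: "\<And>v. (\<And>n. v n \<in> V) ==>
        (\<And>e. 0 < e ==> \<exists>N. \<forall>m\<ge>N. \<forall>n\<ge>N. B (\<lambda>x. v m x - v n x) (\<lambda>x. v m x - v n x) < e) ==>
        \<exists>w\<in>V. (\<lambda>n. B (\<lambda>x. v n x - w x) (\<lambda>x. v n x - w x)) \<longlonglongrightarrow> 0"
  shows "\<exists>u\<in>V. \<forall>v\<in>V. B u v + S * A u u * A u v = F v"
proof -
  interpret A: psd_form V A by fact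
  define J where "J v = B v v / 2 + S / 4 * (A v v)\<^sup>2 - F v" for v
  \<comment> \<open>The arithmetic-geometric mean inequality for \<bar>K'\<bar> and
    \<open>B v v\<close> bounds \<bar>F v\<bar> by half their sum, so the quadratic part of the
    energy absorbs the linear one.\<close>
  have low: "- \<bar>K'\<bar> / 2 \<le> J v" if v: "v \<in> V" for v
  proof -
    have "(F v)\<^sup>2 \<le> \<bar>K'\<bar> * B v v"
      using FB[OF v] mult_right_mono[OF abs_ge_self nonneg[OF v], of K'] by linarith
    also have "\<dots> \<le> ((\<bar>K'\<bar> + B v v) / 2)\<^sup>2"
      using zero_le_power2[of "\<bar>K'\<bar> - B v v"] by (simp add: power2_eq_square field_simps)
    finally have "\<bar>F v\<bar>\<^sup>2 \<le> ((\<bar>K'\<bar> + B v v) / 2)\<^sup>2" by simp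
    then have "\<bar>F v\<bar> \<le> (\<bar>K'\<bar> + B v v) / 2"
      by (rule power2_le_imp_le) (use nonneg[OF v] in simp)
    moreover have "0 \<le> S / 4 * (A v v)\<^sup>2" using S by simp
    ultimately show ?thesis unfolding J_def by (simp add: field_simps)
  qed
  \<comment> \<open>Uniform convexity: the parallelogram identity for B gains one eighth of
    \<open>B\<close> of the difference, while the quartic term is merely convex.\<close>
  have mid: "J (\<lambda>x. 1/2 * u x + 1/2 * v x) \<le> (J u + J v) / 2 - B (\<lambda>x. u x - v x) (\<lambda>x. u x - v x) / 8"
    if u: "u \<in> V" and v: "v \<in> V" for u v
  proof -
    let ?w = "\<lambda>x. 1/2 * u x + 1/2 * v x"
    have b: "B ?w ?w = (B u u + B v v) / 2 - B (\<lambda>x. u x - v x) (\<lambda>x. u x - v x) / 4"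
      using quad[OF u v, of "1/2" "1/2"] quad_diff[OF u v] by (simp add: power2_eq_square field_simps)
    have "A ?w ?w = (A u u + A v v) / 2 - A (\<lambda>x. u x - v x) (\<lambda>x. u x - v x) / 4"
      using A.quad[OF u v, of "1/2" "1/2"] A.quad_diff[OF u v] by (simp add: power2_eq_square field_simps)
    then have "A ?w ?w \<le> (A u u + A v v) / 2" using A.nonneg[OF diff[OF u v]] by linarith
    then have "(A ?w ?w)\<^sup>2 \<le> ((A u u + A v v) / 2)\<^sup>2"
      by (intro power_mono A.nonneg comb u v)
    also have "\<dots> \<le> ((A u u)\<^sup>2 + (A v v)\<^sup>2) / 2"
      using zero_le_power2[of "A u u - A v v"] by (simp add: power2_eq_square field_simps)
    finally have "S / 4 * (A ?w ?w)\<^sup>2 \<le> S / 4 * (((A u u)\<^sup>2 + (A v v)\<^sup>2) / 2)"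
      using S by (intro mult_left_mono) auto
    moreover have "F ?w = (F u + F v) / 2" using lin_onD[OF F u v, of "1/2" "1/2"] by simp
    ultimately show ?thesis unfolding J_def b by (simp add: field_simps)
  qed
  define m where "m = Inf (J ` V)"
  have bdd: "bdd_below (J ` V)" using low by (auto intro!: bdd_belowI[of _ "- \<bar>K'\<bar> / 2"])
  have ne: "J ` V \<noteq> {}" using zero by auto
  have mle: "m \<le> J v" if "v \<in> V" for v unfolding m_def using bdd that by (intro cInf_lower) auto
  have "\<exists>v. v \<in> V \<and> J v < m + 1 / real (Suc n)" for n
    using cInf_lessD[OF ne, of "m + 1 / real (Suc n)"] unfolding m_def by auto
  then obtain v where v: "\<And>n. v n \<in> V" and Jv: "\<And>n. J (v n) < m + 1 / real (Suc n)" by metis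
  have avg: "m \<le> (p + q) / 2 - b / 8 ==> p < m + r ==> q < m + s ==> b \<le> 4 * (r + s)" for p q b r s :: real
    by (simp add: field_simps)
  have dist: "B (\<lambda>x. v i x - v j x) (\<lambda>x. v i x - v j x) \<le> 4 * (1 / real (Suc i) + 1 / real (Suc j))" for i j
  proof -
    have "m \<le> (J (v i) + J (v j)) / 2 - B (\<lambda>x. v i x - v j x) (\<lambda>x. v i x - v j x) / 8"
      using mid[OF v v] mle[OF comb[OF v v]] order_trans by blast
    then show ?thesis using Jv[of i] Jv[of j] by (rule avg)
  qed
  have cauchy: "\<exists>N. \<forall>i\<ge>N. \<forall>j\<ge>N. B (\<lambda>x. v i x - v j x) (\<lambda>x. v i x - v j x) < e" if e: "0 < e" for e :: real
  proof -
    \<comment> \<open>The factor 1/8 balances the estimate \<open>dist\<close>: 4 times the sum of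
      two terms below e/8 is below e.\<close>
    obtain N where N: "1 / real (Suc N) < e / 8" using reals_Archimedean[of "e/8"] e by (auto simp: inverse_eq_divide)
    have "B (\<lambda>x. v i x - v j x) (\<lambda>x. v i x - v j x) < e" if "i \<ge> N" "j \<ge> N" for i j
    proof -
      have "1 / real (Suc i) \<le> 1 / real (Suc N)" "1 / real (Suc j) \<le> 1 / real (Suc N)"
        using that by (auto intro!: divide_left_mono)
      from less_of_quarters[OF this dist[of i j] N] show ?thesis .
    qed
    then show ?thesis by blast
  qed
  obtain w where w: "w \<in> V" and lim: "(\<lambda>n. B (\<lambda>x. v n x - w x) (\<lambda>x. v n x - w x)) \<longlonglongrightarrow> 0"
    using complete[of v] v cauchy by (elim meta_impE bexE) (auto intro: that)
  \<comment> \<open>The graph of the energy lies above its tangent at u. Applied at the limit w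
    along the minimising sequence, this replaces a proof of lower semicontinuity.\<close>
  have conv: "J u + (B u (\<lambda>x. z x - u x) + S * A u u * A u (\<lambda>x. z x - u x) - F (\<lambda>x. z x - u x)) \<le> J z"
    if u: "u \<in> V" and z: "z \<in> V" for u z
  proof -
    have d: "B u (\<lambda>x. z x - u x) = B u z - B u u" "A u (\<lambda>x. z x - u x) = A u z - A u u"
      "F (\<lambda>x. z x - u x) = F z - F u"
      using lin_on_diff[OF lin_on_right[OF u] z u] lin_on_diff[OF A.lin_on_right[OF u] z u] lin_on_diff[OF F z u] by auto
    have am: "2 * B u z \<le> B u u + B z z" "2 * A u z \<le> A u u + A z z"
      using quad_diff[OF u z] nonneg[OF diff[OF u z]] A.quad_diff[OF u z] A.nonneg[OF diff[OF u z]] by auto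
    have "A u u * (A u z - A u u) \<le> ((A z z)\<^sup>2 - (A u u)\<^sup>2) / 4"
    proof -
      have "A u u * (A u z - A u u) \<le> A u u * ((A z z - A u u) / 2)"
        using am(2) by (intro mult_left_mono A.nonneg u) simp
      also have "\<dots> \<le> ((A z z)\<^sup>2 - (A u u)\<^sup>2) / 4"
        using zero_le_power2[of "A z z - A u u"] by (simp add: power2_eq_square field_simps)
      finally show ?thesis .
    qed
    then have "S * (A u u * (A u z - A u u)) \<le> S * (((A z z)\<^sup>2 - (A u u)\<^sup>2) / 4)"
      using S by (intro mult_left_mono)
    from convex_ineq[OF d am(1) this] show ?thesis unfolding J_def .
  qed
  have lin0: "(\<lambda>n. G (\<lambda>x. v n x - w x)) \<longlonglongrightarrow> 0"
    if G: "\<And>z. z \<in> V ==> (G z)\<^sup>2 \<le> c * B z z" for G c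
  proof (rule Lim_null_comparison)
    show "\<forall>\<^sub>F n in sequentially. norm (G (\<lambda>x. v n x - w x)) \<le> sqrt (c * B (\<lambda>x. v n x - w x) (\<lambda>x. v n x - w x))"
      using G[OF diff[OF v w]] by (intro always_eventually) (simp add: real_le_rsqrt)
    show "(\<lambda>n. sqrt (c * B (\<lambda>x. v n x - w x) (\<lambda>x. v n x - w x))) \<longlonglongrightarrow> 0"
      using tendsto_real_sqrt[OF tendsto_mult_left[OF lim, of c]] by simp
  qed
  have AK: "(A w z)\<^sup>2 \<le> (A w w * K) * B z z" if "z \<in> V" for z
    using A.cauchy_schwarz[OF w that] mult_left_mono[OF AB[OF that] A.nonneg[OF w]] by (simp add: mult.assoc)
  have "(\<lambda>n. B w (\<lambda>x. v n x - w x) + S * A w w * A w (\<lambda>x. v n x - w x) - F (\<lambda>x. v n x - w x)) \<longlonglongrightarrow> 0 + S * A w w * 0 - 0"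
    by (intro tendsto_intros lin0[OF cauchy_schwarz[OF w]] lin0[OF AK] lin0[OF FB])
  then have 1: "(\<lambda>n. J w + (B w (\<lambda>x. v n x - w x) + S * A w w * A w (\<lambda>x. v n x - w x) - F (\<lambda>x. v n x - w x))) \<longlonglongrightarrow> J w"
    using tendsto_add[OF tendsto_const[of "J w"]] by fastforce
  have 2: "(\<lambda>n. m + 1 / real (Suc n)) \<longlonglongrightarrow> m"
    using tendsto_add[OF tendsto_const[of m] LIMSEQ_inverse_real_of_nat] by (simp add: inverse_eq_divide)
  \<comment> \<open>The tangents at w, evaluated along the minimising sequence, tend to
    \<open>J w\<close> and stay below m + 1/(n+1).\<close>
  have "J w \<le> m"
  proof (rule LIMSEQ_le[OF 1 2], intro exI[of _ 0] allI impI)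
    fix n :: nat
    show "J w + (B w (\<lambda>x. v n x - w x) + S * A w w * A w (\<lambda>x. v n x - w x) - F (\<lambda>x. v n x - w x)) \<le> m + 1 / real (Suc n)"
      using order.trans[OF conv[OF w v] less_imp_le[OF Jv]] .
  qed
  then have min: "J w \<le> J z" if "z \<in> V" for z using mle[OF that] by simp
  have "B w z + S * A w w * A w z = F z" if z: "z \<in> V" for z
  proof -
    have "0 \<le> t * (B w z + S * A w w * A w z - F z) + t^2 * (B z z / 2 + S / 4 * (4 * (A w z)\<^sup>2 + 2 * A w w * A z z))
        + t^3 * (S * A w z * A z z) + t^4 * (S / 4 * (A z z)\<^sup>2)" for t
    proof -
      have "J w \<le> J (lc 1 w t z)" by (intro min comb w z)
      moreover have "J (lc 1 w t z) - J w =
        t * (B w z + S * A w w * A w z - F z) + t^2 * (B z z / 2 + S / 4 * (4 * (A w z)\<^sup>2 + 2 * A w w * A z z))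
        + t^3 * (S * A w z * A z z) + t^4 * (S / 4 * (A z z)\<^sup>2)"
        unfolding J_def quad[OF w z] A.quad[OF w z] lin_onD[OF F w z] using quartic_expand[of "B w w" t] by simp
      ultimately show ?thesis by linarith
    qed
    from quartic_min_linear_coeff[OF this] show ?thesis by simp
  qed
  then show ?thesis using w by blast
qed

text \<open>Test the difference of the two equations with u - v. The right side is S times a
  quantity of sign opposite to B, because u \<mapsto> A(u,u) A(u, .) is a monotone map. As B is only
  semidefinite, the conclusion is that the difference is a null vector.\<close>

lemma quartic_unique:
  assumes A: "psd_form V A" and S: "0 \<le> S" and u: "u \<in> V" and v: "v \<in> V"
    and eu: "\<And>z. z \<in> V ==> B u z + S * A u u * A u z = F z"
    and ev: "\<And>z. z \<in> V ==> B v z + S * A v v * A v z = F z"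
  shows "B (\<lambda>x. u x - v x) (\<lambda>x. u x - v x) = 0"
proof -
  interpret A: psd_form V A by fact
  let ?w = "\<lambda>x. u x - v x"
  have w: "?w \<in> V" by (intro diff u v)
  have "B ?w ?w = B u ?w - B v ?w" using lin_on_diff[OF lin_on_left[OF w] u v] .
  also have "\<dots> = S * (A v v * A v ?w - A u u * A u ?w)"
    using eu[OF w] ev[OF w] by (simp add: algebra_simps)
  also have "A v v * A v ?w - A u u * A u ?w = A v v * (A u v - A v v) - A u u * (A u u - A u v)"
    using lin_on_diff[OF A.lin_on_right[OF u] u v] lin_on_diff[OF A.lin_on_right[OF v] u v] A.sym[OF u v] by simp
  finally have e: "B ?w ?w = S * (A v v * (A u v - A v v) - A u u * (A u u - A u v))" .
  \<comment> \<open>With a = A(u,u), c = A(v,v), b = A(u,v): from 2b \<le> a + c follows b(a+c)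
    \<le> (a+c)^2/2 \<le> a^2 + c^2.\<close>
  have "A v v * (A u v - A v v) - A u u * (A u u - A u v) \<le> 0"
  proof -
    have "2 * A u v \<le> A u u + A v v" using A.quad_diff[OF u v] A.nonneg[OF w] by simp
    then have "(A u u + A v v) * (2 * A u v) \<le> (A u u + A v v) * (A u u + A v v)"
      using A.nonneg[OF u] A.nonneg[OF v] by (intro mult_left_mono) auto
    moreover have "0 \<le> (A u u - A v v)\<^sup>2" by simp
    ultimately show ?thesis by (simp add: power2_eq_square algebra_simps)
  qed
  then have "B ?w ?w \<le> 0" unfolding e using S by (simp add: mult_le_0_iff)
  then show ?thesis using nonneg[OF w] by simp
qed

end

section \<open>The space \<open>L\<^sup>2\<close>\<close>

lemma L2I: "u \<in> borel_measurable (lebesgue_on E) ==> integrable (lebesgue_on E) (\<lambda>x. (u x)\<^sup>2) ==> u \<in> L2 E"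
  by (simp add: L2_def)

lemma L2_measurable: "u \<in> L2 E ==> u \<in> borel_measurable (lebesgue_on E)"
  by (simp add: L2_def)

lemma L2_mult:
  assumes "u \<in> L2 E" "v \<in> L2 E"
  shows "integrable (lebesgue_on E) (\<lambda>x. u x * v x)"
proof (rule Bochner_Integration.integrable_bound)
  show "integrable (lebesgue_on E) (\<lambda>x. (u x)\<^sup>2 + (v x)\<^sup>2)"
    using assms by (simp add: L2_def)
  show "(\<lambda>x. u x * v x) \<in> borel_measurable (lebesgue_on E)"
    using assms by (intro borel_measurable_times L2_measurable)
  have "norm (a * b) \<le> norm (a\<^sup>2 + b\<^sup>2)" for a b :: real
  proof -
    have "2 * \<bar>a * b\<bar> \<le> a\<^sup>2 + b\<^sup>2"
      using sum_squares_bound[of "\<bar>a\<bar>" "\<bar>b\<bar>"] by (simp add: abs_mult)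
    then show ?thesis by simp
  qed
  then show "AE x in lebesgue_on E. norm (u x * v x) \<le> norm ((u x)\<^sup>2 + (v x)\<^sup>2)" by simp
qed

interpretation L2: psd_form "L2 E" "l2ip E" for E :: "'a::euclidean_space set"
proof
  show "(\<lambda>_. 0) \<in> L2 E" by (simp add: L2_def)
  show "lc a u b v \<in> L2 E" if "u \<in> L2 E" "v \<in> L2 E" for u v :: "'a => real" and a b
  proof (rule L2I)
    show "lc a u b v \<in> borel_measurable (lebesgue_on E)" 
      using that by (intro borel_measurable_add borel_measurable_times L2_measurable borel_measurable_const)
    have "integrable (lebesgue_on E) (\<lambda>x. a\<^sup>2 * (u x)\<^sup>2 + 2 * a * b * (u x * v x) + b\<^sup>2 * (v x)\<^sup>2)"
      using that L2_mult[OF that] by (simp add: L2_def)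
    then show "integrable (lebesgue_on E) (\<lambda>x. (a * u x + b * v x)\<^sup>2)"
      by (simp add: power2_eq_square algebra_simps)
  qed
  show "l2ip E u v = l2ip E v u" for u v by (simp add: l2ip_def mult.commute)
  show "l2ip E (lc a u b v) w = a * l2ip E u w + b * l2ip E v w"
    if "u \<in> L2 E" "v \<in> L2 E" "w \<in> L2 E" for u v w :: "'a => real" and a b
  proof -
    have "l2ip E (lc a u b v) w = (LINT x|lebesgue_on E. a * (u x * w x) + b * (v x * w x))"
      unfolding l2ip_def by (simp add: algebra_simps)
    then show ?thesis using L2_mult[OF that(1,3)] L2_mult[OF that(2,3)] by (simp add: l2ip_def)
  qed
  show "0 \<le> l2ip E u u" for u by (simp add: l2ip_def)
qed

lemma l2ip_self_nonneg [simp]: "0 \<le> l2ip E u u"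
  by (simp add: l2ip_def)

lemma l2norm_sq: "(l2norm E u)\<^sup>2 = l2ip E u u"
  by (simp add: l2norm_def)

lemma l2norm_sq_integral: "(l2norm E u)\<^sup>2 = (LINT x|lebesgue_on E. (u x)\<^sup>2)"
  unfolding l2norm_sq l2ip_def by (simp add: power2_eq_square)

lemma l2norm_nonneg [simp]: "0 \<le> l2norm E u"
  by (simp add: l2norm_def)

lemma l2norm_triangle: "u \<in> L2 E ==> v \<in> L2 E ==> l2norm E (\<lambda>x. u x + v x) \<le> l2norm E u + l2norm E v"
  unfolding l2norm_def by (rule L2.triangle)

lemma l2norm_triangle_diff: "u \<in> L2 E ==> v \<in> L2 E ==> w \<in> L2 E ==>
    l2norm E (\<lambda>x. u x - w x) \<le> l2norm E (\<lambda>x. u x - v x) + l2norm E (\<lambda>x. v x - w x)"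
  unfolding l2norm_def by (rule L2.triangle_diff)

lemma l2ip_abs_le: "u \<in> L2 E ==> v \<in> L2 E ==> \<bar>l2ip E u v\<bar> \<le> l2norm E u * l2norm E v"
  unfolding l2norm_def by (rule L2.cauchy_schwarz_abs)

abbreviation L2lim :: "'a::euclidean_space set => (nat => 'a => real) => ('a => real) => bool" where
  "L2lim E f f' \<equiv> (\<lambda>n. l2norm E (\<lambda>x. f n x - f' x)) \<longlonglongrightarrow> 0"

lemma l2_conv_ip:
  assumes "\<And>n. u n \<in> L2 E" "v \<in> L2 E" "w \<in> L2 E" "L2lim E u v"
  shows "(\<lambda>n. l2ip E (u n) w) \<longlonglongrightarrow> l2ip E v w"
proof (rule L2.conv_left[OF assms(1-3)])
  show "(\<lambda>n. l2ip E (\<lambda>x. u n x - v x) (\<lambda>x. u n x - v x)) \<longlonglongrightarrow> 0"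
    using tendsto_power[OF assms(4), of 2] by (simp add: l2norm_sq)
qed

lemma l2ip_cong_AE:
  assumes "u \<in> borel_measurable (lebesgue_on E)" "u' \<in> borel_measurable (lebesgue_on E)"
    "w \<in> borel_measurable (lebesgue_on E)" "AE x in lebesgue_on E. u x = u' x"
  shows "l2ip E u w = l2ip E u' w"
  unfolding l2ip_def using assms by (intro integral_cong_AE) auto

lemma l2ip_self_eq_0_iff:
  assumes "u \<in> L2 E" shows "l2ip E u u = 0 \<longleftrightarrow> (AE x in lebesgue_on E. u x = 0)"
  unfolding l2ip_def using assms L2_mult[OF assms assms] by (subst integral_nonneg_eq_0_iff_AE) auto

lemma l2norm_eq_0_iff: "u \<in> L2 E ==> l2norm E u = 0 \<longleftrightarrow> (AE x in lebesgue_on E. u x = 0)"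
  by (simp add: l2norm_def l2ip_self_eq_0_iff)

lemma integrable_lebesgue_on_subset:
  fixes f :: "'a::euclidean_space => real"
  assumes "integrable (lebesgue_on E) f" "E' \<subseteq> E" "E \<in> sets lebesgue" "E' \<in> sets lebesgue"
  shows "integrable (lebesgue_on E') f"
proof -
  have "integrable lebesgue (\<lambda>x. indicator E' x *\<^sub>R (indicator E x *\<^sub>R f x))"
    using assms by (intro integrable_mult_indicator[of E']) (auto simp: integrable_restrict_space)
  also have "(\<lambda>x. indicator E' x *\<^sub>R (indicator E x *\<^sub>R f x)) = (\<lambda>x. indicator E' x *\<^sub>R f x)"
    using assms(2) by (auto simp: indicator_def fun_eq_iff)
  finally show ?thesis using assms by (simp add: integrable_restrict_space)
qed

lemma measurable_lebesgue_on_subset: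
  fixes f :: "'a::euclidean_space => real"
  assumes "f \<in> borel_measurable (lebesgue_on E)" "E' \<subseteq> E"
  shows "f \<in> borel_measurable (lebesgue_on E')"
  using assms by (rule measurable_restrict_mono)

lemma L2_subset:
  "u \<in> L2 E ==> E' \<subseteq> E ==> E \<in> sets lebesgue ==> E' \<in> sets lebesgue ==> u \<in> L2 E'"
  by (auto simp: L2_def intro: integrable_lebesgue_on_subset measurable_lebesgue_on_subset)

lemma AE_lebesgue_on_subset:
  assumes "AE x in lebesgue_on E. P x" "E' \<subseteq> E" "E \<in> sets lebesgue" "E' \<in> sets lebesgue"
  shows "AE x in lebesgue_on E'. P x"
  using assms by (simp add: AE_restrict_space_iff) (auto elim: eventually_mono)

lemma l2ip_restrict:
  assumes "E' \<subseteq> E" "E \<in> sets lebesgue" "E' \<in> sets lebesgue" "\<And>x. x \<in> E - E' ==> w x = 0"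
  shows "l2ip E u w = l2ip E' u w"
  unfolding l2ip_def using assms
  by (auto simp: integral_restrict_space indicator_def intro!: Bochner_Integration.integral_cong)

text \<open>Completeness of Lebesgue measure: sublevel sets of v differ from those of u only inside
  a negligible set, all of whose subsets are measurable.\<close>

lemma measurable_lebesgue_on_AE:
  fixes u v :: "'a::euclidean_space => real"
  assumes E: "E \<in> sets lebesgue" and u: "u \<in> borel_measurable (lebesgue_on E)"
    and ae: "AE x in lebesgue_on E. u x = v x"
  shows "v \<in> borel_measurable (lebesgue_on E)"
proof -
  define N where "N = {x. x \<in> E \<and> u x \<noteq> v x}"
  have "AE x in lebesgue. x \<in> E --> u x = v x" using ae E by (simp add: AE_restrict_space_iff)
  then have "AE x in lebesgue. x \<notin> N" by (auto simp: N_def)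
  then obtain N' where N': "N' \<in> null_sets lebesgue" "N \<subseteq> N'"
    unfolding eventually_ae_filter by auto
  then have N: "negligible N" using negligible_subset by (auto simp: negligible_iff_null_sets)
  have "{x \<in> space lebesgue. indicator E x *\<^sub>R v x \<le> a} \<in> sets lebesgue" for a
  proof -
    let ?U = "{x \<in> space lebesgue. indicator E x *\<^sub>R u x \<le> a}" and ?V = "{x \<in> space lebesgue. indicator E x *\<^sub>R v x \<le> a}"
    have "(\<lambda>x. indicator E x *\<^sub>R u x) \<in> borel_measurable lebesgue"
      using u E by (simp add: borel_measurable_restrict_space_iff)
    then have U: "?U \<in> sets lebesgue" by measurable
    have eq: "?V = (?U - N) \<union> (?V \<inter> N)" by (auto simp: N_def indicator_def)
    have "?V \<inter> N \<in> sets lebesgue" by (rule negligible_imp_sets, rule negligible_subset[OF N]) auto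
    then have "(?U - N) \<union> (?V \<inter> N) \<in> sets lebesgue"
      using U negligible_imp_sets[OF N] by auto
    then show ?thesis by (simp only: eq[symmetric])
  qed
  then have "(\<lambda>x. indicator E x *\<^sub>R v x) \<in> borel_measurable lebesgue"
    by (simp only: borel_measurable_iff_le) blast
  then show ?thesis using E by (simp add: borel_measurable_restrict_space_iff)
qed

lemma L2_cong_AE:
  fixes u v :: "'a::euclidean_space => real"
  assumes E: "E \<in> sets lebesgue" and u: "u \<in> L2 E" and ae: "AE x in lebesgue_on E. u x = v x"
  shows "v \<in> L2 E"
proof (rule L2I)
  show v: "v \<in> borel_measurable (lebesgue_on E)"
    using measurable_lebesgue_on_AE[OF E L2_measurable[OF u] ae] .
  show "integrable (lebesgue_on E) (\<lambda>x. (v x)\<^sup>2)"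
  proof (rule integrable_cong_AE_imp)
    show "integrable (lebesgue_on E) (\<lambda>x. (u x)\<^sup>2)" using u by (simp add: L2_def)
    show "(\<lambda>x. (v x)\<^sup>2) \<in> borel_measurable (lebesgue_on E)" using v by (rule borel_measurable_power)
    show "AE x in lebesgue_on E. (u x)\<^sup>2 = (v x)\<^sup>2" using ae by eventually_elim simp
  qed
qed

text \<open>Almost everywhere on E exactly one indicator of the disjoint regions is 1. This splits
  integrals over the plate into integrals over mesh elements, the edges being negligible.\<close>

lemma integral_sum_regions:
  fixes f :: "'a::euclidean_space => real"
  assumes fin: "finite I" and E: "E \<in> sets lebesgue" "\<And>i. i \<in> I ==> R i \<in> sets lebesgue" "\<And>i. i \<in> I ==> R i \<subseteq> E"
    and disj: "\<And>i j. i \<in> I ==> j \<in> I ==> i \<noteq> j ==> R i \<inter> R j = {}" and null: "negligible (E - (\<Union>i\<in>I. R i))"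
    and int: "integrable (lebesgue_on E) f"
  shows "integral\<^sup>L (lebesgue_on E) f = (\<Sum>i\<in>I. integral\<^sup>L (lebesgue_on (R i)) f)"
proof -
  have fi: "integrable lebesgue (\<lambda>x. indicator (R i) x *\<^sub>R f x)" if "i \<in> I" for i
    using integrable_lebesgue_on_subset[OF int E(3)[OF that] E(1) E(2)[OF that]] E(2)[OF that]
    by (simp add: integrable_restrict_space)
  have "(\<Sum>i\<in>I. integral\<^sup>L (lebesgue_on (R i)) f) = integral\<^sup>L lebesgue (\<lambda>x. \<Sum>i\<in>I. indicator (R i) x *\<^sub>R f x)"
    using fi E by (subst Bochner_Integration.integral_sum) (auto simp: integral_restrict_space)
  also have "\<dots> = (LINT x|lebesgue. indicator E x *\<^sub>R f x)"
  proof (rule integral_cong_AE)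
    show "(\<lambda>x. \<Sum>i\<in>I. indicat_real (R i) x *\<^sub>R f x) \<in> borel_measurable lebesgue"
      using fi by (intro borel_measurable_sum) auto
    show "(\<lambda>x. indicat_real E x *\<^sub>R f x) \<in> borel_measurable lebesgue"
      using int E by (simp add: integrable_restrict_space)
    have "AE x in lebesgue. x \<notin> E - (\<Union>i\<in>I. R i)"
      using null by (intro AE_not_in) (simp add: negligible_iff_null_sets)
    then show "AE x in lebesgue. (\<Sum>i\<in>I. indicat_real (R i) x *\<^sub>R f x) = indicat_real E x *\<^sub>R f x"
    proof eventually_elim
      fix x assume x: "x \<notin> E - (\<Union>i\<in>I. R i)"
      show "(\<Sum>i\<in>I. indicat_real (R i) x *\<^sub>R f x) = indicat_real E x *\<^sub>R f x"
      proof (cases "\<exists>i\<in>I. x \<in> R i")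
        case True
        then obtain i where i: "i \<in> I" "x \<in> R i" by blast
        have "(\<Sum>j\<in>I. indicat_real (R j) x *\<^sub>R f x) = (\<Sum>j\<in>I. if j = i then f x else 0)"
          using i disj by (intro sum.cong) (auto simp: indicator_def)
        then show ?thesis using i fin E(3) by (auto simp: indicator_def)
      next
        case False
        then have "x \<notin> E" using x by auto
        then show ?thesis using False by (auto simp: indicator_def)
      qed
    qed
  qed
  finally show ?thesis using E by (simp add: integral_restrict_space)
qed

text \<open>Finite measure turns a Cauchy sequence in L^2 into one in L^1, which has a subsequence
  converging almost everywhere; Fatou's lemma then returns to L^2.\<close>

lemma L2_complete:
  fixes u :: "nat => 'a::euclidean_space => real"
  assumes E: "E \<in> lmeasurable" and u: "\<And>n. u n \<in> L2 E"
    and cauchy: "\<And>e. 0 < e ==> \<exists>N. \<forall>m\<ge>N. \<forall>n\<ge>N. l2norm E (\<lambda>x. u m x - u n x) < e"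
  shows "\<exists>v\<in>L2 E. L2lim E u v"
proof -
  let ?M = "lebesgue_on E"
  have Es: "E \<in> sets lebesgue" using E by auto
  have one: "(\<lambda>_. 1) \<in> L2 E"
    using finite_measure.integrable_const[OF finite_measure_lebesgue_on[OF E]] by (auto simp: L2_def)
  have L1: "(LINT x|?M. norm (w x)) \<le> l2norm E w * l2norm E (\<lambda>_. 1)" if w: "w \<in> L2 E" for w
  proof -
    have wm: "(\<lambda>x. \<bar>w x\<bar>) \<in> L2 E" using w by (auto simp: L2_def)
    have "(LINT x|?M. norm (w x)) = l2ip E (\<lambda>x. \<bar>w x\<bar>) (\<lambda>_. 1)" by (simp add: l2ip_def)
    also have "\<dots> \<le> l2norm E (\<lambda>x. \<bar>w x\<bar>) * l2norm E (\<lambda>_. 1)" by (rule order_trans[OF abs_ge_self l2ip_abs_le[OF wm one]])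
    also have "l2norm E (\<lambda>x. \<bar>w x\<bar>) = l2norm E w" by (simp add: l2norm_def l2ip_def)
    finally show ?thesis .
  qed
  \<comment> \<open>The added 1 keeps the divisor positive when E is a null set.\<close>
  let ?c = "l2norm E (\<lambda>_. 1) + 1"
  have c: "0 < ?c" by (simp add: add_nonneg_pos)
  have cs: "\<exists>N. \<forall>m\<ge>N. \<forall>n\<ge>N. (LINT x|?M. norm (u m x - u n x)) < e" if e: "0 < e" for e
  proof -
    obtain N where N: "\<forall>m\<ge>N. \<forall>n\<ge>N. l2norm E (\<lambda>x. u m x - u n x) < e / ?c" using cauchy[OF divide_pos_pos[OF e c]] by (rule exE)
    have "(LINT x|?M. norm (u m x - u n x)) < e" if "N \<le> m" "N \<le> n" for m n
    proof -
      have "l2norm E (\<lambda>x. u m x - u n x) * l2norm E (\<lambda>_. 1) \<le> l2norm E (\<lambda>x. u m x - u n x) * ?c" by (intro mult_left_mono) auto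
      also have "\<dots> < e" using N that c by (simp add: pos_less_divide_eq)
      finally show ?thesis using L1[OF L2.diff[OF u u], of m n] by linarith
    qed
    then show ?thesis by blast
  qed
  have ui: "integrable ?M (u n)" for n using L2_mult[OF u one] by simp
  obtain r where r: "strict_mono r" "AE x in ?M. Cauchy (\<lambda>i. u (r i) x)"
    by (rule cauchy_L1_AE_cauchy_subseq[OF ui cs])
  define v where "v x = lim (\<lambda>k. u (r k) x)" for x
  have vm: "v \<in> borel_measurable ?M"
    unfolding v_def using L2_measurable[OF u] by (intro borel_measurable_lim_metric) auto
  have dm: "(\<lambda>x. u n x - v x) \<in> borel_measurable ?M" for n using L2_measurable[OF u] vm by simp
  \<comment> \<open>Fatou along the subsequence: as \<open>r j\<close> is at least j, the integrals
    of the squared distance to \<open>u (r j)\<close> are eventually at most e^2, hence so is the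
    integral for the limit.\<close>
  have close: "(\<lambda>x. u n x - v x) \<in> L2 E \<and> l2norm E (\<lambda>x. u n x - v x) \<le> e"
    if e: "0 < e" and N: "\<forall>m\<ge>N. \<forall>n\<ge>N. l2norm E (\<lambda>x. u m x - u n x) < e" and n: "N \<le> n" for e N n
  proof -
    have "(\<integral>\<^sup>+x. ennreal ((u n x - v x)\<^sup>2) \<partial>?M) = (\<integral>\<^sup>+x. liminf (\<lambda>j. ennreal ((u n x - u (r j) x)\<^sup>2)) \<partial>?M)"
    proof (rule nn_integral_cong_AE)
      show "AE x in ?M. ennreal ((u n x - v x)\<^sup>2) = liminf (\<lambda>j. ennreal ((u n x - u (r j) x)\<^sup>2))"
        using r(2)
      proof eventually_elim
        fix x assume "Cauchy (\<lambda>i. u (r i) x)"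
        then have "(\<lambda>k. u (r k) x) \<longlonglongrightarrow> v x" by (simp add: v_def Cauchy_convergent_iff convergent_LIMSEQ_iff)
        then have "(\<lambda>j. ennreal ((u n x - u (r j) x)\<^sup>2)) \<longlonglongrightarrow> ennreal ((u n x - v x)\<^sup>2)"
          by (intro tendsto_ennrealI tendsto_intros)
        then show "ennreal ((u n x - v x)\<^sup>2) = liminf (\<lambda>j. ennreal ((u n x - u (r j) x)\<^sup>2))"
          by (rule lim_imp_Liminf[OF trivial_limit_sequentially, symmetric])
      qed
    qed
    also have "\<dots> \<le> liminf (\<lambda>j. \<integral>\<^sup>+x. ennreal ((u n x - u (r j) x)\<^sup>2) \<partial>?M)"
      using L2_measurable[OF u] by (intro nn_integral_liminf) auto
    also have "\<dots> \<le> ennreal (e\<^sup>2)"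
    proof -
      have "\<forall>\<^sub>F j in sequentially. (\<integral>\<^sup>+x. ennreal ((u n x - u (r j) x)\<^sup>2) \<partial>?M) \<le> ennreal (e\<^sup>2)"
        using eventually_ge_at_top[of N]
      proof eventually_elim
        fix j assume "N \<le> j"
        then have "N \<le> r j" using seq_suble[OF r(1), of j] by linarith
        then have "(l2norm E (\<lambda>x. u n x - u (r j) x))\<^sup>2 \<le> e\<^sup>2" using N n by (intro power_mono) (auto intro: less_imp_le)
        then have le: "(LINT x|?M. (u n x - u (r j) x)\<^sup>2) \<le> e\<^sup>2" unfolding l2norm_sq_integral .
        have "integrable ?M (\<lambda>x. (u n x - u (r j) x)\<^sup>2)" using L2.diff[OF u u, of n "r j"] by (simp add: L2_def)
        then show "(\<integral>\<^sup>+x. ennreal ((u n x - u (r j) x)\<^sup>2) \<partial>?M) \<le> ennreal (e\<^sup>2)"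
          using le by (simp add: nn_integral_eq_integral ennreal_leI)
      qed
      then show ?thesis by (intro Liminf_le) auto
    qed
    finally have le: "(\<integral>\<^sup>+x. ennreal ((u n x - v x)\<^sup>2) \<partial>?M) \<le> ennreal (e\<^sup>2)" .
    have di: "integrable ?M (\<lambda>x. (u n x - v x)\<^sup>2)"
      using dm[of n] le_less_trans[OF le ennreal_less_top] by (intro integrableI_bounded) auto
    have "(l2norm E (\<lambda>x. u n x - v x))\<^sup>2 \<le> e\<^sup>2"
      unfolding l2norm_sq_integral using le nn_integral_eq_integral[OF di] by simp
    then show ?thesis using L2I[OF dm di] power2_le_imp_le e by (simp add: less_imp_le)
  qed
  obtain N where "\<forall>m\<ge>N. \<forall>n\<ge>N. l2norm E (\<lambda>x. u m x - u n x) < 1" using cauchy[OF zero_less_one] by (rule exE)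
  then have "(\<lambda>x. u N x - v x) \<in> L2 E" using close[of 1 N N] by simp
  then have vL: "v \<in> L2 E" using L2.diff[OF u[of N]] by fastforce
  have "L2lim E u v"
  proof (rule LIMSEQ_I)
    fix e :: real assume e: "0 < e"
    then have e2: "0 < e / 2" by simp
    obtain N where N: "\<forall>m\<ge>N. \<forall>n\<ge>N. l2norm E (\<lambda>x. u m x - u n x) < e / 2" using cauchy[OF e2] by (rule exE)
    have "norm (l2norm E (\<lambda>x. u n x - v x) - 0) < e" if "N \<le> n" for n using close[OF e2 N that] e by simp
    then show "\<exists>N. \<forall>n\<ge>N. norm (l2norm E (\<lambda>x. u n x - v x) - 0) < e" by blast
  qed
  then show ?thesis using vL by blast
qed

section \<open>Smooth functions\<close>

text \<open>\<open>pdx\<close> is defined by a one-variable \<open>deriv\<close>, which is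
  0-information unless the derivative exists. Passing through the total derivative makes the chain
  and product rules available for computing it.\<close>

lemma pdx_eqI: "(f has_derivative f') (at p) ==> pdx f p = f' (1, 0)"
proof -
  assume f: "(f has_derivative f') (at p)"
  have g: "((\<lambda>s. (s, snd p)) has_derivative (\<lambda>h. (h, 0))) (at (fst p))"
    by (auto intro!: derivative_eq_intros)
  have "((\<lambda>s. f (s, snd p)) has_derivative (\<lambda>h. f' (h, 0))) (at (fst p))"
    using has_derivative_compose[OF g, of f f'] f by simp
  moreover have "(\<lambda>h. f' (h, 0)) = (*) (f' (1, 0))"
  proof (rule ext)
    fix h
    have "linear f'" using f by (simp add: has_derivative_linear)
    then have "f' (h *\<^sub>R (1, 0)) = h *\<^sub>R f' (1, 0)" by (rule linear_scale)
    then show "f' (h, 0) = f' (1, 0) * h" by (simp add: mult.commute)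
  qed
  ultimately have "((\<lambda>s. f (s, snd p)) has_real_derivative f' (1, 0)) (at (fst p))"
    by (simp add: has_field_derivative_def)
  then show ?thesis unfolding pdx_def by (rule DERIV_imp_deriv)
qed

lemma pdy_eqI: "(f has_derivative f') (at p) ==> pdy f p = f' (0, 1)"
proof -
  assume f: "(f has_derivative f') (at p)"
  have g: "((\<lambda>s. (fst p, s)) has_derivative (\<lambda>h. (0, h))) (at (snd p))"
    by (auto intro!: derivative_eq_intros)
  have "((\<lambda>s. f (fst p, s)) has_derivative (\<lambda>h. f' (0, h))) (at (snd p))"
    using has_derivative_compose[OF g, of f f'] f by simp
  moreover have "(\<lambda>h. f' (0, h)) = (*) (f' (0, 1))"
  proof (rule ext)
    fix h
    have "linear f'" using f by (simp add: has_derivative_linear)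
    then have "f' (h *\<^sub>R (0, 1)) = h *\<^sub>R f' (0, 1)" by (rule linear_scale)
    then show "f' (0, h) = f' (0, 1) * h" by (simp add: mult.commute)
  qed
  ultimately have "((\<lambda>s. f (fst p, s)) has_real_derivative f' (0, 1)) (at (snd p))"
    by (simp add: has_field_derivative_def)
  then show ?thesis unfolding pdy_def by (rule DERIV_imp_deriv)
qed

lemma has_derivative_pd:
  assumes "f differentiable (at p)"
  shows "(f has_derivative (\<lambda>h. pdx f p * fst h + pdy f p * snd h)) (at p)"
proof -
  obtain f' where f: "(f has_derivative f') (at p)" using assms by (auto simp: differentiable_def)
  have "f' h = pdx f p * fst h + pdy f p * snd h" for h
  proof -
    have l: "linear f'" using f by (simp add: has_derivative_linear)
    have "f' (fst h *\<^sub>R (1, 0) + snd h *\<^sub>R (0, 1)) = fst h *\<^sub>R f' (1, 0) + snd h *\<^sub>R f' (0, 1)"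
      by (simp only: linear_add[OF l] linear_scale[OF l])
    then show ?thesis using pdx_eqI[OF f] pdy_eqI[OF f] by (simp add: mult.commute)
  qed
  then have "f' = (\<lambda>h. pdx f p * fst h + pdy f p * snd h)" by (rule ext)
  then show ?thesis using f by simp
qed

lemma pdx_comb:
  assumes "f differentiable (at p)" "g differentiable (at p)"
  shows "pdx (lc a f b g) p = a * pdx f p + b * pdx g p"
  by (subst pdx_eqI[OF has_derivative_add[OF has_derivative_mult_right has_derivative_mult_right]])
    (rule has_derivative_pd assms | simp)+

lemma pdy_comb:
  assumes "f differentiable (at p)" "g differentiable (at p)"
  shows "pdy (lc a f b g) p = a * pdy f p + b * pdy g p"
  by (subst pdy_eqI[OF has_derivative_add[OF has_derivative_mult_right has_derivative_mult_right]])
    (rule has_derivative_pd assms | simp)+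

lemma pdx_mult:
  assumes "f differentiable (at p)" "g differentiable (at p)"
  shows "pdx (\<lambda>x. f x * g x) p = pdx f p * g p + f p * pdx g p"
  by (subst pdx_eqI[OF has_derivative_mult]) (rule has_derivative_pd assms | simp)+

lemma pdy_mult:
  assumes "f differentiable (at p)" "g differentiable (at p)"
  shows "pdy (\<lambda>x. f x * g x) p = pdy f p * g p + f p * pdy g p"
  by (subst pdy_eqI[OF has_derivative_mult]) (rule has_derivative_pd assms | simp)+

lemma Ck_Suc_imp: "Ck (Suc n) f ==> Ck n f"
proof (induction n arbitrary: f)
  case 0
  then show ?case
    by (auto intro!: continuous_at_imp_continuous_on differentiable_imp_continuous_within)
next
  case (Suc n)
  then show ?case by (metis Ck.simps(2))
qed

lemma Ck_comb: "Ck n f ==> Ck n g ==> Ck n (lc a f b g)"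
proof (induction n arbitrary: f g)
  case 0 then show ?case by (auto intro!: continuous_intros)
next
  case (Suc n)
  have d: "\<And>p. f differentiable (at p)" "\<And>p. g differentiable (at p)" using Suc.prems by auto
  have "pdx (lc a f b g) = (\<lambda>x. a * pdx f x + b * pdx g x)"
    "pdy (lc a f b g) = (\<lambda>x. a * pdy f x + b * pdy g x)"
    using pdx_comb[OF d] pdy_comb[OF d] by auto
  then show ?case using Suc d by (auto intro!: derivative_intros)
qed

lemma Ck_mult: "Ck n f ==> Ck n g ==> Ck n (\<lambda>x. f x * g x)"
proof (induction n arbitrary: f g)
  case 0 then show ?case by (auto intro!: continuous_intros)
next
  case (Suc n)
  have d: "\<And>p. f differentiable (at p)" "\<And>p. g differentiable (at p)" using Suc.prems by auto
  have eq: "pdx (\<lambda>x. f x * g x) = (\<lambda>x. 1 * (pdx f x * g x) + 1 * (f x * pdx g x))"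
    "pdy (\<lambda>x. f x * g x) = (\<lambda>x. 1 * (pdy f x * g x) + 1 * (f x * pdy g x))"
    using pdx_mult[OF d] pdy_mult[OF d] by auto
  have "Ck n f" "Ck n g" using Suc.prems by (auto intro: Ck_Suc_imp simp del: Ck.simps)
  moreover have "Ck n (pdx f)" "Ck n (pdx g)" "Ck n (pdy f)" "Ck n (pdy g)" using Suc.prems by auto
  ultimately have "Ck n (pdx (\<lambda>x. f x * g x))" and "Ck n (pdy (\<lambda>x. f x * g x))"
    unfolding eq by - ((intro Ck_comb Suc.IH; assumption)+)
  then show ?case using d by (auto intro!: derivative_intros)
qed

lemma Ck_affine: "Ck n f ==> Ck n (\<lambda>x. f (a * fst x + b * snd x + c, a' * fst x + b' * snd x + c'))"
proof (induction n arbitrary: f)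
  case 0
  then show ?case by (auto intro!: continuous_on_compose2[of UNIV f] continuous_intros)
next
  case (Suc n)
  let ?A = "\<lambda>x. (a * fst x + b * snd x + c, a' * fst x + b' * snd x + c')"
  have d: "f differentiable (at p)" for p using Suc.prems unfolding Ck.simps by blast
  have A: "(?A has_derivative (\<lambda>h. (a * fst h + b * snd h, a' * fst h + b' * snd h))) (at p)" for p
    by (auto intro!: derivative_eq_intros)
  have dA: "(\<lambda>x. f (?A x)) differentiable (at p)" for p
    using has_derivative_compose[OF A has_derivative_pd[OF d]] unfolding differentiable_def by blast
  have h: "((\<lambda>x. f (?A x)) has_derivative (\<lambda>h. pdx f (?A p) * (a * fst h + b * snd h) + pdy f (?A p) * (a' * fst h + b' * snd h))) (at p)" for p
    using has_derivative_compose[OF A has_derivative_pd[OF d]] by simp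
  have eq: "pdx (\<lambda>x. f (?A x)) = (\<lambda>x. a * pdx f (?A x) + a' * pdy f (?A x))"
    "pdy (\<lambda>x. f (?A x)) = (\<lambda>x. b * pdx f (?A x) + b' * pdy f (?A x))"
    using pdx_eqI[OF h] pdy_eqI[OF h] by (auto simp: mult.commute)
  have "Ck n (pdx (\<lambda>x. f (?A x)))" and "Ck n (pdy (\<lambda>x. f (?A x)))"
    unfolding eq by (rule Ck_comb[OF Suc.IH Suc.IH]; use Suc.prems in simp)+
  then show ?case using dA by simp
qed

lemma pdx_const [simp]: "pdx (\<lambda>_. c) = (\<lambda>_. 0)" and pdy_const [simp]: "pdy (\<lambda>_. c) = (\<lambda>_. 0)"
  by (auto simp: pdx_def pdy_def)

lemma Ck_const: "Ck n (\<lambda>_. c)"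
  by (induction n arbitrary: c) auto

lemma Ck_fst: "Ck n fst" and Ck_snd: "Ck n snd"
proof -
  have d: "(fst has_derivative fst) (at (p::pt))" "(snd has_derivative snd) (at (p::pt))" for p
    by (auto intro!: derivative_eq_intros)
  have eq: "pdx fst = (\<lambda>_. 1)" "pdy fst = (\<lambda>_. 0)" "pdx snd = (\<lambda>_. 0)" "pdy snd = (\<lambda>_. 1)"
    using pdx_eqI[OF d(1)] pdx_eqI[OF d(2)] pdy_eqI[OF d(1)] pdy_eqI[OF d(2)] by auto
  have df: "fst differentiable (at (p::pt))" "snd differentiable (at (p::pt))" for p
    using d[of p] unfolding differentiable_def by blast+
  show "Ck n fst"
  proof (cases n)
    case 0 then show ?thesis by (simp add: continuous_on_fst)
  next
    case (Suc m) then show ?thesis using df by (simp add: eq Ck_const del: Ck.simps(1))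
  qed
  show "Ck n snd"
  proof (cases n)
    case 0 then show ?thesis by (simp add: continuous_on_snd)
  next
    case (Suc m) then show ?thesis using df by (simp add: eq Ck_const del: Ck.simps(1))
  qed
qed

lemma smooth_comb: "smooth f ==> smooth g ==> smooth (lc a f b g)"
  by (simp add: smooth_def Ck_comb)

lemma smooth_mult: "smooth f ==> smooth g ==> smooth (\<lambda>x. f x * g x)"
  by (simp add: smooth_def Ck_mult)

lemma smooth_const: "smooth (\<lambda>_. c)"
  by (simp add: smooth_def Ck_const)

lemma smooth_affine: "smooth f ==> smooth (\<lambda>x. f (a * fst x + b * snd x + c, a' * fst x + b' * snd x + c'))"
  by (simp add: smooth_def Ck_affine)

lemma smooth_pd: "smooth f ==> smooth (pdx f)" "smooth f ==> smooth (pdy f)"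
  using Ck.simps(2) by (auto simp only: smooth_def)

lemma smooth_differentiable: "smooth f ==> f differentiable (at p)"
  using Ck.simps(2) by (auto simp only: smooth_def)

lemma smooth_has_derivative: "smooth f ==> (f has_derivative (\<lambda>h. pdx f p * fst h + pdy f p * snd h)) (at p)"
  by (simp add: has_derivative_pd smooth_differentiable)

lemma smooth_continuous: "smooth f ==> continuous_on S f"
  unfolding smooth_def by (metis Ck.simps(1) continuous_on_subset subset_UNIV)

lemma smooth_fst: "smooth fst" and smooth_snd: "smooth snd"
  by (simp_all add: smooth_def Ck_fst Ck_snd)

lemma smooth_power: "smooth f ==> smooth (\<lambda>x. f x ^ n)"
  by (induction n) (auto simp: smooth_const intro: smooth_mult)

lemma smooth_sum: "finite I ==> (\<And>i. i \<in> I ==> smooth (f i)) ==> smooth (\<lambda>x. \<Sum>i\<in>I. f i x)"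
proof (induction I rule: finite_induct)
  case empty then show ?case by (simp add: smooth_const)
next
  case (insert i I)
  then show ?case using smooth_comb[of "f i" "\<lambda>x. \<Sum>i\<in>I. f i x" 1 1] by simp
qed

lemma cD_simps: "cD 0 0 f = f" "cD 1 0 f = pdx f" "cD 0 1 f = pdy f" "cD 2 0 f = pdx (pdx f)"
  "cD 1 1 f = pdx (pdy f)" "cD 0 2 f = pdy (pdy f)"
  by (simp_all add: cD_def numeral_2_eq_2)

subsection \<open>Functions of one variable\<close>

text \<open>A function of one variable is viewed as a function of the first coordinate, so that
  every closure property of \<open>smooth\<close> carries over without a second theory of
  differentiability classes.\<close>

definition smooth1 :: "(real => real) => bool" where
  "smooth1 \<alpha> \<longleftrightarrow> smooth (\<lambda>p. \<alpha> (fst p))"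

lemma smooth1_DERIV:
  assumes "smooth1 \<alpha>" shows "(\<alpha> has_real_derivative deriv \<alpha> x) (at x)"
proof -
  have g: "((\<lambda>s. (s, 0::real)) has_derivative (\<lambda>h. (h, 0))) (at x)"
    by (auto intro!: derivative_eq_intros)
  have "((\<lambda>s. \<alpha> (fst (s, 0::real))) has_derivative (\<lambda>h. pdx (\<lambda>p. \<alpha> (fst p)) (x, 0) * h)) (at x)"
    using has_derivative_compose[OF g, OF smooth_has_derivative[OF assms[unfolded smooth1_def]]] by simp
  then have "(\<alpha> has_real_derivative pdx (\<lambda>p. \<alpha> (fst p)) (x, 0)) (at x)"
    by (simp add: has_field_derivative_def)
  then show ?thesis using DERIV_imp_deriv by fastforce
qed

lemma pd_fst_compose: "smooth1 \<alpha> ==> pdx (\<lambda>p. \<alpha> (fst p)) = (\<lambda>p. deriv \<alpha> (fst p))"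
  "pdy (\<lambda>p. \<alpha> (fst p)) = (\<lambda>_. 0)"
  by (auto simp: pdx_def pdy_def fun_eq_iff)

lemma smooth1_deriv: "smooth1 \<alpha> ==> smooth1 (deriv \<alpha>)"
  using smooth_pd(1)[of "\<lambda>p. \<alpha> (fst p)"] pd_fst_compose(1)[of \<alpha>] by (simp add: smooth1_def)

lemma smooth1_mult: "smooth1 \<alpha> ==> smooth1 \<beta> ==> smooth1 (\<lambda>x. \<alpha> x * \<beta> x)"
  unfolding smooth1_def by (rule smooth_mult)

lemma smooth1_comb: "smooth1 \<alpha> ==> smooth1 \<beta> ==> smooth1 (\<lambda>x. a * \<alpha> x + b * \<beta> x)"
  unfolding smooth1_def by (rule smooth_comb)

lemma smooth1_cmult: "smooth1 \<alpha> ==> smooth1 (\<lambda>x. c * \<alpha> x)"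
  using smooth1_comb[of \<alpha> \<alpha> c 0] by simp

lemma smooth_ridge: "smooth1 \<alpha> ==> smooth (\<lambda>x. \<alpha> (a * fst x + b * snd x + c))"
  unfolding smooth1_def using smooth_affine[of "\<lambda>p. \<alpha> (fst p)" a b c 0 0 0] by simp

lemma smooth1_affine: "smooth1 \<alpha> ==> smooth1 (\<lambda>x. \<alpha> (a * x + c))"
  unfolding smooth1_def[of "\<lambda>x. \<alpha> (a * x + c)"] using smooth_ridge[of \<alpha> a 0 c] by simp

lemma smooth1_continuous: "smooth1 \<alpha> ==> continuous_on S \<alpha>"
  by (rule DERIV_continuous_on, rule has_field_derivative_at_within, rule smooth1_DERIV)

lemma has_derivative_fst_compose:
  assumes "(B has_real_derivative c) (at (fst p))"
  shows "((\<lambda>p. B (fst p)) has_derivative (\<lambda>h. c * fst h)) (at (p::pt))"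
proof (rule has_derivative_compose[of fst fst p UNIV B "(*) c"])
  show "(fst has_derivative fst) (at p)" by (auto intro!: derivative_eq_intros)
  show "(B has_derivative (*) c) (at (fst p))" using assms by (simp add: has_field_derivative_def)
qed

text \<open>The partial derivatives of B(x) as a function on the plane are smooth, so B is of every
  class. Needed for primitives that serve as test functions.\<close>

lemma smooth1_antideriv:
  assumes B: "\<And>x. (B has_real_derivative \<alpha> x) (at x)" and \<alpha>: "smooth1 \<alpha>"
  shows "smooth1 B"
proof -
  have d: "((\<lambda>p. B (fst p)) has_derivative (\<lambda>h. \<alpha> (fst p) * fst h)) (at (p::pt))" for p
    using B by (rule has_derivative_fst_compose)
  have df: "(\<lambda>p. B (fst p)) differentiable (at (p::pt))" for p
    using d[of p] unfolding differentiable_def by blast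
  have eq: "pdx (\<lambda>p. B (fst p)) = (\<lambda>p. \<alpha> (fst p))" "pdy (\<lambda>p. B (fst p)) = (\<lambda>_. 0)"
    using pdx_eqI[OF d] pdy_eqI[OF d] by auto
  have "Ck (Suc n) (\<lambda>p. B (fst p))" for n
    using df \<alpha> by (simp add: eq Ck_const smooth1_def smooth_def)
  then show ?thesis unfolding smooth1_def smooth_def using Ck_Suc_imp by blast
qed

lemma smooth_prod: "smooth1 \<alpha> ==> smooth1 \<beta> ==> smooth (\<lambda>p. \<alpha> (fst p) * \<beta> (snd p))"
  using smooth_mult[OF smooth_ridge[of \<alpha> 1 0 0] smooth_ridge[of \<beta> 0 1 0]] by simp

lemma pd_ridge:
  assumes "smooth1 \<alpha>"
  shows "pdx (\<lambda>x. \<alpha> (a * fst x + b * snd x + c)) p = a * deriv \<alpha> (a * fst p + b * snd p + c)"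
    "pdy (\<lambda>x. \<alpha> (a * fst x + b * snd x + c)) p = b * deriv \<alpha> (a * fst p + b * snd p + c)"
proof -
  have A: "((\<lambda>x. a * fst x + b * snd x + c) has_derivative (\<lambda>h. a * fst h + b * snd h)) (at p)"
    by (auto intro!: derivative_eq_intros)
  have d: "((\<lambda>x. \<alpha> (a * fst x + b * snd x + c)) has_derivative
      (\<lambda>h. deriv \<alpha> (a * fst p + b * snd p + c) * (a * fst h + b * snd h))) (at p)"
    using has_derivative_compose[OF A] smooth1_DERIV[OF assms, unfolded has_field_derivative_def] by blast
  show "pdx (\<lambda>x. \<alpha> (a * fst x + b * snd x + c)) p = a * deriv \<alpha> (a * fst p + b * snd p + c)"
    "pdy (\<lambda>x. \<alpha> (a * fst x + b * snd x + c)) p = b * deriv \<alpha> (a * fst p + b * snd p + c)"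
    using pdx_eqI[OF d] pdy_eqI[OF d] by auto
qed

abbreviation tensor :: "(real => real) => (real => real) => fld" where
  "tensor \<alpha> \<beta> \<equiv> \<lambda>x. \<alpha> (fst x) * \<beta> (snd x)"

lemma pd_prod:
  assumes "smooth1 \<alpha>" "smooth1 \<beta>"
  shows "pdx (tensor \<alpha> \<beta>) = (tensor (deriv \<alpha>) \<beta>)"
    "pdy (tensor \<alpha> \<beta>) = (tensor \<alpha> (deriv \<beta>))"
proof -
  have d: "(\<lambda>p. \<alpha> (fst p)) differentiable (at p)" "(\<lambda>p. \<beta> (snd p)) differentiable (at p)" for p :: pt
    using smooth_differentiable[OF smooth_ridge[OF assms(1), of 1 0 0]]
      smooth_differentiable[OF smooth_ridge[OF assms(2), of 0 1 0]] by auto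
  show "pdx (tensor \<alpha> \<beta>) = (tensor (deriv \<alpha>) \<beta>)"
    "pdy (tensor \<alpha> \<beta>) = (tensor \<alpha> (deriv \<beta>))"
    using pdx_mult[OF d] pdy_mult[OF d] pd_ridge[OF assms(1), of 1 0 0] pd_ridge[OF assms(2), of 0 1 0]
    by (auto simp: fun_eq_iff)
qed

text \<open>The basic flat function, times a polynomial in \<open>1/x\<close>; this family is closed under
  differentiation.\<close>

definition flat :: "real poly => real => real" where
  "flat P x = (if 0 < x then poly P (1 / x) * exp (- 1 / x) else 0)"

lemma poly_exp_tendsto_0: "((\<lambda>t. poly P t * exp (- t)) \<longlongrightarrow> (0::real)) at_top"
proof -
  have "((\<lambda>t. \<Sum>i\<le>degree P. coeff P i * (t ^ i / exp t)) \<longlongrightarrow> (\<Sum>i\<le>degree P. coeff P i * 0)) at_top"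
    by (intro tendsto_intros tendsto_power_div_exp_0)
  moreover have "(\<lambda>t. \<Sum>i\<le>degree P. coeff P i * (t ^ i / exp t)) = (\<lambda>t. poly P t * exp (- t))"
    by (auto simp: poly_altdef exp_minus sum_distrib_right divide_inverse mult.assoc)
  ultimately show ?thesis by simp
qed

text \<open>For x > 0 the chain rule gives (P - P')(1/x) x^-2 exp(-1/x), and the factor x^-2 is the
  monomial of degree 2 in 1/x. At 0 the right difference quotient is again of this type, with P
  multiplied by its variable, and tends to 0 because the exponential wins.\<close>

lemma flat_DERIV: "(flat P has_real_derivative flat (monom 1 2 * (P - pderiv P)) x) (at x)"
proof -
  consider "0 < x" | "x < 0" | "x = 0" by linarith
  then show ?thesis
  proof cases
    case 1
    have "((\<lambda>x. poly P (1 / x) * exp (- 1 / x)) has_real_derivative flat (monom 1 2 * (P - pderiv P)) x) (at x)"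
      using 1 by (auto intro!: derivative_eq_intros DERIV_chain2[OF poly_DERIV]
          simp: flat_def poly_monom power2_eq_square field_simps)
    moreover have "\<forall>\<^sub>F y in nhds x. poly P (1 / y) * exp (- 1 / y) = flat P y"
      using eventually_nhds_in_open[of "{0<..}" x] 1 by (auto simp: flat_def elim!: eventually_mono)
    ultimately show ?thesis by (subst (asm) DERIV_cong_ev[OF refl _ refl])
  next
    case 2
    have "((\<lambda>x. 0) has_real_derivative flat (monom 1 2 * (P - pderiv P)) x) (at x)"
      using 2 by (simp add: flat_def)
    moreover have "\<forall>\<^sub>F y in nhds x. 0 = flat P y"
      using eventually_nhds_in_open[of "{..<0}" x] 2 by (auto simp: flat_def elim!: eventually_mono)
    ultimately show ?thesis by (subst (asm) DERIV_cong_ev[OF refl _ refl])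
  next
    case 3
    have "((\<lambda>h. flat P h / h) \<longlongrightarrow> 0) (at_right 0)"
    proof -
      have "((\<lambda>h. poly (monom 1 1 * P) (inverse h) * exp (- inverse h)) \<longlongrightarrow> 0) (at_right 0)"
        by (rule filterlim_compose[OF poly_exp_tendsto_0 filterlim_inverse_at_top_right])
      moreover have "\<forall>\<^sub>F h in at_right 0. poly (monom 1 1 * P) (inverse h) * exp (- inverse h) = flat P h / h"
        using eventually_at_right_less[of 0]
        by eventually_elim (simp add: flat_def poly_monom field_simps inverse_eq_divide)
      ultimately show ?thesis by (rule Lim_transform_eventually)
    qed
    moreover have "((\<lambda>h. flat P h / h) \<longlongrightarrow> 0) (at_left 0)"
    proof -
      have "\<forall>\<^sub>F h in at_left 0. 0 = flat P h / h"
        by (auto simp: eventually_at_filter flat_def intro!: always_eventually)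
      then show ?thesis by (rule Lim_transform_eventually[OF tendsto_const])
    qed
    ultimately have "((\<lambda>h. flat P h / h) \<longlongrightarrow> 0) (at 0)" by (simp add: filterlim_at_split)
    then show ?thesis using 3 by (simp add: DERIV_def flat_def)
  qed
qed

lemma smooth1_flat: "smooth1 (flat P)"
proof -
  have d: "((\<lambda>p. flat P (fst p)) has_derivative (\<lambda>h. flat (monom 1 2 * (P - pderiv P)) (fst p) * fst h)) (at (p::pt))" for P p
    using flat_DERIV by (rule has_derivative_fst_compose)
  have df: "(\<lambda>p. flat P (fst p)) differentiable (at (p::pt))" for P p
    using d[of P p] unfolding differentiable_def by blast
  have eq: "pdx (\<lambda>p. flat P (fst p)) = (\<lambda>p. flat (monom 1 2 * (P - pderiv P)) (fst p))" "pdy (\<lambda>p. flat P (fst p)) = (\<lambda>_. 0)" for P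
    using pdx_eqI[OF d] pdy_eqI[OF d] by auto
  have "Ck n (\<lambda>p. flat P (fst p))" for n
  proof (induction n arbitrary: P)
    case 0
    have "(\<lambda>p. flat P (fst p)) differentiable_on (UNIV :: pt set)"
      using df[of P] by (simp add: differentiable_on_eq_differentiable_at)
    then show ?case by (simp add: differentiable_imp_continuous_on)
  next
    case (Suc n)
    show ?case using df Suc by (simp add: eq Ck_const)
  qed
  then show ?thesis by (simp add: smooth1_def smooth_def)
qed

definition expi :: "real => real" where
  "expi x = (if 0 < x then exp (- 1 / x) else 0)"

lemma smooth1_expi: "smooth1 expi"
proof -
  have "expi = flat 1" by (auto simp: expi_def flat_def)
  show ?thesis unfolding \<open>expi = flat 1\<close> by (rule smooth1_flat)
qed

lemma expi_bounds: "0 \<le> expi x" "expi x \<le> 1"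
  by (auto simp: expi_def)

lemma expi_pos_iff: "0 < expi x \<longleftrightarrow> 0 < x"
  by (simp add: expi_def)

lemma expi_eq_0: "x \<le> 0 ==> expi x = 0"
  by (simp add: expi_def)

text \<open>Smooth approximation of the indicator of the positive half-line, equal to 0 up to 1/n.
  It takes no plateau value: exp(-1/(nx-1)) tends to 1 pointwise, which suffices for dominated
  convergence. For n = 0 it is identically 0.\<close>

definition cutoff :: "nat => real => real" where
  "cutoff n x = expi (real n * x - 1)"

lemma smooth1_cutoff: "smooth1 (cutoff n)"
  unfolding cutoff_def[abs_def] using smooth1_affine[OF smooth1_expi, of "real n" "-1"] by simp

lemma cutoff_bounds: "0 \<le> cutoff n x" "cutoff n x \<le> 1"
  by (simp_all add: cutoff_def expi_bounds)

lemma cutoff_eq_0: "x \<le> 1 / real n ==> cutoff n x = 0"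
  unfolding cutoff_def by (rule expi_eq_0) (cases "n = 0"; simp add: field_simps)

lemma cutoff_tendsto: "0 < x ==> (\<lambda>n. cutoff n x) \<longlonglongrightarrow> 1"
proof -
  assume x: "0 < x"
  have f: "filterlim (\<lambda>n. -1 + real n * x) at_top sequentially"
    by (intro filterlim_tendsto_add_at_top[OF tendsto_const] filterlim_at_top_mult_tendsto_pos[OF tendsto_const x] filterlim_real_sequentially)
  then have "(\<lambda>n. inverse (-1 + real n * x)) \<longlonglongrightarrow> 0"
    by (rule filterlim_compose[OF tendsto_inverse_0_at_top[OF filterlim_ident]])
  then have "(\<lambda>n. exp (- inverse (-1 + real n * x))) \<longlonglongrightarrow> exp (- 0)" by (intro tendsto_intros)
  moreover have "\<forall>\<^sub>F n in sequentially. exp (- inverse (-1 + real n * x)) = cutoff n x"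
    using f[unfolded filterlim_at_top_dense, rule_format, of 0]
    by eventually_elim (simp add: cutoff_def expi_def inverse_eq_divide algebra_simps)
  ultimately show ?thesis by (simp add: Lim_transform_eventually)
qed

text \<open>Bounded by 1, compactly supported inside the open interval from a to b, and pointwise
  convergent to its indicator. Products of two such functions approximate indicators of
  rectangles.\<close>

definition bump :: "nat => real => real => real => real" where
  "bump n a b x = cutoff n (x - a) * cutoff n (b - x)"

lemma smooth1_bump: "smooth1 (bump n a b)"
  unfolding bump_def[abs_def]
  using smooth1_mult[OF smooth1_affine[OF smooth1_cutoff, of n 1 "-a"] smooth1_affine[OF smooth1_cutoff, of n "-1" b]]
  by (simp add: algebra_simps)

lemma bump_bounds: "0 \<le> bump n a b x" "bump n a b x \<le> 1"
  by (auto simp: bump_def cutoff_bounds intro: mult_le_one)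

lemma bump_eq_0: "x \<notin> {a + 1 / real n<..<b - 1 / real n} ==> bump n a b x = 0"
  using cutoff_eq_0[of "x - a" n] cutoff_eq_0[of "b - x" n] by (auto simp: bump_def not_less algebra_simps)

lemma bump_tendsto: "(\<lambda>n. bump n a b x) \<longlonglongrightarrow> indicator {a<..<b} x"
proof (cases "a < x \<and> x < b")
  case True
  then show ?thesis unfolding bump_def
    using tendsto_mult[OF cutoff_tendsto[of "x - a"] cutoff_tendsto[of "b - x"]] by simp
next
  case False
  then have "bump n a b x = 0" for n
    by (intro bump_eq_0) (auto simp: not_less intro: order_trans[of _ b] order_trans[of _ a])
  then show ?thesis using False by (auto simp: indicator_def)
qed

section \<open>Test functions and weak derivatives\<close>

text \<open>Both spellings of the index 1, since simplification may have turned it into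
  \<open>Suc 0\<close>.\<close>

lemmas cD_simps' = cD_simps cD_simps[unfolded One_nat_def]

lemma test_funI:
  assumes "smooth \<psi>" "compact K" "K \<subseteq> E" "\<And>x. x \<notin> K ==> \<psi> x = 0"
  shows "\<psi> \<in> test_fun E"
proof -
  have "{x. \<psi> x \<noteq> 0} \<subseteq> K" using assms(4) by auto
  then have cl: "closure {x. \<psi> x \<noteq> 0} \<subseteq> K"
    using compact_imp_closed[OF assms(2)] by (rule closure_minimal)
  then have "compact (closure {x. \<psi> x \<noteq> 0})"
    using assms(2) by (metis closed_closure compact_Int_closed inf.absorb_iff2)
  then show ?thesis using assms cl by (auto simp: test_fun_def)
qed

lemma test_funE:
  assumes "\<psi> \<in> test_fun E"
  obtains K where "smooth \<psi>" "compact K" "K \<subseteq> E" "\<forall>x. x \<notin> K --> \<psi> x = 0"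
proof (rule that[of "closure {x. \<psi> x \<noteq> 0}"])
  show "\<forall>x. x \<notin> closure {x. \<psi> x \<noteq> 0} --> \<psi> x = 0"
    using closure_subset[of "{x. \<psi> x \<noteq> 0}"] by auto
qed (use assms in \<open>auto simp: test_fun_def\<close>)

lemma test_fun_smooth: "\<psi> \<in> test_fun E ==> smooth \<psi>"
  by (simp add: test_fun_def)

lemma test_fun_mono: "\<psi> \<in> test_fun E' ==> E' \<subseteq> E ==> \<psi> \<in> test_fun E"
  by (auto simp: test_fun_def)

lemma pd_outside:
  assumes "smooth \<psi>" "closed K" "\<And>x. x \<notin> K ==> \<psi> x = 0" "p \<notin> K"
  shows "pdx \<psi> p = 0" "pdy \<psi> p = 0"
proof -
  have "((\<lambda>_. 0::real) has_derivative (\<lambda>_. 0)) (at p)" by simp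
  then have "(\<psi> has_derivative (\<lambda>_. 0)) (at p)"
    by (rule has_derivative_transform_within_open[of _ _ _ _ "- K"]) (use assms in auto)
  then show "pdx \<psi> p = 0" "pdy \<psi> p = 0" using pdx_eqI pdy_eqI by blast+
qed

lemma test_fun_pd:
  assumes "\<psi> \<in> test_fun E" shows "pdx \<psi> \<in> test_fun E" "pdy \<psi> \<in> test_fun E"
proof -
  obtain K where K: "smooth \<psi>" "compact K" "K \<subseteq> E" "\<forall>x. x \<notin> K --> \<psi> x = 0"
    using assms by (rule test_funE)
  note K = K(1-3) K(4)[rule_format]
  note z = pd_outside[OF K(1) compact_imp_closed[OF K(2)] K(4)]
  show "pdx \<psi> \<in> test_fun E" by (rule test_funI[OF smooth_pd(1)[OF K(1)] K(2,3)]) (rule z)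
  show "pdy \<psi> \<in> test_fun E" by (rule test_funI[OF smooth_pd(2)[OF K(1)] K(2,3)]) (rule z)
qed

lemma test_fun_pd_pow: "\<psi> \<in> test_fun E ==> (pdx ^^ i) \<psi> \<in> test_fun E" "\<psi> \<in> test_fun E ==> (pdy ^^ i) \<psi> \<in> test_fun E"
  by (induction i) (auto intro: test_fun_pd)

lemma test_fun_cD: "\<psi> \<in> test_fun E ==> cD i j \<psi> \<in> test_fun E"
  by (simp add: cD_def test_fun_pd_pow)

lemma test_fun_mult:
  assumes "\<psi> \<in> test_fun E" "smooth f"
  shows "(\<lambda>x. f x * \<psi> x) \<in> test_fun E"
proof -
  obtain K where K: "smooth \<psi>" "compact K" "K \<subseteq> E" "\<forall>x. x \<notin> K --> \<psi> x = 0"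
    using assms(1) by (rule test_funE)
  note K = K(1-3) K(4)[rule_format]
  show ?thesis by (rule test_funI[OF smooth_mult[OF assms(2) K(1)] K(2,3)]) (simp add: K(4))
qed

lemma continuous_L2:
  fixes f :: "'a::euclidean_space => real"
  assumes f: "continuous_on UNIV f" and E: "bounded E" "E \<in> sets lebesgue"
  shows "f \<in> L2 E"
proof (rule L2I)
  have fb: "f \<in> borel_measurable borel" using f by (rule borel_measurable_continuous_onI)
  then have "f \<in> borel_measurable lebesgue" by (simp add: measurable_completion)
  then show "f \<in> borel_measurable (lebesgue_on E)" by (rule measurable_restrict_space1)
  obtain r where "\<forall>x\<in>E. norm x \<le> r" using E(1) by (auto simp: bounded_iff)
  then have r: "E \<subseteq> cball 0 r" by auto
  have "continuous_on (cball 0 r) (\<lambda>x. (f x)\<^sup>2)"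
    using continuous_on_subset[OF f] by (intro continuous_on_power) auto
  then have "integrable lborel (\<lambda>x. indicator (cball 0 r) x *\<^sub>R (f x)\<^sup>2)"
    using compact_cball by (intro borel_integrable_compact)
  then have "integrable lebesgue (\<lambda>x. indicator (cball 0 r) x *\<^sub>R (f x)\<^sup>2)"
    using integrable_completion borel_measurable_integrable by blast
  then have "integrable (lebesgue_on (cball 0 r)) (\<lambda>x. (f x)\<^sup>2)"
    by (simp add: integrable_restrict_space)
  then show "integrable (lebesgue_on E) (\<lambda>x. (f x)\<^sup>2)"
    by (rule integrable_lebesgue_on_subset[OF _ r _ E(2)]) auto
qed

lemma smooth_L2: "smooth f ==> bounded E ==> E \<in> sets lebesgue ==> f \<in> L2 E"
  by (intro continuous_L2 smooth_continuous)

lemma test_fun_L2: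
  assumes "\<psi> \<in> test_fun E" and E': "E' \<in> sets lebesgue"
  shows "\<psi> \<in> L2 E'"
proof (rule L2I)
  obtain K where K: "smooth \<psi>" "compact K" "K \<subseteq> E" "\<forall>x. x \<notin> K --> \<psi> x = 0"
    using assms(1) by (rule test_funE)
  note K = K(1-3) K(4)[rule_format]
  have Ks: "K \<in> sets lebesgue" using K(2) by (simp add: borel_compact)
  have "\<psi> \<in> borel_measurable borel" using smooth_continuous[OF K(1)] by (rule borel_measurable_continuous_onI)
  then have "\<psi> \<in> borel_measurable lebesgue" by (simp add: measurable_completion)
  then show "\<psi> \<in> borel_measurable (lebesgue_on E')" by (rule measurable_restrict_space1)
  have "\<psi> \<in> L2 K" using K(1) compact_imp_bounded[OF K(2)] Ks by (rule smooth_L2)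
  then have "integrable lebesgue (\<lambda>x. indicator K x *\<^sub>R (\<psi> x)\<^sup>2)"
    using Ks by (simp add: L2_def integrable_restrict_space)
  then have "integrable lebesgue (\<lambda>x. indicator E' x *\<^sub>R (indicator K x *\<^sub>R (\<psi> x)\<^sup>2))"
    using E' by (intro integrable_mult_indicator[of E'])
  moreover have "(\<lambda>x. indicator E' x *\<^sub>R (indicat_real K x *\<^sub>R (\<psi> x)\<^sup>2)) = (\<lambda>x. indicator E' x *\<^sub>R (\<psi> x)\<^sup>2)"
    using K(4) by (auto simp: fun_eq_iff indicator_def)
  ultimately show "integrable (lebesgue_on E') (\<lambda>x. (\<psi> x)\<^sup>2)"
    using E' by (simp add: integrable_restrict_space)
qed

subsection \<open>Integration by parts\<close>

lemma integral_deriv_compact_support: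
  fixes f :: "real => real"
  assumes f: "\<And>x. (f has_real_derivative f' x) (at x)" and c: "continuous_on UNIV f'"
    and R: "0 \<le> R" "\<And>x. R \<le> \<bar>x\<bar> ==> f x = 0" "\<And>x. R \<le> \<bar>x\<bar> ==> f' x = 0"
  shows "integral\<^sup>L lborel f' = 0"
proof -
  have "(LINT x|lborel. indicator {-R..R} x *\<^sub>R f' x) = f R - f (-R)"
  proof (rule integral_FTC_Icc)
    show "-R \<le> R" using R(1) by simp
    show "(f has_vector_derivative f' x) (at x within {-R..R})" if "-R \<le> x" "x \<le> R" for x
      using has_field_derivative_at_within[OF f] by (simp add: has_real_derivative_iff_has_vector_derivative[symmetric])
    show "continuous_on {-R..R} f'" by (rule continuous_on_subset[OF c]) simp
  qed
  also have "(\<lambda>x. indicator {-R..R} x *\<^sub>R f' x) = f'"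
  proof
    fix x show "indicator {-R..R} x *\<^sub>R f' x = f' x"
      using R(3)[of x] by (cases "R \<le> \<bar>x\<bar>") (auto simp: indicator_def)
  qed
  finally show ?thesis using R(1,2) by simp
qed

lemma smooth_DERIV_x:
  assumes "smooth f" shows "((\<lambda>s. f (s, y)) has_real_derivative pdx f (x, y)) (at x)"
proof -
  have g: "((\<lambda>s. (s, y)) has_derivative (\<lambda>h. (h, 0))) (at x)"
    by (auto intro!: derivative_eq_intros)
  show ?thesis
    using has_derivative_compose[OF g, OF smooth_has_derivative[OF assms]] by (simp add: has_field_derivative_def)
qed

lemma smooth_DERIV_y:
  assumes "smooth f" shows "((\<lambda>s. f (x, s)) has_real_derivative pdy f (x, y)) (at y)"
proof -
  have g: "((\<lambda>s. (x, s)) has_derivative (\<lambda>h. (0, h))) (at y)"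
    by (auto intro!: derivative_eq_intros)
  show ?thesis
    using has_derivative_compose[OF g, OF smooth_has_derivative[OF assms]] by (simp add: has_field_derivative_def)
qed

lemma test_fun_integrable_lborel:
  assumes "\<psi> \<in> test_fun E" shows "integrable lborel \<psi>"
proof -
  obtain K where K: "smooth \<psi>" "compact K" "K \<subseteq> E" "\<forall>x. x \<notin> K --> \<psi> x = 0"
    using assms(1) by (rule test_funE)
  note K = K(1-3) K(4)[rule_format]
  have "integrable lborel (\<lambda>x. indicator K x *\<^sub>R \<psi> x)"
    using K(2) smooth_continuous[OF K(1)] by (rule borel_integrable_compact)
  moreover have "(\<lambda>x. indicator K x *\<^sub>R \<psi> x) = \<psi>" using K(4) by (auto simp: fun_eq_iff indicator_def)
  ultimately show ?thesis by simp
qed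

text \<open>Fubini with the inner integral in the direction of differentiation; there the
  fundamental theorem of calculus gives the difference of two values outside the support.\<close>

lemma integral_pd_test_fun:
  assumes "\<psi> \<in> test_fun E"
  shows "integral\<^sup>L lebesgue (pdx \<psi>) = 0" "integral\<^sup>L lebesgue (pdy \<psi>) = 0"
proof -
  obtain K where K: "smooth \<psi>" "compact K" "K \<subseteq> E" "\<forall>x. x \<notin> K --> \<psi> x = 0"
    using assms(1) by (rule test_funE)
  note K = K(1-3) K(4)[rule_format]
  note z = pd_outside[OF K(1) compact_imp_closed[OF K(2)] K(4)]
  obtain r where r: "\<And>x. x \<in> K ==> norm x \<le> r" using compact_imp_bounded[OF K(2)] by (auto simp: bounded_iff)
  define R where "R = \<bar>r\<bar> + 1"
  have R: "(x, y) \<notin> K" if "R \<le> \<bar>x\<bar> \<or> R \<le> \<bar>y\<bar>" for x y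
  proof
    assume "(x, y) \<in> K"
    then have "norm (x, y) \<le> r" by (rule r)
    then show False using that norm_fst_le[of x y] norm_snd_le[of y x] by (auto simp: R_def)
  qed
  have i: "integrable lborel (pdx \<psi>)" "integrable lborel (pdy \<psi>)"
    using test_fun_pd[OF assms] by (auto intro: test_fun_integrable_lborel)
  have cx: "continuous_on UNIV (\<lambda>x. pdx \<psi> (x, y))" for y
    by (rule continuous_on_compose2[OF smooth_continuous[OF smooth_pd(1)[OF K(1)], of UNIV]]) (auto intro!: continuous_intros)
  have cy: "continuous_on UNIV (\<lambda>y. pdy \<psi> (x, y))" for x
    by (rule continuous_on_compose2[OF smooth_continuous[OF smooth_pd(2)[OF K(1)], of UNIV]]) (auto intro!: continuous_intros)
  have "integral\<^sup>L lebesgue (pdx \<psi>) = integral\<^sup>L lborel (pdx \<psi>)"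
    by (intro integral_completion) (use i(1) in simp)
  also have "\<dots> = (\<integral>y. (\<integral>x. pdx \<psi> (x, y) \<partial>lborel) \<partial>lborel)"
    using i(1) by (subst lborel_pair.integral_snd) (auto simp: lborel_prod)
  also have "(\<lambda>y. \<integral>x. pdx \<psi> (x, y) \<partial>lborel) = (\<lambda>_. 0)"
  proof
    fix y
    show "(\<integral>x. pdx \<psi> (x, y) \<partial>lborel) = 0"
      by (rule integral_deriv_compact_support[OF smooth_DERIV_x[OF K(1)] cx, of R]) (auto simp: R z K(4), simp add: R_def)
  qed
  finally show "integral\<^sup>L lebesgue (pdx \<psi>) = 0" by simp
  have "integral\<^sup>L lebesgue (pdy \<psi>) = integral\<^sup>L lborel (pdy \<psi>)"
    by (intro integral_completion) (use i(2) in simp)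
  also have "\<dots> = (\<integral>x. (\<integral>y. pdy \<psi> (x, y) \<partial>lborel) \<partial>lborel)"
    using i(2) by (subst lborel_pair.integral_fst') (auto simp: lborel_prod)
  also have "(\<lambda>x. \<integral>y. pdy \<psi> (x, y) \<partial>lborel) = (\<lambda>_. 0)"
  proof
    fix x
    show "(\<integral>y. pdy \<psi> (x, y) \<partial>lborel) = 0"
      by (rule integral_deriv_compact_support[OF smooth_DERIV_y[OF K(1)] cy, of R]) (auto simp: R z K(4), simp add: R_def)
  qed
  finally show "integral\<^sup>L lebesgue (pdy \<psi>) = 0" by simp
qed

text \<open>The product of f with a test function is a test function, so the integral of its partial
  derivative is 0.\<close>

lemma by_parts:
  assumes f: "smooth f" and \<psi>: "\<psi> \<in> test_fun E" and E: "E \<in> sets lebesgue"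
  shows "l2ip E f (pdx \<psi>) = - l2ip E (pdx f) \<psi>" "l2ip E f (pdy \<psi>) = - l2ip E (pdy f) \<psi>"
proof -
  obtain K where K: "smooth \<psi>" "compact K" "K \<subseteq> E" "\<forall>x. x \<notin> K --> \<psi> x = 0"
    using \<psi> by (rule test_funE)
  note K = K(1-3) K(4)[rule_format]
  note z = pd_outside[OF K(1) compact_imp_closed[OF K(2)] K(4)]
  have lb: "l2ip E u v = (LINT x|lebesgue. u x * v x)" if "\<And>x. x \<notin> K ==> v x = 0" for u v :: fld
  proof -
    have "l2ip E u v = (LINT x|lebesgue. indicator E x *\<^sub>R (u x * v x))"
      unfolding l2ip_def using E by (simp add: integral_restrict_space)
    also have "(\<lambda>x. indicator E x *\<^sub>R (u x * v x)) = (\<lambda>x. u x * v x)"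
      using that K(3) by (auto simp: fun_eq_iff indicator_def)
    finally show ?thesis .
  qed
  have int: "integrable lebesgue (\<lambda>x. g x * v x)" if "smooth g" "v \<in> test_fun E" for g v
    using test_fun_integrable_lborel[OF test_fun_mult[OF that(2,1)]] integrable_completion borel_measurable_integrable by blast
  have d: "f differentiable (at p)" "\<psi> differentiable (at p)" for p
    using f K(1) by (auto intro: smooth_differentiable)
  have "0 = (LINT x|lebesgue. pdx f x * \<psi> x + f x * pdx \<psi> x)"
    using integral_pd_test_fun(1)[OF test_fun_mult[OF \<psi> f]] by (simp add: ext[of "pdx _", OF pdx_mult[OF d]])
  also have "\<dots> = l2ip E (pdx f) \<psi> + l2ip E f (pdx \<psi>)"
    by (subst Bochner_Integration.integral_add) (auto simp: lb K(4) z intro: int smooth_pd f \<psi> test_fun_pd)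
  finally show "l2ip E f (pdx \<psi>) = - l2ip E (pdx f) \<psi>" by simp
  have "0 = (LINT x|lebesgue. pdy f x * \<psi> x + f x * pdy \<psi> x)"
    using integral_pd_test_fun(2)[OF test_fun_mult[OF \<psi> f]] by (simp add: ext[of "pdy _", OF pdy_mult[OF d]])
  also have "\<dots> = l2ip E (pdy f) \<psi> + l2ip E f (pdy \<psi>)"
    by (subst Bochner_Integration.integral_add) (auto simp: lb K(4) z intro: int smooth_pd f \<psi> test_fun_pd)
  finally show "l2ip E f (pdy \<psi>) = - l2ip E (pdy f) \<psi>" by simp
qed

subsection \<open>The fundamental lemma\<close>

lemma prod_test_fun:
  assumes "smooth1 \<alpha>" "smooth1 \<beta>" "\<And>x. x \<notin> {a..b} ==> \<alpha> x = 0" "\<And>x. x \<notin> {c..d} ==> \<beta> x = 0" "{a..b} \<times> {c..d} \<subseteq> E"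
  shows "(tensor \<alpha> \<beta>) \<in> test_fun E"
proof (rule test_funI[of _ "{a..b} \<times> {c..d}"])
  show "\<alpha> (fst p) * \<beta> (snd p) = 0" if "p \<notin> {a..b} \<times> {c..d}" for p
  proof (cases "fst p \<in> {a..b}")
    case True
    then have "snd p \<notin> {c..d}" using that by (cases p) auto
    then show ?thesis using assms(4) by simp
  qed (use assms(3) in simp)
qed (use assms in \<open>auto intro: smooth_prod compact_Times\<close>)

lemma bump_outside: "x \<notin> {a..b} ==> bump n a b x = 0"
proof (rule bump_eq_0)
  assume "x \<notin> {a..b}"
  moreover have "0 \<le> 1 / real n" by simp
  ultimately show "x \<notin> {a + 1 / real n<..<b - 1 / real n}" unfolding atLeastAtMost_iff greaterThanLessThan_iff by linarith
qed

lemma One_pt: "(One :: pt) = (1, 1)"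
  by (simp add: prod_eq_iff Basis_prod_def sum.union_disjoint sum.reindex inj_on_def fst_sum snd_sum)

text \<open>Products of bumps converge to the indicator of the open rectangle and are dominated by
  that of the closed one, on which u is integrable.\<close>

lemma fundamental_box:
  assumes E: "E \<in> sets lebesgue" and u: "u \<in> L2 E" and sub: "{a..b} \<times> {c..d} \<subseteq> E"
    and z: "\<And>\<alpha> \<beta>. smooth1 \<alpha> ==> smooth1 \<beta> ==> (\<And>x. x \<notin> {a..b} ==> \<alpha> x = 0) ==> (\<And>x. x \<notin> {c..d} ==> \<beta> x = 0)
       ==> l2ip E u (tensor \<alpha> \<beta>) = 0"
  shows "l2ip E u (indicator ({a<..<b} \<times> {c<..<d})) = 0"
proof -
  let ?Q = "{a..b} \<times> {c..d}"
  have Q: "compact ?Q" by (intro compact_Times) auto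
  have Qs: "?Q \<in> sets lebesgue" using borel_compact[OF Q] by simp
  have one: "indicator ?Q \<in> L2 E"
  proof (rule L2I)
    show "indicat_real ?Q \<in> borel_measurable (lebesgue_on E)"
      using Qs by (intro measurable_restrict_space1 borel_measurable_indicator)
    have "?Q \<in> lmeasurable" using Q by (rule lmeasurable_compact)
    then have "integrable lebesgue (indicat_real ?Q)" by (simp add: lmeasurable_iff_integrable)
    then have "integrable lebesgue (\<lambda>x. indicator E x *\<^sub>R indicat_real ?Q x)" using E by (intro integrable_mult_indicator)
    moreover have "(\<lambda>x. (indicat_real ?Q x)\<^sup>2) = indicat_real ?Q" by (auto simp: indicator_def fun_eq_iff)
    ultimately show "integrable (lebesgue_on E) (\<lambda>x. (indicat_real ?Q x)\<^sup>2)"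
      using E by (simp add: integrable_restrict_space)
  qed
  let ?f = "\<lambda>n p. bump n a b (fst p) * bump n c d (snd p)"
  have zero: "l2ip E u (?f n) = 0" for n
    by (rule z[OF smooth1_bump smooth1_bump bump_outside bump_outside])
  have "(\<lambda>n. l2ip E u (?f n)) \<longlonglongrightarrow> l2ip E u (indicator ({a<..<b} \<times> {c<..<d}))"
    unfolding l2ip_def
  proof (rule integral_dominated_convergence[where w = "\<lambda>x. \<bar>u x * indicator ?Q x\<bar>"])
    have fb: "?f n \<in> borel_measurable borel" for n
      using smooth_continuous[OF smooth_prod[OF smooth1_bump smooth1_bump]] by (rule borel_measurable_continuous_onI)
    show "(\<lambda>x. u x * ?f n x) \<in> borel_measurable (lebesgue_on E)" for n
    proof (rule borel_measurable_times[OF L2_measurable[OF u]])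
      show "?f n \<in> borel_measurable (lebesgue_on E)"
        by (rule measurable_restrict_space1, rule measurable_completion) (use fb[of n] in simp)
    qed
    show "(\<lambda>x. u x * indicator ({a<..<b} \<times> {c<..<d}) x) \<in> borel_measurable (lebesgue_on E)"
    proof (rule borel_measurable_times[OF L2_measurable[OF u]])
      show "indicat_real ({a<..<b} \<times> {c<..<d}) \<in> borel_measurable (lebesgue_on E)"
        by (rule measurable_restrict_space1, rule measurable_completion, rule borel_measurable_indicator)
          (simp add: borel_open open_Times)
    qed
    show "integrable (lebesgue_on E) (\<lambda>x. \<bar>u x * indicator ?Q x\<bar>)"
      using L2_mult[OF u one] by simp
    show "AE x in lebesgue_on E. (\<lambda>n. u x * ?f n x) \<longlonglongrightarrow> u x * indicator ({a<..<b} \<times> {c<..<d}) x"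
    proof (rule AE_I2)
      fix x :: pt
      have "(\<lambda>n. u x * ?f n x) \<longlonglongrightarrow> u x * (indicator {a<..<b} (fst x) * indicator {c<..<d} (snd x))"
        by (intro tendsto_intros bump_tendsto)
      then show "(\<lambda>n. u x * ?f n x) \<longlonglongrightarrow> u x * indicator ({a<..<b} \<times> {c<..<d}) x"
        by (simp add: indicator_times)
    qed
    show "AE x in lebesgue_on E. norm (u x * ?f n x) \<le> \<bar>u x * indicator ?Q x\<bar>" for n
    proof (rule AE_I2)
      fix x :: pt
      have "\<bar>?f n x\<bar> \<le> indicator ?Q x"
      proof (cases "x \<in> ?Q")
        case True
        then show ?thesis using bump_bounds[of n a b "fst x"] bump_bounds[of n c d "snd x"] by (simp add: abs_mult mult_le_one)
      next
        case False
        then have "fst x \<notin> {a..b} \<or> snd x \<notin> {c..d}" by (cases x) auto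
        then have "bump n a b (fst x) = 0 \<or> bump n c d (snd x) = 0" using bump_outside by blast
        then show ?thesis by auto
      qed
      then have "\<bar>u x\<bar> * \<bar>?f n x\<bar> \<le> \<bar>u x\<bar> * indicator ?Q x" by (intro mult_left_mono) auto
      then show "norm (u x * ?f n x) \<le> \<bar>u x * indicator ?Q x\<bar>" by (simp add: abs_mult)
    qed
  qed
  then have "(\<lambda>n::nat. 0) \<longlonglongrightarrow> l2ip E u (indicator ({a<..<b} \<times> {c<..<d}))" unfolding zero .
  then show ?thesis by (simp only: LIMSEQ_const_iff)
qed


lemma indicator_box_integral:
  fixes u :: "pt => real"
  assumes E: "E \<in> sets lebesgue" and u: "u \<in> L2 E" and sub: "cbox p q \<subseteq> E"
  shows "integral (cbox p q) (\<lambda>x. if x \<in> E then u x else 0) = l2ip E u (indicator (box p q))"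
proof -
  have bs: "box p q \<subseteq> E" using sub box_subset_cbox by blast
  have bq: "box p q \<in> lmeasurable" by simp
  have "(\<lambda>_. 1) \<in> L2 (box p q)" by (auto simp: L2_def finite_measure.integrable_const finite_measure_lebesgue_on)
  then have i: "integrable (lebesgue_on (box p q)) u"
    using L2_mult[OF L2_subset[OF u bs E]] by fastforce
  have "integral (cbox p q) (\<lambda>x. if x \<in> E then u x else 0) = integral (box p q) (\<lambda>x. if x \<in> E then u x else 0)"
    by (rule integral_open_interval[symmetric])
  also have "\<dots> = integral (box p q) u"
    by (rule Henstock_Kurzweil_Integration.integral_cong) (use bs in auto)
  also have "\<dots> = integral\<^sup>L (lebesgue_on (box p q)) u"
    using i by (intro lebesgue_integral_eq_integral[symmetric]) auto
  also have "\<dots> = (LINT x|lebesgue. indicator (box p q) x *\<^sub>R u x)"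
    by (simp add: integral_restrict_space)
  also have "(\<lambda>x. indicator (box p q) x *\<^sub>R u x) = (\<lambda>x. indicator E x *\<^sub>R (u x * indicator (box p q) x))"
    using bs by (auto simp: fun_eq_iff indicator_def)
  also have "integral\<^sup>L lebesgue \<dots> = l2ip E u (indicator (box p q))"
    unfolding l2ip_def using E by (simp add: integral_restrict_space)
  finally show ?thesis .
qed

text \<open>Testing with tensor products supported in closed rectangles inside E already determines
  u: its integrals over small squares vanish, and by Lebesgue differentiation these averages
  converge to u at almost every point. The tensor form allows later arguments to work in one
  variable at a time.\<close>

lemma fundamental:
  assumes E: "open E" and u: "u \<in> L2 E"
    and z: "\<And>\<alpha> \<beta> a b c d. smooth1 \<alpha> ==> smooth1 \<beta> ==> (\<And>x. x \<notin> {a..b} ==> \<alpha> x = 0) ==> (\<And>x. x \<notin> {c..d} ==> \<beta> x = 0)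
       ==> {a..b} \<times> {c..d} \<subseteq> E ==> l2ip E u (tensor \<alpha> \<beta>) = 0"
  shows "AE x in lebesgue_on E. u x = 0"
proof -
  have Es: "E \<in> sets lebesgue" using E by (simp add: borel_open)
  define f where "f x = (if x \<in> E then u x else 0)" for x
  have "f integrable_on cbox p q" for p q
  proof -
    have "cbox p q \<inter> E \<in> lmeasurable" using Es by (intro fmeasurable_Int_fmeasurable) auto
    then have "E \<inter> cbox p q \<in> lmeasurable" by (simp add: Int_commute)
    then have fin: "finite_measure (lebesgue_on (E \<inter> cbox p q))" by (rule finite_measure_lebesgue_on)
    have "u \<in> L2 (E \<inter> cbox p q)" by (rule L2_subset[OF u _ Es]) (use Es in auto)
    moreover have "(\<lambda>_. 1) \<in> L2 (E \<inter> cbox p q)" using fin by (auto simp: L2_def finite_measure.integrable_const)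
    ultimately have "integrable (lebesgue_on (E \<inter> cbox p q)) u" using L2_mult by fastforce
    then have "u integrable_on (E \<inter> cbox p q)" using Es by (intro integrable_on_lebesgue_on) auto
    then show ?thesis unfolding f_def by (simp add: integrable_restrict_Int)
  qed
  then obtain N where N: "negligible N"
    and lim: "\<And>x e. x \<notin> N ==> 0 < e ==> \<exists>d>0. \<forall>h. 0 < h \<and> h < d -->
       norm (integral (cbox x (x + h *\<^sub>R One)) f /\<^sub>R h ^ DIM(pt) - f x) < e"
    using integrable_ccontinuous_explicit[of f] by blast
  have zero: "u x = 0" if x: "x \<in> E" "x \<notin> N" for x
  proof (rule ccontr)
    assume "u x \<noteq> 0"
    \<comment> \<open>The tolerance is \<bar>u x\<bar> itself, so a vanishing average at distance
      less than \<bar>u x\<bar> from u x is a contradiction.\<close>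
    then obtain d where d: "0 < d" "\<And>h. 0 < h ==> h < d ==> norm (integral (cbox x (x + h *\<^sub>R One)) f /\<^sub>R h ^ DIM(pt) - f x) < \<bar>u x\<bar>"
      using lim[OF x(2), of "\<bar>u x\<bar>"] by auto
    obtain r where r: "0 < r" "cball x r \<subseteq> E" using E x(1) open_contains_cball by blast
    define h where "h = min (d / 2) (r / 2)"
    have h: "0 < h" "h < d" "2 * h \<le> r" using d r by (auto simp: h_def)
    have box: "cbox x (x + h *\<^sub>R One) = {fst x..fst x + h} \<times> {snd x..snd x + h}"
      by (cases x) (simp add: One_pt cbox_Pair_eq box_real)
    have "{fst x..fst x + h} \<times> {snd x..snd x + h} \<subseteq> cball x r"
    proof
      fix y assume "y \<in> {fst x..fst x + h} \<times> {snd x..snd x + h}"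
      then have "\<bar>fst x - fst y\<bar> \<le> h" "\<bar>snd x - snd y\<bar> \<le> h" by auto
      moreover have "dist x y \<le> \<bar>fst x - fst y\<bar> + \<bar>snd x - snd y\<bar>"
        using sqrt_sum_squares_le_sum_abs[of "fst x - fst y" "snd x - snd y"] by (simp add: dist_prod_def dist_real_def)
      ultimately show "y \<in> cball x r" using h(3) by simp
    qed
    then have sub: "{fst x..fst x + h} \<times> {snd x..snd x + h} \<subseteq> E" using r(2) by blast
    have "integral (cbox x (x + h *\<^sub>R One)) f = l2ip E u (indicator (box x (x + h *\<^sub>R One)))"
      unfolding f_def by (rule indicator_box_integral[OF Es u]) (simp add: box sub)
    also have "box x (x + h *\<^sub>R One) = {fst x<..<fst x + h} \<times> {snd x<..<snd x + h}"
      by (cases x) (auto simp: One_pt mem_box Basis_prod_def ball_Un)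
    also have "l2ip E u (indicator \<dots>) = 0"
      using z sub by (intro fundamental_box[OF Es u sub]) blast
    finally have "norm (f x) < \<bar>u x\<bar>" using d(2)[OF h(1,2)] by simp
    then show False using x(1) by (simp add: f_def)
  qed
  have "AE x in lebesgue_on E. x \<notin> N"
  proof -
    have "AE x in lebesgue. x \<notin> N" using N by (intro AE_not_in) (simp add: negligible_iff_null_sets)
    then show ?thesis using Es by (simp add: AE_restrict_space_iff) (auto elim: eventually_mono)
  qed
  moreover have "AE x in lebesgue_on E. x \<in> E" using Es by (simp add: AE_restrict_space_iff)
  ultimately show ?thesis
  proof eventually_elim
    fix x assume "x \<notin> N" "x \<in> E"
    then show "u x = 0" by (simp add: zero)
  qed
qed

lemma fundamental_test_fun:
  assumes E: "open E" and u: "u \<in> L2 E" and z: "\<And>\<psi>. \<psi> \<in> test_fun E ==> l2ip E u \<psi> = 0"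
  shows "AE x in lebesgue_on E. u x = 0"
proof (rule fundamental[OF E u])
  fix \<alpha> \<beta> :: "real => real" and a b c d
  assume "smooth1 \<alpha>" "smooth1 \<beta>" and "\<And>x. x \<notin> {a..b} ==> \<alpha> x = 0" "\<And>x. x \<notin> {c..d} ==> \<beta> x = 0" "{a..b} \<times> {c..d} \<subseteq> E"
  from z[OF prod_test_fun[OF this]] show "l2ip E u (tensor \<alpha> \<beta>) = 0" .
qed

text \<open>\<open>cD 1 1\<close> fixes the order of differentiation. Integrated by parts against
  tensor products, for which the order is immaterial, the two mixed derivatives have the same
  pairings.\<close>

lemma pd_swap_AE:
  assumes E: "open E" and \<psi>: "\<psi> \<in> test_fun E"
  shows "AE x in lebesgue_on E. pdx (pdy \<psi>) x = pdy (pdx \<psi>) x"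
proof -
  have Es: "E \<in> sets lebesgue" using E by (simp add: borel_open)
  note t = test_fun_pd[OF \<psi>]
  have xy: "pdx (pdy \<psi>) \<in> L2 E" "pdy (pdx \<psi>) \<in> L2 E"
    using test_fun_L2[OF test_fun_pd(1)[OF t(2)] Es] test_fun_L2[OF test_fun_pd(2)[OF t(1)] Es] by auto
  have "AE x in lebesgue_on E. pdx (pdy \<psi>) x - pdy (pdx \<psi>) x = 0"
  proof (rule fundamental[OF E L2.diff[OF xy]])
    fix \<alpha> \<beta> :: "real => real" and a b c d
    assume ab: "smooth1 \<alpha>" "smooth1 \<beta>" and supp: "\<And>x. x \<notin> {a..b} ==> \<alpha> x = 0" "\<And>x. x \<notin> {c..d} ==> \<beta> x = 0" "{a..b} \<times> {c..d} \<subseteq> E"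
    let ?p = "\<lambda>p. \<alpha> (fst p) * \<beta> (snd p)"
    have p: "?p \<in> test_fun E" using ab supp by (rule prod_test_fun)
    note d = pd_prod[OF ab] pd_prod[OF smooth1_deriv[OF ab(1)] ab(2)] pd_prod[OF ab(1) smooth1_deriv[OF ab(2)]]
    have s: "smooth (pdy ?p)" "smooth (pdx ?p)" using p by (auto intro: smooth_pd test_fun_smooth)
    have "l2ip E (pdx (pdy \<psi>)) ?p = l2ip E \<psi> (pdy (pdx ?p))"
      using by_parts(1)[OF smooth_pd(2)[OF test_fun_smooth[OF \<psi>]] p Es]
        by_parts(2)[OF test_fun_smooth[OF \<psi>] test_fun_pd(1)[OF p] Es] by simp
    moreover have "l2ip E (pdy (pdx \<psi>)) ?p = l2ip E \<psi> (pdx (pdy ?p))"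
      using by_parts(2)[OF smooth_pd(1)[OF test_fun_smooth[OF \<psi>]] p Es]
        by_parts(1)[OF test_fun_smooth[OF \<psi>] test_fun_pd(2)[OF p] Es] by simp
    moreover have "pdy (pdx ?p) = pdx (pdy ?p)" by (simp add: d)
    ultimately show "l2ip E (\<lambda>x. pdx (pdy \<psi>) x - pdy (pdx \<psi>) x) ?p = 0"
      using lin_on_diff[OF L2.lin_on_left[OF test_fun_L2[OF p Es]] xy] by simp
  qed
  then show ?thesis by simp
qed

subsection \<open>Weak derivatives\<close>

lemma is_wderivD: "is_wderiv E i j u v ==> \<psi> \<in> test_fun E ==> l2ip E u (cD i j \<psi>) = (-1) ^ (i + j) * l2ip E v \<psi>"
  by (simp add: is_wderiv_def)

lemma is_wderiv_L2: "is_wderiv E i j u v ==> v \<in> L2 E"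
  by (simp add: is_wderiv_def)

lemma wD_is_wderiv: "is_wderiv E i j u v ==> is_wderiv E i j u (wD E i j u)"
  unfolding wD_def by (rule someI[of "is_wderiv E i j u"])

text \<open>The difference of two candidates pairs to 0 with every test function. Thus
  \<open>wD\<close>, a choice, is determined up to null sets.\<close>

lemma wderiv_unique:
  assumes E: "open E" and v: "is_wderiv E i j u v" "is_wderiv E i j u w"
  shows "AE x in lebesgue_on E. v x = w x"
proof -
  have Es: "E \<in> sets lebesgue" using E by (simp add: borel_open)
  note L = is_wderiv_L2[OF v(1)] is_wderiv_L2[OF v(2)]
  have "AE x in lebesgue_on E. v x - w x = 0"
  proof (rule fundamental_test_fun[OF E L2.diff[OF L]])
    fix \<psi> assume \<psi>: "\<psi> \<in> test_fun E"
    have "(-1) ^ (i + j) * l2ip E v \<psi> = (-1) ^ (i + j) * l2ip E w \<psi>"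
      using is_wderivD[OF v(1) \<psi>] is_wderivD[OF v(2) \<psi>] by simp
    then have "l2ip E v \<psi> = l2ip E w \<psi>" by simp
    then show "l2ip E (\<lambda>x. v x - w x) \<psi> = 0"
      using lin_on_diff[OF L2.lin_on_left[OF test_fun_L2[OF \<psi> Es]] L] by simp
  qed
  then show ?thesis by simp
qed

lemma wD_AE: "open E ==> is_wderiv E i j u v ==> AE x in lebesgue_on E. wD E i j u x = v x"
  using wderiv_unique wD_is_wderiv by blast

lemma Hs_L2: "u \<in> Hs s E ==> u \<in> L2 E"
  by (simp add: Hs_def)

lemma Hs_wD: "u \<in> Hs s E ==> i + j \<le> s ==> is_wderiv E i j u (wD E i j u)"
  using wD_is_wderiv unfolding Hs_def by blast

lemma Hs_wD_L2: "u \<in> Hs s E ==> i + j \<le> s ==> wD E i j u \<in> L2 E"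
  using Hs_wD is_wderiv_L2 by blast

lemma Hs_mono: "s \<le> t ==> u \<in> Hs t E ==> u \<in> Hs s E"
  unfolding Hs_def by (auto intro: order_trans)

lemma is_wderiv_comb:
  assumes E: "E \<in> sets lebesgue" and u: "u \<in> L2 E" "u' \<in> L2 E" and v: "is_wderiv E i j u v" "is_wderiv E i j u' v'"
  shows "is_wderiv E i j (lc a u b u') (lc a v b v')"
  unfolding is_wderiv_def
proof (intro conjI ballI)
  show "lc a v b v' \<in> L2 E" by (intro L2.comb is_wderiv_L2[OF v(1)] is_wderiv_L2[OF v(2)])
  fix \<psi> assume \<psi>: "\<psi> \<in> test_fun E"
  show "l2ip E (lc a u b u') (cD i j \<psi>) = (- 1) ^ (i + j) * l2ip E (lc a v b v') \<psi>"
    using L2.lin[OF u test_fun_L2[OF test_fun_cD[OF \<psi>] E]] L2.lin[OF is_wderiv_L2[OF v(1)] is_wderiv_L2[OF v(2)] test_fun_L2[OF \<psi> E]]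
      is_wderivD[OF v(1) \<psi>] is_wderivD[OF v(2) \<psi>] by (simp add: algebra_simps)
qed

lemma Hs_lin_space: "E \<in> sets lebesgue ==> lin_space (Hs s E)"
proof
  assume E: "E \<in> sets lebesgue"
  have "is_wderiv E i j (\<lambda>_. 0) (\<lambda>_. 0)" for i j
    by (simp add: is_wderiv_def L2.zero l2ip_def)
  then show "(\<lambda>_. 0) \<in> Hs s E" by (auto simp: Hs_def L2.zero)
  fix u v a b assume uv: "u \<in> Hs s E" "v \<in> Hs s E"
  then have "is_wderiv E i j (lc a u b v) (\<lambda>x. a * wD E i j u x + b * wD E i j v x)" if "i + j \<le> s" for i j
    using that by (intro is_wderiv_comb E Hs_wD Hs_L2)
  then show "lc a u b v \<in> Hs s E"
    using uv by (auto simp: Hs_def intro: L2.comb)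
qed

lemma wD_comb_AE:
  assumes E: "open E" and u: "u \<in> Hs s E" "v \<in> Hs s E" and ij: "i + j \<le> s"
  shows "AE x in lebesgue_on E. wD E i j (lc a u b v) x = a * wD E i j u x + b * wD E i j v x"
  using E u ij by (intro wD_AE is_wderiv_comb Hs_wD Hs_L2) (auto simp: borel_open)

lemma is_wderiv_subset:
  assumes u: "is_wderiv E i j u v" and s: "E' \<subseteq> E" "E \<in> sets lebesgue" "E' \<in> sets lebesgue"
  shows "is_wderiv E' i j u v"
  unfolding is_wderiv_def
proof (intro conjI ballI)
  show "v \<in> L2 E'" using L2_subset[OF is_wderiv_L2[OF u] s] .
  fix \<psi> assume \<psi>: "\<psi> \<in> test_fun E'"
  have z: "\<phi> x = 0" if "\<phi> \<in> test_fun E'" "x \<in> E - E'" for \<phi> x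
    using that by (auto elim!: test_funE)
  show "l2ip E' u (cD i j \<psi>) = (- 1) ^ (i + j) * l2ip E' v \<psi>"
    using is_wderivD[OF u test_fun_mono[OF \<psi> s(1)]] l2ip_restrict[OF s z[OF \<psi>]] l2ip_restrict[OF s z[OF test_fun_cD[OF \<psi>]]] by simp
qed

lemma Hs_subset: "u \<in> Hs s E ==> E' \<subseteq> E ==> E \<in> sets lebesgue ==> E' \<in> sets lebesgue ==> u \<in> Hs s E'"
  unfolding Hs_def using L2_subset is_wderiv_subset by blast

lemma wD_subset_AE:
  assumes "u \<in> Hs s E" "i + j \<le> s" "E' \<subseteq> E" "open E" "open E'"
  shows "AE x in lebesgue_on E'. wD E' i j u x = wD E i j u x"
  using assms by (intro wD_AE is_wderiv_subset[OF Hs_wD[OF assms(1,2)]]) (auto simp: borel_open)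

lemma is_wderiv_cong:
  assumes E: "E \<in> sets lebesgue" and u: "u \<in> L2 E" "AE x in lebesgue_on E. u x = u' x"
  shows "is_wderiv E i j u = is_wderiv E i j u'"
proof -
  have "l2ip E u (cD i j \<psi>) = l2ip E u' (cD i j \<psi>)" if "\<psi> \<in> test_fun E" for \<psi>
    using that by (intro l2ip_cong_AE L2_measurable u L2_cong_AE[OF E u] test_fun_L2[OF test_fun_cD E])
  then show ?thesis by (auto simp: is_wderiv_def fun_eq_iff)
qed

text \<open>An equality of functions and not just almost everywhere: both sides choose from the same
  predicate. Definitions built from \<open>wD\<close> can therefore be rewritten under almost
  everywhere equal arguments.\<close>

lemma wD_cong:
  assumes "E \<in> sets lebesgue" "u \<in> L2 E" "AE x in lebesgue_on E. u x = u' x"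
  shows "wD E i j u = wD E i j u'"
  unfolding wD_def is_wderiv_cong[OF assms] ..

lemma Hs_cong:
  assumes "E \<in> sets lebesgue" "u \<in> Hs s E" "AE x in lebesgue_on E. u x = u' x"
  shows "u' \<in> Hs s E"
  using assms(2) L2_cong_AE[OF assms(1) Hs_L2[OF assms(2)] assms(3)] is_wderiv_cong[OF assms(1) Hs_L2[OF assms(2)] assms(3)]
  by (simp add: Hs_def)

lemma is_wderiv_limit:
  assumes E: "E \<in> sets lebesgue" and w: "\<And>n. is_wderiv E i j (u n) (v n)" and L: "\<And>n. u n \<in> L2 E" "u' \<in> L2 E" "v' \<in> L2 E"
    and lim: "L2lim E u u'" "L2lim E v v'"
  shows "is_wderiv E i j u' v'"
  unfolding is_wderiv_def
proof (intro conjI ballI L)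
  fix \<psi> assume \<psi>: "\<psi> \<in> test_fun E"
  have "(\<lambda>n. l2ip E (u n) (cD i j \<psi>)) \<longlonglongrightarrow> l2ip E u' (cD i j \<psi>)"
    using L(1,2) test_fun_L2[OF test_fun_cD[OF \<psi>] E] lim(1) by (rule l2_conv_ip)
  moreover have "(\<lambda>n. (-1) ^ (i + j) * l2ip E (v n) \<psi>) \<longlonglongrightarrow> (-1) ^ (i + j) * l2ip E v' \<psi>"
    using is_wderiv_L2[OF w] L(3) test_fun_L2[OF \<psi> E] lim(2) by (intro tendsto_intros l2_conv_ip)
  ultimately show "l2ip E u' (cD i j \<psi>) = (- 1) ^ (i + j) * l2ip E v' \<psi>"
    unfolding is_wderivD[OF w \<psi>] by (rule LIMSEQ_unique)
qed

lemma is_wderiv_00: "u \<in> L2 E ==> is_wderiv E 0 0 u u"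
  by (simp add: is_wderiv_def cD_simps')

lemma smooth_is_wderiv:
  assumes f: "smooth f" and E: "bounded E" "E \<in> sets lebesgue"
  shows "is_wderiv E 1 0 f (pdx f)" "is_wderiv E 0 1 f (pdy f)" "is_wderiv E 2 0 f (pdx (pdx f))"
    "is_wderiv E 0 2 f (pdy (pdy f))" "is_wderiv E 1 1 f (pdy (pdx f))"
proof -
  note s = smooth_pd[OF f]
  note L = smooth_L2[OF _ E]
  note t = test_fun_pd[of _ E]
  show "is_wderiv E 1 0 f (pdx f)" using L[OF s(1)] by_parts(1)[OF f _ E(2)] by (simp add: is_wderiv_def cD_simps')
  show "is_wderiv E 0 1 f (pdy f)" using L[OF s(2)] by_parts(2)[OF f _ E(2)] by (simp add: is_wderiv_def cD_simps')
  show "is_wderiv E 2 0 f (pdx (pdx f))"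
    using L[OF smooth_pd(1)[OF s(1)]] by_parts(1)[OF f t(1) E(2)] by_parts(1)[OF s(1) _ E(2)] by (simp add: is_wderiv_def cD_simps')
  show "is_wderiv E 0 2 f (pdy (pdy f))"
    using L[OF smooth_pd(2)[OF s(2)]] by_parts(2)[OF f t(2) E(2)] by_parts(2)[OF s(2) _ E(2)] by (simp add: is_wderiv_def cD_simps')
  show "is_wderiv E 1 1 f (pdy (pdx f))"
    using L[OF smooth_pd(2)[OF s(1)]] by_parts(1)[OF f t(2) E(2)] by_parts(2)[OF s(1) _ E(2)] by (simp add: is_wderiv_def cD_simps')
qed

text \<open>Second weak derivatives are introduced directly by testing with \<open>cD i j\<close>;
  here they become first derivatives of first derivatives. The y-derivative of
  \<open>wD E 1 0 u\<close> comes with the opposite order of differentiation on the test function,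
  which is where \<open>pd_swap_AE\<close> enters.\<close>

lemma is_wderiv_compose:
  assumes E: "open E" and u: "u \<in> Hs 2 E"
  shows "is_wderiv E 1 0 (wD E 1 0 u) (wD E 2 0 u)" "is_wderiv E 0 1 (wD E 1 0 u) (wD E 1 1 u)"
    "is_wderiv E 1 0 (wD E 0 1 u) (wD E 1 1 u)" "is_wderiv E 0 1 (wD E 0 1 u) (wD E 0 2 u)"
proof -
  have Es: "E \<in> sets lebesgue" using E by (simp add: borel_open)
  note w = Hs_wD[OF u]
  note L = Hs_wD_L2[OF u]
  note t = test_fun_pd[of _ E]
  have sw: "l2ip E u (pdy (pdx \<psi>)) = l2ip E u (pdx (pdy \<psi>))" if \<psi>: "\<psi> \<in> test_fun E" for \<psi>
  proof -
    have "l2ip E (pdy (pdx \<psi>)) u = l2ip E (pdx (pdy \<psi>)) u"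
      using pd_swap_AE[OF E \<psi>] Hs_L2[OF u] test_fun_L2[OF _ Es] t \<psi>
      by (intro l2ip_cong_AE L2_measurable) (auto simp: eq_commute)
    then show ?thesis by (simp add: l2ip_def mult.commute)
  qed
  have e1: "l2ip E (wD E 1 0 u) \<psi> = - l2ip E u (pdx \<psi>)" "l2ip E (wD E 0 1 u) \<psi> = - l2ip E u (pdy \<psi>)"
    "l2ip E (wD E 2 0 u) \<psi> = l2ip E u (pdx (pdx \<psi>))" "l2ip E (wD E 0 2 u) \<psi> = l2ip E u (pdy (pdy \<psi>))"
    "l2ip E (wD E 1 1 u) \<psi> = l2ip E u (pdx (pdy \<psi>))" if "\<psi> \<in> test_fun E" for \<psi>
    using is_wderivD[OF w[of 1 0] that] is_wderivD[OF w[of 0 1] that] is_wderivD[OF w[of 2 0] that]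
      is_wderivD[OF w[of 0 2] that] is_wderivD[OF w[of 1 1] that] by (auto simp: cD_simps')
  show "is_wderiv E 1 0 (wD E 1 0 u) (wD E 2 0 u)" "is_wderiv E 0 1 (wD E 1 0 u) (wD E 1 1 u)"
    "is_wderiv E 1 0 (wD E 0 1 u) (wD E 1 1 u)" "is_wderiv E 0 1 (wD E 0 1 u) (wD E 0 2 u)"
    using L[of 2 0] L[of 1 1] L[of 0 2]
    by (auto simp: is_wderiv_def cD_simps' e1 e1[unfolded One_nat_def] t sw)
qed

lemma Hs1I:
  assumes "w \<in> L2 E" "is_wderiv E 1 0 w a" "is_wderiv E 0 1 w b"
  shows "w \<in> Hs 1 E"
  unfolding Hs_def
proof (intro CollectI conjI allI impI)
  fix i j :: nat assume "i + j \<le> 1"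
  then consider "i = 0" "j = 0" | "i = 1" "j = 0" | "i = 0" "j = 1" by linarith
  then show "\<exists>v. is_wderiv E i j w v"
  proof cases
    case 1 then show ?thesis using is_wderiv_00[OF assms(1)] by blast
  next
    case 2 then show ?thesis using assms(2) by blast
  next
    case 3 then show ?thesis using assms(3) by blast
  qed
qed (rule assms)

lemma Hs2I:
  assumes "w \<in> L2 E" "is_wderiv E 1 0 w a" "is_wderiv E 0 1 w b" "is_wderiv E 2 0 w c" "is_wderiv E 1 1 w d" "is_wderiv E 0 2 w e"
  shows "w \<in> Hs 2 E"
  unfolding Hs_def
proof (intro CollectI conjI allI impI)
  fix i j :: nat assume "i + j \<le> 2"
  then consider "i + j \<le> 1" | "i = 2" "j = 0" | "i = 1" "j = 1" | "i = 0" "j = 2" by linarith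
  then show "\<exists>v. is_wderiv E i j w v"
  proof cases
    case 1
    moreover have "w \<in> Hs 1 E" using assms(1-3) by (rule Hs1I)
    ultimately show ?thesis by (simp add: Hs_def)
  next
    case 2 then show ?thesis using assms(4) by blast
  next
    case 3 then show ?thesis using assms(5) by blast
  next
    case 4 then show ?thesis using assms(6) by blast
  qed
qed (rule assms)

lemma Hs1_wD:
  assumes E: "open E" and u: "u \<in> Hs 2 E"
  shows "wD E 1 0 u \<in> Hs 1 E" "wD E 0 1 u \<in> Hs 1 E"
proof -
  note c = is_wderiv_compose[OF E u]
  show "wD E 1 0 u \<in> Hs 1 E" by (rule Hs1I[OF Hs_wD_L2[OF u] c(1,2)]) simp
  show "wD E 0 1 u \<in> Hs 1 E" by (rule Hs1I[OF Hs_wD_L2[OF u] c(3,4)]) simp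
qed

lemma smooth_Hs:
  assumes "smooth f" "bounded E" "E \<in> sets lebesgue"
  shows "f \<in> Hs 2 E"
proof -
  note w = smooth_is_wderiv[OF assms]
  show ?thesis by (rule Hs2I[OF smooth_L2[OF assms] w(1,2,3,5,4)])
qed

section \<open>Polynomials and projections\<close>

definition monom2 :: "nat \<times> nat => fld" where
  "monom2 = (\<lambda>(i, j) p. fst p ^ i * snd p ^ j)"

definition Pidx :: "nat => (nat \<times> nat) set" where
  "Pidx k = Sigma {..k} (\<lambda>i. {..k - i})"

lemma finite_Pidx [simp]: "finite (Pidx k)"
  by (simp add: Pidx_def)

lemma Pidx_iff: "(i, j) \<in> Pidx k \<longleftrightarrow> i + j \<le> k"
  by (auto simp: Pidx_def)

text \<open>Flattens the double sum over exponents to one index set, so that the Riesz and weak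
  convergence lemmas for finite spans apply to polynomials.\<close>

lemma Pk_span: "Pk k = span_of (Pidx k) monom2"
proof -
  have *: "(\<Sum>i\<le>k. \<Sum>j\<le>k - i. c (i, j) * fst p ^ i * snd p ^ j) = (\<Sum>ij\<in>Pidx k. c ij * monom2 ij p)" for c :: "nat \<times> nat => real" and p :: pt
    unfolding Pidx_def by (subst sum.Sigma) (auto simp: monom2_def mult.assoc intro!: sum.cong)
  show ?thesis
  proof (intro set_eqI iffI)
    fix f assume "f \<in> Pk k"
    then obtain c where c: "\<And>x y. f (x, y) = (\<Sum>i\<le>k. \<Sum>j\<le>k - i. c i j * x ^ i * y ^ j)" by (auto simp: Pk_def)
    have "f p = (\<Sum>ij\<in>Pidx k. (case ij of (i, j) => c i j) * monom2 ij p)" for p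
      using c[of "fst p" "snd p"] *[of "\<lambda>(i, j). c i j" p] by simp
    then show "f \<in> span_of (Pidx k) monom2" unfolding span_of_def by blast
  next
    fix f assume "f \<in> span_of (Pidx k) monom2"
    then obtain c where c: "\<And>p. f p = (\<Sum>ij\<in>Pidx k. c ij * monom2 ij p)" by (auto simp: span_of_def)
    have "f (x, y) = (\<Sum>i\<le>k. \<Sum>j\<le>k - i. c (i, j) * x ^ i * y ^ j)" for x y
      using c[of "(x, y)"] *[of c "(x, y)"] by simp
    then show "f \<in> Pk k" unfolding Pk_def by (intro CollectI exI[of _ "\<lambda>i j. c (i, j)"]) simp
  qed
qed

interpretation Pk: lin_space "Pk k" for k
  unfolding Pk_span by (rule span_of_lin_space)

lemma monom2_Pk: "i + j \<le> k ==> monom2 (i, j) \<in> Pk k"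
  unfolding Pk_span by (intro span_of_base) (simp_all add: Pidx_iff)

lemma Pk_mono: "k \<le> k' ==> Pk k \<subseteq> Pk k'"
  unfolding Pk_span by (intro span_of_mono) (auto simp: Pidx_iff)

lemma monom2_smooth: "smooth (monom2 ij)"
  by (cases ij) (simp add: monom2_def smooth_mult smooth_power smooth_fst smooth_snd)

lemma PkE:
  assumes "f \<in> Pk k"
  obtains c where "f = (\<lambda>p. \<Sum>ij\<in>Pidx k. c ij * monom2 ij p)"
proof -
  obtain c where "\<forall>p. f p = (\<Sum>ij\<in>Pidx k. c ij * monom2 ij p)"
    using assms unfolding Pk_span span_of_def by blast
  then have "f = (\<lambda>p. \<Sum>ij\<in>Pidx k. c ij * monom2 ij p)" by auto
  then show ?thesis by (rule that)
qed

lemma smooth_cmult: "smooth f ==> smooth (\<lambda>x. c * f x)"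
  using smooth_comb[of f f c 0] by simp

lemma Pk_smooth: "f \<in> Pk k ==> smooth f"
  by (elim PkE) (simp add: smooth_sum smooth_cmult monom2_smooth)

lemma pd_sum:
  assumes "finite I" "\<And>i. i \<in> I ==> smooth (e i)"
  shows "pdx (\<lambda>p. \<Sum>i\<in>I. c i * e i p) = (\<lambda>p. \<Sum>i\<in>I. c i * pdx (e i) p)"
    "pdy (\<lambda>p. \<Sum>i\<in>I. c i * e i p) = (\<lambda>p. \<Sum>i\<in>I. c i * pdy (e i) p)"
proof -
  have h: "((\<lambda>p. \<Sum>i\<in>I. c i * e i p) has_derivative (\<lambda>h. \<Sum>i\<in>I. c i * (pdx (e i) p * fst h + pdy (e i) p * snd h))) (at p)" for p
    by (intro has_derivative_sum has_derivative_mult_right smooth_has_derivative assms)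
  show "pdx (\<lambda>p. \<Sum>i\<in>I. c i * e i p) = (\<lambda>p. \<Sum>i\<in>I. c i * pdx (e i) p)"
    "pdy (\<lambda>p. \<Sum>i\<in>I. c i * e i p) = (\<lambda>p. \<Sum>i\<in>I. c i * pdy (e i) p)"
    using pdx_eqI[OF h] pdy_eqI[OF h] by auto
qed

lemma pd_monom2:
  "pdx (monom2 (i, j)) = (\<lambda>p. real i * monom2 (i - 1, j) p)"
  "pdy (monom2 (i, j)) = (\<lambda>p. real j * monom2 (i, j - 1) p)"
proof -
  have h: "(monom2 (i, j) has_derivative (\<lambda>h. fst p ^ i * (real j * snd h * snd p ^ (j - 1)) + real i * fst h * fst p ^ (i - 1) * snd p ^ j)) (at p)" for p
    unfolding monom2_def prod.case by (auto intro!: derivative_eq_intros simp: mult.commute)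
  show "pdx (monom2 (i, j)) = (\<lambda>p. real i * monom2 (i - 1, j) p)"
    "pdy (monom2 (i, j)) = (\<lambda>p. real j * monom2 (i, j - 1) p)"
    using pdx_eqI[OF h] pdy_eqI[OF h] by (auto simp: monom2_def)
qed

lemma Pk_pd: "f \<in> Pk k ==> pdx f \<in> Pk (k - 1)" "f \<in> Pk k ==> pdy f \<in> Pk (k - 1)"
proof -
  assume "f \<in> Pk k"
  then obtain c where f: "f = (\<lambda>p. \<Sum>ij\<in>Pidx k. c ij * monom2 ij p)" by (rule PkE)
  have x: "pdx (monom2 ij) \<in> Pk (k - 1)" if "ij \<in> Pidx k" for ij
  proof (cases ij)
    case (Pair i j)
    show ?thesis
    proof (cases "i = 0")
      case True then show ?thesis unfolding Pair pd_monom2 by (simp add: Pk.zero)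
    next
      case False
      then show ?thesis unfolding Pair pd_monom2 using that Pair by (intro Pk.scale monom2_Pk) (simp add: Pidx_iff)
    qed
  qed
  have y: "pdy (monom2 ij) \<in> Pk (k - 1)" if "ij \<in> Pidx k" for ij
  proof (cases ij)
    case (Pair i j)
    show ?thesis
    proof (cases "j = 0")
      case True then show ?thesis unfolding Pair pd_monom2 by (simp add: Pk.zero)
    next
      case False
      then show ?thesis unfolding Pair pd_monom2 using that Pair by (intro Pk.scale monom2_Pk) (simp add: Pidx_iff)
    qed
  qed
  have "pdx f = (\<lambda>p. \<Sum>ij\<in>Pidx k. c ij * pdx (monom2 ij) p)" "pdy f = (\<lambda>p. \<Sum>ij\<in>Pidx k. c ij * pdy (monom2 ij) p)"
    unfolding f by (rule pd_sum; simp add: monom2_smooth)+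
  then show "pdx f \<in> Pk (k - 1)" "pdy f \<in> Pk (k - 1)"
    using Pk.sum[of "Pidx k" "\<lambda>ij. pdx (monom2 ij)"] x Pk.sum[of "Pidx k" "\<lambda>ij. pdy (monom2 ij)"] y by simp_all
qed

lemma Pk_const: "(\<lambda>_. c) \<in> Pk k"
  using Pk.scale[OF monom2_Pk[of 0 0 k], of c] by (simp add: monom2_def)

lemma Pk_fst: "1 \<le> k ==> fst \<in> Pk k" and Pk_snd: "1 \<le> k ==> snd \<in> Pk k"
  using monom2_Pk[of 1 0 k] monom2_Pk[of 0 1 k] by (simp_all add: monom2_def)

lemma pd_fst_snd: "pdx fst = (\<lambda>_. 1)" "pdy fst = (\<lambda>_. 0)" "pdx snd = (\<lambda>_. 0)" "pdy snd = (\<lambda>_. 1)"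
  using pd_monom2[of 1 0] pd_monom2[of 0 1] by (simp_all add: monom2_def)

lemma Pk_line:
  assumes "f \<in> Pk k"
  shows "\<exists>P::real poly. \<forall>s. f (a1 + s * b1, a2 + s * b2) = poly P s"
proof -
  obtain c where f: "f = (\<lambda>p. \<Sum>ij\<in>Pidx k. c ij * monom2 ij p)" using assms by (rule PkE)
  define P where "P = (\<Sum>ij\<in>Pidx k. smult (c ij) ([:a1, b1:] ^ fst ij * [:a2, b2:] ^ snd ij))"
  have "f (a1 + s * b1, a2 + s * b2) = poly P s" for s
    unfolding f P_def poly_sum by (intro sum.cong) (auto simp: monom2_def poly_power)
  then show ?thesis by blast
qed

lemma poly_zero_on_interval:
  fixes P :: "real poly"
  assumes "a < b" "\<And>s. a < s ==> s < b ==> poly P s = 0"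
  shows "P = 0"
proof (rule ccontr)
  assume "P \<noteq> 0"
  then have "finite {s. poly P s = 0}" by (rule poly_roots_finite)
  moreover have "{a<..<b} \<subseteq> {s. poly P s = 0}" using assms by auto
  ultimately show False using finite_subset infinite_Ioo[OF assms(1)] by blast
qed

lemma Pk_zero_line:
  assumes f: "f \<in> Pk k" and ab: "a < b" and z: "\<And>s. a < s ==> s < b ==> f (linepath p q s) = 0"
  shows "f (linepath p q s) = 0"
proof -
  obtain P where P: "\<And>s. f (fst p + s * (fst q - fst p), snd p + s * (snd q - snd p)) = poly P s"
    using Pk_line[OF f] by blast
  have e: "linepath p q s = (fst p + s * (fst q - fst p), snd p + s * (snd q - snd p))" for s
    by (simp add: linepath_def prod_eq_iff algebra_simps)
  have "P = 0" by (rule poly_zero_on_interval[OF ab]) (use z in \<open>simp add: e P\<close>)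
  then show ?thesis by (simp add: e P)
qed

text \<open>Any point is joined by a line to a point of E; along that line f is a univariate
  polynomial that vanishes on an interval.\<close>

lemma Pk_zero_open:
  assumes f: "f \<in> Pk k" and E: "open E" "E \<noteq> {}" and z: "\<And>x. x \<in> E ==> f x = 0"
  shows "f = (\<lambda>_. 0)"
proof
  fix y
  obtain x where x: "x \<in> E" using E by blast
  have "((\<lambda>s. (1 - s) *\<^sub>R x + s *\<^sub>R y) \<longlongrightarrow> (1 - 0) *\<^sub>R x + 0 *\<^sub>R y) (at 0)" by (intro tendsto_intros)
  then have "((\<lambda>s. linepath x y s) \<longlongrightarrow> x) (at 0)" by (simp add: linepath_def)
  then have "\<forall>\<^sub>F s in at 0. linepath x y s \<in> E" using E(1) x by (rule topological_tendstoD)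
  then obtain d where d: "0 < d" "\<And>s. s \<noteq> 0 ==> dist s 0 < d ==> linepath x y s \<in> E"
    by (auto simp: eventually_at)
  have "f (linepath x y 1) = 0"
    by (rule Pk_zero_line[OF f d(1)]) (rule z, rule d(2), auto)
  then show "f y = 0" by (simp add: linepath_1')
qed

lemma continuous_AE_zero:
  fixes f :: "'a::euclidean_space => real"
  assumes f: "continuous_on UNIV f" and E: "open E" and z: "AE x in lebesgue_on E. f x = 0" and x: "x \<in> E"
  shows "f x = 0"
proof (rule ccontr)
  assume nz: "f x \<noteq> 0"
  define S where "S = E \<inter> {x. f x \<noteq> 0}"
  have o: "open S" unfolding S_def using E f by (intro open_Int open_Collect_neq) auto
  have "AE x in lebesgue. x \<notin> S" using z E by (simp add: AE_restrict_space_iff borel_open S_def)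
  then obtain N where "S \<subseteq> N" "N \<in> null_sets lebesgue" unfolding eventually_ae_filter by auto
  then have "negligible S" using negligible_subset by (auto simp: negligible_iff_null_sets)
  then show False using open_not_negligible[OF o] nz x by (auto simp: S_def)
qed

section \<open>Polynomial projections on a bounded open set\<close>

locale domain =
  fixes E :: "pt set"
  assumes op: "open E" and bd: "bounded E" and ne: "E \<noteq> {}"
begin

lemma meas: "E \<in> sets lebesgue"
  using op by (simp add: borel_open)

lemma Pk_L2: "p \<in> Pk k ==> p \<in> L2 E"
  using Pk_smooth smooth_L2 bd meas by blast

lemma Pk_subset_L2: "Pk k \<subseteq> L2 E"
  using Pk_L2 by blast

lemma Pk_psd: "psd_form (Pk k) (l2ip E)"
  by (rule psd_form_subset[OF L2.psd_form_axioms Pk.lin_space_axioms Pk_subset_L2])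

lemma Pk_null: "p \<in> Pk k ==> l2ip E p p = 0 ==> p = (\<lambda>_. 0)"
proof -
  assume p: "p \<in> Pk k" and "l2ip E p p = 0"
  then have "AE x in lebesgue_on E. p x = 0" using l2ip_self_eq_0_iff[OF Pk_L2[OF p]] by simp
  then have "p x = 0" if "x \<in> E" for x
    using continuous_AE_zero[OF smooth_continuous[OF Pk_smooth[OF p]] op _ that] by blast
  then show ?thesis using Pk_zero_open[OF p op ne] by blast
qed

text \<open>\<open>PiL\<close> is a definite description and is meaningful only because the L^2
  product is definite on polynomials: a null polynomial vanishes on the open set E, hence
  everywhere. Existence is Riesz in the span of monomials.\<close>

lemma PiL_ex1: 
  assumes w: "w \<in> L2 E"
  shows "\<exists>!p. p \<in> Pk j \<and> (\<forall>q \<in> Pk j. l2ip E p q = l2ip E w q)"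
proof -
  interpret P: psd_form "Pk j" "l2ip E" by (rule Pk_psd)
  have "\<exists>p\<in>span_of (Pidx j) monom2. \<forall>q\<in>span_of (Pidx j) monom2. l2ip E w q = l2ip E p q"
  proof (rule span_riesz)
    show "psd_form (span_of (Pidx j) monom2) (l2ip E)" using Pk_psd[of j] by (simp add: Pk_span)
    show "lin_on (span_of (Pidx j) monom2) (l2ip E w)"
      using L2.lin_on_right[OF w] Pk_subset_L2[of j] unfolding Pk_span[symmetric] lin_on_def by blast
    show "l2ip E w q = 0" if "q \<in> span_of (Pidx j) monom2" "l2ip E q q = 0" for q
      using Pk_null[of q j] that by (simp add: Pk_span l2ip_def)
  qed simp
  then obtain p where p: "p \<in> Pk j" "\<forall>q\<in>Pk j. l2ip E p q = l2ip E w q" by (auto simp: Pk_span)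
  show ?thesis
  proof (rule ex1I[of _ p])
    show "p \<in> Pk j \<and> (\<forall>q\<in>Pk j. l2ip E p q = l2ip E w q)" using p by blast
    fix p' assume p': "p' \<in> Pk j \<and> (\<forall>q\<in>Pk j. l2ip E p' q = l2ip E w q)"
    have d: "(\<lambda>x. p' x - p x) \<in> Pk j" using p' p by (intro Pk.diff) auto
    have "l2ip E (\<lambda>x. p' x - p x) (\<lambda>x. p' x - p x) = 0"
      using lin_on_diff[OF P.lin_on_left[OF d], of p' p] p p' d by simp
    then have "(\<lambda>x. p' x - p x) = (\<lambda>_. 0)" by (rule Pk_null[OF d])
    then show "p' = p" by (auto simp: fun_eq_iff)
  qed
qed

lemma PiL_spec:
  assumes "w \<in> L2 E"
  shows "PiL j E w \<in> Pk j" "q \<in> Pk j ==> l2ip E (PiL j E w) q = l2ip E w q"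
  using theI'[OF PiL_ex1[OF assms, of j]] unfolding PiL_def by blast+

lemma PiL_eqI:
  assumes "w \<in> L2 E" "p \<in> Pk j" "\<And>q. q \<in> Pk j ==> l2ip E p q = l2ip E w q"
  shows "PiL j E w = p"
  unfolding PiL_def using assms PiL_ex1[OF assms(1), of j] by (intro the1_equality) auto

lemma PiL_comb:
  assumes u: "u \<in> L2 E" and v: "v \<in> L2 E"
  shows "PiL j E (lc a u b v) = (\<lambda>x. a * PiL j E u x + b * PiL j E v x)"
proof (rule PiL_eqI)
  show "lc a u b v \<in> L2 E" by (intro L2.comb u v)
  show "(\<lambda>x. a * PiL j E u x + b * PiL j E v x) \<in> Pk j" by (intro Pk.comb PiL_spec u v)
  fix q assume q: "q \<in> Pk j"
  show "l2ip E (\<lambda>x. a * PiL j E u x + b * PiL j E v x) q = l2ip E (lc a u b v) q"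
    using L2.lin[OF u v Pk_L2[OF q]] L2.lin[OF Pk_L2[OF PiL_spec(1)[OF u]] Pk_L2[OF PiL_spec(1)[OF v]] Pk_L2[OF q]]
      PiL_spec(2)[OF u q] PiL_spec(2)[OF v q] by simp
qed

lemma PiL_L2: "w \<in> L2 E ==> PiL j E w \<in> L2 E"
  by (rule Pk_L2[OF PiL_spec(1)])

lemma PiL_norm:
  assumes w: "w \<in> L2 E" shows "l2ip E (PiL j E w) (PiL j E w) \<le> l2ip E w w"
proof -
  have p: "PiL j E w \<in> L2 E" by (rule PiL_L2[OF w])
  have "0 \<le> l2ip E (\<lambda>x. w x - PiL j E w x) (\<lambda>x. w x - PiL j E w x)" by simp
  then show ?thesis using L2.quad_diff[OF w p] PiL_spec(2)[OF w PiL_spec(1)[OF w]] by simp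
qed

lemma PiL_cong_AE:
  assumes w: "w \<in> L2 E" and ae: "AE x in lebesgue_on E. w x = w' x"
  shows "PiL j E w = PiL j E w'"
proof (rule PiL_eqI[OF w])
  have w': "w' \<in> L2 E" by (rule L2_cong_AE[OF meas w ae])
  show "PiL j E w' \<in> Pk j" by (rule PiL_spec(1)[OF w'])
  fix q assume q: "q \<in> Pk j"
  have "l2ip E w q = l2ip E w' q"
    by (intro l2ip_cong_AE L2_measurable w w' Pk_L2[OF q] ae)
  then show "l2ip E (PiL j E w') q = l2ip E w q" using PiL_spec(2)[OF w' q] by simp
qed

subsection \<open>The energy form\<close>

lemma l2ip_wD_comb:
  assumes "u \<in> Hs s E" "v \<in> Hs s E" "i + j \<le> s" "w \<in> L2 E"
  shows "l2ip E (wD E i j (lc a u b v)) w = a * l2ip E (wD E i j u) w + b * l2ip E (wD E i j v) w"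
proof -
  interpret Hs: lin_space "Hs s E" by (rule Hs_lin_space[OF meas])
  have "l2ip E (wD E i j (lc a u b v)) w = l2ip E (\<lambda>x. a * wD E i j u x + b * wD E i j v x) w"
    using assms by (intro l2ip_cong_AE L2_measurable wD_comb_AE[OF op, of _ s] L2.comb Hs_wD_L2[of _ s] Hs.comb)
  then show ?thesis using L2.lin[OF Hs_wD_L2 Hs_wD_L2] assms by simp
qed

lemma l2norm_wD_diff:
  assumes "u \<in> Hs s E" "v \<in> Hs s E" "i + j \<le> s"
  shows "l2norm E (wD E i j (\<lambda>x. u x - v x)) = l2norm E (\<lambda>x. wD E i j u x - wD E i j v x)"
proof -
  interpret Hs: lin_space "Hs s E" by (rule Hs_lin_space[OF meas])
  note L = Hs_wD_L2[OF assms(1,3)] Hs_wD_L2[OF assms(2,3)] Hs_wD_L2[OF Hs.diff[OF assms(1,2)] assms(3)]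
  have ae: "AE x in lebesgue_on E. wD E i j (\<lambda>x. u x - v x) x = wD E i j u x - wD E i j v x"
    using wD_comb_AE[OF op assms, of 1 "-1"] by simp
  have "l2ip E (wD E i j (\<lambda>x. u x - v x)) (wD E i j (\<lambda>x. u x - v x)) = l2ip E (\<lambda>x. wD E i j u x - wD E i j v x) (wD E i j (\<lambda>x. u x - v x))"
    by (intro l2ip_cong_AE L2_measurable L L2.diff ae)
  also have "\<dots> = l2ip E (wD E i j (\<lambda>x. u x - v x)) (\<lambda>x. wD E i j u x - wD E i j v x)"
    by (rule L2.sym[OF L2.diff[OF L(1,2)] L(3)])
  also have "\<dots> = l2ip E (\<lambda>x. wD E i j u x - wD E i j v x) (\<lambda>x. wD E i j u x - wD E i j v x)"
    by (intro l2ip_cong_AE L2_measurable L L2.diff ae)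
  finally show ?thesis by (simp add: l2norm_def)
qed

text \<open>Multiplying out leaves the mixed products of the pure second derivatives with weight
  \<sigma>, and the integrand splits into L^2 products, each linear in both arguments.\<close>

lemma Aform_expand:
  assumes u: "u \<in> Hs 2 E" and v: "v \<in> Hs 2 E"
  shows "Aform \<sigma> E u v = l2ip E (wD E 2 0 u) (wD E 2 0 v) + l2ip E (wD E 0 2 u) (wD E 0 2 v)
    + \<sigma> * (l2ip E (wD E 2 0 u) (wD E 0 2 v) + l2ip E (wD E 0 2 u) (wD E 2 0 v))
    + 2 * (1 - \<sigma>) * l2ip E (wD E 1 1 u) (wD E 1 1 v)"
proof -
  have L: "wD E 2 0 u \<in> L2 E" "wD E 0 2 u \<in> L2 E" "wD E 1 1 u \<in> L2 E" "wD E 2 0 v \<in> L2 E" "wD E 0 2 v \<in> L2 E" "wD E 1 1 v \<in> L2 E"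
    using Hs_wD_L2[OF u] Hs_wD_L2[OF v] by auto
  have gen: "(LINT x|lebesgue_on E. (a x + b x) * (a' x + b' x) - (1 - \<sigma>) * (a x * b' x + b x * a' x - 2 * c x * c' x))
      = l2ip E a a' + l2ip E b b' + \<sigma> * (l2ip E a b' + l2ip E b a') + 2 * (1 - \<sigma>) * l2ip E c c'"
    if "a \<in> L2 E" "b \<in> L2 E" "c \<in> L2 E" "a' \<in> L2 E" "b' \<in> L2 E" "c' \<in> L2 E" for a b c a' b' c'
  proof -
    have "(LINT x|lebesgue_on E. (a x + b x) * (a' x + b' x) - (1 - \<sigma>) * (a x * b' x + b x * a' x - 2 * c x * c' x))
      = (LINT x|lebesgue_on E. a x * a' x + b x * b' x + \<sigma> * (a x * b' x + b x * a' x) + 2 * (1 - \<sigma>) * (c x * c' x))"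
      by (intro Bochner_Integration.integral_cong) (auto simp: algebra_simps)
    then show ?thesis
      by (simp add: l2ip_def L2_mult[OF that(1,4)] L2_mult[OF that(2,5)] L2_mult[OF that(1,5)] L2_mult[OF that(2,4)] L2_mult[OF that(3,6)])
  qed
  show ?thesis unfolding Aform_def by (rule gen[OF L])
qed

definition hess :: "fld => real" where
  "hess u = (l2norm E (wD E 2 0 u))\<^sup>2 + (l2norm E (wD E 0 2 u))\<^sup>2 + (l2norm E (wD E 1 1 u))\<^sup>2"

lemma hess_nonneg: "0 \<le> hess u"
  by (simp add: hess_def)

text \<open>With a, b, d the squared norms of the three second derivatives and c the cross product,
  the gaps are \<sigma>(a+2c+b) + (1-\<sigma>)d below and \<sigma>(a-2c+b) + (1-\<sigma>)(a+b) +
  2\<sigma>d above. Each is a sum of nonnegative terms since \<sigma> lies in (0,1).\<close>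

lemma Aform_bounds:
  assumes \<sigma>: "0 < \<sigma>" "\<sigma> < 1" and u: "u \<in> Hs 2 E"
  shows "(1 - \<sigma>) * hess u \<le> Aform \<sigma> E u u" "Aform \<sigma> E u u \<le> 2 * hess u"
proof -
  have L: "wD E 2 0 u \<in> L2 E" "wD E 0 2 u \<in> L2 E" using Hs_wD_L2[OF u] by auto
  let ?a = "l2ip E (wD E 2 0 u) (wD E 2 0 u)" and ?b = "l2ip E (wD E 0 2 u) (wD E 0 2 u)"
  let ?c = "l2ip E (wD E 2 0 u) (wD E 0 2 u)" and ?d = "l2ip E (wD E 1 1 u) (wD E 1 1 u)"
  have A: "Aform \<sigma> E u u = ?a + ?b + 2 * (\<sigma> * ?c) + 2 * ?d - 2 * (\<sigma> * ?d)"
    using Aform_expand[OF u u, of \<sigma>] L2.sym[OF L] by (simp add: algebra_simps)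
  have h: "hess u = ?a + ?b + ?d" by (simp add: hess_def l2norm_sq)
  have "0 \<le> ?a + 2 * ?c + ?b" "0 \<le> ?a - 2 * ?c + ?b"
    using L2.nonneg[OF L2.comb[OF L, of 1 1]] L2.nonneg[OF L2.diff[OF L]]
    unfolding L2.quad[OF L] L2.quad_diff[OF L] by simp_all
  then have "0 \<le> \<sigma> * (?a + 2 * ?c + ?b)" "0 \<le> \<sigma> * (?a - 2 * ?c + ?b)" "0 \<le> (1 - \<sigma>) * (?a + ?b)" "0 \<le> (1 - \<sigma>) * ?d" "0 \<le> \<sigma> * ?d"
    using \<sigma> by auto
  then show "(1 - \<sigma>) * hess u \<le> Aform \<sigma> E u u" "Aform \<sigma> E u u \<le> 2 * hess u"
    unfolding A h by (simp_all add: algebra_simps)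
qed

lemma Aform_psd:
  assumes \<sigma>: "0 < \<sigma>" "\<sigma> < 1" shows "psd_form (Hs 2 E) (Aform \<sigma> E)"
proof -
  interpret Hs: lin_space "Hs 2 E" by (rule Hs_lin_space[OF meas])
  show ?thesis
  proof
    fix u v w and a b :: real
    assume u: "u \<in> Hs 2 E" and v: "v \<in> Hs 2 E"
    show "Aform \<sigma> E u v = Aform \<sigma> E v u"
      unfolding Aform_def by (simp add: algebra_simps)
    show "0 \<le> Aform \<sigma> E u u"
      by (rule order_trans[OF mult_nonneg_nonneg Aform_bounds(1)[OF \<sigma> u]]) (use \<sigma> hess_nonneg in auto)
    assume w: "w \<in> Hs 2 E"
    show "Aform \<sigma> E (lc a u b v) w = a * Aform \<sigma> E u w + b * Aform \<sigma> E v w"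
      unfolding Aform_expand[OF u w] Aform_expand[OF v w] Aform_expand[OF Hs.comb[OF u v] w]
      using l2ip_wD_comb[OF u v _ Hs_wD_L2[OF w]] by (simp add: algebra_simps)
  qed
qed

lemma Pk_Hs: "p \<in> Pk k ==> p \<in> Hs 2 E"
  using Pk_smooth smooth_Hs bd meas by blast

lemma wD_smooth_AE:
  assumes "smooth f"
  shows "AE x in lebesgue_on E. wD E 1 0 f x = pdx f x" "AE x in lebesgue_on E. wD E 0 1 f x = pdy f x"
    "AE x in lebesgue_on E. wD E 2 0 f x = pdx (pdx f) x" "AE x in lebesgue_on E. wD E 0 2 f x = pdy (pdy f) x"
    "AE x in lebesgue_on E. wD E 1 1 f x = pdy (pdx f) x"
  using wD_AE[OF op] smooth_is_wderiv[OF assms bd meas] by blast+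

text \<open>Identifies the kernel of the energy among polynomials as the affine functions. The
  second derivatives are polynomials that vanish almost everywhere on E, hence everywhere.\<close>

lemma Pk_hess_zero:
  assumes p: "p \<in> Pk k" and z: "hess p = 0"
  shows "p x = p 0 + pdx p 0 * fst x + pdy p 0 * snd x" "pdx p x = pdx p 0" "pdy p x = pdy p 0"
proof -
  have L: "wD E 2 0 p \<in> L2 E" "wD E 0 2 p \<in> L2 E" "wD E 1 1 p \<in> L2 E" using Hs_wD_L2[OF Pk_Hs[OF p]] by auto
  have "l2norm E (wD E 2 0 p) = 0" "l2norm E (wD E 0 2 p) = 0" "l2norm E (wD E 1 1 p) = 0"
    using z unfolding hess_def by (auto simp: add_nonneg_eq_0_iff)
  then have ae: "AE x in lebesgue_on E. wD E 2 0 p x = 0" "AE x in lebesgue_on E. wD E 0 2 p x = 0" "AE x in lebesgue_on E. wD E 1 1 p x = 0"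
    using l2norm_eq_0_iff L by blast+
  have zero: "q = (\<lambda>_. 0)" if "q \<in> Pk j" "AE x in lebesgue_on E. w x = 0" "AE x in lebesgue_on E. w x = q x" for q w j
  proof (rule Pk_zero_open[OF that(1) op ne])
    have "AE x in lebesgue_on E. q x = 0" using that(2,3) by eventually_elim simp
    then show "q x = 0" if "x \<in> E" for x
      using continuous_AE_zero[OF smooth_continuous[OF Pk_smooth[OF \<open>q \<in> Pk j\<close>]] op _ that] by blast
  qed
  note w = wD_smooth_AE[OF Pk_smooth[OF p]]
  note q = Pk_pd[OF p]
  have d: "pdx (pdx p) = (\<lambda>_. 0)" "pdy (pdy p) = (\<lambda>_. 0)" "pdy (pdx p) = (\<lambda>_. 0)"
    by (rule zero[OF Pk_pd(1)[OF q(1)] ae(1) w(3)] zero[OF Pk_pd(2)[OF q(2)] ae(2) w(4)] zero[OF Pk_pd(2)[OF q(1)] ae(3) w(5)])+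
  have const: "f x = f 0" if "smooth f" "pdx f = (\<lambda>_. 0)" "pdy f = (\<lambda>_. 0)" for f :: fld and x
  proof -
    have "(f has_derivative (\<lambda>_. 0)) (at y within UNIV)" for y
      using smooth_has_derivative[OF that(1), of y] that(2,3) by simp
    then show ?thesis using has_derivative_zero_unique[of UNIV f x 0] by auto
  qed
  have px: "pdx p x = pdx p 0" for x using const[OF smooth_pd(1)[OF Pk_smooth[OF p]] d(1,3)] .
  \<comment> \<open>Subtract the x-part first: q no longer depends on x and still has the
    y-derivative of p. The y-part is subtracted afterwards.\<close>
  define q where "q x = 1 * p x + (- pdx p 0) * fst x" for x
  have sq: "smooth q" unfolding q_def by (intro smooth_comb Pk_smooth[OF p] smooth_fst)
  have dif: "p differentiable (at x)" "fst differentiable (at x)" for x :: pt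
    using smooth_differentiable[OF Pk_smooth[OF p]] smooth_differentiable[OF smooth_fst] by auto
  have qx: "pdx q = (\<lambda>_. 0)" "pdy q = pdy p"
    unfolding q_def using pdx_comb[OF dif, of 1 "- pdx p 0"] pdy_comb[OF dif, of 1 "- pdx p 0"] px by (auto simp: pd_fst_snd fun_eq_iff)
  have qy: "q (a, b) = q (0, b)" for a b
  proof -
    have "\<exists>c. \<forall>s\<in>UNIV. q (s, b) = c"
      using smooth_DERIV_x[OF sq, of b] qx by (intro has_field_derivative_zero_constant) (auto simp: has_field_derivative_at_within)
    then show ?thesis by force
  qed
  have pyx: "pdy p (a, b) = pdy p (0, b)" for a b
  proof -
    have "((\<lambda>s. q (a, s)) has_real_derivative pdy q (a, b)) (at b)" by (rule smooth_DERIV_y[OF sq])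
    moreover have "((\<lambda>s. q (0, s)) has_real_derivative pdy q (0, b)) (at b)" by (rule smooth_DERIV_y[OF sq])
    moreover have "(\<lambda>s. q (a, s)) = (\<lambda>s. q (0, s))" using qy by (rule ext)
    ultimately show ?thesis unfolding qx(2) by (metis DERIV_unique)
  qed
  have pyy: "pdy p (0, b) = pdy p (0, 0)" for b
  proof -
    have "\<exists>c. \<forall>s\<in>UNIV. pdy p (0, s) = c"
      using smooth_DERIV_y[OF smooth_pd(2)[OF Pk_smooth[OF p]], of 0] d(2)
      by (intro has_field_derivative_zero_constant) (auto simp: has_field_derivative_at_within)
    then show ?thesis by force
  qed
  have py: "pdy p x = pdy p 0" for x using pyx[of "fst x" "snd x"] pyy[of "snd x"] by (simp add: zero_prod_def)
  define r where "r x = 1 * q x + (- pdy p 0) * snd x" for x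
  have sr: "smooth r" unfolding r_def by (intro smooth_comb sq smooth_snd)
  have dif2: "q differentiable (at x)" "snd differentiable (at x)" for x :: pt
    using smooth_differentiable[OF sq] smooth_differentiable[OF smooth_snd] by auto
  have "pdx r = (\<lambda>_. 0)" "pdy r = (\<lambda>_. 0)"
    unfolding r_def using pdx_comb[OF dif2, of 1 "- pdy p 0"] pdy_comb[OF dif2, of 1 "- pdy p 0"] qx py by (auto simp: pd_fst_snd fun_eq_iff)
  then have "r x = r 0" by (rule const[OF sr])
  then show "p x = p 0 + pdx p 0 * fst x + pdy p 0 * snd x" by (simp add: r_def q_def)
  show "pdx p x = pdx p 0" "pdy p x = pdy p 0" by (rule px py)+
qed


lemma vavg_comb: "vavg vs (lc a f b g) = a * vavg vs f + b * vavg vs g"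
  by (simp add: vavg_def sum.distrib sum_distrib_left[symmetric] add_divide_distrib)

lemma vavg_const: "vs \<noteq> [] ==> vavg vs (\<lambda>_. c) = c"
  by (simp add: vavg_def)

lemma Pk_pd_comb:
  assumes "p \<in> Pk k" "q \<in> Pk k'"
  shows "pdx (lc a p b q) = (\<lambda>x. a * pdx p x + b * pdx q x)"
    "pdy (lc a p b q) = (\<lambda>x. a * pdy p x + b * pdy q x)"
  by (intro ext pdx_comb pdy_comb smooth_differentiable Pk_smooth[OF assms(1)] Pk_smooth[OF assms(2)])+

text \<open>An affine function has energy 0, and a null vector of a semidefinite form is orthogonal
  to everything.\<close>

lemma Aform_affine:
  assumes \<sigma>: "0 < \<sigma>" "\<sigma> < 1" and p: "p \<in> Pk 1" and v: "v \<in> Hs 2 E"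
  shows "Aform \<sigma> E p v = 0"
proof -
  interpret A: psd_form "Hs 2 E" "Aform \<sigma> E" by (rule Aform_psd[OF \<sigma>])
  have d: "pdx (pdx p) \<in> Pk 0" "pdy (pdy p) \<in> Pk 0" "pdy (pdx p) \<in> Pk 0" "pdx p \<in> Pk 0" "pdy p \<in> Pk 0"
    using Pk_pd[OF p] Pk_pd[of _ 0] by auto
  have c: "pdx q = (\<lambda>_. 0)" "pdy q = (\<lambda>_. 0)" if q0: "q \<in> Pk 0" for q
  proof -
    obtain c where "q = (\<lambda>p. \<Sum>ij\<in>Pidx 0. c ij * monom2 ij p)" using q0 by (rule PkE)
    then have "q = (\<lambda>_. c (0, 0))" by (simp add: Pidx_def monom2_def)
    then show "pdx q = (\<lambda>_. 0)" "pdy q = (\<lambda>_. 0)" by simp_all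
  qed
  note w = wD_smooth_AE[OF Pk_smooth[OF p]]
  have L: "wD E 2 0 p \<in> L2 E" "wD E 0 2 p \<in> L2 E" "wD E 1 1 p \<in> L2 E" using Hs_wD_L2[OF Pk_Hs[OF p]] by auto
  have "l2norm E (wD E 2 0 p) = 0" "l2norm E (wD E 0 2 p) = 0" "l2norm E (wD E 1 1 p) = 0"
    using l2norm_eq_0_iff[OF L(1)] l2norm_eq_0_iff[OF L(2)] l2norm_eq_0_iff[OF L(3)] w(3-5) c d by auto
  then have "hess p = 0" by (simp add: hess_def)
  then have "Aform \<sigma> E p p = 0" using Aform_bounds(2)[OF \<sigma> Pk_Hs[OF p]] A.nonneg[OF Pk_Hs[OF p]] by simp
  then show ?thesis by (rule A.null_left[OF Pk_Hs[OF p] v])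
qed

text \<open>The energy leaves affine functions undetermined; the three vertex averages fix exactly
  these. Their sum is definite on polynomials, so one Riesz representation in this form solves the
  constrained problem that defines \<open>PiD\<close>.\<close>

definition PiD_form :: "real => poly2 => fld => fld => real" where
  "PiD_form \<sigma> vs p q = Aform \<sigma> E p q + vavg vs p * vavg vs q + vavg vs (pdx p) * vavg vs (pdx q)
     + vavg vs (pdy p) * vavg vs (pdy q)"

lemma PiD_form_psd:
  assumes \<sigma>: "0 < \<sigma>" "\<sigma> < 1" shows "psd_form (Pk k) (PiD_form \<sigma> vs)"
proof -
  interpret A: psd_form "Hs 2 E" "Aform \<sigma> E" by (rule Aform_psd[OF \<sigma>])
  show ?thesis
  proof
    fix u v w and a b :: real
    assume u: "u \<in> Pk k" and v: "v \<in> Pk k"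
    show "PiD_form \<sigma> vs u v = PiD_form \<sigma> vs v u" unfolding PiD_form_def using A.sym[OF Pk_Hs[OF u] Pk_Hs[OF v]] by simp
    show "0 \<le> PiD_form \<sigma> vs u u" unfolding PiD_form_def using A.nonneg[OF Pk_Hs[OF u]] by simp
    assume w: "w \<in> Pk k"
    show "PiD_form \<sigma> vs (lc a u b v) w = a * PiD_form \<sigma> vs u w + b * PiD_form \<sigma> vs v w"
      unfolding PiD_form_def Pk_pd_comb[OF u v] vavg_comb A.lin[OF Pk_Hs[OF u] Pk_Hs[OF v] Pk_Hs[OF w]] by (simp add: algebra_simps)
  qed
qed

lemma PiD_form_null:
  assumes \<sigma>: "0 < \<sigma>" "\<sigma> < 1" and vs: "vs \<noteq> []" and p: "p \<in> Pk k" and z: "PiD_form \<sigma> vs p p = 0"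
  shows "p = (\<lambda>_. 0)"
proof -
  interpret A: psd_form "Hs 2 E" "Aform \<sigma> E" by (rule Aform_psd[OF \<sigma>])
  have pos: "0 \<le> Aform \<sigma> E p p" by (rule A.nonneg[OF Pk_Hs[OF p]])
  have sq: "0 \<le> vavg vs p * vavg vs p" "0 \<le> vavg vs (pdx p) * vavg vs (pdx p)" "0 \<le> vavg vs (pdy p) * vavg vs (pdy p)" by auto
  have A0: "Aform \<sigma> E p p = 0" and "vavg vs p * vavg vs p = 0" "vavg vs (pdx p) * vavg vs (pdx p) = 0" "vavg vs (pdy p) * vavg vs (pdy p) = 0"
    using z pos sq unfolding PiD_form_def by linarith+
  then have v: "vavg vs p = 0" "vavg vs (pdx p) = 0" "vavg vs (pdy p) = 0" by auto
  have "(1 - \<sigma>) * hess p \<le> 0" using Aform_bounds(1)[OF \<sigma> Pk_Hs[OF p]] A0 by simp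
  then have "hess p = 0" using \<sigma> hess_nonneg[of p] by (simp add: mult_le_0_iff)
  note h = Pk_hess_zero[OF p this]
  have "pdx p = (\<lambda>_. pdx p 0)" "pdy p = (\<lambda>_. pdy p 0)" using h by auto
  then have d: "pdx p 0 = 0" "pdy p 0 = 0" using v vavg_const[OF vs] by metis+
  then have "p = (\<lambda>_. p 0)" using h(1) by auto
  then show ?thesis using v(1) vavg_const[OF vs] by metis
qed

text \<open>Represent the functional made of the energy against v and the three prescribed averages.
  Testing with 1, x and y, on which the energy is blind, recovers the averages one after the other;
  what is left is the energy condition. Here 1 \<le> k puts x and y among the test
  polynomials.\<close>

lemma PiD_solve:
  assumes \<sigma>: "0 < \<sigma>" "\<sigma> < 1" and vs: "vs \<noteq> []" and k: "1 \<le> k" and v: "v \<in> Hs 2 E"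
  shows "\<exists>!p. p \<in> Pk k \<and> (\<forall>q \<in> Pk k. Aform \<sigma> E p q = Aform \<sigma> E v q) \<and> vavg vs p = b0 \<and> vavg vs (pdx p) = b1 \<and> vavg vs (pdy p) = b2"
proof -
  interpret A: psd_form "Hs 2 E" "Aform \<sigma> E" by (rule Aform_psd[OF \<sigma>])
  interpret G: psd_form "Pk k" "PiD_form \<sigma> vs" by (rule PiD_form_psd[OF \<sigma>])
  define F where "F q = Aform \<sigma> E v q + b0 * vavg vs q + b1 * vavg vs (pdx q) + b2 * vavg vs (pdy q)" for q
  have F: "lin_on (Pk k) F"
    unfolding lin_on_def F_def
    using Pk_pd_comb A.lin_right[OF Pk_Hs Pk_Hs v] by (simp add: vavg_comb algebra_simps)
  have "\<exists>p\<in>span_of (Pidx k) monom2. \<forall>q\<in>span_of (Pidx k) monom2. F q = PiD_form \<sigma> vs p q"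
  proof (rule span_riesz)
    show "psd_form (span_of (Pidx k) monom2) (PiD_form \<sigma> vs)" using PiD_form_psd[OF \<sigma>, of k] by (simp add: Pk_span)
    show "lin_on (span_of (Pidx k) monom2) F" using F by (simp add: Pk_span)
    show "F q = 0" if "q \<in> span_of (Pidx k) monom2" "PiD_form \<sigma> vs q q = 0" for q
      using PiD_form_null[OF \<sigma> vs, of q k] that Pk.lin_on_zero[OF F] by (simp add: Pk_span)
  qed simp
  then obtain p where p: "p \<in> Pk k" and pF: "\<And>q. q \<in> Pk k ==> F q = PiD_form \<sigma> vs p q" by (auto simp: Pk_span)
  have aff: "Aform \<sigma> E p q = 0" "Aform \<sigma> E v q = 0" if "q \<in> Pk 1" for q
    using Aform_affine[OF \<sigma> that Pk_Hs[OF p]] Aform_affine[OF \<sigma> that v] A.sym[OF Pk_Hs[OF that]] Pk_Hs[OF p] v by auto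
  have one: "(\<lambda>_. 1) \<in> Pk k" "(\<lambda>_. 1) \<in> Pk 1" by (rule Pk_const)+
  have e0: "vavg vs p = b0" using pF[OF one(1)] aff[OF one(2)] by (simp add: F_def PiD_form_def vavg_const[OF vs])
  have e1: "vavg vs (pdx p) = b1"
    using pF[OF Pk_fst[OF k]] aff[OF Pk_fst[OF order_refl]] e0 by (simp add: F_def PiD_form_def vavg_const[OF vs] pd_fst_snd)
  have e2: "vavg vs (pdy p) = b2"
    using pF[OF Pk_snd[OF k]] aff[OF Pk_snd[OF order_refl]] e0 by (simp add: F_def PiD_form_def vavg_const[OF vs] pd_fst_snd)
  have eA: "Aform \<sigma> E p q = Aform \<sigma> E v q" if "q \<in> Pk k" for q
    using pF[OF that] e0 e1 e2 by (simp add: F_def PiD_form_def)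
  show ?thesis
  proof (rule ex1I[of _ p])
    show "p \<in> Pk k \<and> (\<forall>q\<in>Pk k. Aform \<sigma> E p q = Aform \<sigma> E v q) \<and> vavg vs p = b0 \<and> vavg vs (pdx p) = b1 \<and> vavg vs (pdy p) = b2"
      using p eA e0 e1 e2 by blast
    fix p' assume p': "p' \<in> Pk k \<and> (\<forall>q\<in>Pk k. Aform \<sigma> E p' q = Aform \<sigma> E v q) \<and> vavg vs p' = b0 \<and> vavg vs (pdx p') = b1 \<and> vavg vs (pdy p') = b2"
    then have p'k: "p' \<in> Pk k" by blast
    have d: "(\<lambda>x. p' x - p x) \<in> Pk k" using Pk.diff[OF p'k p] .
    have eq: "PiD_form \<sigma> vs p' q = PiD_form \<sigma> vs p q" if "q \<in> Pk k" for q
      using p' e0 e1 e2 eA[OF that] that by (simp add: PiD_form_def)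
    have "PiD_form \<sigma> vs (\<lambda>x. p' x - p x) (\<lambda>x. p' x - p x) = 0"
      using lin_on_diff[OF G.lin_on_left[OF d] p'k p] eq[OF d] by simp
    then have "(\<lambda>x. p' x - p x) = (\<lambda>_. 0)" by (rule PiD_form_null[OF \<sigma> vs d])
    then show "p' = p" by (auto simp: fun_eq_iff)
  qed
qed

end

section \<open>Polygons\<close>

text \<open>\<open>edge_path vs m\<close> runs through the edges 0 to m and ends at vertex m + 1.
  The closing edge is joined separately, since it turns the arc into a loop.\<close>

fun edge_path :: "poly2 => nat => real => pt" where
  "edge_path vs 0 = linepath (vs ! 0) (vs ! 1)"
| "edge_path vs (Suc m) = edge_path vs m +++ linepath (vs ! Suc m) (vs ! Suc (Suc m))"

lemma nxt_less: "Suc i < length vs ==> nxt vs i = vs ! Suc i"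
  by (simp add: nxt_def)

lemma nxt_last: "Suc i = length vs ==> nxt vs i = vs ! 0"
  by (simp add: nxt_def)

lemma edge_path_arc:
  assumes "polygon vs" "Suc m < length vs"
  shows "arc (edge_path vs m) \<and> pathstart (edge_path vs m) = vs ! 0 \<and> pathfinish (edge_path vs m) = vs ! Suc m
    \<and> path_image (edge_path vs m) = (\<Union>i\<le>m. edge vs i)"
  using assms(2)
proof (induction m)
  case 0
  have "distinct vs" "0 < length vs" "1 < length vs" using assms(1) 0 by (auto simp: polygon_def)
  then have "vs ! 0 \<noteq> vs ! 1" using nth_eq_iff_index_eq by fastforce
  then show ?case using 0 by (simp add: edge_def nxt_less)
next
  case (Suc m)
  have IH: "arc (edge_path vs m)" "pathstart (edge_path vs m) = vs ! 0" "pathfinish (edge_path vs m) = vs ! Suc m"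
    "path_image (edge_path vs m) = (\<Union>i\<le>m. edge vs i)" using Suc by auto
  have ne: "vs ! Suc m \<noteq> vs ! Suc (Suc m)" using assms(1) Suc.prems by (auto simp: polygon_def nth_eq_iff_index_eq)
  have "edge vs i \<inter> edge vs (Suc m) \<subseteq> {vs ! Suc m}" if "i \<le> m" for i
  proof -
    have "edge vs i \<inter> edge vs (Suc m) = {vs ! i, nxt vs i} \<inter> {vs ! Suc m, nxt vs (Suc m)}"
      using assms(1) that Suc.prems by (auto simp: polygon_def)
    also have "\<dots> = {vs ! i, vs ! Suc i} \<inter> {vs ! Suc m, vs ! Suc (Suc m)}"
      using that Suc.prems by (simp add: nxt_less)
    also have "\<dots> \<subseteq> {vs ! Suc m}"
      using assms(1) that Suc.prems by (auto simp: polygon_def nth_eq_iff_index_eq)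
    finally show ?thesis .
  qed
  then have int: "path_image (edge_path vs m) \<inter> edge vs (Suc m) \<subseteq> {vs ! Suc m}" unfolding IH(4) by blast
  have e: "edge vs (Suc m) = closed_segment (vs ! Suc m) (vs ! Suc (Suc m))" using Suc.prems by (simp add: edge_def nxt_less)
  have "arc (edge_path vs (Suc m))"
    unfolding edge_path.simps using IH ne int e by (intro arc_join) auto
  moreover have "path_image (edge_path vs (Suc m)) = (\<Union>i\<le>Suc m. edge vs i)"
    using IH e by (simp add: path_image_join atMost_Suc Un_commute)
  ultimately show ?case using IH by simp
qed

text \<open>The boundary without the closing edge is an arc, and the closing edge meets it in its
  two end points only. This makes the theory of Jordan curves applicable to
  \<open>bdry\<close>.\<close>

lemma polygon_simple_loop:
  assumes "polygon vs"
  shows "\<exists>c. simple_path c \<and> pathfinish c = pathstart c \<and> path_image c = bdry vs"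
proof -
  obtain m where m: "length vs = Suc (Suc m)" "1 \<le> m"
    using assms by (cases "length vs"; cases "length vs - 1") (auto simp: polygon_def)
  note A = edge_path_arc[OF assms, of m]
  have A': "arc (edge_path vs m)" "pathstart (edge_path vs m) = vs ! 0" "pathfinish (edge_path vs m) = vs ! Suc m"
    "path_image (edge_path vs m) = (\<Union>i\<le>m. edge vs i)" using A m by auto
  have n: "nxt vs (Suc m) = vs ! 0" using m by (simp add: nxt_last)
  have ne: "vs ! Suc m \<noteq> vs ! 0" using assms m by (auto simp: polygon_def nth_eq_iff_index_eq)
  have e: "edge vs (Suc m) = closed_segment (vs ! Suc m) (vs ! 0)" by (simp add: edge_def n)
  have "edge vs i \<inter> edge vs (Suc m) \<subseteq> {vs ! 0, vs ! Suc m}" if "i \<le> m" for i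
  proof -
    have "edge vs i \<inter> edge vs (Suc m) = {vs ! i, nxt vs i} \<inter> {vs ! Suc m, nxt vs (Suc m)}"
      using assms that m unfolding polygon_def by auto
    then show ?thesis unfolding n by auto
  qed
  then have "simple_path (edge_path vs m +++ linepath (vs ! Suc m) (vs ! 0))"
    using A' ne e by (intro simple_path_join_loop) auto
  moreover have "path_image (edge_path vs m +++ linepath (vs ! Suc m) (vs ! 0)) = bdry vs"
  proof -
    have "{..<length vs} = insert (Suc m) {..m}" using m by auto
    then show ?thesis using A' e by (auto simp: path_image_join bdry_def)
  qed
  ultimately show ?thesis using A' by (intro exI[of _ "edge_path vs m +++ linepath (vs ! Suc m) (vs ! 0)"]) auto
qed

lemma bdry_compact: "compact (bdry vs)"
  unfolding bdry_def edge_def by (intro compact_UN) auto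

lemma bdry_closed: "closed (bdry vs)"
  by (rule compact_imp_closed[OF bdry_compact])

lemma edge_subset_bdry: "i < length vs ==> edge vs i \<subseteq> bdry vs"
  by (auto simp: bdry_def)

lemma region_open: "open (region vs)"
  unfolding region_def by (rule open_inside[OF bdry_closed])

lemma region_bounded: "bounded (region vs)"
  unfolding region_def by (rule bounded_inside[OF compact_imp_bounded[OF bdry_compact]])

lemma region_Int_bdry: "region vs \<inter> bdry vs = {}"
  unfolding region_def by (rule inside_no_overlap)

text \<open>By the Jordan-Brouwer theorem each component of the complement of a closed curve has the
  whole curve as its frontier; the component of an inside point stays inside. Every edge is thus
  accessible from the element, on which the collars depend.\<close>

lemma bdry_subset_closure:
  assumes "polygon vs" "region vs \<noteq> {}"
  shows "bdry vs \<subseteq> closure (region vs)"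
proof -
  obtain c where c: "simple_path c" "pathfinish c = pathstart c" "path_image c = bdry vs"
    using polygon_simple_loop[OF assms(1)] by blast
  have "bdry vs homeomorphic sphere (0::complex) 1"
    using homeomorphic_simple_path_image_circle[OF c(1,2), of 1 0] c(3) by simp
  also have "sphere (0::complex) 1 homeomorphic sphere (0::pt) 1"
    by (rule homeomorphic_spheres') auto
  finally have h: "bdry vs homeomorphic sphere (0::pt) 1" .
  obtain x where x: "x \<in> inside (bdry vs)" using assms(2) by (auto simp: region_def)
  define T where "T = connected_component_set (- bdry vs) x"
  have xn: "x \<in> - bdry vs" using x inside_no_overlap[of "bdry vs"] by blast
  have "T \<in> components (- bdry vs)" unfolding T_def components_def using xn by blast
  then have f: "frontier T = bdry vs" using h by (intro Jordan_Brouwer_frontier[of _ 0 1]) auto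
  have "T \<subseteq> inside (bdry vs)"
  proof
    fix y assume "y \<in> T"
    then have "connected_component (- bdry vs) x y" by (simp add: T_def)
    then show "y \<in> inside (bdry vs)" using x by (rule inside_same_component)
  qed
  then show ?thesis using f closure_mono unfolding region_def frontier_def by blast
qed

lemma negligible_segment: "negligible (closed_segment a (b::pt))"
proof (cases "a = b")
  case True then show ?thesis by simp
next
  case False
  let ?n = "(snd (b - a), - fst (b - a))"
  have "?n \<noteq> 0" using False by (auto simp: prod_eq_iff)
  then have "negligible {x. ?n \<bullet> x = ?n \<bullet> a}" by (intro negligible_hyperplane) simp
  moreover have "closed_segment a b \<subseteq> {x. ?n \<bullet> x = ?n \<bullet> a}"
  proof
    fix x assume "x \<in> closed_segment a b"
    then obtain u where "x = (1 - u) *\<^sub>R a + u *\<^sub>R b" by (auto simp: in_segment)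
    then show "x \<in> {x. ?n \<bullet> x = ?n \<bullet> a}" by (simp add: inner_prod_def) (simp add: algebra_simps)
  qed
  ultimately show ?thesis by (rule negligible_subset)
qed

lemma negligible_closure_region: "negligible (closure (region vs) - region vs)"
proof (rule negligible_subset)
  show "negligible (bdry vs)" unfolding bdry_def edge_def
    by (intro negligible_Union) (auto intro: negligible_segment)
  have "frontier (region vs) \<subseteq> bdry vs" unfolding region_def by (rule frontier_inside_subset[OF bdry_closed])
  then show "closure (region vs) - region vs \<subseteq> bdry vs" using region_open[of vs] by (simp add: frontier_def interior_open)
qed

text \<open>Star-shapedness speaks of points of E, but here x lies only in the closure. Having a
  whole ball of centres gives room: replacing x by a nearby point of E is compensated by moving the
  centre.\<close>

lemma star_closure:
  assumes o: "open E" and st: "star_shaped_ball E c \<rho>" and z: "z \<in> ball c \<rho>" and x: "x \<in> closure E" and r: "0 \<le> r" "r < 1"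
  shows "z + r *\<^sub>R (x - z) \<in> E"
proof -
  obtain e where e: "0 < e" "ball z e \<subseteq> ball c \<rho>" using open_ball z by (meson openE)
  obtain x' where x': "x' \<in> E" "dist x' x < e * (1 - r)"
    using x e(1) r(2) closure_approachable[of x E] by (meson diff_gt_0_iff_gt mult_pos_pos)
  \<comment> \<open>Chosen so that (1-r) z' + r x' is the original point. The tolerance e(1-r) on x'
    keeps z' within e of z.\<close>
  define z' where "z' = z + (r / (1 - r)) *\<^sub>R (x - x')"
  have "dist z z' = (r / (1 - r)) * dist x x'" using r by (simp add: z'_def dist_norm norm_minus_commute)
  also have "\<dots> \<le> (1 / (1 - r)) * dist x x'" using r by (intro mult_right_mono divide_right_mono) auto
  also have "\<dots> < e" using x'(2) r by (simp add: field_simps dist_commute)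
  finally have "z' \<in> ball c \<rho>" using e(2) by auto
  then have sub: "closed_segment z' x' \<subseteq> E" using st x'(1) by (auto simp: star_shaped_ball_def)
  have "(1 - r) *\<^sub>R z' = (1 - r) *\<^sub>R z + r *\<^sub>R (x - x')" using r by (simp add: z'_def scaleR_add_right)
  then have "z + r *\<^sub>R (x - z) = (1 - r) *\<^sub>R z' + r *\<^sub>R x'" by (simp add: algebra_simps)
  then have "z + r *\<^sub>R (x - z) \<in> closed_segment z' x'" using r by (auto simp: in_segment intro!: exI[of _ r])
  then show ?thesis using sub by blast
qed

definition det2 :: "pt => pt => real" where
  "det2 u v = fst u * snd v - snd u * fst v"

text \<open>A one-sided parallelogram neighbourhood \<open>{a + s(b-a) + \<tau>d}\<close> of a boundary piece.\<close>

definition collar :: "pt set => pt => pt => real => real => pt => bool" where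
  "collar E a b s0 s1 d \<longleftrightarrow> 0 \<le> s0 \<and> s0 < s1 \<and> s1 \<le> 1 \<and> det2 (b - a) d \<noteq> 0 \<and>
     (\<forall>s \<tau>. s0 < s --> s < s1 --> 0 < \<tau> --> \<tau> < 1 --> linepath a b s + \<tau> *\<^sub>R d \<in> E)"

text \<open>The direction d points from the boundary point at parameter s0 to the star centre c. For
  s slightly larger than s0 the target \<open>linepath s + d\<close> is still in the ball around c,
  so the open segment towards it stays in the element. The collar begins at an arbitrary s0 below 1,
  which lets collars reach every part of an edge.\<close>

lemma collar_exists:
  assumes p: "polygon vs" and st: "star_shaped_ball (region vs) c \<rho>" "0 < \<rho>" and i: "i < length vs" and s0: "0 \<le> s0" "s0 < 1"
  shows "\<exists>s1 d. collar (region vs) (vs ! i) (nxt vs i) s0 s1 d"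
proof -
  let ?a = "vs ! i" and ?b = "nxt vs i" and ?E = "region vs"
  let ?l = "linepath ?a ?b"
  have cE: "c \<in> ?E" using st centre_in_ball[of c \<rho>] unfolding star_shaped_ball_def by blast
  then have cl: "bdry vs \<subseteq> closure ?E" using bdry_subset_closure[OF p] by blast
  have le: "?l s \<in> edge vs i" if "0 \<le> s" "s \<le> 1" for s
    using that by (simp add: edge_def linepath_in_path)
  then have lcl: "?l s \<in> closure ?E" if "0 \<le> s" "s \<le> 1" for s
    using cl edge_subset_bdry[OF i] that by blast
  have lnot: "?l s \<notin> ?E" if "0 \<le> s" "s \<le> 1" for s
    using region_Int_bdry[of vs] edge_subset_bdry[OF i] le[OF that] by blast
  have cball: "c \<in> ball c \<rho>" using st(2) by simp
  define d where "d = c - ?l s0"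
  \<comment> \<open>Two restrictions: s may not exceed 1, and a shift by h along the edge must stay
    below \<rho>.\<close>
  define h where "h = min (1 - s0) (\<rho> / (2 * (norm (?b - ?a) + 1)))"
  have h: "0 < h" "s0 + h \<le> 1" using s0 st(2) by (auto simp: h_def intro!: divide_pos_pos add_nonneg_pos)
  have hr: "h * norm (?b - ?a) < \<rho>"
  proof -
    have "h * norm (?b - ?a) \<le> (\<rho> / (2 * (norm (?b - ?a) + 1))) * norm (?b - ?a)"
      by (intro mult_right_mono) (auto simp: h_def)
    also have "\<dots> = (\<rho> / 2) * (norm (?b - ?a) / (norm (?b - ?a) + 1))" by simp
    also have "\<dots> \<le> (\<rho> / 2) * 1" using st(2) by (intro mult_left_mono) (auto simp: divide_le_eq_1 add_nonneg_pos)
    finally show ?thesis using st(2) by simp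
  qed
  have col: "?l s + \<tau> *\<^sub>R d \<in> ?E" if s: "s0 < s" "s < s0 + h" and t: "0 < \<tau>" "\<tau> < 1" for s \<tau>
  proof -
    have "?l s + d = c + (s - s0) *\<^sub>R (?b - ?a)" by (simp add: d_def linepath_def algebra_simps)
    moreover have "norm ((s - s0) *\<^sub>R (?b - ?a)) < \<rho>"
    proof -
      have "norm ((s - s0) *\<^sub>R (?b - ?a)) \<le> h * norm (?b - ?a)" using s by (auto intro!: mult_right_mono)
      then show ?thesis using hr by simp
    qed
    ultimately have z: "?l s + d \<in> ball c \<rho>" by (simp add: dist_norm)
    have "(?l s + d) + (1 - \<tau>) *\<^sub>R (?l s - (?l s + d)) \<in> ?E"
      using s s0 h t by (intro star_closure[OF region_open st(1) z lcl]) auto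
    then show ?thesis by (simp add: algebra_simps)
  qed
  \<comment> \<open>Otherwise c lies on the line through the edge, at parameter \<sigma>. On the
    edge itself this is impossible; beyond one end, contracting the far end point towards c would
    put the near end point, a boundary point, into the open element.\<close>
  have "det2 (?b - ?a) d \<noteq> 0"
  proof
    assume det: "det2 (?b - ?a) d = 0"
    have "?a \<noteq> ?b"
    proof
      assume "?a = ?b"
      moreover have "nxt vs i = vs ! (Suc i mod length vs)" by (simp add: nxt_def)
      ultimately have "i = Suc i mod length vs"
        using p i by (metis distinct_conv_nth gr_implies_not0 mod_less_divisor not_gr_zero polygon_def)
      moreover have "3 \<le> length vs" using p by (simp add: polygon_def)
      ultimately show False using i by (cases "Suc i = length vs") auto
    qed
    then have "?b - ?a \<noteq> 0" by simp
    then have "\<exists>t. d = t *\<^sub>R (?b - ?a)"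
    proof (cases "fst (?b - ?a) = 0")
      case True
      then have n: "snd (?b - ?a) \<noteq> 0" using \<open>?b - ?a \<noteq> 0\<close> by (auto simp: prod_eq_iff)
      then have "d = (snd d / snd (?b - ?a)) *\<^sub>R (?b - ?a)"
        using det True by (simp add: det2_def prod_eq_iff)
      then show ?thesis by blast
    next
      case False
      define u where "u = ?b - ?a"
      have u: "fst u \<noteq> 0" "fst u * snd d = snd u * fst d" using False det by (auto simp: det2_def u_def)
      then have "d = (fst d / fst u) *\<^sub>R u" by (simp add: prod_eq_iff field_simps)
      then show ?thesis unfolding u_def by blast
    qed
    then obtain t where t: "d = t *\<^sub>R (?b - ?a)" by blast
    define \<sigma> where "\<sigma> = s0 + t"
    have c: "c = ?l \<sigma>"
    proof -
      have "c = ?l s0 + d" by (simp add: d_def)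
      then show ?thesis unfolding t by (simp add: \<sigma>_def linepath_def algebra_simps)
    qed
    have l_aff: "c + r *\<^sub>R (?l s - c) = ?l (\<sigma> + r * (s - \<sigma>))" for r s
      unfolding c by (simp add: linepath_def algebra_simps)
    consider "0 \<le> \<sigma>" "\<sigma> \<le> 1" | "\<sigma> < 0" | "1 < \<sigma>" by linarith
    then show False
    proof cases
      case 1 then show False using lnot cE c by metis
    next
      case 2
      have "c + (- \<sigma> / (1 - \<sigma>)) *\<^sub>R (?l 1 - c) \<in> ?E"
        using 2 by (intro star_closure[OF region_open st(1) cball lcl]) (auto simp: field_simps)
      moreover have "\<sigma> + (- \<sigma> / (1 - \<sigma>)) * (1 - \<sigma>) = 0" using 2 by (simp add: field_simps)
      ultimately have "?l 0 \<in> ?E" unfolding l_aff by (simp only:)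
      then show False using lnot[of 0] by simp
    next
      case 3
      have "c + ((\<sigma> - 1) / \<sigma>) *\<^sub>R (?l 0 - c) \<in> ?E"
        using 3 by (intro star_closure[OF region_open st(1) cball lcl]) (auto simp: field_simps)
      moreover have "\<sigma> + ((\<sigma> - 1) / \<sigma>) * (0 - \<sigma>) = 1" using 3 by (simp add: field_simps)
      ultimately have "?l 1 \<in> ?E" unfolding l_aff by (simp only:)
      then show False using lnot[of 1] by simp
    qed
  qed
  then have "collar ?E ?a ?b s0 (s0 + h) d" using h s0 col by (simp add: collar_def)
  then show ?thesis by blast
qed

section \<open>Traces on edges\<close>

text \<open>Two one-variable affine substitutions, with factors D/p and p, multiply to the
  determinant. They need p \<noteq> 0; if p = 0 then q \<noteq> 0 and the two columns exchange
  roles.\<close>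

lemma nn_integral_linear_change:
  fixes f :: "pt => ennreal"
  assumes f: "f \<in> borel_measurable borel" and D: "det2 (p, p') (q, q') \<noteq> 0"
  shows "(\<integral>\<^sup>+x. f x \<partial>lborel) = ennreal \<bar>det2 (p, p') (q, q')\<bar> *
    (\<integral>\<^sup>+s. \<integral>\<^sup>+\<tau>. f (a1 + s * p + \<tau> * q, a2 + s * p' + \<tau> * q') \<partial>lborel \<partial>lborel)"
proof -
  have fm: "(\<lambda>x. f (g x, h x)) \<in> borel_measurable M" if "g \<in> borel_measurable M" "h \<in> borel_measurable M" for g h and M :: "'z measure"
    using measurable_compose[OF borel_measurable_Pair[OF that] f] .
  have *: "(\<integral>\<^sup>+x. f x \<partial>lborel) = ennreal \<bar>det2 (p, p') (q, q')\<bar> *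
    (\<integral>\<^sup>+\<tau>. \<integral>\<^sup>+s. f (a1 + s * p + \<tau> * q, a2 + s * p' + \<tau> * q') \<partial>lborel \<partial>lborel)"
    if p0: "p \<noteq> 0" and D: "det2 (p, p') (q, q') \<noteq> 0" for p p' q q'
  proof -
    let ?D = "det2 (p, p') (q, q')"
    have Dp: "?D / p \<noteq> 0" using p0 D by simp
    have "(\<integral>\<^sup>+x. f x \<partial>lborel) = (\<integral>\<^sup>+x. \<integral>\<^sup>+y. f (x, y) \<partial>lborel \<partial>lborel)"
      using f by (subst lborel_prod[symmetric], subst lborel.nn_integral_fst[symmetric]) (auto simp: lborel_prod)
    also have "\<dots> = (\<integral>\<^sup>+x. ennreal \<bar>?D / p\<bar> * (\<integral>\<^sup>+\<tau>. f (x, (a2 + (p' / p) * (x - a1)) + (?D / p) * \<tau>) \<partial>lborel) \<partial>lborel)"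
      by (intro nn_integral_cong nn_integral_real_affine[OF _ Dp] fm) auto
    also have "\<dots> = ennreal \<bar>?D / p\<bar> * (\<integral>\<^sup>+x. \<integral>\<^sup>+\<tau>. f (x, (a2 + (p' / p) * (x - a1)) + (?D / p) * \<tau>) \<partial>lborel \<partial>lborel)"
      by (intro nn_integral_cmult lborel.borel_measurable_nn_integral) (auto intro!: fm simp: split_beta')
    also have "(\<integral>\<^sup>+x. \<integral>\<^sup>+\<tau>. f (x, (a2 + (p' / p) * (x - a1)) + (?D / p) * \<tau>) \<partial>lborel \<partial>lborel)
        = (\<integral>\<^sup>+\<tau>. \<integral>\<^sup>+x. f (x, (a2 + (p' / p) * (x - a1)) + (?D / p) * \<tau>) \<partial>lborel \<partial>lborel)"
      by (intro lborel_pair.Fubini') (auto intro!: fm simp: split_beta')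
    also have "\<dots> = (\<integral>\<^sup>+\<tau>. ennreal \<bar>p\<bar> * (\<integral>\<^sup>+s. f (a1 + \<tau> * q + p * s, (a2 + (p' / p) * ((a1 + \<tau> * q + p * s) - a1)) + (?D / p) * \<tau>) \<partial>lborel) \<partial>lborel)"
      by (intro nn_integral_cong nn_integral_real_affine[OF _ p0] fm) auto
    also have "\<dots> = (\<integral>\<^sup>+\<tau>. ennreal \<bar>p\<bar> * (\<integral>\<^sup>+s. f (a1 + s * p + \<tau> * q, a2 + s * p' + \<tau> * q') \<partial>lborel) \<partial>lborel)"
    proof -
      have e1: "(a2 + (p' / p) * ((a1 + \<tau> * q + p * s) - a1)) + (?D / p) * \<tau> = a2 + s * p' + \<tau> * q'" for s \<tau>
        using p0 by (simp add: det2_def field_simps)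
      have e2: "a1 + \<tau> * q + p * s = a1 + s * p + \<tau> * q" for s \<tau> by simp
      show ?thesis by (simp only: e1) (simp only: e2)
    qed
    also have "\<dots> = ennreal \<bar>p\<bar> * (\<integral>\<^sup>+\<tau>. \<integral>\<^sup>+s. f (a1 + s * p + \<tau> * q, a2 + s * p' + \<tau> * q') \<partial>lborel \<partial>lborel)"
      by (intro nn_integral_cmult lborel.borel_measurable_nn_integral) (auto intro!: fm simp: split_beta')
    finally have "(\<integral>\<^sup>+x. f x \<partial>lborel) = (ennreal \<bar>?D / p\<bar> * ennreal \<bar>p\<bar>) * (\<integral>\<^sup>+\<tau>. \<integral>\<^sup>+s. f (a1 + s * p + \<tau> * q, a2 + s * p' + \<tau> * q') \<partial>lborel \<partial>lborel)"
      by (simp add: mult.assoc)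
    also have "ennreal \<bar>?D / p\<bar> * ennreal \<bar>p\<bar> = ennreal \<bar>?D\<bar>"
      using p0 by (simp add: ennreal_mult[symmetric] abs_mult[symmetric] del: abs_divide)
    finally show ?thesis .
  qed
  have swap: "(\<integral>\<^sup>+\<tau>. \<integral>\<^sup>+s. f (a1 + s * p + \<tau> * q, a2 + s * p' + \<tau> * q') \<partial>lborel \<partial>lborel)
     = (\<integral>\<^sup>+s. \<integral>\<^sup>+\<tau>. f (a1 + s * p + \<tau> * q, a2 + s * p' + \<tau> * q') \<partial>lborel \<partial>lborel)" for p q p' q'
    by (intro lborel_pair.Fubini') (auto intro!: fm simp: split_beta')
  show ?thesis
  proof (cases "p = 0")
    case False
    then show ?thesis using *[OF False D] swap by simp
  next
    case True
    then have q: "q \<noteq> 0" and D': "det2 (q, q') (p, p') \<noteq> 0" using D by (auto simp: det2_def)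
    have "\<bar>det2 (q, q') (p, p')\<bar> = \<bar>det2 (p, p') (q, q')\<bar>" by (simp add: det2_def abs_minus_commute mult.commute)
    moreover have "(a1 + s * q + \<tau> * p, a2 + s * q' + \<tau> * p') = (a1 + \<tau> * p + s * q, a2 + \<tau> * p' + s * q')" for s \<tau> by simp
    ultimately show ?thesis using *[OF q D'] by presburger
  qed
qed

text \<open>The nonnegative formula, applied to indicators, identifies Lebesgue measure with
  \<bar>det2 e d\<bar> times its image under the affine parametrisation. The signed formula follows
  by density and image rules for integrals.\<close>

lemma linear_change:
  fixes f :: "pt => real"
  assumes f: "integrable lborel f" and D: "det2 e d \<noteq> 0"
  shows "integral\<^sup>L lborel f = \<bar>det2 e d\<bar> * (\<integral>s. (\<integral>\<tau>. f (a + s *\<^sub>R e + \<tau> *\<^sub>R d) \<partial>lborel) \<partial>lborel)"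
proof -
  define \<Phi> where "\<Phi> = (\<lambda>z::pt. a + fst z *\<^sub>R e + snd z *\<^sub>R d)"
  let ?c = "\<bar>det2 e d\<bar>"
  have \<Phi>m: "\<Phi> \<in> borel_measurable borel"
    unfolding \<Phi>_def by (intro borel_measurable_continuous_onI continuous_intros)
  then have \<Phi>m': "\<Phi> \<in> lborel \<rightarrow>\<^sub>M lborel" by simp
  have fb: "f \<in> borel_measurable borel" using f by simp
  have eq: "(lborel :: pt measure) = density (distr lborel lborel \<Phi>) (\<lambda>_. ennreal ?c)"
  proof (rule measure_eqI)
    show "sets lborel = sets (density (distr lborel lborel \<Phi>) (\<lambda>_. ennreal ?c))" by simp
    fix A :: "pt set" assume "A \<in> sets lborel"
    then have A: "A \<in> sets borel" by simp
    have "emeasure lborel A = (\<integral>\<^sup>+x. indicator A x \<partial>lborel)" using A by simp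
    also have "\<dots> = ennreal \<bar>det2 (fst e, snd e) (fst d, snd d)\<bar> *
      (\<integral>\<^sup>+s. \<integral>\<^sup>+\<tau>. indicator A (fst a + s * fst e + \<tau> * fst d, snd a + s * snd e + \<tau> * snd d) \<partial>lborel \<partial>lborel)"
      using A D by (intro nn_integral_linear_change) auto
    also have "\<dots> = ennreal ?c * (\<integral>\<^sup>+s. \<integral>\<^sup>+\<tau>. indicator A (\<Phi> (s, \<tau>)) \<partial>lborel \<partial>lborel)"
    proof -
      have "(fst a + s * fst e + \<tau> * fst d, snd a + s * snd e + \<tau> * snd d) = \<Phi> (s, \<tau>)" for s \<tau>
        by (simp add: \<Phi>_def prod_eq_iff)
      then show ?thesis by simp
    qed
    also have "(\<integral>\<^sup>+s. \<integral>\<^sup>+\<tau>. indicator A (\<Phi> (s, \<tau>)) \<partial>lborel \<partial>lborel) = (\<integral>\<^sup>+z. indicator A (\<Phi> z) \<partial>(lborel \<Otimes>\<^sub>M lborel))"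
      using \<Phi>m A by (intro lborel.nn_integral_fst) (auto simp: lborel_prod)
    also have "\<dots> = (\<integral>\<^sup>+z. indicator A z \<partial>(distr lborel lborel \<Phi>))"
      using \<Phi>m' A by (subst nn_integral_distr) (auto simp: lborel_prod)
    also have "\<dots> = emeasure (distr lborel lborel \<Phi>) A" using A by simp
    also have "ennreal ?c * \<dots> = emeasure (density (distr lborel lborel \<Phi>) (\<lambda>_. ennreal ?c)) A"
      using A by (simp add: emeasure_density_const)
    finally show "emeasure lborel A = emeasure (density (distr lborel lborel \<Phi>) (\<lambda>_. ennreal ?c)) A" .
  qed
  have c0: "?c \<noteq> 0" using D by simp
  have "integrable (density (distr lborel lborel \<Phi>) (\<lambda>_. ennreal ?c)) f" using f eq by simp
  then have "integrable (distr lborel lborel \<Phi>) (\<lambda>x. ?c * f x)"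
    using fb by (subst (asm) integrable_density) auto
  then have "integrable (distr lborel lborel \<Phi>) f" using c0 by simp
  then have i: "integrable lborel (\<lambda>z. f (\<Phi> z))" using \<Phi>m' fb by (subst (asm) integrable_distr_eq) auto
  have "integral\<^sup>L lborel f = integral\<^sup>L (density (distr lborel lborel \<Phi>) (\<lambda>_. ennreal ?c)) f" using eq by simp
  also have "\<dots> = integral\<^sup>L (distr lborel lborel \<Phi>) (\<lambda>x. ?c * f x)"
    using fb by (subst integral_density) auto
  also have "\<dots> = ?c * (LINT z|lborel. f (\<Phi> z))"
    using \<Phi>m' fb by (subst integral_mult_right_zero, subst integral_distr) auto
  also have "(LINT z|lborel. f (\<Phi> z)) = (\<integral>s. (\<integral>\<tau>. f (\<Phi> (s, \<tau>)) \<partial>lborel) \<partial>lborel)"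
    using i by (subst lborel_pair.integral_fst') (auto simp: lborel_prod)
  finally show ?thesis by (simp add: \<Phi>_def)
qed

text \<open>Transversal weight: positive on the edge, where \<tau> = 0, and 0 from \<tau> = 1/2 on,
  so that weighted functions vanish well inside the collar of height 1.\<close>

definition wt :: "real => real" where
  "wt \<tau> = expi (1/2 - \<tau>)"

lemma smooth1_wt: "smooth1 wt"
  unfolding wt_def[abs_def] using smooth1_affine[OF smooth1_expi, of "-1" "1/2"] by simp

lemma wt_eq_0: "1/2 \<le> \<tau> ==> wt \<tau> = 0"
  by (simp add: wt_def expi_eq_0)

lemma wt0_pos: "0 < wt 0"
  by (simp add: wt_def expi_pos_iff)

lemma deriv_eq_0_outside:
  fixes f :: "real => real"
  assumes "closed K" "\<And>x. x \<notin> K ==> f x = 0" "x \<notin> K"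
  shows "deriv f x = 0"
proof -
  have "((\<lambda>_. 0) has_real_derivative 0) (at x)" by simp
  then have "(f has_real_derivative 0) (at x)"
    by (rule has_field_derivative_transform_within_open[of _ _ _ "- K"]) (use assms in auto)
  then show ?thesis by (rule DERIV_imp_deriv)
qed

lemma deriv_wt_eq_0: "1/2 < \<tau> ==> deriv wt \<tau> = 0"
  by (rule deriv_eq_0_outside[of "{..1/2}"]) (auto intro: wt_eq_0)

lemma L2_indicator:
  assumes f: "f \<in> L2 E" and A: "A \<in> sets lebesgue" and E: "E \<in> sets lebesgue"
  shows "(\<lambda>x. indicator A x * f x) \<in> L2 E"
proof (rule L2I)
  have m: "indicat_real A \<in> borel_measurable (lebesgue_on E)"
    using A by (intro measurable_restrict_space1 borel_measurable_indicator)
  show "(\<lambda>x. indicat_real A x * f x) \<in> borel_measurable (lebesgue_on E)"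
    by (rule borel_measurable_times[OF m L2_measurable[OF f]])
  have "integrable lebesgue (\<lambda>x. indicator A x *\<^sub>R (indicator E x *\<^sub>R (f x)\<^sup>2))"
    using f A E by (intro integrable_mult_indicator[of A]) (auto simp: L2_def integrable_restrict_space)
  moreover have "(\<lambda>x. indicator A x *\<^sub>R (indicator E x *\<^sub>R (f x)\<^sup>2)) = (\<lambda>x. indicat_real E x *\<^sub>R (indicat_real A x * f x)\<^sup>2)"
    by (auto simp: fun_eq_iff indicator_def)
  ultimately show "integrable (lebesgue_on E) (\<lambda>x. (indicat_real A x * f x)\<^sup>2)"
    using E by (simp add: integrable_restrict_space)
qed

subsection \<open>Green's formula on a collar\<close>

locale collar_domain = domain E for E +
  fixes a b :: pt and s0 s1 :: real and d :: pt
  assumes col: "collar E a b s0 s1 d"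
begin

definition D :: real where "D = det2 (b - a) d"

lemma D: "D \<noteq> 0"
  using col by (simp add: collar_def D_def)

lemma s01: "0 \<le> s0" "s0 < s1" "s1 \<le> 1"
  using col by (auto simp: collar_def)

text \<open>\<open>xi\<close> and \<open>eta\<close> are the coordinates inverse to (s, \<tau>)
  \<mapsto> a + s(b-a) + \<tau>d, written out by Cramer's rule as affine functions so that the facts
  on ridge functions apply.\<close>

definition xi :: "pt => real" where
  "xi x = (snd d / D) * fst x + (- fst d / D) * snd x + (- det2 a d / D)"

definition eta :: "pt => real" where
  "eta x = (- snd (b - a) / D) * fst x + (fst (b - a) / D) * snd x + (- det2 (b - a) a / D)"

lemma D_xi: "D * xi x = det2 (x - a) d"
  using D unfolding xi_def by (simp add: field_simps det2_def)

lemma D_eta: "D * eta x = det2 (b - a) (x - a)"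
  using D unfolding eta_def by (simp add: field_simps det2_def)

lemma xi_lin: "xi (a + s *\<^sub>R (b - a) + \<tau> *\<^sub>R d) = s"
proof -
  have "D * xi (a + s *\<^sub>R (b - a) + \<tau> *\<^sub>R d) = D * s"
    unfolding D_xi by (simp add: D_def det2_def algebra_simps)
  then show ?thesis using D by simp
qed

lemma eta_lin: "eta (a + s *\<^sub>R (b - a) + \<tau> *\<^sub>R d) = \<tau>"
proof -
  have "D * eta (a + s *\<^sub>R (b - a) + \<tau> *\<^sub>R d) = D * \<tau>"
    unfolding D_eta by (simp add: D_def det2_def algebra_simps)
  then show ?thesis using D by simp
qed

lemma lin_xi_eta: "a + xi x *\<^sub>R (b - a) + eta x *\<^sub>R d = x"
proof -
  have *: "D * (p + xi x * q + eta x * r) = D * p + (D * xi x) * q + (D * eta x) * r" for p q r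
    by (simp add: algebra_simps)
  have "D * (fst a + xi x * fst (b - a) + eta x * fst d) = D * fst x"
    "D * (snd a + xi x * snd (b - a) + eta x * snd d) = D * snd x"
    unfolding * D_xi D_eta by (simp_all add: D_def det2_def algebra_simps)
  then show ?thesis using D by (simp add: prod_eq_iff)
qed

lemma linepath_lin: "linepath a b s = a + s *\<^sub>R (b - a)"
  by (simp add: linepath_def algebra_simps)

lemma in_collar: "s0 < xi x ==> xi x < s1 ==> 0 < eta x ==> eta x < 1 ==> x \<in> E"
  using col lin_xi_eta[of x] unfolding collar_def linepath_lin by metis

text \<open>A collar function that is cut off sharply at the edge. Its jump across \<eta> = 0 is
  what produces the boundary term in Green's formula.\<close>

definition bulk :: "(real => real) => (real => real) => fld" where
  "bulk \<alpha> \<gamma> x = indicator {x. 0 < eta x} x * (\<alpha> (xi x) * \<gamma> (eta x))"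

lemma smooth_xi: "smooth1 \<alpha> ==> smooth (\<lambda>x. \<alpha> (xi x))"
  unfolding xi_def by (rule smooth_ridge)

lemma smooth_eta: "smooth1 \<gamma> ==> smooth (\<lambda>x. \<gamma> (eta x))"
  unfolding eta_def by (rule smooth_ridge)

lemma cont_xi: "continuous_on S xi" and cont_eta: "continuous_on S eta"
  unfolding xi_def eta_def by (intro continuous_intros)+

lemma half_plane: "{x. 0 < eta x} \<in> sets borel"
  by (intro borel_open open_Collect_less cont_eta continuous_on_const)

lemma bulk_L2:
  assumes "smooth1 \<alpha>" "smooth1 \<gamma>" shows "bulk \<alpha> \<gamma> \<in> L2 E"
  unfolding bulk_def[abs_def] using half_plane
  by (intro L2_indicator[OF _ _ meas] smooth_L2[OF _ bd meas] smooth_mult smooth_xi smooth_eta assms) simp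

lemma bulk_borel:
  assumes "smooth1 \<alpha>" "smooth1 \<gamma>" shows "bulk \<alpha> \<gamma> \<in> borel_measurable borel"
  unfolding bulk_def[abs_def]
proof (rule borel_measurable_times[OF borel_measurable_indicator[OF half_plane]])
  show "(\<lambda>x. \<alpha> (xi x) * \<gamma> (eta x)) \<in> borel_measurable borel"
    by (rule borel_measurable_continuous_onI[OF smooth_continuous[OF smooth_mult[OF smooth_xi[OF assms(1)] smooth_eta[OF assms(2)]]]])
qed

lemma bulk_outside:
  assumes "\<And>s. s \<notin> {s0<..<s1} ==> \<alpha> s = 0" "\<And>\<tau>. 1/2 < \<tau> ==> \<gamma> \<tau> = 0" "x \<notin> E"
  shows "bulk \<alpha> \<gamma> x = 0"
proof (rule ccontr)
  assume "bulk \<alpha> \<gamma> x \<noteq> 0"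
  then have "0 < eta x" "\<alpha> (xi x) \<noteq> 0" "\<gamma> (eta x) \<noteq> 0" by (auto simp: bulk_def indicator_def split: if_splits)
  then have "x \<in> E" using assms(1)[of "xi x"] assms(2)[of "eta x"] by (intro in_collar) force+
  then show False using assms(3) by simp
qed

text \<open>Volume side of Green's formula: the integral of the d-derivative of w \<alpha>(\<xi>)
  wt(\<eta>), using that \<xi> is constant along d and \<eta> has derivative 1. The gradient enters
  as separate arguments so that the expression passes to limits in L^2.\<close>

definition G :: "(real => real) => fld => fld => fld => real" where
  "G \<alpha> w wx wy = fst d * l2ip E wx (bulk \<alpha> wt) + snd d * l2ip E wy (bulk \<alpha> wt) + l2ip E w (bulk \<alpha> (deriv wt))"

text \<open>The integrand S vanishes outside E, so the integral may be taken over the plane and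
  transformed to the collar coordinates. For fixed s it is a \<tau>-derivative; the upper end
  contributes nothing since \<open>wt\<close> vanishes there, and the lower end is the edge value.
  The factor \<bar>D\<bar> is the Jacobian.\<close>

lemma green_smooth:
  assumes \<alpha>: "smooth1 \<alpha>" "\<And>s. s \<notin> {s0<..<s1} ==> \<alpha> s = 0" and f: "smooth f"
  shows "G \<alpha> f (pdx f) (pdy f) = - \<bar>D\<bar> * wt 0 * l2ip {0..1} (\<lambda>s. f (linepath a b s)) \<alpha>"
proof -
  note dw = smooth1_deriv[OF smooth1_wt]
  define S where "S x = (fst d * pdx f x + snd d * pdy f x) * bulk \<alpha> wt x + f x * bulk \<alpha> (deriv wt) x" for x
  note K = bulk_L2[OF \<alpha>(1) smooth1_wt] bulk_L2[OF \<alpha>(1) dw]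
  note fL = smooth_L2[OF f bd meas] smooth_L2[OF smooth_pd(1)[OF f] bd meas] smooth_L2[OF smooth_pd(2)[OF f] bd meas]
  have i: "integrable (lebesgue_on E) (\<lambda>x. fst d * (pdx f x * bulk \<alpha> wt x) + snd d * (pdy f x * bulk \<alpha> wt x) + f x * bulk \<alpha> (deriv wt) x)"
    by (intro Bochner_Integration.integrable_add integrable_mult_right L2_mult fL K)
  have "G \<alpha> f (pdx f) (pdy f) = (LINT x|lebesgue_on E. fst d * (pdx f x * bulk \<alpha> wt x) + snd d * (pdy f x * bulk \<alpha> wt x) + f x * bulk \<alpha> (deriv wt) x)"
    unfolding G_def l2ip_def using L2_mult[OF fL(2) K(1)] L2_mult[OF fL(3) K(1)] L2_mult[OF fL(1) K(2)] by simp
  also have "(\<lambda>x. fst d * (pdx f x * bulk \<alpha> wt x) + snd d * (pdy f x * bulk \<alpha> wt x) + f x * bulk \<alpha> (deriv wt) x) = S"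
    by (simp add: S_def fun_eq_iff algebra_simps)
  finally have GS: "G \<alpha> f (pdx f) (pdy f) = integral\<^sup>L (lebesgue_on E) S" .
  have iS: "integrable (lebesgue_on E) S"
    using i by (simp add: S_def[abs_def] algebra_simps)
  have S0: "S x = 0" if "x \<notin> E" for x
  proof -
    have "bulk \<alpha> wt x = 0" "bulk \<alpha> (deriv wt) x = 0"
      by (rule bulk_outside; use \<alpha>(2) wt_eq_0 deriv_wt_eq_0 that in simp)+
    then show ?thesis by (simp add: S_def)
  qed
  have SE: "(\<lambda>x. indicator E x * S x) = S" using S0 by (auto simp: fun_eq_iff indicator_def)
  have fb: "f \<in> borel_measurable borel" "pdx f \<in> borel_measurable borel" "pdy f \<in> borel_measurable borel"
    by (rule borel_measurable_continuous_onI[OF smooth_continuous] f smooth_pd[OF f])+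
  have Sb: "S \<in> borel_measurable borel"
    unfolding S_def[abs_def] using bulk_borel[OF \<alpha>(1) smooth1_wt] bulk_borel[OF \<alpha>(1) dw] fb by measurable
  have "integrable lebesgue S" using iS meas by (simp add: integrable_restrict_space SE)
  then have Sl: "integrable lborel S" using Sb by (subst (asm) integrable_completion) auto
  have "integral\<^sup>L (lebesgue_on E) S = integral\<^sup>L lebesgue S" using meas by (simp add: integral_restrict_space SE)
  also have "\<dots> = integral\<^sup>L lborel S" using Sb by (intro integral_completion) simp
  also have "\<dots> = \<bar>D\<bar> * (\<integral>s. (\<integral>\<tau>. S (a + s *\<^sub>R (b - a) + \<tau> *\<^sub>R d) \<partial>lborel) \<partial>lborel)"
    unfolding D_def by (rule linear_change[OF Sl]) (use D in \<open>simp add: D_def\<close>)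
  also have "(\<lambda>s. \<integral>\<tau>. S (a + s *\<^sub>R (b - a) + \<tau> *\<^sub>R d) \<partial>lborel) = (\<lambda>s. - wt 0 * (f (linepath a b s) * \<alpha> s))"
  proof
    fix s
    let ?p = "\<lambda>\<tau>. a + s *\<^sub>R (b - a) + \<tau> *\<^sub>R d"
    let ?g = "\<lambda>\<tau>. \<alpha> s * (f (?p \<tau>) * wt \<tau>)"
    let ?g' = "\<lambda>\<tau>. \<alpha> s * ((fst d * pdx f (?p \<tau>) + snd d * pdy f (?p \<tau>)) * wt \<tau> + f (?p \<tau>) * deriv wt \<tau>)"
    have pd: "(?p has_derivative (\<lambda>h. h *\<^sub>R d)) (at \<tau>)" for \<tau> by (auto intro!: derivative_eq_intros)
    have fd: "((\<lambda>\<tau>. f (?p \<tau>)) has_real_derivative (fst d * pdx f (?p \<tau>) + snd d * pdy f (?p \<tau>))) (at \<tau>)" for \<tau>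
    proof -
      have "((\<lambda>\<tau>. f (?p \<tau>)) has_derivative (\<lambda>h. pdx f (?p \<tau>) * fst (h *\<^sub>R d) + pdy f (?p \<tau>) * snd (h *\<^sub>R d))) (at \<tau>)"
        using has_derivative_compose[OF pd smooth_has_derivative[OF f]] by simp
      moreover have "(\<lambda>h. pdx f (?p \<tau>) * fst (h *\<^sub>R d) + pdy f (?p \<tau>) * snd (h *\<^sub>R d)) = (*) (fst d * pdx f (?p \<tau>) + snd d * pdy f (?p \<tau>))"
        by (auto simp: algebra_simps)
      ultimately show ?thesis by (simp add: has_field_derivative_def)
    qed
    have gd: "(?g has_real_derivative ?g' \<tau>) (at \<tau>)" for \<tau>
      using DERIV_cmult[OF DERIV_mult[OF fd smooth1_DERIV[OF smooth1_wt]], of "\<alpha> s" \<tau>] by (simp add: algebra_simps)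
    have pc: "continuous_on X ?p" for X by (intro continuous_intros)
    have hc: "continuous_on X (\<lambda>\<tau>. h (?p \<tau>))" if "smooth h" for h X
      by (rule continuous_on_compose2[OF smooth_continuous[OF that, of UNIV] pc]) auto
    have gc: "continuous_on {0..1} ?g'"
      by (intro continuous_intros hc smooth_pd f smooth1_continuous smooth1_wt dw)
    have "(\<integral>\<tau>. S (?p \<tau>) \<partial>lborel) = (\<integral>\<tau>. indicator {0..1} \<tau> *\<^sub>R ?g' \<tau> \<partial>lborel)"
    proof (rule integral_cong_AE)
      show "(\<lambda>\<tau>. S (?p \<tau>)) \<in> borel_measurable lborel"
        using measurable_compose[OF borel_measurable_continuous_onI[OF pc] Sb] by simp
      have "integrable lborel (\<lambda>\<tau>. indicator {0..1} \<tau> *\<^sub>R ?g' \<tau>)" by (rule borel_integrable_compact[OF _ gc]) simp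
      then show "(\<lambda>\<tau>. indicator {0..1} \<tau> *\<^sub>R ?g' \<tau>) \<in> borel_measurable lborel" by (rule borel_measurable_integrable)
      \<comment> \<open>S jumps at \<tau> = 0, where the indicator in \<open>bulk\<close> is 0 but
        the smooth integrand need not be; one point is negligible.\<close>
      have "AE \<tau> in lborel. \<tau> \<noteq> (0::real)" by (rule AE_lborel_singleton)
      then show "AE \<tau> in lborel. S (?p \<tau>) = indicator {0..1} \<tau> *\<^sub>R ?g' \<tau>"
      proof eventually_elim
        fix \<tau> :: real assume "\<tau> \<noteq> 0"
        then consider "\<tau> < 0" | "0 < \<tau>" "\<tau> \<le> 1" | "1 < \<tau>" by linarith
        then show "S (?p \<tau>) = indicator {0..1} \<tau> *\<^sub>R ?g' \<tau>"
        proof cases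
          case 1 then show ?thesis by (simp add: S_def bulk_def eta_lin)
        next
          case 2
          have bk: "bulk \<alpha> \<gamma> (?p \<tau>) = \<alpha> s * \<gamma> \<tau>" for \<gamma>
            unfolding bulk_def xi_lin eta_lin using 2 by (simp add: indicator_def eta_lin)
          show ?thesis unfolding S_def bk using 2 by (simp add: indicator_def distrib_left mult.commute mult.left_commute)
        next
          case 3 then show ?thesis by (simp add: S_def bulk_def eta_lin xi_lin wt_eq_0 deriv_wt_eq_0)
        qed
      qed
    qed
    also have "\<dots> = ?g 1 - ?g 0"
      by (rule integral_FTC_Icc[OF _ _ gc])
        (use has_field_derivative_at_within[OF gd] in \<open>auto simp: has_real_derivative_iff_has_vector_derivative[symmetric]\<close>)
    also have "\<dots> = - wt 0 * (f (linepath a b s) * \<alpha> s)" by (simp add: wt_eq_0 linepath_lin)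
    finally show "(\<integral>\<tau>. S (?p \<tau>) \<partial>lborel) = - wt 0 * (f (linepath a b s) * \<alpha> s)" .
  qed
  also have "(\<integral>s. - wt 0 * (f (linepath a b s) * \<alpha> s) \<partial>lborel) = - wt 0 * (\<integral>s. f (linepath a b s) * \<alpha> s \<partial>lborel)" by simp
  also have "(\<integral>s. f (linepath a b s) * \<alpha> s \<partial>lborel) = l2ip {0..1} (\<lambda>s. f (linepath a b s)) \<alpha>"
  proof -
    have lc: "continuous_on UNIV (\<lambda>s. f (linepath a b s) * \<alpha> s)"
      by (intro continuous_intros smooth1_continuous \<alpha> continuous_on_compose2[OF smooth_continuous[OF f, of UNIV]]) auto
    have "(\<integral>s. f (linepath a b s) * \<alpha> s \<partial>lborel) = (LINT s|lebesgue. f (linepath a b s) * \<alpha> s)"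
      using borel_measurable_continuous_onI[OF lc] by (intro integral_completion[symmetric]) simp
    also have "\<dots> = (LINT s|lebesgue. indicator {0..1} s *\<^sub>R (f (linepath a b s) * \<alpha> s))"
    proof (rule Bochner_Integration.integral_cong[OF refl])
      fix s show "f (linepath a b s) * \<alpha> s = indicator {0..1} s *\<^sub>R (f (linepath a b s) * \<alpha> s)"
        using \<alpha>(2)[of s] s01 by (cases "s \<in> {s0<..<s1}") (auto simp: indicator_def)
    qed
    finally show ?thesis by (simp add: l2ip_def integral_restrict_space)
  qed
  finally show ?thesis using GS by simp
qed

end

declare One_nat_def [simp del]

section \<open>Convergence in H^1 and the calculus of traces\<close>

lemma l2norm_cong_AE:
  assumes "u \<in> L2 E" "v \<in> L2 E" "AE x in lebesgue_on E. u x = v x"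
  shows "l2norm E u = l2norm E v"
proof -
  have "l2ip E u u = l2ip E v u" by (intro l2ip_cong_AE L2_measurable assms)
  also have "\<dots> = l2ip E u v" by (rule L2.sym) (rule assms)+
  also have "\<dots> = l2ip E v v" by (intro l2ip_cong_AE L2_measurable assms)
  finally show ?thesis by (simp add: l2norm_def)
qed

lemma l2norm_scale: "l2norm E (\<lambda>x. a * u x) = \<bar>a\<bar> * l2norm E u"
proof -
  have "(\<lambda>x. a * u x * (a * u x)) = (\<lambda>x. a\<^sup>2 * (u x * u x))" by (simp add: fun_eq_iff power2_eq_square)
  then show ?thesis unfolding l2norm_def l2ip_def by (simp add: real_sqrt_mult)
qed

lemma l2norm_comb_diff:
  assumes "u \<in> L2 E" "v \<in> L2 E" "u' \<in> L2 E" "v' \<in> L2 E"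
  shows "l2norm E (\<lambda>x. (a * u x + b * v x) - (a * u' x + b * v' x)) \<le> \<bar>a\<bar> * l2norm E (\<lambda>x. u x - u' x) + \<bar>b\<bar> * l2norm E (\<lambda>x. v x - v' x)"
proof -
  have "(\<lambda>x. (a * u x + b * v x) - (a * u' x + b * v' x)) = (\<lambda>x. a * (u x - u' x) + b * (v x - v' x))"
    by (simp add: fun_eq_iff algebra_simps)
  then show ?thesis
    using l2norm_triangle[OF L2.scale[OF L2.diff[OF assms(1,3)], of a] L2.scale[OF L2.diff[OF assms(2,4)], of b]]
    by (simp add: l2norm_scale)
qed

lemma null_seq_comb:
  assumes "\<And>n. 0 \<le> z n" "\<And>n. z n \<le> c1 * x n + c2 * y n" "x \<longlonglongrightarrow> 0" "y \<longlonglongrightarrow> (0::real)"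
  shows "z \<longlonglongrightarrow> 0"
proof (rule Lim_null_comparison)
  show "\<forall>\<^sub>F n in sequentially. norm (z n) \<le> c1 * x n + c2 * y n" using assms(1,2) by (simp add: always_eventually)
  have "(\<lambda>n. c1 * x n + c2 * y n) \<longlonglongrightarrow> c1 * 0 + c2 * 0" by (intro tendsto_intros assms)
  then show "(\<lambda>n. c1 * x n + c2 * y n) \<longlonglongrightarrow> 0" by simp
qed

context domain
begin

lemma hnorm1_diff:
  assumes f: "smooth f" and w: "w \<in> Hs 1 E"
  shows "hnorm 1 E (\<lambda>x. f x - w x) = sqrt ((l2norm E (\<lambda>x. f x - w x))\<^sup>2 + ((l2norm E (\<lambda>x. pdy f x - wD E 0 1 w x))\<^sup>2
    + (l2norm E (\<lambda>x. pdx f x - wD E 1 0 w x))\<^sup>2))"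
proof -
  interpret Hs: lin_space "Hs 1 E" by (rule Hs_lin_space[OF meas])
  have fH: "f \<in> Hs 1 E" using smooth_Hs[OF f bd meas] by (rule Hs_mono[rotated]) simp
  note dH = Hs.diff[OF fH w]
  have 0: "l2norm E (wD E 0 0 (\<lambda>x. f x - w x)) = l2norm E (\<lambda>x. f x - w x)"
    using wD_AE[OF op is_wderiv_00[OF Hs_L2[OF dH]]] by (intro l2norm_cong_AE Hs_wD_L2[OF dH] Hs_L2[OF dH]) auto
  note L = Hs_wD_L2[OF w] smooth_L2[OF smooth_pd(1)[OF f] bd meas] smooth_L2[OF smooth_pd(2)[OF f] bd meas] Hs_wD_L2[OF fH]
  have 1: "l2norm E (wD E 1 0 (\<lambda>x. f x - w x)) = l2norm E (\<lambda>x. pdx f x - wD E 1 0 w x)"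
    unfolding l2norm_wD_diff[OF fH w, of 1 0, simplified]
    using wD_smooth_AE(1)[OF f] by (intro l2norm_cong_AE L2.diff L) (auto elim: eventually_mono)
  have 2: "l2norm E (wD E 0 1 (\<lambda>x. f x - w x)) = l2norm E (\<lambda>x. pdy f x - wD E 0 1 w x)"
    unfolding l2norm_wD_diff[OF fH w, of 0 1, simplified]
    using wD_smooth_AE(2)[OF f] by (intro l2norm_cong_AE L2.diff L) (auto elim: eventually_mono)
  have s0: "hsemi 0 E u = l2norm E (wD E 0 0 u)" for u by (simp add: hsemi_def)
  have s1: "(hsemi 1 E u)\<^sup>2 = (l2norm E (wD E 0 1 u))\<^sup>2 + (l2norm E (wD E 1 0 u))\<^sup>2" for u
  proof -
    have "{..1::nat} = {0, 1}" by auto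
    then have "hsemi 1 E u = sqrt ((l2norm E (wD E 0 1 u))\<^sup>2 + (l2norm E (wD E 1 0 u))\<^sup>2)" by (simp add: hsemi_def)
    then show ?thesis by simp
  qed
  have "hnorm 1 E u = sqrt ((hsemi 0 E u)\<^sup>2 + (hsemi 1 E u)\<^sup>2)" for u
  proof -
    have "{..1::nat} = {0, 1}" by auto
    then show ?thesis by (simp add: hnorm_def)
  qed
  then show ?thesis by (simp only: s0 s1 0 1 2)
qed

text \<open>Convergence in the norm \<open>hnorm 1\<close>, with classical derivatives of the smooth
  approximants in place of chosen weak derivatives of differences.\<close>

definition H1conv :: "(nat => fld) => fld => bool" where
  "H1conv \<psi> w \<longleftrightarrow> L2lim E \<psi> w \<and>
     L2lim E (\<lambda>n. pdx (\<psi> n)) (wD E 1 0 w) \<and>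
     L2lim E (\<lambda>n. pdy (\<psi> n)) (wD E 0 1 w)"

lemma H1conv_iff:
  assumes f: "\<And>n. smooth (\<psi> n)" and w: "w \<in> Hs 1 E"
  shows "(\<lambda>n. hnorm 1 E (\<lambda>x. \<psi> n x - w x)) \<longlonglongrightarrow> 0 \<longleftrightarrow> H1conv \<psi> w"
proof -
  let ?a = "\<lambda>n. l2norm E (\<lambda>x. \<psi> n x - w x)" and ?b = "\<lambda>n. l2norm E (\<lambda>x. pdy (\<psi> n) x - wD E 0 1 w x)"
    and ?c = "\<lambda>n. l2norm E (\<lambda>x. pdx (\<psi> n) x - wD E 1 0 w x)"
  let ?h = "\<lambda>n. sqrt ((?a n)\<^sup>2 + ((?b n)\<^sup>2 + (?c n)\<^sup>2))"
  have h: "(\<lambda>n. hnorm 1 E (\<lambda>x. \<psi> n x - w x)) = ?h" using hnorm1_diff[OF f w] by (rule ext)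
  have le: "?a n \<le> ?h n" "?b n \<le> ?h n" "?c n \<le> ?h n" for n by (auto intro!: real_le_rsqrt)
  show ?thesis unfolding h H1conv_def
  proof (intro iffI conjI; (elim conjE)?)
    assume h0: "?h \<longlonglongrightarrow> 0"
    have "f \<longlonglongrightarrow> 0" if "\<And>n. f n \<le> ?h n" "\<And>n. 0 \<le> f n" for f
      by (rule tendsto_sandwich[where f = "\<lambda>_. 0" and h = ?h]) (simp_all only: that always_eventually h0 tendsto_const simp_thms)
    then show "?a \<longlonglongrightarrow> 0" "?b \<longlonglongrightarrow> 0" "?c \<longlonglongrightarrow> 0"
      by (simp_all only: le l2norm_nonneg)
  next
    assume "?a \<longlonglongrightarrow> 0" "?b \<longlonglongrightarrow> 0" "?c \<longlonglongrightarrow> 0"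
    then have "?h \<longlonglongrightarrow> sqrt (0\<^sup>2 + (0\<^sup>2 + 0\<^sup>2))" by (intro tendsto_intros)
    then show "?h \<longlonglongrightarrow> 0" by simp
  qed
qed

lemma edge_trace_iff:
  "edge_trace E a b w t \<longleftrightarrow> w \<in> Hs 1 E \<and> (\<lambda>s. t (linepath a b s)) \<in> L2 {0..1} \<and>
    (\<exists>\<psi>. (\<forall>n. smooth (\<psi> n)) \<and> H1conv \<psi> w \<and> L2lim {0..1} (\<lambda>n s. \<psi> n (linepath a b s)) (\<lambda>s. t (linepath a b s)))"
  unfolding edge_trace_def using H1conv_iff by blast

lemma smooth_line_L2: "smooth f ==> (\<lambda>s. f (linepath a b s)) \<in> L2 {0..1}"
  by (intro continuous_L2 continuous_on_compose2[OF smooth_continuous[of f UNIV]]) auto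

lemma edge_trace_smooth:
  assumes f: "smooth f" and w: "w \<in> Hs 1 E" and ae: "AE x in lebesgue_on E. w x = f x"
  shows "edge_trace E a b w f"
  unfolding edge_trace_iff
proof (intro conjI w smooth_line_L2[OF f] exI[of _ "\<lambda>_. f"] allI f)
  have fH: "f \<in> Hs 1 E" using smooth_Hs[OF f bd meas] by (rule Hs_mono[rotated]) simp
  have c: "wD E i j w = wD E i j f" for i j by (rule wD_cong[OF meas Hs_L2[OF w] ae])
  have z: "l2norm E (\<lambda>x. g x - v x) = 0" if "g \<in> L2 E" "v \<in> L2 E" "AE x in lebesgue_on E. v x = g x" for g v
    using l2norm_eq_0_iff[OF L2.diff[OF that(1,2)]] that(3) by auto
  have "l2norm E (\<lambda>x. f x - w x) = 0" by (rule z[OF Hs_L2[OF fH] Hs_L2[OF w] ae])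
  moreover have "l2norm E (\<lambda>x. pdx f x - wD E 1 0 w x) = 0"
    unfolding c by (rule z[OF smooth_L2[OF smooth_pd(1)[OF f] bd meas] Hs_wD_L2[OF fH] wD_smooth_AE(1)[OF f]]) simp
  moreover have "l2norm E (\<lambda>x. pdy f x - wD E 0 1 w x) = 0"
    unfolding c by (rule z[OF smooth_L2[OF smooth_pd(2)[OF f] bd meas] Hs_wD_L2[OF fH] wD_smooth_AE(2)[OF f]]) simp
  ultimately show "H1conv (\<lambda>_. f) w" by (simp add: H1conv_def)
qed (simp add: l2norm_def l2ip_def)

lemma edge_trace_cong:
  assumes t: "edge_trace E a b w t" and ae: "AE x in lebesgue_on E. w x = w' x"
  shows "edge_trace E a b w' t"
proof -
  have w: "w \<in> Hs 1 E" using t by (simp add: edge_trace_def)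
  have w': "w' \<in> Hs 1 E" by (rule Hs_cong[OF meas w ae])
  have c: "wD E i j w = wD E i j w'" for i j by (rule wD_cong[OF meas Hs_L2[OF w] ae])
  have "H1conv \<psi> w'" if "\<forall>n. smooth (\<psi> n)" "H1conv \<psi> w" for \<psi>
  proof -
    have "l2norm E (\<lambda>x. \<psi> n x - w' x) = l2norm E (\<lambda>x. \<psi> n x - w x)" for n
      using ae that(1) by (intro l2norm_cong_AE L2.diff Hs_L2[OF w] Hs_L2[OF w'] smooth_L2 bd meas) auto
    then show ?thesis using that(2) by (simp add: H1conv_def c)
  qed
  then show ?thesis using t w' unfolding edge_trace_iff by blast
qed

lemma edge_trace_comb:
  assumes t: "edge_trace E a b w t" and t': "edge_trace E a b w' t'"
  shows "edge_trace E a b (lc r w s w') (lc r t s t')"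
proof -
  interpret Hs: lin_space "Hs 1 E" by (rule Hs_lin_space[OF meas])
  obtain \<psi> where \<psi>: "\<And>n. smooth (\<psi> n)" "H1conv \<psi> w" "L2lim {0..1} (\<lambda>n s. \<psi> n (linepath a b s)) (\<lambda>s. t (linepath a b s))"
    using t unfolding edge_trace_iff by blast
  obtain \<phi> where \<phi>: "\<And>n. smooth (\<phi> n)" "H1conv \<phi> w'" "L2lim {0..1} (\<lambda>n s. \<phi> n (linepath a b s)) (\<lambda>s. t' (linepath a b s))"
    using t' unfolding edge_trace_iff by blast
  have w: "w \<in> Hs 1 E" "w' \<in> Hs 1 E" and tL: "(\<lambda>s. t (linepath a b s)) \<in> L2 {0..1}" "(\<lambda>s. t' (linepath a b s)) \<in> L2 {0..1}"
    using t t' by (auto simp: edge_trace_def)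
  let ?\<chi> = "\<lambda>n x. r * \<psi> n x + s * \<phi> n x" and ?w = "\<lambda>x. r * w x + s * w' x"
  have wH: "?w \<in> Hs 1 E" using w by (rule Hs.comb)
  have dw: "l2norm E (\<lambda>x. g x - wD E i j ?w x) = l2norm E (\<lambda>x. g x - (r * wD E i j w x + s * wD E i j w' x))"
    if "i + j \<le> 1" "g \<in> L2 E" for i j g
    using wD_comb_AE[OF op w that(1), of r s] that
    by (intro l2norm_cong_AE L2.diff L2.comb Hs_wD_L2[OF wH] Hs_wD_L2[OF w(1)] Hs_wD_L2[OF w(2)]) (auto elim: eventually_mono)
  have px: "pdx (?\<chi> n) = (\<lambda>x. r * pdx (\<psi> n) x + s * pdx (\<phi> n) x)" "pdy (?\<chi> n) = (\<lambda>x. r * pdy (\<psi> n) x + s * pdy (\<phi> n) x)" for n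
    by (intro ext pdx_comb pdy_comb smooth_differentiable \<psi> \<phi>)+
  note L = smooth_L2[OF _ bd meas] Hs_L2[OF w(1)] Hs_L2[OF w(2)] Hs_wD_L2[OF w(1)] Hs_wD_L2[OF w(2)] \<psi>(1) \<phi>(1) smooth_pd
  have "H1conv ?\<chi> ?w" unfolding H1conv_def
  proof (intro conjI)
    show "L2lim E ?\<chi> ?w"
      by (rule null_seq_comb[OF l2norm_nonneg l2norm_comb_diff]) (use \<psi>(2) \<phi>(2) in \<open>auto simp: H1conv_def intro: L\<close>)
    show "L2lim E (\<lambda>n. pdx (?\<chi> n)) (wD E 1 0 ?w)"
    proof (rule null_seq_comb[OF l2norm_nonneg])
      show "l2norm E (\<lambda>x. pdx (?\<chi> n) x - wD E 1 0 ?w x) \<le> \<bar>r\<bar> * l2norm E (\<lambda>x. pdx (\<psi> n) x - wD E 1 0 w x) + \<bar>s\<bar> * l2norm E (\<lambda>x. pdx (\<phi> n) x - wD E 1 0 w' x)" for n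
        by (subst dw) (auto simp: px intro!: l2norm_comb_diff L L2.comb smooth_comb)
    qed (use \<psi>(2) \<phi>(2) in \<open>auto simp: H1conv_def\<close>)
    show "L2lim E (\<lambda>n. pdy (?\<chi> n)) (wD E 0 1 ?w)"
    proof (rule null_seq_comb[OF l2norm_nonneg])
      show "l2norm E (\<lambda>x. pdy (?\<chi> n) x - wD E 0 1 ?w x) \<le> \<bar>r\<bar> * l2norm E (\<lambda>x. pdy (\<psi> n) x - wD E 0 1 w x) + \<bar>s\<bar> * l2norm E (\<lambda>x. pdy (\<phi> n) x - wD E 0 1 w' x)" for n
        by (subst dw) (auto simp: px intro!: l2norm_comb_diff L L2.comb smooth_comb)
    qed (use \<psi>(2) \<phi>(2) in \<open>auto simp: H1conv_def\<close>)
  qed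
  moreover have "L2lim {0..1} (\<lambda>n x. ?\<chi> n (linepath a b x)) (\<lambda>x. (r * t (linepath a b x) + s * t' (linepath a b x)))"
    by (rule null_seq_comb[OF l2norm_nonneg l2norm_comb_diff \<psi>(3) \<phi>(3)]) (intro smooth_line_L2 \<psi> \<phi> tL)+
  moreover have "smooth (?\<chi> n)" for n by (rule smooth_comb[OF \<psi>(1) \<phi>(1)])
  ultimately show ?thesis
    unfolding edge_trace_iff by (intro conjI wH L2.comb[OF tL] exI[of _ ?\<chi>] allI)
qed

text \<open>Diagonal argument: for each n pick one smooth function that is within 1/(n+1) of
  \<open>w n\<close>, of its two first derivatives and of its trace. These functions approximate the
  limit and its trace simultaneously.\<close>

lemma edge_trace_limit:
  assumes t: "\<And>n. edge_trace E a b (w n) (t n)" and w': "w' \<in> Hs 1 E" and t': "(\<lambda>s. t' (linepath a b s)) \<in> L2 {0..1}"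
    and lim: "L2lim E w w'"
      "L2lim E (\<lambda>n. wD E 1 0 (w n)) (wD E 1 0 w')"
      "L2lim E (\<lambda>n. wD E 0 1 (w n)) (wD E 0 1 w')"
      "L2lim {0..1} (\<lambda>n s. t n (linepath a b s)) (\<lambda>s. t' (linepath a b s))"
  shows "edge_trace E a b w' t'"
proof -
  have w: "w n \<in> Hs 1 E" and tL: "(\<lambda>s. t n (linepath a b s)) \<in> L2 {0..1}" for n using t[of n] by (auto simp: edge_trace_def)
  define P where "P n f \<longleftrightarrow> smooth f \<and> l2norm E (\<lambda>x. f x - w n x) < 1 / real (Suc n) \<and> l2norm E (\<lambda>x. pdx f x - wD E 1 0 (w n) x) < 1 / real (Suc n)
     \<and> l2norm E (\<lambda>x. pdy f x - wD E 0 1 (w n) x) < 1 / real (Suc n) \<and> l2norm {0..1} (\<lambda>s. f (linepath a b s) - t n (linepath a b s)) < 1 / real (Suc n)" for n f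
  have "\<exists>f. P n f" for n
  proof -
    obtain \<psi> where \<psi>: "\<And>k. smooth (\<psi> k)" "H1conv \<psi> (w n)" "(\<lambda>k. l2norm {0..1} (\<lambda>s. \<psi> k (linepath a b s) - t n (linepath a b s))) \<longlonglongrightarrow> 0"
      using t[of n] unfolding edge_trace_iff by blast
    have p: "0 < 1 / real (Suc n)" by simp
    note ev = order_tendstoD(2)[OF _ p]
    have "\<forall>\<^sub>F k in sequentially. P n (\<psi> k)"
      using \<psi>(2,3) unfolding H1conv_def P_def by (intro eventually_conj ev) (auto simp: \<psi>(1))
    then have "\<exists>k. P n (\<psi> k)" by (rule eventually_happens'[OF sequentially_bot])
    then show ?thesis by blast
  qed
  then have "\<forall>n. \<exists>f. P n f" by blast
  from choice[OF this] obtain \<psi> where "\<forall>n. P n (\<psi> n)" by blast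
  then have \<psi>: "\<And>n. smooth (\<psi> n)" "\<And>n. l2norm E (\<lambda>x. \<psi> n x - w n x) < 1 / real (Suc n)"
    "\<And>n. l2norm E (\<lambda>x. pdx (\<psi> n) x - wD E 1 0 (w n) x) < 1 / real (Suc n)" "\<And>n. l2norm E (\<lambda>x. pdy (\<psi> n) x - wD E 0 1 (w n) x) < 1 / real (Suc n)"
    "\<And>n. l2norm {0..1} (\<lambda>s. \<psi> n (linepath a b s) - t n (linepath a b s)) < 1 / real (Suc n)"
    unfolding P_def by simp_all
  have null: "(\<lambda>n. 1 / real (Suc n)) \<longlonglongrightarrow> 0" using LIMSEQ_inverse_real_of_nat by (simp add: inverse_eq_divide)
  have tri: "L2lim A f v'"
    if "\<And>n. f n \<in> L2 A" "\<And>n. v n \<in> L2 A" "v' \<in> L2 A" "\<And>n. l2norm A (\<lambda>x. f n x - v n x) < 1 / real (Suc n)" "L2lim A v v'"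
    for A :: "'z::euclidean_space set" and f v v'
  proof (rule null_seq_comb[OF l2norm_nonneg _ null that(5), where ?c1.0 = 1 and ?c2.0 = 1])
    show "l2norm A (\<lambda>x. f n x - v' x) \<le> 1 * (1 / real (Suc n)) + 1 * l2norm A (\<lambda>x. v n x - v' x)" for n
      using l2norm_triangle_diff[OF that(1)[of n] that(2)[of n] that(3)] that(4)[of n] by linarith
  qed
  note L = smooth_L2[OF \<psi>(1) bd meas] smooth_L2[OF smooth_pd(1)[OF \<psi>(1)] bd meas] smooth_L2[OF smooth_pd(2)[OF \<psi>(1)] bd meas]
  have "H1conv \<psi> w'" unfolding H1conv_def
  proof (intro conjI)
    show "L2lim E \<psi> w'" by (rule tri[OF L(1) Hs_L2[OF w] Hs_L2[OF w'] \<psi>(2) lim(1)])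
    show "L2lim E (\<lambda>n. pdx (\<psi> n)) (wD E 1 0 w')" by (rule tri[OF L(2) Hs_wD_L2[OF w] Hs_wD_L2[OF w'] \<psi>(3) lim(2)]) auto
    show "L2lim E (\<lambda>n. pdy (\<psi> n)) (wD E 0 1 w')" by (rule tri[OF L(3) Hs_wD_L2[OF w] Hs_wD_L2[OF w'] \<psi>(4) lim(3)]) auto
  qed
  moreover have "L2lim {0..1} (\<lambda>n s. \<psi> n (linepath a b s)) (\<lambda>s. t' (linepath a b s))"
    by (rule tri[OF smooth_line_L2[OF \<psi>(1)] tL t' \<psi>(5) lim(4)])
  ultimately show ?thesis unfolding edge_trace_iff using w' t' \<psi>(1) by blast
qed

end

context collar_domain
begin

text \<open>Both sides are continuous along the smooth sequence that defines the trace. The left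
  side does not mention t, so the edge integrals of a trace are determined by w.\<close>

lemma green_trace:
  assumes \<alpha>: "smooth1 \<alpha>" "\<And>s. s \<notin> {s0<..<s1} ==> \<alpha> s = 0" and t: "edge_trace E a b w t"
  shows "G \<alpha> w (wD E 1 0 w) (wD E 0 1 w) = - \<bar>D\<bar> * wt 0 * l2ip {0..1} (\<lambda>s. t (linepath a b s)) \<alpha>"
proof -
  obtain \<psi> where \<psi>: "\<And>n. smooth (\<psi> n)" "H1conv \<psi> w" "L2lim {0..1} (\<lambda>n s. \<psi> n (linepath a b s)) (\<lambda>s. t (linepath a b s))"
    using t unfolding edge_trace_iff by blast
  have w: "w \<in> Hs 1 E" and tL: "(\<lambda>s. t (linepath a b s)) \<in> L2 {0..1}" using t by (auto simp: edge_trace_def)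
  note K = bulk_L2[OF \<alpha>(1) smooth1_wt] bulk_L2[OF \<alpha>(1) smooth1_deriv[OF smooth1_wt]]
  have aL: "\<alpha> \<in> L2 {0..1}" by (rule continuous_L2[OF smooth1_continuous[OF \<alpha>(1)]]) auto
  note L = smooth_L2[OF \<psi>(1) bd meas] smooth_L2[OF smooth_pd(1)[OF \<psi>(1)] bd meas] smooth_L2[OF smooth_pd(2)[OF \<psi>(1)] bd meas]
  have wL: "wD E 1 0 w \<in> L2 E" "wD E 0 1 w \<in> L2 E" using Hs_wD_L2[OF w] by auto
  have c: "L2lim E \<psi> w" "L2lim E (\<lambda>n. pdx (\<psi> n)) (wD E 1 0 w)"
    "L2lim E (\<lambda>n. pdy (\<psi> n)) (wD E 0 1 w)" using \<psi>(2) by (auto simp: H1conv_def)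
  have 1: "(\<lambda>n. G \<alpha> (\<psi> n) (pdx (\<psi> n)) (pdy (\<psi> n))) \<longlonglongrightarrow> G \<alpha> w (wD E 1 0 w) (wD E 0 1 w)"
    unfolding G_def
    by (intro tendsto_intros l2_conv_ip[OF L(1) Hs_L2[OF w] K(2) c(1)] l2_conv_ip[OF L(2) wL(1) K(1) c(2)] l2_conv_ip[OF L(3) wL(2) K(1) c(3)])
  have 2: "(\<lambda>n. - \<bar>D\<bar> * wt 0 * l2ip {0..1} (\<lambda>s. \<psi> n (linepath a b s)) \<alpha>) \<longlonglongrightarrow> - \<bar>D\<bar> * wt 0 * l2ip {0..1} (\<lambda>s. t (linepath a b s)) \<alpha>"
    by (intro tendsto_intros l2_conv_ip[OF smooth_line_L2[OF \<psi>(1)] tL aL \<psi>(3)])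
  have 3: "(\<lambda>n. G \<alpha> (\<psi> n) (pdx (\<psi> n)) (pdy (\<psi> n))) = (\<lambda>n. - \<bar>D\<bar> * wt 0 * l2ip {0..1} (\<lambda>s. \<psi> n (linepath a b s)) \<alpha>)"
    by (rule ext, rule green_smooth[OF \<alpha> \<psi>(1)])
  show ?thesis by (rule LIMSEQ_unique[OF 1[unfolded 3] 2])
qed

lemma trace_ip_unique:
  assumes \<alpha>: "smooth1 \<alpha>" "\<And>s. s \<notin> {s0<..<s1} ==> \<alpha> s = 0" and t: "edge_trace E a b w t" "edge_trace E a b w t'"
  shows "l2ip {0..1} (\<lambda>s. t (linepath a b s)) \<alpha> = l2ip {0..1} (\<lambda>s. t' (linepath a b s)) \<alpha>"
  using green_trace[OF \<alpha> t(1)] green_trace[OF \<alpha> t(2)] D wt0_pos by simp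

end

text \<open>One-variable fundamental lemma with a pointwise conclusion. Test functions are compactly
  supported in the open interval from s0 to s1, where collar formulas hold. If g s were nonzero, a
  positive test function living where g keeps its sign would have a nonzero pairing.\<close>

lemma continuous_zero_of_weak:
  fixes g :: "real => real"
  assumes g: "continuous_on {0..1} g" and s: "0 \<le> s0" "s0 < s" "s < s1" "s1 \<le> 1"
    and z: "\<And>\<alpha> u v. smooth1 \<alpha> ==> s0 < u ==> v < s1 ==> (\<And>x. x \<notin> {u..v} ==> \<alpha> x = 0) ==> l2ip {0..1} g \<alpha> = 0"
  shows "g s = 0"
proof (rule ccontr)
  assume nz: "g s \<noteq> 0"
  have "s \<in> {0..1}" using s by auto
  then obtain e where e: "0 < e" "\<And>x. x \<in> {0..1} ==> dist x s < e ==> dist (g x) (g s) < \<bar>g s\<bar>"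
    using g[unfolded continuous_on_iff, rule_format, of s "\<bar>g s\<bar>"] nz by auto
  define u where "u = max ((s0 + s) / 2) (s - e)"
  define v where "v = min ((s1 + s) / 2) (s + e)"
  have uv: "s0 < u" "u < s" "s < v" "v < s1" "s - e \<le> u" "v \<le> s + e" using s e(1) by (auto simp: u_def v_def less_max_iff_disj min_less_iff_disj field_simps)
  define \<alpha> where "\<alpha> x = expi (x - u) * expi (v - x)" for x
  have sa: "smooth1 \<alpha>" unfolding \<alpha>_def[abs_def]
    using smooth1_mult[OF smooth1_affine[OF smooth1_expi, of 1 "-u"] smooth1_affine[OF smooth1_expi, of "-1" v]] by simp
  have a0: "\<alpha> x = 0" if "x \<notin> {u<..<v}" for x using that by (auto simp: \<alpha>_def expi_def)
  have ap: "0 < \<alpha> x" if "x \<in> {u<..<v}" for x using that by (auto simp: \<alpha>_def expi_def)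
  \<comment> \<open>The factor g s makes the integrand nonnegative irrespective of the sign of
    g.\<close>
  define h where "h x = g s * (g x * \<alpha> x)" for x
  have hp: "0 < h x" if x: "x \<in> {u<..<v}" for x
  proof -
    have "dist (g x) (g s) < \<bar>g s\<bar>" using x uv s by (intro e(2)) (auto simp: dist_real_def)
    then have "0 < g s * g x" by (cases "g s > 0") (auto simp: dist_real_def abs_real_def zero_less_mult_iff split: if_splits)
    then have "0 < (g s * g x) * \<alpha> x" using ap[OF x] by simp
    then show ?thesis by (simp add: h_def mult.assoc)
  qed
  have h0: "0 \<le> h x" for x using hp[of x] a0[of x] by (cases "x \<in> {u<..<v}") (auto simp: h_def)
  have hc: "continuous_on {0..1} h" unfolding h_def by (intro continuous_intros g smooth1_continuous sa)
  have hi: "integrable (lebesgue_on {0..1}) h" by (rule continuous_imp_integrable_real[OF hc])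
  have "l2ip {0..1} g \<alpha> = 0" by (rule z[OF sa uv(1,4)]) (use a0 in auto)
  then have "integral\<^sup>L (lebesgue_on {0..1}) h = 0" by (simp add: h_def[abs_def] l2ip_def)
  then have "AE x in lebesgue_on {0..1}. h x = 0"
    using integral_nonneg_eq_0_iff_AE[OF hi] h0 by simp
  then have "AE x in lebesgue. x \<notin> {u<..<v}"
    unfolding AE_restrict_space_iff[of "{0..1::real}" lebesgue, simplified]
  proof eventually_elim
    case (elim x)
    then show ?case using hp[of x] uv s by force
  qed
  then have "{u<..<v} \<in> null_sets lebesgue" by (subst AE_iff_null_sets) auto
  then have "negligible {u<..<v}" by (simp add: negligible_iff_null_sets)
  then show False using open_not_negligible[of "{u<..<v}"] uv by force
qed

text \<open>A collar gives information only on a short interval to the right of its starting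
  parameter. Since every s0 below 1 may start one, continuity yields g s0 = 0 there, and finally g 1
  = 0.\<close>

lemma zero_on_unit_interval:
  fixes g :: "real => real"
  assumes g: "continuous_on {0..1} g"
    and z: "\<And>s0. 0 \<le> s0 ==> s0 < 1 ==> \<exists>s1. s0 < s1 \<and> s1 \<le> 1 \<and> (\<forall>s. s0 < s --> s < s1 --> g s = 0)"
    and s: "s \<in> {0..1}"
  shows "g s = 0"
proof -
  have *: "g x = 0" if x: "0 \<le> x" "x < 1" for x
  proof -
    obtain s1 where s1: "x < s1" "s1 \<le> 1" "\<And>s. x < s ==> s < s1 ==> g s = 0" using z[OF x] by blast
    have cl: "closure {x<..<s1} = {x..s1}" using s1 by simp
    show ?thesis
    proof (rule continuous_constant_on_closure[of "{x<..<s1}" g 0])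
      show "continuous_on (closure {x<..<s1}) g" unfolding cl by (rule continuous_on_subset[OF g]) (use x s1 in auto)
      show "g y = 0" if "y \<in> {x<..<s1}" for y using that by (intro s1(3)) auto
      show "x \<in> closure {x<..<s1}" unfolding cl using s1 by simp
    qed
  qed
  have cl: "closure {0..<1} = {0..1::real}" by simp
  show ?thesis
  proof (rule continuous_constant_on_closure[of "{0..<1}" g 0])
    show "continuous_on (closure {0..<1}) g" unfolding cl by (rule g)
    show "g x = 0" if "x \<in> {0..<1}" for x using that by (intro *) auto
    show "s \<in> closure {0..<1}" unfolding cl by (rule s)
  qed
qed

lemma smooth_line: "smooth f ==> smooth1 (\<lambda>s. f (linepath a b s))"
proof -
  assume f: "smooth f"
  have "linepath a b s = ((fst b - fst a) * s + fst a, (snd b - snd a) * s + snd a)" for s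
    by (simp add: linepath_def prod_eq_iff algebra_simps)
  then show ?thesis unfolding smooth1_def
    using smooth_affine[OF f, of "fst b - fst a" 0 "fst a" "snd b - snd a" 0 "snd a"] by simp
qed

lemma edge_trace_eq_on:
  assumes "edge_trace E a b w t" "\<And>s. s \<in> {0..1} ==> t (linepath a b s) = t' (linepath a b s)"
  shows "edge_trace E a b w t'"
proof -
  have ae: "AE s in lebesgue_on {0..1}. t (linepath a b s) = t' (linepath a b s)"
    using assms(2) by (intro AE_I2) auto
  have L: "(\<lambda>s. t (linepath a b s)) \<in> L2 {0..1}" using assms(1) by (simp add: edge_trace_def)
  have L': "(\<lambda>s. t' (linepath a b s)) \<in> L2 {0..1}" by (rule L2_cong_AE[OF _ L ae]) simp
  have "l2norm {0..1} (\<lambda>s. \<psi> (linepath a b s) - t (linepath a b s)) = l2norm {0..1} (\<lambda>s. \<psi> (linepath a b s) - t' (linepath a b s))" for \<psi>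
    unfolding l2norm_def l2ip_def using assms(2)
    by (intro arg_cong[where f = sqrt] Bochner_Integration.integral_cong) auto
  then show ?thesis using assms(1) L' unfolding edge_trace_def by simp
qed

context collar_domain
begin

lemma trace_unique:
  assumes t: "edge_trace E a b w t" "edge_trace E a b w t'"
    and c: "continuous_on {0..1} (\<lambda>s. t (linepath a b s))" "continuous_on {0..1} (\<lambda>s. t' (linepath a b s))"
    and s: "s0 < s" "s < s1"
  shows "t (linepath a b s) = t' (linepath a b s)"
proof -
  have tL: "(\<lambda>s. t (linepath a b s)) \<in> L2 {0..1}" "(\<lambda>s. t' (linepath a b s)) \<in> L2 {0..1}" using t by (auto simp: edge_trace_def)
  have "t (linepath a b s) - t' (linepath a b s) = 0"
  proof (rule continuous_zero_of_weak[of "\<lambda>s. t (linepath a b s) - t' (linepath a b s)"])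
    show "continuous_on {0..1} (\<lambda>s. t (linepath a b s) - t' (linepath a b s))" by (intro continuous_intros c)
    show "0 \<le> s0" "s0 < s" "s < s1" "s1 \<le> 1" using s01 s by auto
    fix \<alpha> u v assume \<alpha>: "smooth1 \<alpha>" "s0 < u" "v < s1" "\<And>x. x \<notin> {u..v} ==> \<alpha> x = 0"
    have aL: "\<alpha> \<in> L2 {0..1}" by (rule continuous_L2[OF smooth1_continuous[OF \<alpha>(1)]]) auto
    have "\<alpha> x = 0" if "x \<notin> {s0<..<s1}" for x using that \<alpha>(2,3) by (intro \<alpha>(4)) auto
    from trace_ip_unique[OF \<alpha>(1) this t]
    show "l2ip {0..1} (\<lambda>s. t (linepath a b s) - t' (linepath a b s)) \<alpha> = 0"
      using lin_on_diff[OF L2.lin_on_left[OF aL] tL] by simp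
  qed
  then show ?thesis by simp
qed

subsection \<open>The tangential derivative of a trace\<close>

text \<open>Integration by parts in the direction of the edge produces no boundary term, since
  \<eta> is constant along b - a. The sharply cut function is not a test function, so it is
  multiplied by \<open>cutoff (Suc m)\<close> of \<eta> and m tends to infinity; the cutoff is not
  affected by the tangential derivative.\<close>

lemma bulk_by_parts:
  assumes \<alpha>: "smooth1 \<alpha>" "s0 < u'" "v' < s1" "\<And>x. x \<notin> {u'..v'} ==> \<alpha> x = 0"
    and \<gamma>: "smooth1 \<gamma>" "\<And>\<tau>. 1/2 < \<tau> ==> \<gamma> \<tau> = 0" and u: "u \<in> Hs 1 E"
  shows "l2ip E u (bulk (deriv \<alpha>) \<gamma>) = - (fst (b - a) * l2ip E (wD E 1 0 u) (bulk \<alpha> \<gamma>) + snd (b - a) * l2ip E (wD E 0 1 u) (bulk \<alpha> \<gamma>))"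
proof -
  let ?c = "\<lambda>m x. cutoff (Suc m) (eta x)"
  have cb: "(\<lambda>x. ?c m x * bulk \<beta> \<gamma> x) = (\<lambda>x. \<beta> (xi x) * (\<gamma> (eta x) * ?c m x))" for \<beta> m
  proof
    fix x show "?c m x * bulk \<beta> \<gamma> x = \<beta> (xi x) * (\<gamma> (eta x) * ?c m x)"
    proof (cases "0 < eta x")
      case True then show ?thesis by (simp add: bulk_def indicator_def)
    next
      case False
      moreover have "0 \<le> 1 / real (Suc m)" by simp
      ultimately have "eta x \<le> 1 / real (Suc m)" by linarith
      then show ?thesis by (simp add: cutoff_eq_0)
    qed
  qed
  have lim: "(\<lambda>m. l2ip E v (\<lambda>x. ?c m x * bulk \<beta> \<gamma> x)) \<longlonglongrightarrow> l2ip E v (bulk \<beta> \<gamma>)" if "smooth1 \<beta>" "v \<in> L2 E" for \<beta> v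
    unfolding l2ip_def
  proof (rule integral_dominated_convergence[where w = "\<lambda>x. \<bar>v x * bulk \<beta> \<gamma> x\<bar>"])
    have B: "bulk \<beta> \<gamma> \<in> L2 E" by (rule bulk_L2[OF that(1) \<gamma>(1)])
    show "(\<lambda>x. v x * bulk \<beta> \<gamma> x) \<in> borel_measurable (lebesgue_on E)"
      by (intro borel_measurable_times L2_measurable that B)
    show "(\<lambda>x. v x * (?c m x * bulk \<beta> \<gamma> x)) \<in> borel_measurable (lebesgue_on E)" for m
      by (intro borel_measurable_times L2_measurable that B smooth_L2[OF smooth_eta[OF smooth1_cutoff] bd meas])
    show "integrable (lebesgue_on E) (\<lambda>x. \<bar>v x * bulk \<beta> \<gamma> x\<bar>)" using L2_mult[OF that(2) B] by simp
    show "AE x in lebesgue_on E. (\<lambda>m. v x * (?c m x * bulk \<beta> \<gamma> x)) \<longlonglongrightarrow> v x * bulk \<beta> \<gamma> x"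
    proof (rule AE_I2)
      fix x
      show "(\<lambda>m. v x * (?c m x * bulk \<beta> \<gamma> x)) \<longlonglongrightarrow> v x * bulk \<beta> \<gamma> x"
      proof (cases "0 < eta x")
        case True
        have "(\<lambda>m. v x * (?c m x * bulk \<beta> \<gamma> x)) \<longlonglongrightarrow> v x * (1 * bulk \<beta> \<gamma> x)"
          by (intro tendsto_intros LIMSEQ_Suc[OF cutoff_tendsto[OF True]])
        then show ?thesis by simp
      next
        case False then show ?thesis by (simp add: bulk_def)
      qed
    qed
    show "AE x in lebesgue_on E. norm (v x * (?c m x * bulk \<beta> \<gamma> x)) \<le> \<bar>v x * bulk \<beta> \<gamma> x\<bar>" for m
    proof (rule AE_I2)
      fix x
      have "\<bar>?c m x\<bar> * \<bar>v x * bulk \<beta> \<gamma> x\<bar> \<le> 1 * \<bar>v x * bulk \<beta> \<gamma> x\<bar>"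
        using cutoff_bounds[of "Suc m" "eta x"] by (intro mult_right_mono) auto
      then show "norm (v x * (?c m x * bulk \<beta> \<gamma> x)) \<le> \<bar>v x * bulk \<beta> \<gamma> x\<bar>" by (simp add: abs_mult mult.left_commute mult.assoc)
    qed
  qed
  have eq: "l2ip E u (\<lambda>x. ?c m x * bulk (deriv \<alpha>) \<gamma> x) =
     - (fst (b - a) * l2ip E (wD E 1 0 u) (\<lambda>x. ?c m x * bulk \<alpha> \<gamma> x) + snd (b - a) * l2ip E (wD E 0 1 u) (\<lambda>x. ?c m x * bulk \<alpha> \<gamma> x))" for m
  proof -
    let ?g = "\<lambda>\<tau>. \<gamma> \<tau> * cutoff (Suc m) \<tau>"
    have sg: "smooth1 ?g" by (rule smooth1_mult[OF \<gamma>(1) smooth1_cutoff])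
    let ?\<zeta> = "\<lambda>x. \<alpha> (xi x) * ?g (eta x)"
    have s\<zeta>: "smooth ?\<zeta>" by (rule smooth_mult[OF smooth_xi[OF \<alpha>(1)] smooth_eta[OF sg]])
    have t\<zeta>: "?\<zeta> \<in> test_fun E"
    proof (rule test_funI[OF s\<zeta>])
      let ?K = "(\<lambda>z. a + fst z *\<^sub>R (b - a) + snd z *\<^sub>R d) ` ({u'..v'} \<times> {1 / real (Suc m)..1/2})"
      show "compact ?K" by (intro compact_continuous_image continuous_intros compact_Times) auto
      show "?\<zeta> x = 0" if "x \<notin> ?K" for x
      proof (rule ccontr)
        assume "?\<zeta> x \<noteq> 0"
        then have "\<alpha> (xi x) \<noteq> 0" "\<gamma> (eta x) \<noteq> 0" "cutoff (Suc m) (eta x) \<noteq> 0" by auto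
        then have "xi x \<in> {u'..v'}" "eta x \<in> {1 / real (Suc m)..1/2}"
          using \<alpha>(4)[of "xi x"] \<gamma>(2)[of "eta x"] cutoff_eq_0[of "eta x" "Suc m"] by force+
        then have "x \<in> ?K" using lin_xi_eta[of x] by (intro image_eqI[of _ _ "(xi x, eta x)"]) auto
        then show False using that by simp
      qed
      show "?K \<subseteq> E"
      proof
        fix x assume "x \<in> ?K"
        then obtain z where z: "z \<in> {u'..v'} \<times> {1 / real (Suc m)..1/2}" "x = a + fst z *\<^sub>R (b - a) + snd z *\<^sub>R d" by blast
        have pm: "0 < 1 / real (Suc m)" by simp
        have "0 < snd z" using z(1) by (cases z) (auto intro: less_le_trans[OF pm] simp del: of_nat_Suc)
        then show "x \<in> E" using z \<alpha>(2,3) by (intro in_collar) (auto simp: xi_lin eta_lin)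
      qed
    qed
    have dif: "(\<lambda>x. \<alpha> (xi x)) differentiable (at x)" "(\<lambda>x. ?g (eta x)) differentiable (at x)" for x
      using smooth_xi[OF \<alpha>(1)] smooth_eta[OF sg] by (auto intro: smooth_differentiable)
    note rx = pd_ridge[OF \<alpha>(1), of "snd d / D" "- fst d / D" "- det2 a d / D", folded xi_def]
    note re = pd_ridge[OF sg, of "- snd (b - a) / D" "fst (b - a) / D" "- det2 (b - a) a / D", folded eta_def]
    \<comment> \<open>The contributions of \<eta> cancel because the gradient of \<open>eta\<close>
      is orthogonal to b - a, and the derivative of \<open>xi\<close> along b - a is 1.\<close>
    have de: "fst (b - a) * pdx ?\<zeta> x + snd (b - a) * pdy ?\<zeta> x = deriv \<alpha> (xi x) * ?g (eta x)" for x
    proof -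
      have "fst (b - a) * (snd d / D) + snd (b - a) * (- fst d / D) = 1"
      proof -
        have "fst (b - a) * (snd d / D) + snd (b - a) * (- fst d / D) = (fst (b - a) * snd d - snd (b - a) * fst d) / D"
          by (simp add: diff_divide_distrib)
        also have "fst (b - a) * snd d - snd (b - a) * fst d = D" by (simp add: D_def det2_def)
        finally show ?thesis using D by simp
      qed
      moreover have "fst (b - a) * pdx ?\<zeta> x + snd (b - a) * pdy ?\<zeta> x =
        (fst (b - a) * (snd d / D) + snd (b - a) * (- fst d / D)) * (deriv \<alpha> (xi x) * ?g (eta x))"
      proof -
        have "e1 * ((x1 * A) * B + A' * ((- e2 / D) * C)) + e2 * ((x2 * A) * B + A' * ((e1 / D) * C)) = (e1 * x1 + e2 * x2) * (A * B)"
          for e1 e2 x1 x2 A A' B C :: real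
          by (simp add: algebra_simps)
        then show ?thesis unfolding pdx_mult[OF dif] pdy_mult[OF dif] rx re .
      qed
      ultimately show ?thesis by simp
    qed
    have uL: "u \<in> L2 E" by (rule Hs_L2[OF u])
    have tL: "pdx ?\<zeta> \<in> L2 E" "pdy ?\<zeta> \<in> L2 E" using test_fun_pd[OF t\<zeta>] test_fun_L2 meas by blast+
    have "l2ip E u (\<lambda>x. ?c m x * bulk (deriv \<alpha>) \<gamma> x) = l2ip E u (\<lambda>x. fst (b - a) * pdx ?\<zeta> x + snd (b - a) * pdy ?\<zeta> x)"
      unfolding cb de ..
    also have "\<dots> = fst (b - a) * l2ip E u (pdx ?\<zeta>) + snd (b - a) * l2ip E u (pdy ?\<zeta>)"
      by (rule L2.lin_right[OF tL uL])
    also have "\<dots> = - (fst (b - a) * l2ip E (wD E 1 0 u) ?\<zeta> + snd (b - a) * l2ip E (wD E 0 1 u) ?\<zeta>)"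
      using is_wderivD[OF Hs_wD[OF u, of 1 0] t\<zeta>] is_wderivD[OF Hs_wD[OF u, of 0 1] t\<zeta>] by (simp add: cD_simps)
    finally show ?thesis unfolding cb .
  qed
  have 1: "(\<lambda>m. l2ip E u (\<lambda>x. ?c m x * bulk (deriv \<alpha>) \<gamma> x)) \<longlonglongrightarrow> l2ip E u (bulk (deriv \<alpha>) \<gamma>)"
    by (rule lim[OF smooth1_deriv[OF \<alpha>(1)] Hs_L2[OF u]])
  have 2: "(\<lambda>m. l2ip E u (\<lambda>x. ?c m x * bulk (deriv \<alpha>) \<gamma> x)) \<longlonglongrightarrow>
     - (fst (b - a) * l2ip E (wD E 1 0 u) (bulk \<alpha> \<gamma>) + snd (b - a) * l2ip E (wD E 0 1 u) (bulk \<alpha> \<gamma>))"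
    unfolding eq by (intro tendsto_intros lim[OF \<alpha>(1)] Hs_wD_L2[OF u]) auto
  show ?thesis using LIMSEQ_unique[OF 1 2] .
qed


text \<open>Taking traces commutes with differentiating along the edge. Green's formula for w with
  weight \<alpha>' is integrated by parts tangentially inside the collar; the result regroups into
  Green's formulas for the two components of the gradient with weight \<alpha>.\<close>

lemma tangential_trace:
  assumes w: "w \<in> Hs 2 E" and p: "smooth p" and t: "edge_trace E a b w p"
    and g: "edge_trace E a b (wD E 1 0 w) gx" "edge_trace E a b (wD E 0 1 w) gy"
    and c: "continuous_on {0..1} (\<lambda>s. gx (linepath a b s))" "continuous_on {0..1} (\<lambda>s. gy (linepath a b s))"
    and s: "s0 < s" "s < s1"
  shows "fst (b - a) * gx (linepath a b s) + snd (b - a) * gy (linepath a b s)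
    = fst (b - a) * pdx p (linepath a b s) + snd (b - a) * pdy p (linepath a b s)"
proof -
  let ?e1 = "fst (b - a)" and ?e2 = "snd (b - a)" and ?l = "linepath a b"
  let ?f = "\<lambda>s. p (?l s)" and ?f' = "\<lambda>s. ?e1 * pdx p (?l s) + ?e2 * pdy p (?l s)"
  have fd: "(?f has_real_derivative ?f' s) (at s)" for s
  proof -
    have ld: "(?l has_derivative (\<lambda>h. h *\<^sub>R (b - a))) (at s)"
      unfolding linepath_lin by (auto intro!: derivative_eq_intros)
    have "(?f has_derivative (\<lambda>h. pdx p (?l s) * fst (h *\<^sub>R (b - a)) + pdy p (?l s) * snd (h *\<^sub>R (b - a)))) (at s)"
      using has_derivative_compose[OF ld smooth_has_derivative[OF p]] by simp
    moreover have "(\<lambda>h. pdx p (?l s) * fst (h *\<^sub>R (b - a)) + pdy p (?l s) * snd (h *\<^sub>R (b - a))) = (*) (?f' s)"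
      by (auto simp: algebra_simps)
    ultimately show ?thesis by (simp add: has_field_derivative_def)
  qed
  have gL: "(\<lambda>s. gx (?l s)) \<in> L2 {0..1}" "(\<lambda>s. gy (?l s)) \<in> L2 {0..1}" using g by (auto simp: edge_trace_def)
  have f'L: "?f' \<in> L2 {0..1}" by (intro L2.comb smooth_line_L2 smooth_pd p)
  have f'c: "continuous_on S ?f'" for S by (intro continuous_intros smooth1_continuous smooth_line smooth_pd p)
  let ?g = "\<lambda>s. ?e1 * gx (?l s) + ?e2 * gy (?l s)"
  have gcL: "?g \<in> L2 {0..1}" by (intro L2.comb gL)
  have "?g s - ?f' s = 0"
  proof (rule continuous_zero_of_weak[of "\<lambda>s. ?g s - ?f' s"])
    show "continuous_on {0..1} (\<lambda>s. ?g s - ?f' s)" by (intro continuous_intros c f'c)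
    show "0 \<le> s0" "s0 < s" "s < s1" "s1 \<le> 1" using s01 s by auto
    fix \<alpha> u v assume \<alpha>: "smooth1 \<alpha>" "s0 < u" "v < s1" "\<And>x. x \<notin> {u..v} ==> \<alpha> x = 0"
    have \<alpha>0: "\<alpha> x = 0" if "x \<notin> {s0<..<s1}" for x using that \<alpha>(2,3) by (intro \<alpha>(4)) auto
    have d\<alpha>0: "deriv \<alpha> x = 0" if "x \<notin> {s0<..<s1}" for x
      by (rule deriv_eq_0_outside[of "{u..v}"]) (use \<alpha> that in auto)
    have aL: "\<alpha> \<in> L2 {0..1}" "deriv \<alpha> \<in> L2 {0..1}"
      by (rule continuous_L2[OF smooth1_continuous]; simp add: \<alpha> smooth1_deriv)+
    have parts: "l2ip {0..1} ?f' \<alpha> = - l2ip {0..1} ?f (deriv \<alpha>)"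
    proof -
      let ?F = "\<lambda>s. ?f s * \<alpha> s" and ?F' = "\<lambda>s. ?f' s * \<alpha> s + ?f s * deriv \<alpha> s"
      have d: "(?F has_real_derivative ?F' s) (at s)" for s
        using DERIV_mult[OF fd smooth1_DERIV[OF \<alpha>(1)], of s] by (simp add: algebra_simps)
      have Fc: "continuous_on {0..1} ?F'"
        by (intro continuous_intros f'c smooth1_continuous \<alpha> smooth1_deriv smooth_line smooth_pd p)
      have "(?F' has_integral (?F 1 - ?F 0)) {0..1}"
        by (rule fundamental_theorem_of_calculus)
          (use has_field_derivative_at_within[OF d] in \<open>auto simp: has_real_derivative_iff_has_vector_derivative[symmetric]\<close>)
      moreover have "?F 1 = 0" "?F 0 = 0" using s01 \<alpha>0[of 0] \<alpha>0[of 1] by auto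
      ultimately have "integral {0..1} ?F' = 0" by (simp add: integral_unique)
      moreover have "integral\<^sup>L (lebesgue_on {0..1}) ?F' = integral {0..1} ?F'"
        by (rule lebesgue_integral_eq_integral[OF continuous_imp_integrable_real[OF Fc]]) simp
      ultimately have "integral\<^sup>L (lebesgue_on {0..1}) ?F' = 0" by simp
      moreover have "integral\<^sup>L (lebesgue_on {0..1}) ?F' = l2ip {0..1} ?f' \<alpha> + l2ip {0..1} ?f (deriv \<alpha>)"
        unfolding l2ip_def by (rule Bochner_Integration.integral_add[OF L2_mult[OF f'L aL(1)] L2_mult[OF smooth_line_L2[OF p] aL(2)]])
      ultimately show ?thesis by simp
    qed
    note K = bulk_L2[OF \<alpha>(1) smooth1_wt] bulk_L2[OF \<alpha>(1) smooth1_deriv[OF smooth1_wt]]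
    have w1: "w \<in> Hs 1 E" by (rule Hs_mono[OF _ w]) simp
    note H1 = Hs1_wD[OF op w] and cp = is_wderiv_compose[OF op w]
    have rep: "l2ip E (wD E i j v) k = l2ip E v' k" if "is_wderiv E i j v v'" "k \<in> L2 E" for i j v v' k
      by (intro l2ip_cong_AE L2_measurable that is_wderiv_L2[OF that(1)] is_wderiv_L2[OF wD_is_wderiv[OF that(1)]] wD_AE[OF op that(1)])
    \<comment> \<open>X, Y, Z pair the three second derivatives with \<open>wt\<close>, and x', y'
      pair the first derivatives with its derivative. The mixed term Y occurs in both gradient
      formulas, which makes the regrouping work.\<close>
    define X where "X = l2ip E (wD E 2 0 w) (bulk \<alpha> wt)"
    define Y where "Y = l2ip E (wD E 1 1 w) (bulk \<alpha> wt)"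
    define Z where "Z = l2ip E (wD E 0 2 w) (bulk \<alpha> wt)"
    define x' where "x' = l2ip E (wD E 1 0 w) (bulk \<alpha> (deriv wt))"
    define y' where "y' = l2ip E (wD E 0 1 w) (bulk \<alpha> (deriv wt))"
    have gx: "fst d * X + snd d * Y + x' = - \<bar>D\<bar> * wt 0 * l2ip {0..1} (\<lambda>s. gx (?l s)) \<alpha>"
      using green_trace[OF \<alpha>(1) \<alpha>0 g(1)] rep[OF cp(1) K(1)] rep[OF cp(2) K(1)] by (simp add: G_def X_def Y_def x'_def)
    have gy: "fst d * Y + snd d * Z + y' = - \<bar>D\<bar> * wt 0 * l2ip {0..1} (\<lambda>s. gy (?l s)) \<alpha>"
      using green_trace[OF \<alpha>(1) \<alpha>0 g(2)] rep[OF cp(3) K(1)] rep[OF cp(4) K(1)] by (simp add: G_def Z_def Y_def y'_def)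
    note bp = bulk_by_parts[OF \<alpha> smooth1_wt _ H1(1)] bulk_by_parts[OF \<alpha> smooth1_wt _ H1(2)] bulk_by_parts[OF \<alpha> smooth1_deriv[OF smooth1_wt] deriv_wt_eq_0 w1]
    have b1: "l2ip E (wD E 1 0 w) (bulk (deriv \<alpha>) wt) = - (?e1 * X + ?e2 * Y)"
      using bulk_by_parts[OF \<alpha> smooth1_wt wt_eq_0[OF less_imp_le] H1(1)] rep[OF cp(1) K(1)] rep[OF cp(2) K(1)] by (simp add: X_def Y_def)
    have b2: "l2ip E (wD E 0 1 w) (bulk (deriv \<alpha>) wt) = - (?e1 * Y + ?e2 * Z)"
      using bulk_by_parts[OF \<alpha> smooth1_wt wt_eq_0[OF less_imp_le] H1(2)] rep[OF cp(3) K(1)] rep[OF cp(4) K(1)] by (simp add: Z_def Y_def)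
    have b3: "l2ip E w (bulk (deriv \<alpha>) (deriv wt)) = - (?e1 * x' + ?e2 * y')"
      using bulk_by_parts[OF \<alpha> smooth1_deriv[OF smooth1_wt] deriv_wt_eq_0 w1] by (simp add: x'_def y'_def)
    \<comment> \<open>Reads the double sum once by columns (tangential parts) and next by rows (the
      Green formulas \<open>gx\<close> and \<open>gy\<close>).\<close>
    have "- \<bar>D\<bar> * wt 0 * l2ip {0..1} ?f (deriv \<alpha>) = - (fst d * (?e1 * X + ?e2 * Y) + snd d * (?e1 * Y + ?e2 * Z) + (?e1 * x' + ?e2 * y'))"
      using green_trace[OF smooth1_deriv[OF \<alpha>(1)] d\<alpha>0 t] unfolding G_def b1 b2 b3 by (simp add: algebra_simps)
    also have "\<dots> = - (?e1 * (fst d * X + snd d * Y + x') + ?e2 * (fst d * Y + snd d * Z + y'))" by (simp add: algebra_simps)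
    also have "\<dots> = \<bar>D\<bar> * wt 0 * (?e1 * l2ip {0..1} (\<lambda>s. gx (?l s)) \<alpha> + ?e2 * l2ip {0..1} (\<lambda>s. gy (?l s)) \<alpha>)"
      unfolding gx gy by (simp add: algebra_simps)
    also have "?e1 * l2ip {0..1} (\<lambda>s. gx (?l s)) \<alpha> + ?e2 * l2ip {0..1} (\<lambda>s. gy (?l s)) \<alpha> = l2ip {0..1} ?g \<alpha>"
      by (rule L2.lin[OF gL aL(1), symmetric])
    finally have "\<bar>D\<bar> * wt 0 * l2ip {0..1} ?f' \<alpha> = \<bar>D\<bar> * wt 0 * l2ip {0..1} ?g \<alpha>" unfolding parts by simp
    then have "l2ip {0..1} ?f' \<alpha> = l2ip {0..1} ?g \<alpha>" using D wt0_pos by simp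
    then show "l2ip {0..1} (\<lambda>s. ?g s - ?f' s) \<alpha> = 0"
      using lin_on_diff[OF L2.lin_on_left[OF aL(1)] gcL f'L] by simp
  qed
  then show ?thesis by simp
qed

subsection \<open>Limits of polynomial traces\<close>

text \<open>Smooth weight that is positive exactly on the open collar interval; a polynomial times
  \<open>chi\<close> is admissible as the edge factor in Green's formula.\<close>

definition chi :: "real => real" where
  "chi s = expi (s - s0) * expi (s1 - s)"

lemma smooth1_chi: "smooth1 chi"
  unfolding chi_def[abs_def]
  using smooth1_mult[OF smooth1_affine[OF smooth1_expi, of 1 "-s0"] smooth1_affine[OF smooth1_expi, of "-1" s1]] by simp

lemma chi_outside: "s \<notin> {s0<..<s1} ==> chi s = 0"
  by (auto simp: chi_def expi_def)

lemma chi_nonneg: "0 \<le> chi s" and chi_pos: "s0 < s ==> s < s1 ==> 0 < chi s"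
  by (auto simp: chi_def expi_def)

text \<open>Weighted L^2 product along the edge. Its values on traces are computable from the
  volume, and it detects polynomials on the whole line through the edge although the weight lives on
  a part of it.\<close>

definition eform :: "fld => fld => real" where
  "eform p q = l2ip {0..1} (\<lambda>s. p (linepath a b s)) (\<lambda>s. q (linepath a b s) * chi s)"

lemma line_psd: "psd_form (Pk k) (\<lambda>p q. l2ip {0..1} (\<lambda>s. p (linepath a b s)) (\<lambda>s. q (linepath a b s)))"
proof
  note L = smooth_line_L2[OF Pk_smooth]
  fix u v w and r s :: real
  assume u: "u \<in> Pk k" and v: "v \<in> Pk k"
  show "l2ip {0..1} (\<lambda>s. u (linepath a b s)) (\<lambda>s. v (linepath a b s)) = l2ip {0..1} (\<lambda>s. v (linepath a b s)) (\<lambda>s. u (linepath a b s))"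
    by (rule L2.sym[OF L[OF u] L[OF v]])
  show "0 \<le> l2ip {0..1} (\<lambda>s. u (linepath a b s)) (\<lambda>s. u (linepath a b s))" by simp
  assume w: "w \<in> Pk k"
  show "l2ip {0..1} (\<lambda>x. r * u (linepath a b x) + s * v (linepath a b x)) (\<lambda>s. w (linepath a b s))
      = r * l2ip {0..1} (\<lambda>s. u (linepath a b s)) (\<lambda>s. w (linepath a b s)) + s * l2ip {0..1} (\<lambda>s. v (linepath a b s)) (\<lambda>s. w (linepath a b s))"
    by (rule L2.lin[OF L[OF u] L[OF v] L[OF w]])
qed

lemma smooth1_test: "q \<in> Pk k ==> smooth1 (\<lambda>s. q (linepath a b s) * chi s)"
  by (intro smooth1_mult smooth_line Pk_smooth smooth1_chi)

lemma test_L2: "q \<in> Pk k ==> (\<lambda>s. q (linepath a b s) * chi s) \<in> L2 {0..1}"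
  by (rule continuous_L2[OF smooth1_continuous[OF smooth1_test]]) auto

lemma eform_psd: "psd_form (Pk k) eform"
proof
  note L = smooth_line_L2[OF Pk_smooth]
  fix u v w and r s :: real
  assume u: "u \<in> Pk k" and v: "v \<in> Pk k"
  show "eform u v = eform v u" unfolding eform_def l2ip_def by (simp add: mult.commute mult.left_commute)
  show "0 \<le> eform u u" unfolding eform_def l2ip_def
    by (rule Bochner_Integration.integral_nonneg) (simp add: mult.assoc[symmetric] chi_nonneg)
  assume w: "w \<in> Pk k"
  show "eform (lc r u s v) w = r * eform u w + s * eform v w"
    unfolding eform_def by (rule L2.lin[OF L[OF u] L[OF v] test_L2[OF w]])
qed

lemma eform_null:
  assumes p: "p \<in> Pk k" and z: "eform p p = 0"
  shows "p (linepath a b s) = 0"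
proof -
  interpret e: psd_form "Pk k" eform by (rule eform_psd)
  let ?m = "(s0 + s1) / 2"
  have "p (linepath a b s) * (p (linepath a b s) * chi s) = 0" if s: "s0 < s" "s < s1" for s
  proof (rule continuous_zero_of_weak[of "\<lambda>s. p (linepath a b s) * (p (linepath a b s) * chi s)" s0 s s1])
    let ?h = "\<lambda>s. p (linepath a b s) * (p (linepath a b s) * chi s)"
    show c: "continuous_on {0..1} ?h" by (intro continuous_intros smooth1_continuous smooth_line Pk_smooth[OF p] smooth1_chi)
    show "0 \<le> s0" "s1 \<le> 1" "s0 < s" "s < s1" using s01 s by auto
    fix \<alpha> u v assume \<alpha>: "smooth1 \<alpha>"
    have "AE s in lebesgue_on {0..1}. ?h s = 0"
    proof (subst integral_nonneg_eq_0_iff_AE[symmetric])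
      show "integrable (lebesgue_on {0..1}) ?h" by (rule continuous_imp_integrable_real[OF c])
      show "AE s in lebesgue_on {0..1}. 0 \<le> ?h s" by (simp add: mult.assoc[symmetric] chi_nonneg)
      show "integral\<^sup>L (lebesgue_on {0..1}) ?h = 0" using z by (simp add: eform_def l2ip_def)
    qed
    then have "AE s in lebesgue_on {0..1}. ?h s * \<alpha> s = 0" by eventually_elim simp
    then show "l2ip {0..1} ?h \<alpha> = 0" unfolding l2ip_def by (intro integral_eq_zero_AE)
  qed
  then have "p (linepath a b s) = 0" if "s0 < s" "s < s1" for s using chi_pos[OF that] that by fastforce
  then show ?thesis by (rule Pk_zero_line[OF p s01(2)])
qed

text \<open>Green's formula turns H^1 convergence of \<open>w n\<close> into convergence of
  \<open>eform (p n) q\<close> for every polynomial q. The limit functional is represented by a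
  polynomial, and finite dimension upgrades this to L^2 convergence on the full edge, so the
  polynomial is the trace of the limit.\<close>

lemma edge_poly_limit:
  assumes w: "\<And>n. w n \<in> Hs 1 E" "w' \<in> Hs 1 E" and t: "\<And>n. edge_trace E a b (w n) (p n)" and p: "\<And>n. p n \<in> Pk k"
    and lim: "L2lim E w w'"
      "L2lim E (\<lambda>n. wD E 1 0 (w n)) (wD E 1 0 w')"
      "L2lim E (\<lambda>n. wD E 0 1 (w n)) (wD E 0 1 w')"
  shows "\<exists>q\<in>Pk k. edge_trace E a b w' q \<and> (\<forall>s. (\<lambda>n. p n (linepath a b s)) \<longlonglongrightarrow> q (linepath a b s))"
proof -
  interpret e: psd_form "Pk k" eform by (rule eform_psd)
  let ?H = "\<lambda>p q. l2ip {0..1} (\<lambda>s. p (linepath a b s)) (\<lambda>s. q (linepath a b s))"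
  interpret H: psd_form "Pk k" ?H by (rule line_psd)
  let ?\<alpha> = "\<lambda>q s. q (linepath a b s) * chi s"
  define c where "c = - \<bar>D\<bar> * wt 0"
  have c: "c \<noteq> 0" using D wt0_pos by (simp add: c_def)
  have \<alpha>0: "?\<alpha> q s = 0" if "s \<notin> {s0<..<s1}" for q s using chi_outside[OF that] by simp
  \<comment> \<open>The value that \<open>eform\<close> would give for the trace of w', read off
    from the volume before any polynomial trace of w' is known.\<close>
  define \<Lambda> where "\<Lambda> q = G (?\<alpha> q) w' (wD E 1 0 w') (wD E 0 1 w') / c" for q
  have conv: "(\<lambda>n. eform (p n) q) \<longlonglongrightarrow> \<Lambda> q" if q: "q \<in> Pk k" for q
  proof -
    note K = bulk_L2[OF smooth1_test[OF q] smooth1_wt] bulk_L2[OF smooth1_test[OF q] smooth1_deriv[OF smooth1_wt]]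
    have d: "wD E 1 0 (w n) \<in> L2 E" "wD E 0 1 (w n) \<in> L2 E" "wD E 1 0 w' \<in> L2 E" "wD E 0 1 w' \<in> L2 E" for n
      using Hs_wD_L2[OF w(1)] Hs_wD_L2[OF w(2)] by auto
    have "(\<lambda>n. G (?\<alpha> q) (w n) (wD E 1 0 (w n)) (wD E 0 1 (w n)) / c) \<longlonglongrightarrow> \<Lambda> q"
      unfolding \<Lambda>_def G_def
      by (intro tendsto_divide tendsto_add tendsto_mult tendsto_const c
          l2_conv_ip[OF Hs_L2[OF w(1)] Hs_L2[OF w(2)] K(2) lim(1)] l2_conv_ip[OF d(1,3) K(1) lim(2)] l2_conv_ip[OF d(2,4) K(1) lim(3)])
    moreover have "G (?\<alpha> q) (w n) (wD E 1 0 (w n)) (wD E 0 1 (w n)) / c = eform (p n) q" for n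
      using green_trace[of "?\<alpha> q", OF smooth1_test[OF q] \<alpha>0[where q = q] t[of n]] c by (simp add: eform_def c_def)
    ultimately show ?thesis by simp
  qed
  have "\<exists>q\<in>span_of (Pidx k) monom2. \<forall>r\<in>span_of (Pidx k) monom2. \<Lambda> r = eform q r"
  proof (rule span_riesz)
    show "psd_form (span_of (Pidx k) monom2) eform" using eform_psd[of k] by (simp add: Pk_span)
    show "lin_on (span_of (Pidx k) monom2) \<Lambda>" unfolding Pk_span[symmetric] lin_on_def
    proof (intro ballI allI)
      fix u v :: fld and r s :: real assume u: "u \<in> Pk k" and v: "v \<in> Pk k"
      have 1: "(\<lambda>n. eform (p n) (lc r u s v)) \<longlonglongrightarrow> \<Lambda> (lc r u s v)" by (rule conv[OF Pk.comb[OF u v]])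
      have 2: "(\<lambda>n. eform (p n) (lc r u s v)) \<longlonglongrightarrow> r * \<Lambda> u + s * \<Lambda> v"
        unfolding e.lin_right[OF u v p] by (intro tendsto_intros conv u v)
      show "\<Lambda> (lc r u s v) = r * \<Lambda> u + s * \<Lambda> v" by (rule LIMSEQ_unique[OF 1 2])
    qed
    \<comment> \<open>Null polynomials of \<open>eform\<close> pair to 0 with each
      \<open>p n\<close>, and this passes to the limit.\<close>
    show "\<Lambda> q = 0" if "q \<in> span_of (Pidx k) monom2" "eform q q = 0" for q
    proof -
      have q: "q \<in> Pk k" using that by (simp add: Pk_span)
      have "eform (p n) q = 0" for n using e.null_left[OF q p that(2)] e.sym[OF q p] by simp
      then show ?thesis using conv[OF q] by (simp add: LIMSEQ_const_iff)
    qed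
  qed simp
  then obtain q where q: "q \<in> Pk k" and qL: "\<And>r. r \<in> Pk k ==> \<Lambda> r = eform q r" by (auto simp: Pk_span)
  define dn where "dn n x = p n x - q x" for n x
  have dk: "dn n \<in> Pk k" for n unfolding dn_def using Pk.diff[OF p q] .
  have d0: "(\<lambda>n. eform (dn n) r) \<longlonglongrightarrow> 0" if r: "r \<in> Pk k" for r
  proof -
    have "(\<lambda>n. eform (p n) r - eform q r) \<longlonglongrightarrow> 0" using conv[OF r] qL[OF r] by (simp add: LIM_zero_iff)
    then show ?thesis using lin_on_diff[OF e.lin_on_left[OF r] p q] by (simp add: dn_def[abs_def])
  qed
  have "(\<lambda>n. ?H (dn n) (dn n)) \<longlonglongrightarrow> 0"
  proof (rule span_weak_conv[of "Pidx k" monom2 eform ?H dn])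
    show "psd_form (span_of (Pidx k) monom2) eform" "psd_form (span_of (Pidx k) monom2) ?H"
      using eform_psd[of k] line_psd[of k] by (simp_all add: Pk_span)
    show "?H r r = 0" if "r \<in> span_of (Pidx k) monom2" "eform r r = 0" for r
      using eform_null[of r k] that by (simp add: Pk_span l2ip_def)
    show "dn n \<in> span_of (Pidx k) monom2" for n using dk by (simp add: Pk_span)
    show "(\<lambda>n. eform (dn n) r) \<longlonglongrightarrow> 0" if "r \<in> span_of (Pidx k) monom2" for r using d0 that by (simp add: Pk_span)
  qed simp
  then have "(\<lambda>n. sqrt (?H (dn n) (dn n))) \<longlonglongrightarrow> sqrt 0" by (rule tendsto_real_sqrt)
  then have n0: "L2lim {0..1} (\<lambda>n s. p n (linepath a b s)) (\<lambda>s. q (linepath a b s))"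
    by (simp add: l2norm_def dn_def)
  have tr: "edge_trace E a b w' q"
    by (rule edge_trace_limit[OF t w(2) smooth_line_L2[OF Pk_smooth[OF q]] lim n0])
  have "(\<lambda>n. p n (linepath a b s)) \<longlonglongrightarrow> q (linepath a b s)" for s
  proof -
    \<comment> \<open>Evaluation at a point of the edge line is itself represented in
      \<open>eform\<close>, which gives pointwise convergence.\<close>
    have "\<exists>r\<in>span_of (Pidx k) monom2. \<forall>u\<in>span_of (Pidx k) monom2. u (linepath a b s) = eform r u"
    proof (rule span_riesz)
      show "psd_form (span_of (Pidx k) monom2) eform" using eform_psd[of k] by (simp add: Pk_span)
      show "lin_on (span_of (Pidx k) monom2) (\<lambda>u. u (linepath a b s))" by (simp add: lin_on_def)
      show "u (linepath a b s) = 0" if "u \<in> span_of (Pidx k) monom2" "eform u u = 0" for u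
        using eform_null[of u k] that by (simp add: Pk_span)
    qed simp
    then obtain r where r: "r \<in> Pk k" "\<And>u. u \<in> Pk k ==> u (linepath a b s) = eform r u" by (auto simp: Pk_span)
    have "(\<lambda>n. dn n (linepath a b s)) \<longlonglongrightarrow> 0" using d0[OF r(1)] r(2)[OF dk] e.sym[OF r(1) dk] by simp
    then show ?thesis by (simp add: dn_def LIM_zero_iff)
  qed
  then show ?thesis using q tr by blast
qed

end

section \<open>The local virtual element space\<close>

locale element =
  fixes vs :: poly2 and ctr :: pt and \<rho> :: real
  assumes poly: "polygon vs" and star: "star_shaped_ball (region vs) ctr \<rho>" and rho: "0 < \<rho>"

sublocale element \<subseteq> domain "region vs"
proof
  show "region vs \<noteq> {}" using star rho centre_in_ball[of ctr \<rho>] unfolding star_shaped_ball_def by blast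
qed (rule region_open region_bounded)+

context element
begin

abbreviation E :: "pt set" where "E \<equiv> region vs"
abbreviation ln :: "nat => real => pt" where "ln i \<equiv> linepath (vs ! i) (nxt vs i)"

lemma vs_ne: "vs \<noteq> []"
  using poly by (auto simp: polygon_def)

lemma collar_at:
  assumes "i < length vs" "0 \<le> s0" "s0 < 1"
  shows "\<exists>s1 d. collar_domain E (vs ! i) (nxt vs i) s0 s1 d"
proof -
  obtain s1 d where "collar E (vs ! i) (nxt vs i) s0 s1 d"
    using collar_exists[OF poly star rho assms] by blast
  then have "collar_domain E (vs ! i) (nxt vs i) s0 s1 d"
    by (intro collar_domain.intro domain_axioms collar_domain_axioms.intro)
  then show ?thesis by blast
qed

lemma edge_zero:
  fixes g :: "real => real"
  assumes i: "i < length vs" and g: "continuous_on {0..1} g"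
    and z: "\<And>s0 s1 d s. collar_domain E (vs ! i) (nxt vs i) s0 s1 d ==> s0 < s ==> s < s1 ==> g s = 0"
    and s: "s \<in> {0..1}"
  shows "g s = 0"
proof (rule zero_on_unit_interval[OF g _ s])
  fix s0 :: real assume s0: "0 \<le> s0" "s0 < 1"
  obtain s1 d where c: "collar_domain E (vs ! i) (nxt vs i) s0 s1 d" using collar_at[OF i s0] by blast
  show "\<exists>s1>s0. s1 \<le> 1 \<and> (\<forall>s>s0. s < s1 --> g s = 0)"
    using collar_domain.s01[OF c] z[OF c] by (intro exI[of _ s1]) auto
qed

lemma edge_param: "x \<in> edge vs i ==> \<exists>s\<in>{0..1}. x = ln i s"
  unfolding edge_def linepath_image_01[symmetric] by blast

lemma ln_edge: "s \<in> {0..1} ==> ln i s \<in> edge vs i"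
  unfolding edge_def linepath_image_01[symmetric] by blast

lemma vertex_edge: "vs ! i = ln i 0" "vs ! i \<in> edge vs i"
  by (simp_all add: edge_def linepath_0')

lemma bdry_edge: "x \<in> bdry vs ==> \<exists>i<length vs. x \<in> edge vs i"
  by (auto simp: bdry_def)

lemma cont_trace_line:
  assumes "cont_trace vs w t" "i < length vs"
  shows "continuous_on {0..1} (\<lambda>s. t (ln i s))"
proof (rule continuous_on_compose2[of "bdry vs" t])
  show "continuous_on (bdry vs) t" using assms(1) by (simp add: cont_trace_def)
  show "ln i ` {0..1} \<subseteq> bdry vs" using edge_subset_bdry[OF assms(2)] ln_edge by blast
qed (intro continuous_intros)

text \<open>Collars starting at arbitrary parameters force the two continuous traces to agree on
  each edge. Hence the choice \<open>bval\<close> is determined on the whole boundary.\<close>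

lemma cont_trace_unique:
  assumes t: "cont_trace vs w t" "cont_trace vs w t'" and x: "x \<in> bdry vs"
  shows "t x = t' x"
proof -
  obtain i where i: "i < length vs" "x \<in> edge vs i" using bdry_edge[OF x] by blast
  obtain s where s: "s \<in> {0..1}" "x = ln i s" using edge_param[OF i(2)] by blast
  have e: "edge_trace E (vs ! i) (nxt vs i) w t" "edge_trace E (vs ! i) (nxt vs i) w t'"
    using t i(1) by (auto simp: cont_trace_def)
  note c = cont_trace_line[OF t(1) i(1)] cont_trace_line[OF t(2) i(1)]
  have "t (ln i s) - t' (ln i s) = 0"
  proof (rule edge_zero[OF i(1) _ _ s(1), of "\<lambda>s. t (ln i s) - t' (ln i s)"])
    show "continuous_on {0..1} (\<lambda>s. t (ln i s) - t' (ln i s))" by (intro continuous_intros c)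
    show "t (ln i s) - t' (ln i s) = 0" if "collar_domain E (vs ! i) (nxt vs i) s0 s1 d" "s0 < s" "s < s1" for s0 s1 d s
      using collar_domain.trace_unique[OF that(1) e c that(2,3)] by simp
  qed
  then show ?thesis using s(2) by simp
qed

lemma bval_eq:
  assumes t: "cont_trace vs w t" and x: "x \<in> bdry vs"
  shows "bval vs w x = t x"
proof -
  have "cont_trace vs w (bval vs w)" unfolding bval_def by (rule someI[of "cont_trace vs w", OF t])
  then show ?thesis using cont_trace_unique[OF _ t x] by blast
qed

lemma vavg_bval: "cont_trace vs w t ==> vavg vs (bval vs w) = vavg vs t"
proof -
  assume t: "cont_trace vs w t"
  have "bval vs w (vs ! i) = t (vs ! i)" if "i < length vs" for i
    using bval_eq[OF t] vertex_edge(2) edge_subset_bdry[OF that] by blast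
  then show ?thesis unfolding vavg_def by simp
qed

lemma cont_trace_comb:
  "cont_trace vs w t ==> cont_trace vs w' t' ==> cont_trace vs (lc a w b w') (lc a t b t')"
  unfolding cont_trace_def using edge_trace_comb by (auto intro!: continuous_intros)

lemma cont_trace_cong:
  "cont_trace vs w t ==> AE x in lebesgue_on E. w x = w' x ==> cont_trace vs w' t"
  unfolding cont_trace_def using edge_trace_cong by blast

lemma cont_trace_smooth:
  "smooth f ==> w \<in> Hs 1 E ==> AE x in lebesgue_on E. w x = f x ==> cont_trace vs w f"
  unfolding cont_trace_def using edge_trace_smooth smooth_continuous by blast

definition tdata :: "fld => fld => fld => fld => bool" where
  "tdata \<phi> t gx gy \<longleftrightarrow> cont_trace vs \<phi> t \<and> cont_trace vs (wD E 1 0 \<phi>) gx \<and> cont_trace vs (wD E 0 1 \<phi>) gy"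

lemma tdata_comb:
  assumes u: "u \<in> Hs 2 E" "tdata u t gx gy" and v: "v \<in> Hs 2 E" "tdata v t' gx' gy'"
  shows "tdata (lc a u b v) (lc a t b t') (lc a gx b gx') (lc a gy b gy')"
  unfolding tdata_def
proof (intro conjI)
  show "cont_trace vs (lc a u b v) (lc a t b t')"
    using u v by (auto simp: tdata_def intro: cont_trace_comb)
  have "cont_trace vs (\<lambda>x. a * wD E 1 0 u x + b * wD E 1 0 v x) (lc a gx b gx')"
    using u v by (auto simp: tdata_def intro: cont_trace_comb)
  then show "cont_trace vs (wD E 1 0 (lc a u b v)) (lc a gx b gx')"
    by (rule cont_trace_cong) (use wD_comb_AE[OF op u(1) v(1), of 1 0 a b] in auto)
  have "cont_trace vs (\<lambda>x. a * wD E 0 1 u x + b * wD E 0 1 v x) (lc a gy b gy')"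
    using u v by (auto simp: tdata_def intro: cont_trace_comb)
  then show "cont_trace vs (wD E 0 1 (lc a u b v)) (lc a gy b gy')"
    by (rule cont_trace_cong) (use wD_comb_AE[OF op u(1) v(1), of 0 1 a b] in auto)
qed

lemma tdata_smooth:
  assumes f: "smooth f" shows "tdata f f (pdx f) (pdy f)"
proof -
  have H: "f \<in> Hs 2 E" by (rule smooth_Hs[OF f bd meas])
  show ?thesis unfolding tdata_def
    using cont_trace_smooth[OF f Hs_mono[OF _ H]] cont_trace_smooth[OF smooth_pd(1)[OF f] Hs1_wD(1)[OF op H] wD_smooth_AE(1)[OF f]]
      cont_trace_smooth[OF smooth_pd(2)[OF f] Hs1_wD(2)[OF op H] wD_smooth_AE(2)[OF f]] by simp
qed

subsection \<open>The projection onto polynomials in the energy form\<close>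

end

locale velement = element +
  fixes \<sigma> :: real and k :: nat
  assumes \<sigma>: "0 < \<sigma>" "\<sigma> < 1" and k: "1 \<le> k"
begin

text \<open>The definition averages the chosen traces \<open>bval\<close>; by uniqueness any
  available traces have the same vertex averages, and the unique solvability of the constrained
  problem applies to them.\<close>

lemma PiD_spec:
  assumes v: "v \<in> Hs 2 E" "tdata v t gx gy"
  shows "PiD \<sigma> k vs v \<in> Pk k" "\<And>q. q \<in> Pk k ==> Aform \<sigma> E (PiD \<sigma> k vs v) q = Aform \<sigma> E v q"
    "vavg vs (PiD \<sigma> k vs v) = vavg vs t" "vavg vs (pdx (PiD \<sigma> k vs v)) = vavg vs gx" "vavg vs (pdy (PiD \<sigma> k vs v)) = vavg vs gy"
proof -
  have b: "vavg vs (bval vs v) = vavg vs t" "vavg vs (bval vs (wD E 1 0 v)) = vavg vs gx" "vavg vs (bval vs (wD E 0 1 v)) = vavg vs gy"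
    using v(2) unfolding tdata_def by (auto intro: vavg_bval)
  note th = theI'[OF PiD_solve[OF \<sigma> vs_ne k v(1), of "vavg vs t" "vavg vs gx" "vavg vs gy"]]
  have e: "PiD \<sigma> k vs v = (THE p. p \<in> Pk k \<and> (\<forall>q\<in>Pk k. Aform \<sigma> E p q = Aform \<sigma> E v q) \<and>
      vavg vs p = vavg vs t \<and> vavg vs (pdx p) = vavg vs gx \<and> vavg vs (pdy p) = vavg vs gy)"
    unfolding PiD_def b ..
  show "PiD \<sigma> k vs v \<in> Pk k" "\<And>q. q \<in> Pk k ==> Aform \<sigma> E (PiD \<sigma> k vs v) q = Aform \<sigma> E v q"
    "vavg vs (PiD \<sigma> k vs v) = vavg vs t" "vavg vs (pdx (PiD \<sigma> k vs v)) = vavg vs gx" "vavg vs (pdy (PiD \<sigma> k vs v)) = vavg vs gy"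
    using th unfolding e by blast+
qed

lemma PiD_eqI:
  assumes v: "v \<in> Hs 2 E" "tdata v t gx gy" and p: "p \<in> Pk k" "\<And>q. q \<in> Pk k ==> Aform \<sigma> E p q = Aform \<sigma> E v q"
    "vavg vs p = vavg vs t" "vavg vs (pdx p) = vavg vs gx" "vavg vs (pdy p) = vavg vs gy"
  shows "PiD \<sigma> k vs v = p"
  using PiD_solve[OF \<sigma> vs_ne k v(1), of "vavg vs t" "vavg vs gx" "vavg vs gy"] PiD_spec[OF v] p by blast

lemma PiD_comb:
  assumes u: "u \<in> Hs 2 E" "tdata u t gx gy" and v: "v \<in> Hs 2 E" "tdata v t' gx' gy'"
  shows "PiD \<sigma> k vs (lc a u b v) = (\<lambda>x. a * PiD \<sigma> k vs u x + b * PiD \<sigma> k vs v x)"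
proof -
  interpret A: psd_form "Hs 2 E" "Aform \<sigma> E" by (rule Aform_psd[OF \<sigma>])
  note pu = PiD_spec[OF u] and pv = PiD_spec[OF v]
  show ?thesis
  proof (rule PiD_eqI[OF A.comb[OF u(1) v(1)] tdata_comb[OF u v] Pk.comb[OF pu(1) pv(1)]])
    fix q assume q: "q \<in> Pk k"
    show "Aform \<sigma> E (\<lambda>x. a * PiD \<sigma> k vs u x + b * PiD \<sigma> k vs v x) q = Aform \<sigma> E (lc a u b v) q"
      using A.lin[OF u(1) v(1) Pk_Hs[OF q]] A.lin[OF Pk_Hs[OF pu(1)] Pk_Hs[OF pv(1)] Pk_Hs[OF q]] pu(2)[OF q] pv(2)[OF q] by simp
  qed (simp_all add: vavg_comb pu pv Pk_pd_comb[OF pu(1) pv(1)])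
qed

lemma PiD_poly:
  assumes p: "p \<in> Pk k" shows "PiD \<sigma> k vs p = p"
  by (rule PiD_eqI[OF Pk_Hs[OF p] tdata_smooth[OF Pk_smooth[OF p]] p]) auto

lemma PiD_cong:
  assumes u: "u \<in> Hs 2 E" and ae: "AE x in lebesgue_on E. u x = u' x"
  shows "PiD \<sigma> k vs u = PiD \<sigma> k vs u'"
proof -
  have w: "wD E i j u = wD E i j u'" for i j by (rule wD_cong[OF meas Hs_L2[OF u] ae])
  have ae': "AE x in lebesgue_on E. u' x = u x" using ae by eventually_elim simp
  have "cont_trace vs u = cont_trace vs u'" using cont_trace_cong[OF _ ae] cont_trace_cong[OF _ ae'] by blast
  then have "bval vs u = bval vs u'" by (simp add: bval_def)
  moreover have "Aform \<sigma> E u q = Aform \<sigma> E u' q" for q by (simp add: Aform_def w)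
  ultimately show ?thesis by (simp add: PiD_def w)
qed

subsection \<open>Linearity of the local space\<close>

definition edge_polys :: "fld => fld => fld => bool" where
  "edge_polys t gx gy \<longleftrightarrow> (\<forall>i<length vs. (\<exists>q \<in> Pk (max 3 k). \<forall>x \<in> edge vs i. t x = q x) \<and>
     (\<exists>q \<in> Pk (k - 1). \<forall>x \<in> edge vs i. (gx x, gy x) \<bullet> enormal vs i = q x))"

lemma Ztilde_iff: "\<phi> \<in> Ztilde k vs \<longleftrightarrow> \<phi> \<in> Hs 2 E \<and>
    (\<exists>p \<in> Pk k. \<forall>\<psi> \<in> test_fun E. l2ip E \<phi> (bilap \<psi>) = l2ip E p \<psi>) \<and> (\<exists>t gx gy. tdata \<phi> t gx gy \<and> edge_polys t gx gy)"
  unfolding Ztilde_def tdata_def edge_polys_def mem_Collect_eq conj_assoc ..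

lemma ZtildeE:
  assumes "\<phi> \<in> Ztilde k vs"
  obtains t gx gy where "\<phi> \<in> Hs 2 E" "tdata \<phi> t gx gy" "edge_polys t gx gy"
  using assms unfolding Ztilde_iff by blast

lemma bilap_L2: "\<psi> \<in> test_fun E ==> bilap \<psi> \<in> L2 E"
proof -
  assume \<psi>: "\<psi> \<in> test_fun E"
  have "(\<lambda>p. 1 * (1 * cD 4 0 \<psi> p + 2 * cD 2 2 \<psi> p) + 1 * cD 0 4 \<psi> p) \<in> L2 E"
    by (intro L2.comb test_fun_L2[OF test_fun_cD[OF \<psi>] meas])
  then show ?thesis by (simp add: bilap_def[abs_def])
qed

lemma edge_polys_comb:
  assumes "edge_polys t gx gy" "edge_polys t' gx' gy'"
  shows "edge_polys (lc a t b t') (lc a gx b gx') (lc a gy b gy')"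
  unfolding edge_polys_def
proof (intro allI impI conjI)
  fix i assume i: "i < length vs"
  obtain q r where q: "q \<in> Pk (max 3 k)" "\<And>x. x \<in> edge vs i ==> t x = q x" "r \<in> Pk (k - 1)" "\<And>x. x \<in> edge vs i ==> (gx x, gy x) \<bullet> enormal vs i = r x"
    using assms(1) i unfolding edge_polys_def by blast
  obtain q' r' where q': "q' \<in> Pk (max 3 k)" "\<And>x. x \<in> edge vs i ==> t' x = q' x" "r' \<in> Pk (k - 1)" "\<And>x. x \<in> edge vs i ==> (gx' x, gy' x) \<bullet> enormal vs i = r' x"
    using assms(2) i unfolding edge_polys_def by blast
  show "\<exists>q\<in>Pk (max 3 k). \<forall>x\<in>edge vs i. a * t x + b * t' x = q x"
    by (rule bexI[OF _ Pk.comb[OF q(1) q'(1), of a b]]) (simp add: q q')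
  show "\<exists>q\<in>Pk (k - 1). \<forall>x\<in>edge vs i. (a * gx x + b * gx' x, a * gy x + b * gy' x) \<bullet> enormal vs i = q x"
    by (rule bexI[OF _ Pk.comb[OF q(3) q'(3), of a b]])
      (simp add: q(4)[symmetric] q'(4)[symmetric] inner_prod_def algebra_simps)
qed

lemma Ztilde_comb:
  assumes "u \<in> Ztilde k vs" "v \<in> Ztilde k vs"
  shows "lc a u b v \<in> Ztilde k vs"
proof -
  interpret Hs: lin_space "Hs 2 E" by (rule Hs_lin_space[OF meas])
  obtain p t gx gy where u: "u \<in> Hs 2 E" "p \<in> Pk k" "\<And>\<psi>. \<psi> \<in> test_fun E ==> l2ip E u (bilap \<psi>) = l2ip E p \<psi>" "tdata u t gx gy" "edge_polys t gx gy"
    using assms(1) unfolding Ztilde_iff by blast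
  obtain p' t' gx' gy' where v: "v \<in> Hs 2 E" "p' \<in> Pk k" "\<And>\<psi>. \<psi> \<in> test_fun E ==> l2ip E v (bilap \<psi>) = l2ip E p' \<psi>" "tdata v t' gx' gy'" "edge_polys t' gx' gy'"
    using assms(2) unfolding Ztilde_iff by blast
  show ?thesis unfolding Ztilde_iff
  proof (intro conjI)
    show "lc a u b v \<in> Hs 2 E" by (intro Hs.comb u v)
    have "l2ip E (lc a u b v) (bilap \<psi>) = l2ip E (lc a p b p') \<psi>" if \<psi>: "\<psi> \<in> test_fun E" for \<psi>
      using L2.lin[OF Hs_L2[OF u(1)] Hs_L2[OF v(1)] bilap_L2[OF \<psi>]] L2.lin[OF Pk_L2[OF u(2)] Pk_L2[OF v(2)] test_fun_L2[OF \<psi> meas]]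
        u(3)[OF \<psi>] v(3)[OF \<psi>] by simp
    then show "\<exists>p\<in>Pk k. \<forall>\<psi>\<in>test_fun E. l2ip E (lc a u b v) (bilap \<psi>) = l2ip E p \<psi>"
      using Pk.comb[OF u(2) v(2)] by blast
    show "\<exists>t gx gy. tdata (lc a u b v) t gx gy \<and> edge_polys t gx gy"
      using tdata_comb[OF u(1,4) v(1,4)] edge_polys_comb[OF u(5) v(5)] by blast
  qed
qed

lemma Pk_Ztilde:
  assumes p: "p \<in> Pk k" shows "p \<in> Ztilde k vs"
  unfolding Ztilde_iff
proof (intro conjI)
  show "p \<in> Hs 2 E" by (rule Pk_Hs[OF p])
  \<comment> \<open>The bilaplacian of p, with derivatives in the order in which integration by
    parts moves them off the test function, and with explicit unit coefficients to match the form of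
    linear combinations.\<close>
  define p' where "p' x = 1 * (1 * pdx (pdx (pdx (pdx p))) x + 2 * pdy (pdy (pdx (pdx p))) x) + 1 * pdy (pdy (pdy (pdy p))) x" for x
  have inP: "pdx q \<in> Pk k" "pdy q \<in> Pk k" if "q \<in> Pk k" for q using Pk_pd[OF that] Pk_mono[of "k - 1" k] by auto
  have p': "p' \<in> Pk k" unfolding p'_def by (intro Pk.comb inP p)
  have "l2ip E p (bilap \<psi>) = l2ip E p' \<psi>" if \<psi>: "\<psi> \<in> test_fun E" for \<psi>
  proof -
    note t = test_fun_pd[of _ E]
    have bx: "l2ip E q (pdx \<phi>) = - l2ip E (pdx q) \<phi>" and by': "l2ip E q (pdy \<phi>) = - l2ip E (pdy q) \<phi>" if "q \<in> Pk k" "\<phi> \<in> test_fun E" for q \<phi>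
      using by_parts[OF Pk_smooth[OF that(1)] that(2) meas] by auto
    have four: "(4::nat) = Suc (Suc (Suc (Suc 0)))" by simp
    have c: "cD 4 0 \<psi> = pdx (pdx (pdx (pdx \<psi>)))" "cD 2 2 \<psi> = pdx (pdx (pdy (pdy \<psi>)))" "cD 0 4 \<psi> = pdy (pdy (pdy (pdy \<psi>)))"
      unfolding cD_def four numeral_2_eq_2 funpow.simps o_apply id_apply by simp_all
    have L: "cD i j \<psi> \<in> L2 E" for i j by (rule test_fun_L2[OF test_fun_cD[OF \<psi>] meas])
    have "l2ip E p (bilap \<psi>) = l2ip E p (\<lambda>x. 1 * (1 * cD 4 0 \<psi> x + 2 * cD 2 2 \<psi> x) + 1 * cD 0 4 \<psi> x)"
      by (simp add: bilap_def[abs_def])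
    also have "\<dots> = l2ip E p (cD 4 0 \<psi>) + 2 * l2ip E p (cD 2 2 \<psi>) + l2ip E p (cD 0 4 \<psi>)"
      using L2.lin_right[OF L2.comb[OF L[of 4 0] L[of 2 2], of 1 2] L[of 0 4] Pk_L2[OF p], of 1 1] L2.lin_right[OF L[of 4 0] L[of 2 2] Pk_L2[OF p], of 1 2] by simp
    also have "\<dots> = l2ip E (pdx (pdx (pdx (pdx p)))) \<psi> + 2 * l2ip E (pdy (pdy (pdx (pdx p)))) \<psi> + l2ip E (pdy (pdy (pdy (pdy p)))) \<psi>"
      by (simp add: c bx by' p \<psi> t inP)
    also have "\<dots> = l2ip E p' \<psi>"
      unfolding p'_def[abs_def]
      by (subst L2.lin, (intro L2.comb Pk_L2[of _ k] inP p test_fun_L2[OF \<psi>] meas)+, subst L2.lin, (intro L2.comb Pk_L2[of _ k] inP p test_fun_L2[OF \<psi>] meas)+) simp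
    finally show ?thesis .
  qed
  then show "\<exists>p'\<in>Pk k. \<forall>\<psi>\<in>test_fun E. l2ip E p (bilap \<psi>) = l2ip E p' \<psi>" using p' by blast
  have "edge_polys p (pdx p) (pdy p)" unfolding edge_polys_def
  proof (intro allI impI conjI)
    fix i
    have "p \<in> Pk (max 3 k)" using p Pk_mono[of k "max 3 k"] by auto
    then show "\<exists>q\<in>Pk (max 3 k). \<forall>x\<in>edge vs i. p x = q x" by blast
    have "(\<lambda>x. fst (enormal vs i) * pdx p x + snd (enormal vs i) * pdy p x) \<in> Pk (k - 1)" by (intro Pk.comb Pk_pd p)
    then show "\<exists>q\<in>Pk (k - 1). \<forall>x\<in>edge vs i. (pdx p x, pdy p x) \<bullet> enormal vs i = q x"
      by (rule bexI[rotated]) (simp add: inner_prod_def mult.commute)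
  qed
  then show "\<exists>t gx gy. tdata p t gx gy \<and> edge_polys t gx gy" using tdata_smooth[OF Pk_smooth[OF p]] by blast
qed

lemma scaled_monomial_smooth: "m \<in> scaled_monomials vs \<alpha> ==> smooth m"
proof -
  assume "m \<in> scaled_monomials vs \<alpha>"
  then obtain i j where m: "m = (\<lambda>(x, y). ((x - fst (centroid vs)) / diam vs) ^ i * ((y - snd (centroid vs)) / diam vs) ^ j)"
    by (auto simp: scaled_monomials_def)
  let ?f = "\<lambda>x::pt. ((1 / diam vs) * fst x + (- fst (centroid vs) / diam vs) * 1) ^ i * ((1 / diam vs) * snd x + (- snd (centroid vs) / diam vs) * 1) ^ j"
  have "m = ?f" unfolding m by (auto simp: fun_eq_iff diff_divide_distrib)
  moreover have "smooth ?f" by (intro smooth_mult smooth_power smooth_comb smooth_fst smooth_snd smooth_const)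
  ultimately show ?thesis by simp
qed

lemma scaled_monomial_L2: "m \<in> scaled_monomials vs \<alpha> ==> m \<in> L2 E"
  by (rule smooth_L2[OF scaled_monomial_smooth bd meas])

lemma ZE_Ztilde: "\<phi> \<in> ZE \<sigma> k vs ==> \<phi> \<in> Ztilde k vs"
  by (simp add: ZE_def)

lemma ZE_Hs: "\<phi> \<in> ZE \<sigma> k vs ==> \<phi> \<in> Hs 2 E"
  by (simp add: ZE_def Ztilde_iff)

lemma PiD_Ztilde:
  assumes "v \<in> Ztilde k vs" shows "PiD \<sigma> k vs v \<in> Pk k"
  using assms by (rule ZtildeE) (rule PiD_spec)

lemma PiD_Ztilde_comb:
  assumes "u \<in> Ztilde k vs" "v \<in> Ztilde k vs"
  shows "PiD \<sigma> k vs (lc a u b v) = (\<lambda>x. a * PiD \<sigma> k vs u x + b * PiD \<sigma> k vs v x)"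
proof -
  obtain t gx gy where u: "u \<in> Hs 2 E" "tdata u t gx gy" using assms(1) unfolding Ztilde_iff by blast
  obtain t' gx' gy' where v: "v \<in> Hs 2 E" "tdata v t' gx' gy'" using assms(2) unfolding Ztilde_iff by blast
  show ?thesis by (rule PiD_comb[OF u v])
qed

lemma Pk_ZE: "p \<in> Pk k ==> p \<in> ZE \<sigma> k vs"
  unfolding ZE_def using Pk_Ztilde PiD_poly by simp

lemma ZE_lin_space: "lin_space (ZE \<sigma> k vs)"
proof
  show "(\<lambda>_. 0) \<in> ZE \<sigma> k vs" by (rule Pk_ZE[OF Pk.zero])
  fix u v and a b :: real assume u: "u \<in> ZE \<sigma> k vs" and v: "v \<in> ZE \<sigma> k vs"
  have uv: "u \<in> Ztilde k vs" "v \<in> Ztilde k vs" using u v by (auto simp: ZE_def)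
  have "l2ip E m (PiD \<sigma> k vs (lc a u b v)) = l2ip E m (lc a u b v)"
    if "k \<le> \<alpha> + 3 \<and> \<alpha> \<le> k" and m: "m \<in> scaled_monomials vs \<alpha>" for \<alpha> m
  proof -
    note mL = scaled_monomial_L2[OF m]
    have "l2ip E m (PiD \<sigma> k vs u) = l2ip E m u" "l2ip E m (PiD \<sigma> k vs v) = l2ip E m v"
      using u v that by (auto simp: ZE_def)
    then show ?thesis
      unfolding PiD_Ztilde_comb[OF uv] L2.lin_right[OF Hs_L2[OF ZE_Hs[OF u]] Hs_L2[OF ZE_Hs[OF v]] mL]
        L2.lin_right[OF Pk_L2[OF PiD_Ztilde[OF uv(1)]] Pk_L2[OF PiD_Ztilde[OF uv(2)]] mL] by simp
  qed
  then show "lc a u b v \<in> ZE \<sigma> k vs" unfolding ZE_def using Ztilde_comb[OF uv] by blast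
qed

text \<open>The scheme prescribes its two initial values only up to null sets, so membership in the
  space must not depend on the representative.\<close>

lemma ZE_cong:
  assumes u: "u \<in> ZE \<sigma> k vs" and ae: "AE x in lebesgue_on E. u x = u' x"
  shows "u' \<in> ZE \<sigma> k vs"
proof -
  have uH: "u \<in> Hs 2 E" by (rule ZE_Hs[OF u])
  have w: "wD E i j u = wD E i j u'" for i j by (rule wD_cong[OF meas Hs_L2[OF uH] ae])
  have u'H: "u' \<in> Hs 2 E" by (rule Hs_cong[OF meas uH ae])
  have ip: "l2ip E u v = l2ip E u' v" "l2ip E v u = l2ip E v u'" if "v \<in> L2 E" for v
  proof -
    show "l2ip E u v = l2ip E u' v" by (intro l2ip_cong_AE L2_measurable Hs_L2[OF uH] Hs_L2[OF u'H] that ae)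
    then show "l2ip E v u = l2ip E v u'" by (simp add: l2ip_def mult.commute)
  qed
  have td: "tdata u' t gx gy" if "tdata u t gx gy" for t gx gy
    using that cont_trace_cong[OF _ ae] unfolding tdata_def w by blast
  obtain p t gx gy where p: "p \<in> Pk k" "\<forall>\<psi>\<in>test_fun E. l2ip E u (bilap \<psi>) = l2ip E p \<psi>"
    and t: "tdata u t gx gy" "edge_polys t gx gy"
    using ZE_Ztilde[OF u] unfolding Ztilde_iff by blast
  have u'Z: "u' \<in> Ztilde k vs" unfolding Ztilde_iff
  proof (intro conjI u'H)
    show "\<exists>p\<in>Pk k. \<forall>\<psi>\<in>test_fun E. l2ip E u' (bilap \<psi>) = l2ip E p \<psi>"
      by (rule bexI[OF _ p(1)]) (simp add: p(2) ip(1)[OF bilap_L2, symmetric])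
    show "\<exists>t gx gy. tdata u' t gx gy \<and> edge_polys t gx gy" using td[OF t(1)] t(2) by blast
  qed
  show ?thesis unfolding ZE_def mem_Collect_eq
  proof (intro conjI allI impI ballI u'Z)
    fix \<alpha> m assume "k \<le> \<alpha> + 3 \<and> \<alpha> \<le> k" and m: "m \<in> scaled_monomials vs \<alpha>"
    then have "l2ip E m (PiD \<sigma> k vs u) = l2ip E m u" using u unfolding ZE_def by simp
    then show "l2ip E m (PiD \<sigma> k vs u') = l2ip E m u'"
      unfolding PiD_cong[OF uH ae] ip(2)[OF scaled_monomial_L2[OF m]] .
  qed
qed

end

lemma nxt_neq: "polygon vs ==> i < length vs ==> nxt vs i \<noteq> vs ! i"
proof -
  assume p: "polygon vs" and i: "i < length vs"
  have n: "3 \<le> length vs" "distinct vs" using p by (auto simp: polygon_def)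
  have "Suc i mod length vs \<noteq> i"
  proof (cases "Suc i = length vs")
    case True
    then show ?thesis using n by auto
  next
    case False
    then show ?thesis using i by simp
  qed
  moreover have "Suc i mod length vs < length vs" using n by (intro mod_less_divisor) linarith
  ultimately show ?thesis using n i by (simp add: nxt_def nth_eq_iff_index_eq)
qed

lemma bump_pos_ex:
  assumes "a < b" shows "\<exists>n x. 0 < bump n a b x"
proof -
  have "(\<lambda>n. bump n a b ((a + b) / 2)) \<longlonglongrightarrow> 1" using bump_tendsto[of a b "(a + b) / 2"] assms by simp
  then have "\<forall>\<^sub>F n in sequentially. 0 < bump n a b ((a + b) / 2)" by (rule order_tendstoD) simp
  then obtain n where "0 < bump n a b ((a + b) / 2)" using eventually_happens'[OF sequentially_bot] by blast
  then show ?thesis by blast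
qed

section \<open>Convergence in H^1 and H^2\<close>

context domain
begin

definition H1lim :: "(nat => fld) => fld => bool" where
  "H1lim w w' \<longleftrightarrow> L2lim E w w' \<and>
     L2lim E (\<lambda>n. wD E 1 0 (w n)) (wD E 1 0 w') \<and>
     L2lim E (\<lambda>n. wD E 0 1 (w n)) (wD E 0 1 w')"

lemma l2norm_lim_cong:
  assumes "L2lim E u u'"
    and L: "\<And>n. u n \<in> L2 E" "u' \<in> L2 E" "\<And>n. v n \<in> L2 E" "v' \<in> L2 E"
    and ae: "\<And>n. AE x in lebesgue_on E. u n x = v n x" "AE x in lebesgue_on E. u' x = v' x"
  shows "L2lim E v v'"
proof -
  have "l2norm E (\<lambda>x. u n x - u' x) = l2norm E (\<lambda>x. v n x - v' x)" for n
  proof (rule l2norm_cong_AE)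
    show "AE x in lebesgue_on E. u n x - u' x = v n x - v' x" using ae(1)[of n] ae(2) by eventually_elim simp
  qed (intro L2.diff L)+
  then show ?thesis using assms(1) by simp
qed

lemma l2norm_lim_comb:
  assumes "L2lim E u u'" "L2lim E v v'"
    and L: "\<And>n. u n \<in> L2 E" "u' \<in> L2 E" "\<And>n. v n \<in> L2 E" "v' \<in> L2 E"
  shows "L2lim E (\<lambda>n x. (a * u n x + b * v n x)) (\<lambda>x. (a * u' x + b * v' x))"
proof (rule null_seq_comb)
  show "l2norm E (\<lambda>x. (a * u n x + b * v n x) - (a * u' x + b * v' x))
      \<le> \<bar>a\<bar> * l2norm E (\<lambda>x. u n x - u' x) + \<bar>b\<bar> * l2norm E (\<lambda>x. v n x - v' x)" for n
    by (intro l2norm_comb_diff L)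
  show "0 \<le> l2norm E (\<lambda>x. (a * u n x + b * v n x) - (a * u' x + b * v' x))" for n
    by (intro l2norm_nonneg)
qed (rule assms)+

lemma H1lim_comb:
  assumes u: "\<And>n. u n \<in> Hs 1 E" "u' \<in> Hs 1 E" "H1lim u u'" and v: "\<And>n. v n \<in> Hs 1 E" "v' \<in> Hs 1 E" "H1lim v v'"
  shows "H1lim (\<lambda>n x. a * u n x + b * v n x) (lc a u' b v')"
proof -
  interpret Hs: lin_space "Hs 1 E" by (rule Hs_lin_space[OF meas])
  have e: "AE x in lebesgue_on E. a * wD E i j f x + b * wD E i j g x = wD E i j (lc a f b g) x"
    if "f \<in> Hs 1 E" "g \<in> Hs 1 E" "i + j \<le> 1" for i j f g
    using wD_comb_AE[OF op that, of a b] by eventually_elim simp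
  have d: "L2lim E (\<lambda>n x. wD E i j (\<lambda>x. a * u n x + b * v n x) x) (\<lambda>x. wD E i j (lc a u' b v') x)"
    if ij: "i + j \<le> 1" and l: "L2lim E (\<lambda>n. wD E i j (u n)) (wD E i j u')" "L2lim E (\<lambda>n. wD E i j (v n)) (wD E i j v')" for i j
    by (rule l2norm_lim_cong[OF l2norm_lim_comb[OF l] _ _ _ _ e[OF u(1) v(1) ij] e[OF u(2) v(2) ij]])
      (intro L2.comb Hs.comb Hs_wD_L2[OF _ ij] u v)+
  show ?thesis unfolding H1lim_def
    using u(3) v(3) d[of 1 0] d[of 0 1] l2norm_lim_comb[OF _ _ Hs_L2[OF u(1)] Hs_L2[OF u(2)] Hs_L2[OF v(1)] Hs_L2[OF v(2)]] 
    unfolding H1lim_def by simp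
qed

text \<open>Order 0 is stated for w itself, since \<open>wD E 0 0 w\<close> is a chosen
  representative that agrees with w only almost everywhere.\<close>

definition H2lim :: "(nat => fld) => fld => bool" where
  "H2lim w w' \<longleftrightarrow> L2lim E w w' \<and>
     (\<forall>i j. 1 \<le> i + j \<and> i + j \<le> 2 --> L2lim E (\<lambda>n. wD E i j (w n)) (wD E i j w'))"

lemma H2lim_H1lim:
  assumes w: "\<And>n. w n \<in> Hs 2 E" "w' \<in> Hs 2 E" and l: "H2lim w w'"
  shows "H1lim w w'" "H1lim (\<lambda>n. wD E 1 0 (w n)) (wD E 1 0 w')" "H1lim (\<lambda>n. wD E 0 1 (w n)) (wD E 0 1 w')"
proof -
  note c = is_wderiv_compose[OF op]
  have s: "AE x in lebesgue_on E. v x = wD E i j u x" if "is_wderiv E i j u v" for i j u v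
    using wD_AE[OF op that] by eventually_elim simp
  have lim: "L2lim E (\<lambda>n. wD E i j (w n)) (wD E i j w')" if "1 \<le> i + j" "i + j \<le> 2" for i j
    using l that unfolding H2lim_def by blast
  have g: "L2lim E (\<lambda>n. wD E i' j' (wD E a b (w n))) (wD E i' j' (wD E a b w'))"
    if h: "\<And>u. u \<in> Hs 2 E ==> is_wderiv E i' j' (wD E a b u) (wD E i j u)" and ij: "1 \<le> i + j" "i + j \<le> 2" and H: "\<And>u. u \<in> Hs 2 E ==> wD E a b u \<in> Hs 1 E" "i' + j' \<le> 1" for i j i' j' a b
    by (rule l2norm_lim_cong[OF lim[OF ij] _ _ _ _ s[OF h[OF w(1)]] s[OF h[OF w(2)]]])
      (intro Hs_wD_L2[OF _ ij(2)] Hs_wD_L2[OF H(1) H(2)] w)+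
  show "H1lim w w'" unfolding H1lim_def using l lim[of 1 0] lim[of 0 1] by (simp add: H2lim_def)
  show "H1lim (\<lambda>n. wD E 1 0 (w n)) (wD E 1 0 w')" unfolding H1lim_def
    using lim[of 1 0] g[of 1 0 1 0 2 0, OF c(1)] g[of 0 1 1 0 1 1, OF c(2)] Hs1_wD(1)[OF op] by simp
  show "H1lim (\<lambda>n. wD E 0 1 (w n)) (wD E 0 1 w')" unfolding H1lim_def
    using lim[of 0 1] g[of 1 0 0 1 1 1, OF c(3)] g[of 0 1 0 1 0 2, OF c(4)] Hs1_wD(2)[OF op] by simp
qed

lemma Aform_conv:
  assumes \<sigma>: "0 < \<sigma>" "\<sigma> < 1" and u: "\<And>n. u n \<in> Hs 2 E" "u' \<in> Hs 2 E" "H2lim u u'"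
  shows "(\<lambda>n. Aform \<sigma> E (\<lambda>x. u n x - u' x) (\<lambda>x. u n x - u' x)) \<longlonglongrightarrow> 0"
proof -
  interpret A: psd_form "Hs 2 E" "Aform \<sigma> E" by (rule Aform_psd[OF \<sigma>])
  have lim: "(\<lambda>n. (l2norm E (wD E i j (\<lambda>x. u n x - u' x)))\<^sup>2) \<longlonglongrightarrow> 0" if "i + j = 2" for i j
  proof -
    have "L2lim E (\<lambda>n. wD E i j (u n)) (wD E i j u')" using u(3) that unfolding H2lim_def by simp
    then have "(\<lambda>n. (l2norm E (\<lambda>x. wD E i j (u n) x - wD E i j u' x))\<^sup>2) \<longlonglongrightarrow> 0\<^sup>2" by (intro tendsto_intros)
    then show ?thesis using l2norm_wD_diff[OF u(1,2), of i j] that by simp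
  qed
  have "(\<lambda>n. 2 * hess (\<lambda>x. u n x - u' x)) \<longlonglongrightarrow> 2 * (0 + 0 + 0)"
    unfolding hess_def by (intro tendsto_intros lim) simp_all
  then have l: "(\<lambda>n. 2 * hess (\<lambda>x. u n x - u' x)) \<longlonglongrightarrow> 0" by simp
  show ?thesis
  proof (rule Lim_null_comparison[OF always_eventually l], rule allI)
    show "norm (Aform \<sigma> E (\<lambda>x. u n x - u' x) (\<lambda>x. u n x - u' x)) \<le> 2 * hess (\<lambda>x. u n x - u' x)" for n
      using A.nonneg[OF A.diff[OF u(1)[of n] u(2)]] Aform_bounds(2)[OF \<sigma> A.diff[OF u(1)[of n] u(2)]] by simp
  qed
qed

subsection \<open>Distributional limits of polynomials\<close>

lemma test_fun_ex: "\<exists>\<eta> \<in> test_fun E. (\<forall>x. 0 \<le> \<eta> x) \<and> (\<exists>x. 0 < \<eta> x)"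
proof -
  obtain x where x: "x \<in> E" using ne by blast
  obtain a b where ab: "cbox a b \<subseteq> E" "x \<in> box a b" using op x by (rule open_contains_cbox)
  have l: "fst a < fst b" "snd a < snd b" using ab(2) by (auto simp: mem_box Basis_prod_def inner_prod_def)
  obtain m s where m: "0 < bump m (fst a) (fst b) s" using bump_pos_ex[OF l(1)] by blast
  obtain n t where n: "0 < bump n (snd a) (snd b) t" using bump_pos_ex[OF l(2)] by blast
  have "{fst a..fst b} \<times> {snd a..snd b} \<subseteq> E"
    using ab(1) cbox_Pair_eq[of "fst a" "snd a" "fst b" "snd b"] by simp
  then have T: "(\<lambda>p. bump m (fst a) (fst b) (fst p) * bump n (snd a) (snd b) (snd p)) \<in> test_fun E"
    by (intro prod_test_fun smooth1_bump bump_outside)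
  show ?thesis
  proof (rule bexI[OF _ T], intro conjI allI exI)
    show "0 \<le> bump m (fst a) (fst b) (fst p) * bump n (snd a) (snd b) (snd p)" for p
      by (simp add: bump_bounds)
    show "0 < bump m (fst a) (fst b) (fst (s, t)) * bump n (snd a) (snd b) (snd (s, t))"
      using m n by simp
  qed
qed

text \<open>Fix a nonnegative test function \<eta>, not identically 0. Polynomials times \<eta> are
  test functions, so the products weighted by \<eta> converge; Riesz represents the limit functional
  by a polynomial q, and convergence in the finite span becomes L^2 convergence, which identifies F
  on all test functions.\<close>

lemma Pk_weak_limit:
  assumes p: "\<And>n. p n \<in> Pk k" and lim: "\<And>\<psi>. \<psi> \<in> test_fun E ==> (\<lambda>n. l2ip E (p n) \<psi>) \<longlonglongrightarrow> F \<psi>"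
  shows "\<exists>q\<in>Pk k. \<forall>\<psi>\<in>test_fun E. F \<psi> = l2ip E q \<psi>"
proof -
  obtain \<eta> where \<eta>: "\<eta> \<in> test_fun E" "\<And>x. 0 \<le> \<eta> x" "\<exists>x. 0 < \<eta> x" using test_fun_ex by blast
  note t = test_fun_mult[OF \<eta>(1) Pk_smooth]
  note tL = test_fun_L2[OF t meas]
  define G where "G u v = l2ip E u (\<lambda>x. v x * \<eta> x)" for u v
  have G: "psd_form (Pk k) G"
  proof
    fix u v w and a b :: real assume u: "u \<in> Pk k" and v: "v \<in> Pk k"
    show "G u v = G v u" unfolding G_def l2ip_def by (simp add: mult.commute mult.left_commute)
    show "0 \<le> G u u" unfolding G_def l2ip_def
      by (intro integral_nonneg_AE always_eventually allI) (simp add: \<eta>(2) mult.assoc[symmetric])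
    assume w: "w \<in> Pk k"
    show "G (lc a u b v) w = a * G u w + b * G v w"
      unfolding G_def by (rule L2.lin[OF Pk_L2[OF u] Pk_L2[OF v] tL[OF w]])
  qed
  interpret G: psd_form "Pk k" G by (rule G)
  have null: "q = (\<lambda>_. 0)" if q: "q \<in> Pk k" and z: "G q q = 0" for q
  proof (rule Pk_zero_open[OF q])
    \<comment> \<open>The weight may vanish on part of E; a null polynomial vanishes on the open set
      where it does not, and hence everywhere.\<close>
    let ?S = "{x \<in> E. \<eta> x \<noteq> 0}"
    have \<eta>E: "\<eta> x = 0" if "x \<notin> E" for x using \<eta>(1) that closure_subset[of "{x. \<eta> x \<noteq> 0}"] unfolding test_fun_def by blast
    show "open ?S" using open_Int[OF op open_Collect_neq[OF smooth_continuous[OF test_fun_smooth[OF \<eta>(1)]] continuous_on_const, of 0]] by (simp add: Collect_conj_eq)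
    obtain x where "0 < \<eta> x" using \<eta>(3) by blast
    then show "?S \<noteq> {}" using \<eta>E[of x] by fastforce
    let ?f = "\<lambda>x. q x * (q x * \<eta> x)"
    have sf: "smooth ?f" by (intro smooth_mult Pk_smooth[OF q] test_fun_smooth[OF \<eta>(1)])
    have int: "integrable (lebesgue_on E) ?f" using L2_mult[OF Pk_L2[OF q] tL[OF q]] .
    have "AE x in lebesgue_on E. ?f x = 0"
      using z integral_nonneg_eq_0_iff_AE[OF int] unfolding G_def l2ip_def by (simp add: \<eta>(2) mult.assoc[symmetric])
    then show "q x = 0" if "x \<in> ?S" for x
      using continuous_AE_zero[OF smooth_continuous[OF sf] op _, of x] that by simp
  qed
  define \<Phi> where "\<Phi> q = F (\<lambda>x. q x * \<eta> x)" for q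
  have \<Phi>: "(\<lambda>n. G (p n) q) \<longlonglongrightarrow> \<Phi> q" if "q \<in> Pk k" for q unfolding G_def \<Phi>_def by (rule lim[OF t[OF that]])
  have lin: "lin_on (Pk k) \<Phi>" unfolding lin_on_def
  proof (intro ballI allI)
    fix u v and a b :: real assume u: "u \<in> Pk k" and v: "v \<in> Pk k"
    have "(\<lambda>n. a * G (p n) u + b * G (p n) v) \<longlonglongrightarrow> a * \<Phi> u + b * \<Phi> v" by (intro tendsto_intros \<Phi> u v)
    then have "(\<lambda>n. G (p n) (lc a u b v)) \<longlonglongrightarrow> a * \<Phi> u + b * \<Phi> v" by (simp add: G.lin_right[OF u v p])
    then show "\<Phi> (lc a u b v) = a * \<Phi> u + b * \<Phi> v" by (rule LIMSEQ_unique[OF \<Phi>[OF Pk.comb[OF u v]]])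
  qed
  have fin: "finite (Pidx k)" by (simp add: Pidx_def)
  have n0: "\<Phi> q = 0" if "q \<in> Pk k" "G q q = 0" for q
  proof -
    have "q = (\<lambda>_. 0)" by (rule null[OF that])
    then show ?thesis using lin_space.lin_on_zero[OF Pk.lin_space_axioms lin] by simp
  qed
  obtain q where q: "q \<in> Pk k" "\<forall>r\<in>Pk k. \<Phi> r = G q r"
    using span_riesz[OF fin, of monom2 G \<Phi>] G lin n0 unfolding Pk_span[symmetric] by blast
  have d: "(\<lambda>x. p n x - q x) \<in> Pk k" for n by (rule Pk.diff[OF p q(1)])
  have "(\<lambda>n. l2ip E (\<lambda>x. p n x - q x) (\<lambda>x. p n x - q x)) \<longlonglongrightarrow> 0"
  proof (rule span_weak_conv[OF fin, of monom2 G "l2ip E" "\<lambda>n x. p n x - q x", folded Pk_span])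
    show "l2ip E r r = 0" if "r \<in> Pk k" "G r r = 0" for r
      using null[OF that] by (simp add: l2ip_def)
    show "(\<lambda>n. G (\<lambda>x. p n x - q x) r) \<longlonglongrightarrow> 0" if r: "r \<in> Pk k" for r
    proof -
      have "G (\<lambda>x. p n x - q x) r = G (p n) r - G q r" for n using G.lin[OF p q(1) r, of 1 n "-1"] by simp
      then show ?thesis using tendsto_diff[OF \<Phi>[OF r] tendsto_const[of "G q r"]] q(2) r by simp
    qed
  qed (rule G Pk_psd d)+
  then have l: "L2lim E p q"
    unfolding l2norm_def by (rule tendsto_real_sqrt[of _ 0, simplified])
  have "F \<psi> = l2ip E q \<psi>" if \<psi>: "\<psi> \<in> test_fun E" for \<psi>
    by (rule LIMSEQ_unique[OF lim[OF \<psi>] l2_conv_ip[OF Pk_L2[OF p] Pk_L2[OF q(1)] test_fun_L2[OF \<psi> meas] l]])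
  then show ?thesis using q(1) by blast
qed

end

subsection \<open>Closedness of the local space\<close>

context element
begin

text \<open>The normal component is a polynomial by definition of the space, the tangential one is
  the derivative of the polynomial trace. Since edge direction and normal are orthogonal, both
  Cartesian components are combinations of these with constant coefficients on the edge.\<close>

lemma edge_grad_polys:
  assumes \<phi>: "\<phi> \<in> Hs 2 E" "tdata \<phi> t gx gy" and i: "i < length vs"
    and q: "q \<in> Pk K" "\<And>x. x \<in> edge vs i ==> t x = q x"
    and r: "r \<in> Pk K" "\<And>x. x \<in> edge vs i ==> (gx x, gy x) \<bullet> enormal vs i = r x"
  shows "\<exists>p\<in>Pk K. \<forall>x\<in>edge vs i. gx x = p x" "\<exists>p\<in>Pk K. \<forall>x\<in>edge vs i. gy x = p x"
proof -
  define e where "e = nxt vs i - vs ! i"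
  define m where "m = norm e"
  have m: "m \<noteq> 0" using nxt_neq[OF poly i] by (simp add: m_def e_def)
  have m2: "m * m = fst e * fst e + snd e * snd e"
    using dot_square_norm[of e] by (simp add: m_def inner_prod_def power2_eq_square)
  define \<tau> where "\<tau> x = fst e * pdx q x + snd e * pdy q x" for x
  have \<tau>: "\<tau> \<in> Pk K" unfolding \<tau>_def using Pk_pd[OF q(1)] Pk_mono[of "K - 1" K] by (intro Pk.comb) auto
  have tr: "cont_trace vs \<phi> t" "cont_trace vs (wD E 1 0 \<phi>) gx" "cont_trace vs (wD E 0 1 \<phi>) gy" using \<phi>(2) by (auto simp: tdata_def)
  note c = cont_trace_line[OF tr(2) i] cont_trace_line[OF tr(3) i]
  have et: "edge_trace E (vs ! i) (nxt vs i) \<phi> q"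
    by (rule edge_trace_eq_on[of _ _ _ _ t]) (use tr(1) i q(2) ln_edge in \<open>auto simp: cont_trace_def\<close>)
  have eg: "edge_trace E (vs ! i) (nxt vs i) (wD E 1 0 \<phi>) gx" "edge_trace E (vs ! i) (nxt vs i) (wD E 0 1 \<phi>) gy"
    using tr i by (auto simp: cont_trace_def)
  have tang: "fst e * gx (ln i s) + snd e * gy (ln i s) = \<tau> (ln i s)" if s: "s \<in> {0..1}" for s
  proof -
    let ?g = "\<lambda>s. (fst e * gx (ln i s) + snd e * gy (ln i s)) - \<tau> (ln i s)"
    have "?g s = 0"
    proof (rule edge_zero[OF i _ _ s, of ?g])
      have "continuous_on {0..1} (\<lambda>s. \<tau> (ln i s))"
        by (rule continuous_on_compose2[OF smooth_continuous[OF Pk_smooth[OF \<tau>]]]) (auto intro!: continuous_intros)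
      then show "continuous_on {0..1} ?g" by (intro continuous_intros c)
      show "?g s = 0" if cd: "collar_domain E (vs ! i) (nxt vs i) s0 s1 d" "s0 < s" "s < s1" for s0 s1 d s
        using collar_domain.tangential_trace[OF cd(1) \<phi>(1) Pk_smooth[OF q(1)] et eg c cd(2,3)] by (simp add: \<tau>_def e_def)
    qed
    then show ?thesis by simp
  qed
  have nrm: "gx x * snd e - gy x * fst e = m * r x" if "x \<in> edge vs i" for x
  proof -
    have "(gx x * snd e - gy x * fst e) / m = r x"
      using r(2)[OF that] by (simp add: enormal_def Let_def inner_prod_def e_def[symmetric] m_def[symmetric] diff_divide_distrib)
    then show ?thesis using m by (simp add: field_simps)
  qed
  have ta: "fst e * gx x + snd e * gy x = \<tau> x" if x: "x \<in> edge vs i" for x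
  proof -
    obtain s where s: "s \<in> {0..1}" "x = ln i s" using edge_param[OF x] by blast
    show ?thesis using tang[OF s(1)] s(2) by simp
  qed
  show "\<exists>p\<in>Pk K. \<forall>x\<in>edge vs i. gx x = p x"
  proof (rule bexI[rotated])
    show "(\<lambda>x. (fst e / (m * m)) * \<tau> x + (snd e * m / (m * m)) * r x) \<in> Pk K" by (intro Pk.comb \<tau> r)
    show "\<forall>x\<in>edge vs i. gx x = (fst e / (m * m)) * \<tau> x + (snd e * m / (m * m)) * r x"
    proof
    fix x assume x: "x \<in> edge vs i"
    have "gx x * (m * m) = fst e * (fst e * gx x + snd e * gy x) + snd e * (gx x * snd e - gy x * fst e)"
      unfolding m2 by (simp add: algebra_simps)
    also have "\<dots> = fst e * \<tau> x + snd e * (m * r x)" unfolding ta[OF x] nrm[OF x] ..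
    finally have "gx x = (fst e * \<tau> x + snd e * (m * r x)) / (m * m)" using m by (simp add: eq_divide_eq)
    then show "gx x = (fst e / (m * m)) * \<tau> x + (snd e * m / (m * m)) * r x" by (simp add: add_divide_distrib mult.assoc)
    qed
  qed
  show "\<exists>p\<in>Pk K. \<forall>x\<in>edge vs i. gy x = p x"
  proof (rule bexI[rotated])
    show "(\<lambda>x. (snd e / (m * m)) * \<tau> x + (- (fst e * m) / (m * m)) * r x) \<in> Pk K" by (intro Pk.comb \<tau> r)
    show "\<forall>x\<in>edge vs i. gy x = (snd e / (m * m)) * \<tau> x + (- (fst e * m) / (m * m)) * r x"
    proof
    fix x assume x: "x \<in> edge vs i"
    have "gy x * (m * m) = snd e * (fst e * gx x + snd e * gy x) - fst e * (gx x * snd e - gy x * fst e)"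
      unfolding m2 by (simp add: algebra_simps)
    also have "\<dots> = snd e * \<tau> x - fst e * (m * r x)" unfolding ta[OF x] nrm[OF x] ..
    finally have "gy x = (snd e * \<tau> x - fst e * (m * r x)) / (m * m)" using m by (simp add: eq_divide_eq)
    then show "gy x = (snd e / (m * m)) * \<tau> x + (- (fst e * m) / (m * m)) * r x" by (simp add: diff_divide_distrib mult.assoc)
    qed
  qed
qed

text \<open>A single collar at the beginning of the edge suffices: the traces are polynomials, and a
  polynomial is determined on the whole edge by its values on a piece.\<close>

lemma edge_limit:
  assumes w: "\<And>n. w n \<in> Hs 1 E" "w' \<in> Hs 1 E" "H1lim w w'" and i: "i < length vs"
    and t: "\<And>n. edge_trace E (vs ! i) (nxt vs i) (w n) (t n)" and p: "\<And>n. \<exists>p\<in>Pk K. \<forall>x\<in>edge vs i. t n x = p x"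
  shows "\<exists>q\<in>Pk K. edge_trace E (vs ! i) (nxt vs i) w' q \<and> (\<forall>x\<in>edge vs i. (\<lambda>n. t n x) \<longlonglongrightarrow> q x)"
proof -
  obtain s1 d where c: "collar_domain E (vs ! i) (nxt vs i) 0 s1 d" using collar_at[OF i, of 0] by auto
  have "\<forall>n. \<exists>p. p \<in> Pk K \<and> (\<forall>x\<in>edge vs i. t n x = p x)" using p by blast
  then obtain p where p: "\<forall>n. p n \<in> Pk K \<and> (\<forall>x\<in>edge vs i. t n x = p n x)" using choice[of "\<lambda>n p. p \<in> Pk K \<and> (\<forall>x\<in>edge vs i. t n x = p x)"] by blast
  have pP: "p n \<in> Pk K" and pe: "x \<in> edge vs i ==> t n x = p n x" for n x using p by auto
  have e: "edge_trace E (vs ! i) (nxt vs i) (w n) (p n)" for n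
    by (rule edge_trace_eq_on[OF t]) (simp add: pe[OF ln_edge])
  have l: "L2lim E w w'" "L2lim E (\<lambda>n. wD E 1 0 (w n)) (wD E 1 0 w')"
    "L2lim E (\<lambda>n. wD E 0 1 (w n)) (wD E 0 1 w')" using w(3) unfolding H1lim_def by auto
  obtain q where q: "q \<in> Pk K" "edge_trace E (vs ! i) (nxt vs i) w' q" "\<forall>s. (\<lambda>n. p n (ln i s)) \<longlonglongrightarrow> q (ln i s)"
    using collar_domain.edge_poly_limit[OF c, where w = w and w' = w' and p = p and k = K, OF w(1,2) e pP l] by blast
  have "(\<lambda>n. t n x) \<longlonglongrightarrow> q x" if x: "x \<in> edge vs i" for x
  proof -
    obtain s where s: "x = ln i s" using edge_param[OF x] by blast
    show ?thesis using q(3)[rule_format, of s] pe[OF x] s by simp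
  qed
  then show ?thesis using q(1,2) by blast
qed

text \<open>Take the pointwise limit as candidate. On each edge it equals a polynomial, and at a
  shared vertex both polynomials are limits of the same values, so the pieces fit together
  continuously.\<close>

lemma cont_trace_limit:
  assumes w: "\<And>n. w n \<in> Hs 1 E" "w' \<in> Hs 1 E" "H1lim w w'"
    and t: "\<And>n. cont_trace vs (w n) (t n)" and p: "\<And>n i. i < length vs ==> \<exists>p\<in>Pk K. \<forall>x\<in>edge vs i. t n x = p x"
  shows "\<exists>t'. cont_trace vs w' t' \<and> (\<forall>x\<in>bdry vs. (\<lambda>n. t n x) \<longlonglongrightarrow> t' x) \<and> (\<forall>i<length vs. \<exists>q\<in>Pk K. \<forall>x\<in>edge vs i. t' x = q x)"
proof -
  define t' where "t' x = lim (\<lambda>n. t n x)" for x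
  have A: "\<exists>q\<in>Pk K. edge_trace E (vs ! i) (nxt vs i) w' q \<and> (\<forall>x\<in>edge vs i. (\<lambda>n. t n x) \<longlonglongrightarrow> q x \<and> t' x = q x)" if i: "i < length vs" for i
  proof -
    have e: "edge_trace E (vs ! i) (nxt vs i) (w n) (t n)" for n using t i by (simp add: cont_trace_def)
    obtain q where q: "q \<in> Pk K" "edge_trace E (vs ! i) (nxt vs i) w' q" "\<forall>x\<in>edge vs i. (\<lambda>n. t n x) \<longlonglongrightarrow> q x"
      using edge_limit[OF w i e p[OF i]] by blast
    have "t' x = q x" if "x \<in> edge vs i" for x unfolding t'_def using q(3) that by (intro limI) blast
    then show ?thesis using q by blast
  qed
  have "cont_trace vs w' t'" unfolding cont_trace_def bdry_def
  proof (intro conjI allI impI)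
    show "continuous_on (\<Union>i<length vs. edge vs i) t'"
    proof (rule continuous_on_closed_Union)
      fix i assume "i \<in> {..<length vs}"
      then have i: "i < length vs" by simp
      show "closed (edge vs i)" by (simp add: edge_def)
      obtain q where q: "q \<in> Pk K" "\<forall>x\<in>edge vs i. t' x = q x" using A[OF i] by blast
      have "continuous_on (edge vs i) q" using smooth_continuous[OF Pk_smooth[OF q(1)]] continuous_on_subset by blast
      then show "continuous_on (edge vs i) t'" using q(2) by (simp cong: continuous_on_cong)
    qed simp
    fix i assume i: "i < length vs"
    obtain q where q: "edge_trace E (vs ! i) (nxt vs i) w' q" "\<forall>x\<in>edge vs i. t' x = q x" using A[OF i] by blast
    show "edge_trace E (vs ! i) (nxt vs i) w' t'"
      by (rule edge_trace_eq_on[OF q(1)]) (simp add: q(2) ln_edge)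
  qed
  moreover have "(\<lambda>n. t n x) \<longlonglongrightarrow> t' x" if x: "x \<in> bdry vs" for x
  proof -
    obtain i where i: "i < length vs" "x \<in> edge vs i" using bdry_edge[OF x] by blast
    obtain q where "\<forall>x\<in>edge vs i. (\<lambda>n. t n x) \<longlonglongrightarrow> q x \<and> t' x = q x" using A[OF i(1)] by blast
    then show ?thesis using i(2) by simp
  qed
  moreover have "\<exists>q\<in>Pk K. \<forall>x\<in>edge vs i. t' x = q x" if "i < length vs" for i using A[OF that] by blast
  ultimately show ?thesis by blast
qed

end

context velement
begin

text \<open>Each gradient component is handled in degree max 3 k, high enough to contain both the
  derivative of the trace and the normal data. This yields continuous limits but forgets the degree
  bound on the normal component.\<close>

lemma tdata_limit:
  assumes u: "\<And>n. u n \<in> Hs 2 E" "u' \<in> Hs 2 E" "H2lim u u'"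
    and t: "\<And>n. tdata (u n) (t n) (gx n) (gy n)" "\<And>n. edge_polys (t n) (gx n) (gy n)"
  shows "\<exists>t' gx' gy'. tdata u' t' gx' gy' \<and> edge_polys t' gx' gy' \<and>
    (\<forall>x\<in>bdry vs. (\<lambda>n. t n x) \<longlonglongrightarrow> t' x \<and> (\<lambda>n. gx n x) \<longlonglongrightarrow> gx' x \<and> (\<lambda>n. gy n x) \<longlonglongrightarrow> gy' x)"
proof -
  let ?K = "max 3 k"
  note H = H2lim_H1lim[OF u]
  note u1 = Hs_mono[OF _ u(1), of 1] Hs_mono[OF _ u(2), of 1]
  note ux = Hs1_wD(1)[OF op u(1)] Hs1_wD(1)[OF op u(2)] and uy = Hs1_wD(2)[OF op u(1)] Hs1_wD(2)[OF op u(2)]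
  have tr: "cont_trace vs (u n) (t n)" "cont_trace vs (wD E 1 0 (u n)) (gx n)" "cont_trace vs (wD E 0 1 (u n)) (gy n)" for n
    using t(1)[of n] by (auto simp: tdata_def)
  have q: "\<exists>q\<in>Pk ?K. \<forall>x\<in>edge vs i. t n x = q x" and r: "\<exists>r\<in>Pk (k - 1). \<forall>x\<in>edge vs i. (gx n x, gy n x) \<bullet> enormal vs i = r x"
    if "i < length vs" for n i using t(2)[of n] that unfolding edge_polys_def by blast+
  have g: "(\<exists>p\<in>Pk ?K. \<forall>x\<in>edge vs i. gx n x = p x) \<and> (\<exists>p\<in>Pk ?K. \<forall>x\<in>edge vs i. gy n x = p x)" if i: "i < length vs" for n i
  proof -
    obtain q where q: "q \<in> Pk ?K" "\<forall>x\<in>edge vs i. t n x = q x" using q[OF i] by blast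
    obtain r where r: "r \<in> Pk (k - 1)" "\<forall>x\<in>edge vs i. (gx n x, gy n x) \<bullet> enormal vs i = r x" using r[OF i] by blast
    have "r \<in> Pk ?K" by (rule subsetD[OF Pk_mono r(1)]) simp
    then show ?thesis using edge_grad_polys[OF u(1) t(1) i q(1) q(2)[rule_format] _ r(2)[rule_format]] by blast
  qed
  obtain t' where t': "cont_trace vs u' t'" "\<forall>x\<in>bdry vs. (\<lambda>n. t n x) \<longlonglongrightarrow> t' x" "\<forall>i<length vs. \<exists>q\<in>Pk ?K. \<forall>x\<in>edge vs i. t' x = q x"
    using cont_trace_limit[of u u' t ?K, OF u1 H(1) tr(1) q] by auto
  obtain gx' where gx': "cont_trace vs (wD E 1 0 u') gx'" "\<forall>x\<in>bdry vs. (\<lambda>n. gx n x) \<longlonglongrightarrow> gx' x"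
    using cont_trace_limit[of "\<lambda>n. wD E 1 0 (u n)" "wD E 1 0 u'" gx ?K, OF ux H(2) tr(2)] g by blast
  obtain gy' where gy': "cont_trace vs (wD E 0 1 u') gy'" "\<forall>x\<in>bdry vs. (\<lambda>n. gy n x) \<longlonglongrightarrow> gy' x"
    using cont_trace_limit[of "\<lambda>n. wD E 0 1 (u n)" "wD E 0 1 u'" gy ?K, OF uy H(3) tr(3)] g by blast
  \<comment> \<open>The degree k - 1 is recovered by applying the edge limit once more to the normal
    component alone, and comparing pointwise limits.\<close>
  have "\<exists>r\<in>Pk (k - 1). \<forall>x\<in>edge vs i. (gx' x, gy' x) \<bullet> enormal vs i = r x" if i: "i < length vs" for i
  proof -
    let ?a = "fst (enormal vs i)" and ?b = "snd (enormal vs i)"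
    interpret Hs: lin_space "Hs 1 E" by (rule Hs_lin_space[OF meas])
    let ?g = "\<lambda>n x. ?a * gx n x + ?b * gy n x"
    have e: "edge_trace E (vs ! i) (nxt vs i) (\<lambda>x. ?a * wD E 1 0 (u n) x + ?b * wD E 0 1 (u n) x) (?g n)" for n
      using tr(2,3) i edge_trace_comb by (auto simp: cont_trace_def)
    have "\<exists>q\<in>Pk (k - 1). \<forall>x\<in>edge vs i. ?g n x = q x" for n
      using r[OF i, of n] by (simp add: inner_prod_def mult.commute)
    then obtain q where qq: "q \<in> Pk (k - 1)" "\<forall>x\<in>edge vs i. (\<lambda>n. ?g n x) \<longlonglongrightarrow> q x"
      using edge_limit[OF Hs.comb[OF ux(1) uy(1)] Hs.comb[OF ux(2) uy(2)] H1lim_comb[OF ux H(2) uy H(3)] i e] by blast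
    have "(gx' x, gy' x) \<bullet> enormal vs i = q x" if x: "x \<in> edge vs i" for x
    proof -
      have xb: "x \<in> bdry vs" using edge_subset_bdry[OF i] x by blast
      have "(\<lambda>n. ?g n x) \<longlonglongrightarrow> ?a * gx' x + ?b * gy' x" using gx'(2) gy'(2) xb by (intro tendsto_intros) auto
      then have "?a * gx' x + ?b * gy' x = q x" using qq(2) x LIMSEQ_unique by blast
      then show ?thesis by (simp add: inner_prod_def mult.commute)
    qed
    then show ?thesis using qq(1) by blast
  qed
  then have "edge_polys t' gx' gy'" unfolding edge_polys_def using t'(3) by blast
  moreover have "tdata u' t' gx' gy'" using t'(1) gx'(1) gy'(1) by (simp add: tdata_def)
  ultimately show ?thesis using t'(2) gx'(2) gy'(2) by blast
qed

lemma vavg_tendsto: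
  assumes "\<And>x. x \<in> bdry vs ==> (\<lambda>n. t n x) \<longlonglongrightarrow> t' x"
  shows "(\<lambda>n. vavg vs (t n)) \<longlonglongrightarrow> vavg vs t'"
proof -
  have "vs ! i \<in> bdry vs" if "i < length vs" for i using vertex_edge(2) edge_subset_bdry[OF that] by blast
  then have "(\<lambda>n. \<Sum>i<length vs. t n (vs ! i)) \<longlonglongrightarrow> (\<Sum>i<length vs. t' (vs ! i))" by (intro tendsto_sum assms) simp
  then show ?thesis unfolding vavg_def using vs_ne by (intro tendsto_divide tendsto_const) auto
qed

text \<open>The projection of the difference pairs to 0 in \<open>PiD_form\<close>: the energy part
  by Cauchy-Schwarz, the averages because traces converge at the vertices. Definiteness on
  polynomials turns this into L^2 convergence.\<close>

lemma PiD_conv: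
  assumes u: "\<And>n. u n \<in> Hs 2 E" "u' \<in> Hs 2 E" "H2lim u u'" and t: "\<And>n. tdata (u n) (t n) (gx n) (gy n)" "tdata u' t' gx' gy'"
    and lim: "\<forall>x\<in>bdry vs. (\<lambda>n. t n x) \<longlonglongrightarrow> t' x \<and> (\<lambda>n. gx n x) \<longlonglongrightarrow> gx' x \<and> (\<lambda>n. gy n x) \<longlonglongrightarrow> gy' x"
  shows "L2lim E (\<lambda>n. PiD \<sigma> k vs (u n)) (PiD \<sigma> k vs u')"
proof -
  interpret A: psd_form "Hs 2 E" "Aform \<sigma> E" by (rule Aform_psd[OF \<sigma>])
  have fin: "finite (Pidx k)" by (simp add: Pidx_def)
  define d where "d n = (\<lambda>x. PiD \<sigma> k vs (u n) x - PiD \<sigma> k vs u' x)" for n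
  let ?u = "\<lambda>n x. 1 * u n x + (-1) * u' x"
  have uH: "?u n \<in> Hs 2 E" for n by (intro A.comb u)
  have td: "tdata (?u n) (\<lambda>x. 1 * t n x + (-1) * t' x) (\<lambda>x. 1 * gx n x + (-1) * gx' x) (\<lambda>x. 1 * gy n x + (-1) * gy' x)" for n
    by (rule tdata_comb[OF u(1) t(1) u(2) t(2)])
  have dn: "d n = PiD \<sigma> k vs (?u n)" for n
    using PiD_comb[OF u(1)[of n] t(1)[of n] u(2) t(2), of 1 "-1"] by (simp add: d_def)
  note sp = PiD_spec[OF uH td, folded dn]
  have v: "(\<lambda>n. vavg vs (\<lambda>x. 1 * f n x + (-1) * f' x)) \<longlonglongrightarrow> 0" if "\<And>x. x \<in> bdry vs ==> (\<lambda>n. f n x) \<longlonglongrightarrow> f' x" for f f'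
  proof -
    have "(\<lambda>n. 1 * vavg vs (f n) + (-1) * vavg vs f') \<longlonglongrightarrow> 1 * vavg vs f' + (-1) * vavg vs f'"
      by (intro tendsto_intros vavg_tendsto that)
    then show ?thesis unfolding vavg_comb by simp
  qed
  have "(\<lambda>n. l2ip E (d n) (d n)) \<longlonglongrightarrow> 0"
  proof (rule span_weak_conv[OF fin, of monom2 "PiD_form \<sigma> vs" "l2ip E" d, folded Pk_span])
    show "l2ip E q q = 0" if "q \<in> Pk k" "PiD_form \<sigma> vs q q = 0" for q
      using PiD_form_null[OF \<sigma> vs_ne that] by (simp add: l2ip_def)
    fix q assume q: "q \<in> Pk k"
    have "(\<lambda>n. Aform \<sigma> E (?u n) (?u n)) \<longlonglongrightarrow> 0" using Aform_conv[OF \<sigma> u] by simp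
    then have "(\<lambda>n. sqrt (Aform \<sigma> E (?u n) (?u n)) * sqrt (Aform \<sigma> E q q)) \<longlonglongrightarrow> sqrt 0 * sqrt (Aform \<sigma> E q q)" by (intro tendsto_intros)
    then have l: "(\<lambda>n. sqrt (Aform \<sigma> E (?u n) (?u n)) * sqrt (Aform \<sigma> E q q)) \<longlonglongrightarrow> 0" by simp
    have "(\<lambda>n. Aform \<sigma> E (?u n) q) \<longlonglongrightarrow> 0"
    proof (rule Lim_null_comparison[OF always_eventually l], rule allI)
      show "norm (Aform \<sigma> E (?u n) q) \<le> sqrt (Aform \<sigma> E (?u n) (?u n)) * sqrt (Aform \<sigma> E q q)" for n
        using A.cauchy_schwarz_abs[OF uH[of n] Pk_Hs[OF q]] by simp
    qed
    moreover have "(\<lambda>n. vavg vs (d n)) \<longlonglongrightarrow> 0" "(\<lambda>n. vavg vs (pdx (d n))) \<longlonglongrightarrow> 0" "(\<lambda>n. vavg vs (pdy (d n))) \<longlonglongrightarrow> 0"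
      unfolding sp(3-5) by (rule v, use lim in blast)+
    ultimately have "(\<lambda>n. PiD_form \<sigma> vs (d n) q) \<longlonglongrightarrow> 0 + 0 * vavg vs q + 0 * vavg vs (pdx q) + 0 * vavg vs (pdy q)"
      unfolding PiD_form_def sp(2)[OF q] by (intro tendsto_intros)
    then show "(\<lambda>n. PiD_form \<sigma> vs (d n) q) \<longlonglongrightarrow> 0" by simp
  qed (rule PiD_form_psd[OF \<sigma>] Pk_psd sp(1))+
  then show ?thesis unfolding l2norm_def d_def by (rule tendsto_real_sqrt[of _ 0, simplified])
qed

text \<open>The bilaplacian condition passes to the limit by \<open>Pk_weak_limit\<close>, the
  boundary conditions by \<open>tdata_limit\<close>, and the moment conditions by
  \<open>PiD_conv\<close> together with L^2 convergence.\<close>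

theorem ZE_closed:
  assumes u: "\<And>n. u n \<in> ZE \<sigma> k vs" and u': "u' \<in> Hs 2 E" "H2lim u u'"
  shows "u' \<in> ZE \<sigma> k vs"
proof -
  note uZ = ZE_Ztilde[OF u] and uH = ZE_Hs[OF u]
  have l: "L2lim E u u'" using u'(2) by (simp add: H2lim_def)
  have ip: "(\<lambda>n. l2ip E (u n) v) \<longlonglongrightarrow> l2ip E u' v" if "v \<in> L2 E" for v
    by (rule l2_conv_ip[OF Hs_L2[OF uH] Hs_L2[OF u'(1)] that l])
  \<comment> \<open>Bundles the three boundary functions in one triple, so that a single use of
    choice selects them for all n coherently.\<close>
  define Q where "Q n T \<longleftrightarrow> tdata (u n) (fst T) (fst (snd T)) (snd (snd T)) \<and> edge_polys (fst T) (fst (snd T)) (snd (snd T))" for n and T :: "fld \<times> fld \<times> fld"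
  have "\<forall>n. \<exists>T. Q n T"
  proof
    fix n obtain t gx gy where "tdata (u n) t gx gy" "edge_polys t gx gy" using uZ[of n] unfolding Ztilde_iff by blast
    then have "Q n (t, gx, gy)" by (simp add: Q_def)
    then show "\<exists>T. Q n T" by blast
  qed
  then obtain T where T: "\<forall>n. Q n (T n)" using choice[of Q] by blast
  have t: "tdata (u n) (fst (T n)) (fst (snd (T n))) (snd (snd (T n)))" "edge_polys (fst (T n)) (fst (snd (T n))) (snd (snd (T n)))" for n
    using T[rule_format, of n] unfolding Q_def by auto
  obtain t' gx' gy' where t': "tdata u' t' gx' gy'" "edge_polys t' gx' gy'"
    "\<forall>x\<in>bdry vs. (\<lambda>n. fst (T n) x) \<longlonglongrightarrow> t' x \<and> (\<lambda>n. fst (snd (T n)) x) \<longlonglongrightarrow> gx' x \<and> (\<lambda>n. snd (snd (T n)) x) \<longlonglongrightarrow> gy' x"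
    using tdata_limit[OF uH u' t] by blast
  have "\<forall>n. \<exists>p. p \<in> Pk k \<and> (\<forall>\<psi>\<in>test_fun E. l2ip E (u n) (bilap \<psi>) = l2ip E p \<psi>)"
    using uZ unfolding Ztilde_iff by blast
  then obtain p where p: "\<forall>n. p n \<in> Pk k \<and> (\<forall>\<psi>\<in>test_fun E. l2ip E (u n) (bilap \<psi>) = l2ip E (p n) \<psi>)"
    using choice[of "\<lambda>n p. p \<in> Pk k \<and> (\<forall>\<psi>\<in>test_fun E. l2ip E (u n) (bilap \<psi>) = l2ip E p \<psi>)"] by blast
  have pP: "p n \<in> Pk k" and pe: "\<psi> \<in> test_fun E ==> l2ip E (u n) (bilap \<psi>) = l2ip E (p n) \<psi>" for n \<psi> using p by auto
  have "(\<lambda>n. l2ip E (p n) \<psi>) \<longlonglongrightarrow> l2ip E u' (bilap \<psi>)" if \<psi>: "\<psi> \<in> test_fun E" for \<psi>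
    using ip[OF bilap_L2[OF \<psi>]] pe[OF \<psi>] by simp
  then have "\<exists>q\<in>Pk k. \<forall>\<psi>\<in>test_fun E. l2ip E u' (bilap \<psi>) = l2ip E q \<psi>"
    by (rule Pk_weak_limit[OF pP, where F = "\<lambda>\<psi>. l2ip E u' (bilap \<psi>)"])
  then have Z: "u' \<in> Ztilde k vs" unfolding Ztilde_iff using u'(1) t'(1,2) by blast
  show ?thesis unfolding ZE_def mem_Collect_eq
  proof (intro conjI allI impI ballI Z)
    fix \<alpha> m assume \<alpha>: "k \<le> \<alpha> + 3 \<and> \<alpha> \<le> k" and m: "m \<in> scaled_monomials vs \<alpha>"
    note mL = scaled_monomial_L2[OF m]
    have e: "l2ip E (PiD \<sigma> k vs (u n)) m = l2ip E (u n) m" for n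
    proof -
      have "l2ip E m (PiD \<sigma> k vs (u n)) = l2ip E m (u n)" using u[of n] \<alpha> m unfolding ZE_def by blast
      then show ?thesis by (simp add: l2ip_def mult.commute)
    qed
    have "(\<lambda>n. l2ip E (PiD \<sigma> k vs (u n)) m) \<longlonglongrightarrow> l2ip E (PiD \<sigma> k vs u') m"
      by (rule l2_conv_ip[OF Pk_L2[OF PiD_Ztilde[OF uZ]] Pk_L2[OF PiD_Ztilde[OF Z]] mL PiD_conv[OF uH u' t(1) t'(1,3)]])
    then have "l2ip E (PiD \<sigma> k vs u') m = l2ip E u' m"
      using ip[OF mL] unfolding e by (rule LIMSEQ_unique)
    then show "l2ip E m (PiD \<sigma> k vs u') = l2ip E m u'" by (simp add: l2ip_def mult.commute)
  qed
qed

end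

section \<open>A first derivative bounded by the second one\<close>

text \<open>Lebesgue measurable functions need not have measurable sections. A Borel representative
  that is 0 outside E makes Tonelli and Fubini on product Borel spaces applicable.\<close>

lemma L2_borel_rep:
  fixes E :: "pt set"
  assumes E: "E \<in> sets borel" and u: "u \<in> L2 E"
  shows "\<exists>g. g \<in> borel_measurable borel \<and> (\<forall>x. x \<notin> E --> g x = 0) \<and> (AE x in lebesgue_on E. u x = g x) \<and> integrable lborel (\<lambda>x. (g x)\<^sup>2)"
proof -
  have El: "E \<in> sets lebesgue" using E by simp
  define f where "f x = indicator E x *\<^sub>R u x" for x
  have f: "f \<in> borel_measurable (completion lborel)"
    unfolding f_def[abs_def] using L2_measurable[OF u] El by (simp add: borel_measurable_restrict_space_iff)
  have fi: "integrable lebesgue (\<lambda>x. (f x)\<^sup>2)"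
  proof -
    have "integrable lebesgue (\<lambda>x. indicator E x *\<^sub>R (u x)\<^sup>2)"
      using u El by (simp add: L2_def integrable_restrict_space)
    moreover have "(\<lambda>x. indicator E x *\<^sub>R (u x)\<^sup>2) = (\<lambda>x. (f x)\<^sup>2)" by (auto simp: f_def fun_eq_iff indicator_def)
    ultimately show ?thesis by simp
  qed
  obtain g0 where g0: "g0 \<in> borel_measurable lborel" "AE x in lborel. f x = g0 x" using completion_ex_borel_measurable_real[OF f] by blast
  define g where "g x = indicator E x * g0 x" for x
  have g: "g \<in> borel_measurable borel" unfolding g_def[abs_def] using g0(1) E by (intro borel_measurable_times borel_measurable_indicator) auto
  have ae: "AE x in lebesgue. f x = g x" using AE_completion[OF g0(2)] by eventually_elim (auto simp: f_def g_def indicator_def)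
  have "(\<lambda>x. (g x)\<^sup>2) \<in> borel_measurable lebesgue" using g by (intro measurable_completion) simp
  then have "integrable lebesgue (\<lambda>x. (g x)\<^sup>2)"
    by (rule Bochner_Integration.integrable_cong_AE_imp[OF fi]) (use ae in auto)
  then have gi: "integrable lborel (\<lambda>x. (g x)\<^sup>2)" using g by (subst (asm) integrable_completion) auto
  have "AE x in lebesgue_on E. u x = g x"
    using ae El by (subst AE_restrict_space_iff) (auto simp: f_def elim!: eventually_mono)
  moreover have "\<forall>x. x \<notin> E --> g x = 0" by (simp add: g_def)
  ultimately show ?thesis using g gi by blast
qed

lemma l2ip_lborel:
  fixes E :: "pt set"
  assumes "E \<in> sets borel" "g \<in> borel_measurable borel" "w \<in> borel_measurable borel" "\<And>x. x \<notin> E ==> g x = 0"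
  shows "l2ip E g w = (LINT x|lborel. g x * w x)"
proof -
  have "l2ip E g w = (LINT x|lebesgue. indicator E x *\<^sub>R (g x * w x))"
    unfolding l2ip_def using assms(1) by (intro integral_restrict_space) simp
  also have "(\<lambda>x. indicator E x *\<^sub>R (g x * w x)) = (\<lambda>x. g x * w x)" using assms(4) by (auto simp: fun_eq_iff indicator_def)
  also have "(LINT x|lebesgue. g x * w x) = (LINT x|lborel. g x * w x)"
    using assms(2,3) by (intro integral_completion) simp
  finally show ?thesis .
qed

lemma square_integrable_imp:
  fixes g :: fld
  assumes gm: "g \<in> borel_measurable borel" and gi: "integrable lborel (\<lambda>x. (g x)\<^sup>2)"
    and E: "E \<in> sets borel" "bounded E" and z: "\<And>x. x \<notin> E ==> g x = 0"
  shows "integrable lborel g"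
proof (rule Bochner_Integration.integrable_bound)
  have "integrable lborel (indicat_real E)"
    using E emeasure_bounded_finite[OF E(2)] by (simp add: integrable_indicator_iff)
  then show "integrable lborel (\<lambda>x. indicat_real E x + (g x)\<^sup>2)" by (rule Bochner_Integration.integrable_add[OF _ gi])
  show "g \<in> borel_measurable lborel" using gm by simp
  have "\<bar>g x\<bar> \<le> \<bar>indicat_real E x + (g x)\<^sup>2\<bar>" for x
  proof (cases "x \<in> E")
    case True
    have "0 \<le> (\<bar>g x\<bar> - 1)\<^sup>2" by simp
    then have "2 * \<bar>g x\<bar> \<le> 1 + (g x)\<^sup>2" by (simp add: power2_diff)
    then show ?thesis using True by simp
  qed (simp add: z)
  then show "AE x in lborel. norm (g x) \<le> norm (indicat_real E x + (g x)\<^sup>2)" by simp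
qed

section \<open>Integral operators acting in the second variable\<close>

locale kernel =
  fixes K :: "real => real => real" and g :: fld and c p q :: real
  assumes Km[measurable]: "(\<lambda>x. K (fst x) (snd x)) \<in> borel_measurable borel" and gm[measurable]: "g \<in> borel_measurable borel"
    and Kb: "\<And>y z. \<bar>K y z\<bar> \<le> c * (indicator {p<..<q} y * indicator {p<..<q} z)" and c: "0 \<le> c" and pq: "p \<le> q"
    and gi: "integrable lborel (\<lambda>x. (g x)\<^sup>2)"
begin

definition h :: fld where "h x = (LINT z|lborel. K (snd x) z * g (fst x, z))"

lemma pair_measurable [measurable]:
  "(\<lambda>x. K (fst x) (snd x)) \<in> borel_measurable (borel \<Otimes>\<^sub>M borel)" "g \<in> borel_measurable (borel \<Otimes>\<^sub>M borel)"
  using Km gm by (simp_all add: borel_prod)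

lemma kernel_measurable [measurable]:
  "f \<in> borel_measurable N ==> e \<in> borel_measurable N ==> (\<lambda>x. K (f x) (e x)) \<in> borel_measurable N"
  using measurable_compose[of "\<lambda>x. (f x, e x)" N "borel \<Otimes>\<^sub>M borel", OF _ pair_measurable(1)] by simp

text \<open>Cauchy-Schwarz in z bounds h(x,y)^2 by c^2 (q-p) times the integral of g(x, .)^2, and
  only for y in the interval; integrating over y gives the second factor q - p. The estimate is
  carried out with nonnegative integrals, so that square integrability of h is a result.\<close>

lemma kernel_bound:
  shows "h \<in> borel_measurable borel" "integrable lborel (\<lambda>x. (h x)\<^sup>2)"
    "(LINT x|lborel. (h x)\<^sup>2) \<le> (c * (q - p))\<^sup>2 * (LINT x|lborel. (g x)\<^sup>2)"
proof -
  have hm: "h \<in> borel_measurable (borel \<Otimes>\<^sub>M borel)" unfolding h_def[abs_def] by measurable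
  then show hm': "h \<in> borel_measurable borel" by (simp add: borel_prod)
  note hm[measurable]
  let ?J = "{p<..<q}"
  have nnK: "(\<integral>\<^sup>+z. (ennreal \<bar>K y z\<bar>)\<^sup>2 \<partial>lborel) \<le> ennreal (c\<^sup>2 * (q - p)) * indicator ?J y" for y
  proof -
    have "(\<integral>\<^sup>+z. (ennreal \<bar>K y z\<bar>)\<^sup>2 \<partial>lborel) \<le> (\<integral>\<^sup>+z. (ennreal (c\<^sup>2) * indicator ?J y) * indicator ?J z \<partial>lborel)"
    proof (rule nn_integral_mono)
      fix z
      have "(ennreal \<bar>K y z\<bar>)\<^sup>2 = ennreal (\<bar>K y z\<bar>\<^sup>2)" by (simp add: ennreal_power)
      also have "\<dots> \<le> ennreal ((c * (indicator ?J y * indicator ?J z))\<^sup>2)" by (intro ennreal_leI power_mono Kb) simp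
      also have "\<dots> = (ennreal (c\<^sup>2) * indicator ?J y) * indicator ?J z" by (auto simp: indicator_def)
      finally show "(ennreal \<bar>K y z\<bar>)\<^sup>2 \<le> (ennreal (c\<^sup>2) * indicator ?J y) * indicator ?J z" .
    qed
    also have "\<dots> = (ennreal (c\<^sup>2) * indicator ?J y) * ennreal (q - p)" using pq by (subst nn_integral_cmult_indicator) auto
    also have "\<dots> = ennreal (c\<^sup>2 * (q - p)) * indicator ?J y" using pq by (simp add: ennreal_mult mult_ac)
    finally show ?thesis .
  qed
  have pw: "ennreal ((h x)\<^sup>2) \<le> (ennreal (c\<^sup>2 * (q - p)) * indicator ?J (snd x)) * (\<integral>\<^sup>+z. ennreal ((g (fst x, z))\<^sup>2) \<partial>lborel)" for x
  proof -
    \<comment> \<open>If the section is not integrable, the Bochner integral is 0 by convention and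
      the bound holds trivially.\<close>
    have "ennreal \<bar>h x\<bar> \<le> (\<integral>\<^sup>+z. ennreal \<bar>K (snd x) z * g (fst x, z)\<bar> \<partial>lborel)"
      unfolding h_def using integral_norm_bound_ennreal[of lborel "\<lambda>z. K (snd x) z * g (fst x, z)"] not_integrable_integral_eq[of lborel "\<lambda>z. K (snd x) z * g (fst x, z)"]
      by (cases "integrable lborel (\<lambda>z. K (snd x) z * g (fst x, z))") auto
    also have "\<dots> = (\<integral>\<^sup>+z. ennreal \<bar>K (snd x) z\<bar> * ennreal \<bar>g (fst x, z)\<bar> \<partial>lborel)" by (simp add: abs_mult ennreal_mult)
    finally have "(ennreal \<bar>h x\<bar>)\<^sup>2 \<le> (\<integral>\<^sup>+z. ennreal \<bar>K (snd x) z\<bar> * ennreal \<bar>g (fst x, z)\<bar> \<partial>lborel)\<^sup>2" by (rule power_mono) simp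
    also have "\<dots> \<le> (\<integral>\<^sup>+z. (ennreal \<bar>K (snd x) z\<bar>)\<^sup>2 \<partial>lborel) * (\<integral>\<^sup>+z. (ennreal \<bar>g (fst x, z)\<bar>)\<^sup>2 \<partial>lborel)"
      by (rule Cauchy_Schwarz_nn_integral) measurable
    also have "\<dots> \<le> (ennreal (c\<^sup>2 * (q - p)) * indicator ?J (snd x)) * (\<integral>\<^sup>+z. (ennreal \<bar>g (fst x, z)\<bar>)\<^sup>2 \<partial>lborel)"
      by (intro mult_right_mono nnK) simp
    finally show ?thesis by (simp add: ennreal_power)
  qed
  have nn: "(\<integral>\<^sup>+x. ennreal ((h x)\<^sup>2) \<partial>lborel) \<le> ennreal ((c * (q - p))\<^sup>2) * (\<integral>\<^sup>+x. ennreal ((g x)\<^sup>2) \<partial>lborel)"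
  proof -
    let ?G = "\<lambda>x. \<integral>\<^sup>+z. ennreal ((g (x, z))\<^sup>2) \<partial>lborel"
    have Gm: "?G \<in> borel_measurable lborel" by measurable
    have im: "(indicator ?J :: real => ennreal) \<in> borel_measurable lborel" by simp
    have M: "(\<lambda>x. (ennreal (c\<^sup>2 * (q - p)) * indicator ?J (snd x)) * ?G (fst x)) \<in> borel_measurable (lborel \<Otimes>\<^sub>M lborel)"
      by (intro borel_measurable_times_ennreal borel_measurable_const measurable_compose[OF measurable_snd im] measurable_compose[OF measurable_fst Gm])
    have "(\<integral>\<^sup>+x. ennreal ((h x)\<^sup>2) \<partial>lborel) \<le> (\<integral>\<^sup>+x. (ennreal (c\<^sup>2 * (q - p)) * indicator ?J (snd x)) * ?G (fst x) \<partial>lborel)"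
      by (intro nn_integral_mono pw)
    also have "\<dots> = (\<integral>\<^sup>+x. (ennreal (c\<^sup>2 * (q - p)) * indicator ?J (snd x)) * ?G (fst x) \<partial>(lborel \<Otimes>\<^sub>M lborel))" by (simp add: lborel_prod)
    also have "\<dots> = (\<integral>\<^sup>+x. \<integral>\<^sup>+y. (ennreal (c\<^sup>2 * (q - p)) * indicator ?J y) * ?G x \<partial>lborel \<partial>lborel)"
      by (subst lborel.nn_integral_fst[OF M, symmetric]) simp
    also have "\<dots> = (\<integral>\<^sup>+x. ennreal ((c * (q - p))\<^sup>2) * ?G x \<partial>lborel)"
    proof (rule nn_integral_cong)
      fix x
      have "(\<integral>\<^sup>+y. (ennreal (c\<^sup>2 * (q - p)) * indicator ?J y) * ?G x \<partial>lborel) = (ennreal (c\<^sup>2 * (q - p)) * ennreal (q - p)) * ?G x"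
        using pq by (subst nn_integral_multc) (auto simp: nn_integral_cmult_indicator)
      also have "ennreal (c\<^sup>2 * (q - p)) * ennreal (q - p) = ennreal ((c * (q - p))\<^sup>2)"
        using pq c by (subst ennreal_mult[symmetric]) (simp_all add: power2_eq_square mult_ac)
      finally show "(\<integral>\<^sup>+y. (ennreal (c\<^sup>2 * (q - p)) * indicator ?J y) * ?G x \<partial>lborel) = ennreal ((c * (q - p))\<^sup>2) * ?G x" .
    qed
    also have "\<dots> = ennreal ((c * (q - p))\<^sup>2) * (\<integral>\<^sup>+x. ?G x \<partial>lborel)" by (rule nn_integral_cmult) measurable
    also have "(\<integral>\<^sup>+x. ?G x \<partial>lborel) = (\<integral>\<^sup>+x. ennreal ((g x)\<^sup>2) \<partial>lborel)"
      by (subst lborel.nn_integral_fst) (measurable, simp add: lborel_prod)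
    finally show ?thesis .
  qed
  have gn: "(\<integral>\<^sup>+x. ennreal ((g x)\<^sup>2) \<partial>lborel) = ennreal ((LINT x|lborel. (g x)\<^sup>2))" by (rule nn_integral_eq_integral[OF gi]) simp
  have le: "(\<integral>\<^sup>+x. ennreal ((h x)\<^sup>2) \<partial>lborel) \<le> ennreal ((c * (q - p))\<^sup>2 * (LINT x|lborel. (g x)\<^sup>2))"
    using nn unfolding gn by (simp add: ennreal_mult)
  show hi: "integrable lborel (\<lambda>x. (h x)\<^sup>2)"
  proof (rule integrableI_bounded)
    show "(\<lambda>x. (h x)\<^sup>2) \<in> borel_measurable lborel" using hm' by simp
    show "(\<integral>\<^sup>+x. ennreal (norm ((h x)\<^sup>2)) \<partial>lborel) < \<infinity>" using le_less_trans[OF le] by simp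
  qed
  have "ennreal ((LINT x|lborel. (h x)\<^sup>2)) \<le> ennreal ((c * (q - p))\<^sup>2 * (LINT x|lborel. (g x)\<^sup>2))"
    using le nn_integral_eq_integral[OF hi] by simp
  then show "(LINT x|lborel. (h x)\<^sup>2) \<le> (c * (q - p))\<^sup>2 * (LINT x|lborel. (g x)\<^sup>2)"
    by (subst (asm) ennreal_le_iff) simp_all
qed


lemma h_outside:
  assumes gz: "\<And>x. x \<notin> {a<..<b} \<times> {p<..<q} ==> g x = 0" and x: "x \<notin> {a<..<b} \<times> {p<..<q}"
  shows "h x = 0"
proof -
  have "K (snd x) z * g (fst x, z) = 0" for z
    using Kb[of "snd x" z] gz[of "(fst x, z)"] x by (cases "snd x \<in> {p<..<q}") (auto simp: mem_Times_iff)
  then have "(\<lambda>z. K (snd x) z * g (fst x, z)) = (\<lambda>_. 0)" by (rule ext)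
  then show ?thesis by (simp only: h_def) simp
qed

text \<open>Fubini moves the kernel to the test function, on which it acts by its transpose.\<close>

lemma kernel_dual:
  assumes gz: "\<And>x. x \<notin> {a<..<b} \<times> {p<..<q} ==> g x = 0"
    and \<alpha>[measurable]: "\<alpha> \<in> borel_measurable borel" "\<And>x. \<bar>\<alpha> x\<bar> \<le> A" and \<beta>[measurable]: "\<beta> \<in> borel_measurable borel" "\<And>x. \<bar>\<beta> x\<bar> \<le> B"
  shows "(LINT x|lborel. h x * (\<alpha> (fst x) * \<beta> (snd x)))
    = (LINT x|lborel. g x * (\<alpha> (fst x) * (LINT y|lborel. \<beta> y * K y (snd x))))"
proof -
  let ?J = "{p<..<q}" and ?I = "{a<..<b}"
  have A: "0 \<le> A" "0 \<le> B" using order_trans[OF abs_ge_zero \<alpha>(2)] order_trans[OF abs_ge_zero \<beta>(2)] by auto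
  have "bounded {u<..<v}" for u v :: real by (rule bounded_subset[of "{u..v}"]) auto
  then have b: "bounded (?I \<times> ?J)" by (intro bounded_Times)
  then have b: "bounded (?I \<times> ?J)" "?I \<times> ?J \<in> sets borel" by (auto intro!: borel_open open_Times)
  have gI: "integrable lborel g" by (rule square_integrable_imp[OF gm gi b(2,1) gz])
  have hI: "integrable lborel h" by (rule square_integrable_imp[OF kernel_bound(1,2) b(2,1) h_outside[OF gz]])
  define R where "R z = (LINT y|lborel. \<beta> y * K y z)" for z
  have Rm[measurable]: "R \<in> borel_measurable borel" unfolding R_def by measurable
  have Rb: "\<bar>R z\<bar> \<le> B * c * (q - p)" for z
  proof -
    have "\<bar>\<beta> y * K y z\<bar> \<le> B * c * indicator ?J y" for y
    proof -
      have "\<bar>\<beta> y * K y z\<bar> \<le> B * (c * (indicator ?J y * indicator ?J z))"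
        unfolding abs_mult by (intro mult_mono \<beta> Kb A) simp
      also have "\<dots> \<le> B * c * indicator ?J y" using A c by (auto simp: indicator_def)
      finally show ?thesis .
    qed
    then have le: "norm (\<beta> y * K y z) \<le> B * c * indicator ?J y" for y by simp
    have i: "integrable lborel (\<lambda>y. B * c * indicat_real ?J y)" using pq by simp
    have "integrable lborel (\<lambda>y. \<beta> y * K y z)"
      by (rule Bochner_Integration.integrable_bound[OF i]) (measurable, intro AE_I2 order_trans[OF le], simp)
    then have "norm (R z) \<le> (LINT y|lborel. B * c * indicator ?J y)"
      unfolding R_def by (rule Bochner_Integration.integral_norm_bound_integral[OF _ i le])
    then show ?thesis using pq by simp
  qed
  have mulI: "integrable (lborel \<Otimes>\<^sub>M lborel) (\<lambda>x. f x * w x)" if f: "integrable lborel f" and w: "w \<in> borel_measurable borel" "\<And>x. \<bar>w x\<bar> \<le> C" for f w :: fld and C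
  proof -
    have C: "0 \<le> C" using order_trans[OF abs_ge_zero w(2)] by blast
    have "integrable lborel (\<lambda>x. f x * w x)"
    proof (rule Bochner_Integration.integrable_bound)
      show "integrable lborel (\<lambda>x. C * f x)" using f by simp
      show "(\<lambda>x. f x * w x) \<in> borel_measurable lborel" using f w(1) by simp
      have "\<bar>f x * w x\<bar> \<le> \<bar>C * f x\<bar>" for x using mult_left_mono[OF w(2)[of x], of "\<bar>f x\<bar>"] C by (simp add: abs_mult mult.commute)
      then show "AE x in lborel. norm (f x * w x) \<le> norm (C * f x)" by simp
    qed
    then show ?thesis by (simp add: lborel_prod)
  qed
  have "\<bar>\<alpha> (fst x) * \<beta> (snd x)\<bar> \<le> A * B" for x unfolding abs_mult by (intro mult_mono \<alpha> \<beta> A) simp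
  then have i1: "integrable (lborel \<Otimes>\<^sub>M lborel) (\<lambda>x. h x * (\<alpha> (fst x) * \<beta> (snd x)))"
    by (intro mulI[OF hI]) (simp add: borel_prod[symmetric])
  have "\<bar>\<alpha> (fst x) * R (snd x)\<bar> \<le> A * (B * c * (q - p))" for x unfolding abs_mult by (intro mult_mono \<alpha> Rb A) simp
  then have i2: "integrable (lborel \<Otimes>\<^sub>M lborel) (\<lambda>x. g x * (\<alpha> (fst x) * R (snd x)))"
    by (intro mulI[OF gI]) (simp add: borel_prod[symmetric])
  have gI2: "integrable (lborel \<Otimes>\<^sub>M lborel) g" using gI by (simp add: lborel_prod)
  \<comment> \<open>The exchange of y and z needs g(x, .) integrable, which holds for almost every x
    only.\<close>
  have inner: "AE x in lborel. (\<integral>y. h (x, y) * (\<alpha> x * \<beta> y) \<partial>lborel) = (\<integral>z. g (x, z) * (\<alpha> x * R z) \<partial>lborel)"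
    using lborel_pair.AE_integrable_fst'[OF gI2]
  proof eventually_elim
    fix x assume gx: "integrable lborel (\<lambda>z. g (x, z))"
    have f0: "integrable (lborel \<Otimes>\<^sub>M lborel) (\<lambda>w. indicat_real ?J (fst w) * g (x, snd w))"
      using gx pq by (intro lborel_pair.Fubini_integrable) (auto simp: abs_mult)
    have f: "integrable (lborel \<Otimes>\<^sub>M lborel) (\<lambda>(z, y). \<beta> y * K y z * g (x, z))"
    proof (subst lborel_pair.integrable_product_swap_iff[symmetric], rule Bochner_Integration.integrable_bound)
      show "integrable (lborel \<Otimes>\<^sub>M lborel) (\<lambda>w. (B * c) * (indicat_real ?J (fst w) * g (x, snd w)))" using f0 by simp
      show "(\<lambda>(x', y). case (y, x') of (z, y) => \<beta> y * K y z * g (x, z)) \<in> borel_measurable (lborel \<Otimes>\<^sub>M lborel)" by measurable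
      have "\<bar>\<beta> y * K y z * g (x, z)\<bar> \<le> \<bar>(B * c) * (indicat_real ?J y * g (x, z))\<bar>" for y z
      proof -
        have "\<bar>\<beta> y * K y z\<bar> \<le> B * (c * (indicator ?J y * indicator ?J z))"
          unfolding abs_mult by (intro mult_mono \<beta> Kb A) simp
        also have "\<dots> \<le> B * c * indicator ?J y" using A c by (auto simp: indicator_def)
        finally have "\<bar>\<beta> y * K y z\<bar> * \<bar>g (x, z)\<bar> \<le> B * c * indicator ?J y * \<bar>g (x, z)\<bar>" by (rule mult_right_mono) simp
        then show ?thesis using A c by (simp add: abs_mult mult.assoc)
      qed
      then show "AE w in lborel \<Otimes>\<^sub>M lborel. norm (case w of (x', y) => case (y, x') of (z, y) => \<beta> y * K y z * g (x, z)) \<le> norm ((B * c) * (indicat_real ?J (fst w) * g (x, snd w)))"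
        by (intro AE_I2) (simp add: case_prod_beta)
    qed
    have "(\<integral>y. h (x, y) * (\<alpha> x * \<beta> y) \<partial>lborel) = (\<integral>y. \<alpha> x * (\<integral>z. \<beta> y * K y z * g (x, z) \<partial>lborel) \<partial>lborel)"
      unfolding h_def by (simp add: mult.assoc mult.left_commute mult.commute)
    also have "\<dots> = \<alpha> x * (\<integral>y. (\<integral>z. \<beta> y * K y z * g (x, z) \<partial>lborel) \<partial>lborel)" by simp
    also have "(\<integral>y. (\<integral>z. \<beta> y * K y z * g (x, z) \<partial>lborel) \<partial>lborel) = (\<integral>z. (\<integral>y. \<beta> y * K y z * g (x, z) \<partial>lborel) \<partial>lborel)"
      using f by (rule lborel_pair.Fubini_integral)
    also have "(\<lambda>z. \<integral>y. \<beta> y * K y z * g (x, z) \<partial>lborel) = (\<lambda>z. R z * g (x, z))" by (simp add: R_def)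
    also have "\<alpha> x * (\<integral>z. R z * g (x, z) \<partial>lborel) = (\<integral>z. \<alpha> x * (R z * g (x, z)) \<partial>lborel)" by simp
    also have "(\<lambda>z. \<alpha> x * (R z * g (x, z))) = (\<lambda>z. g (x, z) * (\<alpha> x * R z))" by (simp add: fun_eq_iff)
    finally show "(\<integral>y. h (x, y) * (\<alpha> x * \<beta> y) \<partial>lborel) = (\<integral>z. g (x, z) * (\<alpha> x * R z) \<partial>lborel)" .
  qed
  have "(LINT x|lborel. h x * (\<alpha> (fst x) * \<beta> (snd x))) = (\<integral>x. \<integral>y. h (x, y) * (\<alpha> x * \<beta> y) \<partial>lborel \<partial>lborel)"
    using lborel_pair.integral_fst'[OF i1] by (simp add: lborel_prod)
  also have "\<dots> = (\<integral>x. \<integral>z. g (x, z) * (\<alpha> x * R z) \<partial>lborel \<partial>lborel)"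
    using lborel_pair.integrable_fst'[OF i1] lborel_pair.integrable_fst'[OF i2] inner by (intro integral_cong_AE) (auto dest: borel_measurable_integrable)
  also have "\<dots> = (LINT x|lborel. g x * (\<alpha> (fst x) * R (snd x)))"
    using lborel_pair.integral_fst'[OF i2] by (simp add: lborel_prod)
  finally show ?thesis by (simp add: R_def)
qed

end

text \<open>Describes h as the image of u under the operator with kernel K by duality with tensor
  products. This form is insensitive to null sets and matches the hypothesis of
  \<open>fundamental\<close>.\<close>

definition kernel_image :: "pt set => (real => real => real) => fld => fld => bool" where
  "kernel_image E K u h \<longleftrightarrow> (\<forall>\<alpha> \<beta> A B. \<alpha> \<in> borel_measurable borel --> (\<forall>x. \<bar>\<alpha> x\<bar> \<le> A) --> \<beta> \<in> borel_measurable borel --> (\<forall>x. \<bar>\<beta> x\<bar> \<le> B) -->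
     l2ip E h (tensor \<alpha> \<beta>) = l2ip E u (\<lambda>x. \<alpha> (fst x) * (LINT y|lborel. \<beta> y * K y (snd x))))"

lemma kernel_op:
  fixes K :: "real => real => real" and a b :: real
  assumes Km: "(\<lambda>x. K (fst x) (snd x)) \<in> borel_measurable borel"
    and Kb: "\<And>y z. \<bar>K y z\<bar> \<le> c * (indicator {p<..<q} y * indicator {p<..<q} z)" and c: "0 \<le> c" and pq: "p \<le> q"
    and u: "u \<in> L2 ({a<..<b} \<times> {p<..<q})"
  shows "\<exists>h\<in>L2 ({a<..<b} \<times> {p<..<q}). l2norm ({a<..<b} \<times> {p<..<q}) h \<le> c * (q - p) * l2norm ({a<..<b} \<times> {p<..<q}) u \<and>
    kernel_image ({a<..<b} \<times> {p<..<q}) K u h"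
proof -
  let ?E = "{a<..<b} \<times> {p<..<q}"
  have Eb: "?E \<in> sets borel" by (intro borel_open open_Times) auto
  obtain g where g: "g \<in> borel_measurable borel" "\<And>x. x \<notin> ?E ==> g x = 0" "AE x in lebesgue_on ?E. u x = g x" "integrable lborel (\<lambda>x. (g x)\<^sup>2)"
    using L2_borel_rep[OF Eb u] by blast
  interpret kernel K g c p q by unfold_locales (use Km g Kb c pq in auto)
  note kb = kernel_bound and hz = h_outside[OF g(2)]
  have bm: "f \<in> borel_measurable (lebesgue_on ?E)" if "f \<in> borel_measurable borel" for f :: fld
    using that by (intro measurable_restrict_space1 measurable_completion) simp
  have bL: "f \<in> L2 ?E" if f: "f \<in> borel_measurable borel" "integrable lborel (\<lambda>x. (f x)\<^sup>2)" for f
  proof (rule L2I[OF bm[OF f(1)]])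
    have "integrable lebesgue (\<lambda>x. (f x)\<^sup>2)" using f by (subst integrable_completion) auto
    then have "integrable lebesgue (\<lambda>x. indicator ?E x *\<^sub>R (f x)\<^sup>2)" using Eb by (intro integrable_mult_indicator) auto
    then show "integrable (lebesgue_on ?E) (\<lambda>x. (f x)\<^sup>2)" using Eb by (simp add: integrable_restrict_space)
  qed
  have sq: "(l2norm ?E f)\<^sup>2 = (LINT x|lborel. (f x)\<^sup>2)" if "f \<in> borel_measurable borel" "\<And>x. x \<notin> ?E ==> f x = 0" for f
    unfolding l2norm_sq using l2ip_lborel[OF Eb that(1,1,2)] by (simp add: power2_eq_square)
  have ug: "l2norm ?E u = l2norm ?E g" by (rule l2norm_cong_AE[OF u bL[OF g(1,4)] g(3)])
  show ?thesis
    unfolding kernel_image_def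
  proof (intro bexI[of _ h] conjI allI impI)
    show "h \<in> L2 ?E" by (rule bL[OF kb(1,2)])
    have "(l2norm ?E h)\<^sup>2 \<le> (c * (q - p) * l2norm ?E g)\<^sup>2"
      using kb(3) sq[OF kb(1) hz] sq[OF g(1,2)] by (simp add: power_mult_distrib)
    then show "l2norm ?E h \<le> c * (q - p) * l2norm ?E u"
      unfolding ug by (rule power2_le_imp_le) (use c pq in simp)
    fix \<alpha> \<beta> :: "real => real" and A B assume \<alpha>: "\<alpha> \<in> borel_measurable borel" "\<forall>x. \<bar>\<alpha> x\<bar> \<le> A" and \<beta>: "\<beta> \<in> borel_measurable borel" "\<forall>x. \<bar>\<beta> x\<bar> \<le> B"
    have Km2: "(\<lambda>x. K (fst x) (snd x)) \<in> borel_measurable (borel \<Otimes>\<^sub>M borel)" using Km by (simp add: borel_prod)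
    have "(\<lambda>z. (LINT y|lborel. \<beta> y * K y z)) \<in> borel_measurable borel"
    proof (rule lborel.borel_measurable_lebesgue_integral)
      have "(\<lambda>w. K (snd w) (fst w)) \<in> borel_measurable (borel \<Otimes>\<^sub>M lborel)"
        using measurable_compose[of "\<lambda>w. (snd w, fst w)" "borel \<Otimes>\<^sub>M lborel" "borel \<Otimes>\<^sub>M borel", OF _ Km2] by simp
      then show "(\<lambda>(z, y). \<beta> y * K y z) \<in> borel_measurable (borel \<Otimes>\<^sub>M lborel)"
        using \<beta>(1) by (simp add: case_prod_beta)
    qed
    then have wm: "(\<lambda>x::pt. \<alpha> (fst x) * (LINT y|lborel. \<beta> y * K y (snd x))) \<in> borel_measurable borel"
      using \<alpha>(1) by (simp add: borel_prod[symmetric])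
    have "l2ip ?E h (tensor \<alpha> \<beta>) = (LINT x|lborel. h x * (\<alpha> (fst x) * \<beta> (snd x)))"
      by (rule l2ip_lborel[OF Eb kb(1) _ hz]) (use \<alpha>(1) \<beta>(1) in \<open>simp_all add: borel_prod[symmetric]\<close>)
    also have "\<dots> = (LINT x|lborel. g x * (\<alpha> (fst x) * (LINT y|lborel. \<beta> y * K y (snd x))))"
      by (rule kernel_dual[OF g(2) \<alpha>(1) \<alpha>(2)[rule_format] \<beta>(1) \<beta>(2)[rule_format]])
    also have "\<dots> = l2ip ?E g (\<lambda>x. \<alpha> (fst x) * (LINT y|lborel. \<beta> y * K y (snd x)))"
      by (rule l2ip_lborel[OF Eb g(1) wm g(2), symmetric])
    also have "\<dots> = l2ip ?E u (\<lambda>x. \<alpha> (fst x) * (LINT y|lborel. \<beta> y * K y (snd x)))"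
      by (rule l2ip_cong_AE[OF bm[OF g(1)] L2_measurable[OF u] bm[OF wm]]) (use g(3) in \<open>eventually_elim, simp\<close>)
    finally show "l2ip ?E h (tensor \<alpha> \<beta>) = l2ip ?E u (\<lambda>x. \<alpha> (fst x) * (LINT y|lborel. \<beta> y * K y (snd x)))" .
  qed
qed


lemma const_on_convex:
  fixes f :: "real => real"
  assumes "convex S" "\<And>x. x \<in> S ==> (f has_real_derivative 0) (at x)" "x \<in> S" "y \<in> S"
  shows "f x = f y"
proof -
  obtain c where "\<And>x. x \<in> S ==> f x = c"
    using has_field_derivative_zero_constant[OF assms(1), of f] assms(2) has_field_derivative_at_within by blast
  then show ?thesis using assms(3,4) by simp
qed

lemma antideriv_ex:
  fixes f :: "real => real"
  assumes "continuous_on UNIV f" shows "\<exists>B. \<forall>x. (B has_real_derivative f x) (at x)"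
  using einterval_antiderivative[of "-\<infinity>" "\<infinity>" f] assms
  by (simp add: continuous_on_eq_continuous_at has_real_derivative_iff_has_vector_derivative)

text \<open>A smooth function of mass 1 with support strictly inside the interval, together with its
  primitive H. Any bump with a positive value will do after division by its mass.\<close>

lemma unit_bump:
  fixes p q :: real
  assumes pq: "p < q"
  shows "\<exists>H \<eta> c d. smooth1 \<eta> \<and> (\<forall>x. (H has_real_derivative \<eta> x) (at x)) \<and> H q - H p = 1 \<and> p < c \<and> d < q \<and> c \<le> d \<and> (\<forall>x. x \<notin> {c..d} --> \<eta> x = 0)"
proof -
  obtain n s where n: "0 < bump n p q s" using bump_pos_ex[OF pq] by blast
  have n0: "n \<noteq> 0"
  proof
    assume "n = 0"
    then show False using n by (simp add: bump_def cutoff_def expi_def)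
  qed
  have s: "s \<in> {p + 1 / real n<..<q - 1 / real n}" using bump_eq_0[of s p n q] n by (cases "s \<in> {p + 1 / real n<..<q - 1 / real n}") auto
  obtain B where B: "\<And>x. (B has_real_derivative bump n p q x) (at x)" using antideriv_ex[OF smooth1_continuous[OF smooth1_bump]] by blast
  have mono: "B x \<le> B y" if "x \<le> y" for x y
    by (rule DERIV_nonneg_imp_nondecreasing[OF that]) (use B bump_bounds(1) in blast)
  \<comment> \<open>A nondecreasing primitive with equal end values is constant in between,
    contradicting the positive derivative at s.\<close>
  have "B p \<noteq> B q"
  proof
    assume e: "B p = B q"
    have c: "B x = B p" if "x \<in> {p<..<q}" for x using mono[of p x] mono[of x q] that e by simp
    have inv: "0 < 1 / real n" using n0 by simp
    have "s \<in> {p<..<q}" using s inv unfolding greaterThanLessThan_iff by linarith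
    moreover have "((\<lambda>_. B p) has_real_derivative 0) (at s)" by simp
    ultimately have "(B has_real_derivative 0) (at s)"
      by (intro has_field_derivative_transform_within_open[of "\<lambda>_. B p" 0 s "{p<..<q}" B]) (simp_all add: c)
    then show False using DERIV_unique[OF B] n by fastforce
  qed
  then have m: "B q - B p > 0" using mono[of p q] pq by simp
  define m where "m = B q - B p"
  show ?thesis
  proof (intro exI conjI allI impI)
    show "smooth1 (\<lambda>x. (1 / m) * bump n p q x)" by (rule smooth1_cmult[OF smooth1_bump])
    show "((\<lambda>x. (1 / m) * B x) has_real_derivative (1 / m) * bump n p q x) (at x)" for x by (rule DERIV_cmult[OF B])
    show "(1 / m) * B q - (1 / m) * B p = 1" using m by (simp add: m_def diff_divide_distrib[symmetric])
    show "p < p + 1 / real n" "q - 1 / real n < q" "p + 1 / real n \<le> q - 1 / real n" using n0 s by auto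
    show "(1 / m) * bump n p q x = 0" if "x \<notin> {p + 1 / real n..q - 1 / real n}" for x
      using bump_eq_0[of x p n q] greaterThanLessThan_subseteq_atLeastAtMost_iff[of "p + 1 / real n" "q - 1 / real n" "p + 1 / real n" "q - 1 / real n"] that by auto
  qed
qed

lemma lborel_FTC:
  fixes f :: "real => real"
  assumes "a \<le> b" "\<And>x. (B has_real_derivative f x) (at x)" "continuous_on UNIV f"
  shows "(LINT y|lborel. f y * indicator {a..b} y) = B b - B a" "integrable lborel (\<lambda>y. f y * indicator {a..b} y)"
proof -
  have c: "\<And>x. isCont f x" using assms(3) by (simp add: continuous_on_eq_continuous_at)
  have "has_bochner_integral lborel (\<lambda>y. f y * indicator {a..b} y) (B b - B a)"
    by (rule has_bochner_integral_FTC_Icc_real[OF assms(1)]) (use assms(2) c in auto)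
  then show "(LINT y|lborel. f y * indicator {a..b} y) = B b - B a" "integrable lborel (\<lambda>y. f y * indicator {a..b} y)"
    by (auto simp: has_bochner_integral_iff)
qed

lemma cD_01: "cD 0 1 \<psi> = pdy \<psi>"
  by (simp add: cD_def One_nat_def)

text \<open>On a line in direction y, average w(y) = w(t) + (integral of F from t to y) over t with
  the weight \<eta> of mass 1. The average of w is minus the integral of \<eta>' v, and exchanging
  the order of integration turns the rest into a kernel acting on F. Both operators are bounded on
  L^2. The identity is verified weakly, against tensor products.\<close>

theorem dy_estimate:
  fixes a b p q :: real
  assumes pq: "p < q"
  defines "E \<equiv> {a<..<b} \<times> {p<..<q}"
  shows "\<exists>C\<ge>0. \<forall>v w F. v \<in> L2 E --> is_wderiv E 0 1 v w --> is_wderiv E 0 1 w F --> l2norm E w \<le> C * (l2norm E v + l2norm E F)"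
proof -
  let ?J = "{p<..<q}"
  have op: "open E" unfolding E_def by (intro open_Times open_greaterThanLessThan)
  then have ms: "E \<in> sets lebesgue" by (simp add: borel_open)
  obtain H \<eta> c0 d0 where \<eta>: "smooth1 \<eta>" "\<And>x. (H has_real_derivative \<eta> x) (at x)" "H q - H p = 1" "p < c0" "d0 < q" "c0 \<le> d0" "\<And>x. x \<notin> {c0..d0} ==> \<eta> x = 0"
    using unit_bump[OF pq] by auto
  define N where "N z = H q - H z" for z
  have cont: "continuous_on UNIV \<eta>" "continuous_on UNIV (deriv \<eta>)" "continuous_on UNIV N"
    using smooth1_continuous[OF \<eta>(1)] smooth1_continuous[OF smooth1_deriv[OF \<eta>(1)]] smooth1_continuous[OF smooth1_antideriv[OF \<eta>(2,1)]]
    unfolding N_def[abs_def] by (auto intro!: continuous_intros)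
  have bdd: "\<exists>C\<ge>0. \<forall>x\<in>{p..q}. \<bar>f x\<bar> \<le> C" if "continuous_on UNIV f" for f :: "real => real"
  proof -
    have "continuous_on {p..q} f" by (rule continuous_on_subset[OF that]) simp
    then have "bounded (f ` {p..q})" by (intro compact_imp_bounded compact_continuous_image compact_Icc)
    then obtain C where C: "\<forall>y\<in>f ` {p..q}. norm y \<le> C" unfolding bounded_iff by (rule exE)
    have "\<bar>f x\<bar> \<le> max C 0" if "x \<in> {p..q}" for x using bspec[OF C imageI[OF that]] by simp
    then show ?thesis by (intro exI[of _ "max C 0"] conjI ballI) simp_all
  qed
  obtain C1 where C1: "0 \<le> C1" "\<And>x. x \<in> {p..q} ==> \<bar>N x\<bar> \<le> C1" using bdd[OF cont(3)] by blast
  obtain C2 where C2: "0 \<le> C2" "\<And>x. x \<in> {p..q} ==> \<bar>deriv \<eta> x\<bar> \<le> C2" using bdd[OF cont(2)] by blast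
  \<comment> \<open>N(z) is the mass of \<eta> beyond z, so the indicator of z \<le> y minus N(z) is
    what averaging over t leaves of the kernel of the integral from t to y.\<close>
  define K1 where "K1 y z = indicator ?J y * indicator ?J z * ((if z \<le> y then 1 else 0) - N z)" for y z
  define K2 where "K2 y z = indicator ?J y * indicator ?J z * (- deriv \<eta> z)" for y z
  have m[measurable]: "N \<in> borel_measurable borel" "deriv \<eta> \<in> borel_measurable borel" using cont by (auto intro: borel_measurable_continuous_onI)
  have K1m: "(\<lambda>x. K1 (fst x) (snd x)) \<in> borel_measurable borel" unfolding K1_def borel_prod[symmetric] by measurable
  have K2m: "(\<lambda>x. K2 (fst x) (snd x)) \<in> borel_measurable borel" unfolding K2_def borel_prod[symmetric] by measurable
  have K1b: "\<bar>K1 y z\<bar> \<le> (1 + C1) * (indicator ?J y * indicator ?J z)" for y z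
    using C1(2)[of z] unfolding K1_def by (auto simp: indicator_def abs_le_iff)
  have K2b: "\<bar>K2 y z\<bar> \<le> C2 * (indicator ?J y * indicator ?J z)" for y z
    using C2(2)[of z] unfolding K2_def by (auto simp: indicator_def)
  define C where "C = max ((1 + C1) * (q - p)) (C2 * (q - p))"
  have C: "0 \<le> C" "(1 + C1) * (q - p) \<le> C" "C2 * (q - p) \<le> C"
    using C2(1) pq mult_nonneg_nonneg[of C2 "q - p"] by (auto simp: C_def le_max_iff_disj)
  have "l2norm E w \<le> C * (l2norm E v + l2norm E F)" if v: "v \<in> L2 E" and w: "is_wderiv E 0 1 v w" and F: "is_wderiv E 0 1 w F" for v w F
  proof -
    note wL = is_wderiv_L2[OF w] and FL = is_wderiv_L2[OF F]
    have c1: "0 \<le> 1 + C1" using C1(1) by simp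
    obtain h1 where h1: "h1 \<in> L2 E" "l2norm E h1 \<le> (1 + C1) * (q - p) * l2norm E F"
      and d1: "kernel_image E K1 F h1"
      using kernel_op[OF K1m K1b c1 less_imp_le[OF pq] FL[unfolded E_def], folded E_def] by blast
    obtain h2 where h2: "h2 \<in> L2 E" "l2norm E h2 \<le> C2 * (q - p) * l2norm E v"
      and d2: "kernel_image E K2 v h2"
      using kernel_op[OF K2m K2b C2(1) less_imp_le[OF pq] v[unfolded E_def], folded E_def] by blast
    have "AE x in lebesgue_on E. w x - (h1 x + h2 x) = 0"
    proof (rule fundamental[OF op])
      show "(\<lambda>x. w x - (h1 x + h2 x)) \<in> L2 E" by (intro L2.diff L2.add wL h1 h2)
      fix \<alpha> \<beta> :: "real => real" and a' b' c' d'
      assume \<alpha>: "smooth1 \<alpha>" and \<beta>: "smooth1 \<beta>" and \<alpha>0: "\<And>x. x \<notin> {a'..b'} ==> \<alpha> x = 0" and \<beta>0: "\<And>x. x \<notin> {c'..d'} ==> \<beta> x = 0" and sub: "{a'..b'} \<times> {c'..d'} \<subseteq> E"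
      show "l2ip E (\<lambda>x. w x - (h1 x + h2 x)) (tensor \<alpha> \<beta>) = 0"
      proof (cases "a' \<le> b' \<and> c' \<le> d'")
        case False
        then have "\<alpha> x * \<beta> y = 0" for x y using \<alpha>0[of x] \<beta>0[of y] by auto
        then have e: "(\<lambda>x::pt. \<alpha> (fst x) * \<beta> (snd x)) = (\<lambda>_. 0)" by (rule ext)
        show ?thesis unfolding e by (simp add: l2ip_def)
      next
        case True
        have inE: "a < a'" "b' < b" "p < c'" "d' < q"
        proof -
          have "(a', c') \<in> E" "(b', d') \<in> E" using True by (auto intro!: subsetD[OF sub])
          then show "a < a'" "b' < b" "p < c'" "d' < q" by (auto simp: E_def)
        qed
        obtain B where B: "\<And>x. (B has_real_derivative \<beta> x) (at x)" using antideriv_ex[OF smooth1_continuous[OF \<beta>]] by blast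
        define M where "M = B q - B p"
        \<comment> \<open>A primitive of \<beta> has compact support only if \<beta> has mass 0.
          Subtracting M \<eta>, with M the mass of \<beta>, corrects this, and the remainder M
          \<eta> is handled through v.\<close>
        define bb where "bb z = 1 * B z + (- M) * (H z - H p) - B p" for z
        have Bsm: "smooth1 B" "smooth1 H" by (rule smooth1_antideriv[OF B \<beta>], rule smooth1_antideriv[OF \<eta>(2,1)])
        have bd: "(bb has_real_derivative (\<beta> z - M * \<eta> z)) (at z)" for z
          unfolding bb_def by (auto intro!: derivative_eq_intros B \<eta>(2))
        have bdsm: "smooth1 (\<lambda>z. \<beta> z - M * \<eta> z)" using smooth1_comb[OF \<beta> \<eta>(1), of 1 "-M"] by simp
        have bsm: "smooth1 bb" by (rule smooth1_antideriv[OF bd bdsm])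
        \<comment> \<open>c2 and d2' bound the supports of \<beta> and \<eta> together; outside, bb
          keeps the value it has at p or at q, which is 0.\<close>
        define c2 where "c2 = min c0 c'"
        define d2' where "d2' = max d0 d'"
        have cd: "p < c2" "d2' < q" "c2 \<le> d2'" using \<eta>(4-6) inE by (auto simp: c2_def d2'_def)
        have bz: "bb z = 0" if z: "z \<notin> {c2..d2'}" for z
        proof (cases "z < c2")
          case True
          have e: "\<beta> x = 0" "\<eta> x = 0" if "x \<in> {..<c2}" for x using that \<beta>0 \<eta>(7) by (auto simp: c2_def)
          have dB: "(B has_real_derivative 0) (at x)" and dH: "(H has_real_derivative 0) (at x)" if "x \<in> {..<c2}" for x
            using B[of x] \<eta>(2)[of x] e[OF that] by simp_all
          have "B z = B p" by (rule const_on_convex[of "{..<c2}", OF _ dB]) (use True cd in auto)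
          moreover have "H z = H p" by (rule const_on_convex[of "{..<c2}", OF _ dH]) (use True cd in auto)
          ultimately show ?thesis by (simp add: bb_def)
        next
          case False
          then have z: "d2' < z" using that by simp
          have e: "\<beta> x = 0" "\<eta> x = 0" if "x \<in> {d2'<..}" for x using that \<beta>0 \<eta>(7) by (auto simp: d2'_def)
          have dB: "(B has_real_derivative 0) (at x)" and dH: "(H has_real_derivative 0) (at x)" if "x \<in> {d2'<..}" for x
            using B[of x] \<eta>(2)[of x] e[OF that] by simp_all
          have "B z = B q" by (rule const_on_convex[of "{d2'<..}", OF _ dB]) (use z cd in auto)
          moreover have "H z = H q" by (rule const_on_convex[of "{d2'<..}", OF _ dH]) (use z cd in auto)
          ultimately show ?thesis using \<eta>(3) by (simp add: bb_def M_def)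
        qed
        have in2: "{a'..b'} \<times> {c..d} \<subseteq> E" if "p < c" "d < q" for c d using inE(1,2) that by (auto simp: E_def)
        have t1: "(tensor \<alpha> bb) \<in> test_fun E" by (rule prod_test_fun[OF \<alpha> bsm \<alpha>0 bz in2[OF cd(1,2)]])
        have t2: "(tensor \<alpha> \<eta>) \<in> test_fun E" by (rule prod_test_fun[OF \<alpha> \<eta>(1) \<alpha>0 \<eta>(7) in2[OF \<eta>(4,5)]])
        have db: "deriv bb = (\<lambda>z. \<beta> z - M * \<eta> z)" using bd DERIV_imp_deriv by blast
        have p1: "cD 0 1 (tensor \<alpha> bb) = (\<lambda>x. \<alpha> (fst x) * (\<beta> (snd x) - M * \<eta> (snd x)))"
          unfolding cD_01 pd_prod(2)[OF \<alpha> bsm] db ..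
        have p2: "cD 0 1 (tensor \<alpha> \<eta>) = (tensor \<alpha> (deriv \<eta>))"
          unfolding cD_01 pd_prod(2)[OF \<alpha> \<eta>(1)] ..
        have t1D: "(\<lambda>x. \<alpha> (fst x) * (\<beta> (snd x) - M * \<eta> (snd x))) \<in> L2 E" using test_fun_L2[OF test_fun_cD[OF t1, of 0 1] ms] unfolding p1 .
        have t2D: "(tensor \<alpha> (deriv \<eta>)) \<in> L2 E" using test_fun_L2[OF test_fun_cD[OF t2, of 0 1] ms] unfolding p2 .
        note L = test_fun_L2[OF t1 ms] test_fun_L2[OF t2 ms]
        have "l2ip E w (tensor \<alpha> \<beta>) = l2ip E w (\<lambda>x. 1 * (\<alpha> (fst x) * (\<beta> (snd x) - M * \<eta> (snd x))) + M * (\<alpha> (fst x) * \<eta> (snd x)))"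
          by (simp add: algebra_simps)
        also have "\<dots> = l2ip E w (\<lambda>x. \<alpha> (fst x) * (\<beta> (snd x) - M * \<eta> (snd x))) + M * l2ip E w (tensor \<alpha> \<eta>)"
          using L2.lin_right[OF t1D L(2) wL, of 1 M] by simp
        also have "\<dots> = - l2ip E F (tensor \<alpha> bb) + M * (- l2ip E v (tensor \<alpha> (deriv \<eta>)))"
          using is_wderivD[OF F t1] is_wderivD[OF w t2] unfolding p1 p2 by simp
        finally have W: "l2ip E w (tensor \<alpha> \<beta>) = - l2ip E F (tensor \<alpha> bb) - M * l2ip E v (tensor \<alpha> (deriv \<eta>))" by simp
        have bnd: "\<exists>A. \<forall>x. \<bar>f x\<bar> \<le> A" if "smooth1 f" "\<And>x. x \<notin> {c..d} ==> f x = 0" for f c d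
        proof -
          have "bounded (f ` {c..d})" by (intro compact_imp_bounded compact_continuous_image smooth1_continuous that(1) compact_Icc)
          then obtain C where C: "\<forall>y\<in>f ` {c..d}. norm y \<le> C" unfolding bounded_iff by (rule exE)
          have "\<bar>f x\<bar> \<le> max C 0" for x
          proof (cases "x \<in> {c..d}")
            case True
            then show ?thesis using bspec[OF C imageI[OF True]] by simp
          qed (simp add: that(2))
          then show ?thesis by (intro exI allI)
        qed
        obtain A where A: "\<forall>x. \<bar>\<alpha> x\<bar> \<le> A" using bnd[OF \<alpha> \<alpha>0] by blast
        obtain B' where B': "\<forall>x. \<bar>\<beta> x\<bar> \<le> B'" using bnd[OF \<beta> \<beta>0] by blast
        have bm: "\<alpha> \<in> borel_measurable borel" "\<beta> \<in> borel_measurable borel" by (auto intro!: borel_measurable_continuous_onI smooth1_continuous \<alpha> \<beta>)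
        note D1 = d1[unfolded kernel_image_def, rule_format, OF bm(1) A[rule_format] bm(2) B'[rule_format]] and D2 = d2[unfolded kernel_image_def, rule_format, OF bm(1) A[rule_format] bm(2) B'[rule_format]]
        have \<beta>pq: "\<beta> p = 0" "\<beta> q = 0" using \<beta>0 inE by auto
        note FT = lborel_FTC[OF _ B smooth1_continuous[OF \<beta>]]
        \<comment> \<open>The transpose of K1 sends \<beta> to minus its corrected primitive, which
          matches the derivative identity for F.\<close>
        have R1: "(LINT y|lborel. \<beta> y * K1 y z) = - bb z" if z: "z \<in> ?J" for z
        proof -
          have zq: "z \<le> q" "p \<le> q" using z by auto
          have "(\<lambda>y. \<beta> y * K1 y z) = (\<lambda>y. \<beta> y * indicator {z..q} y - N z * (\<beta> y * indicator {p..q} y))"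
          proof
            fix y show "\<beta> y * K1 y z = \<beta> y * indicator {z..q} y - N z * (\<beta> y * indicator {p..q} y)"
              using z \<beta>pq by (cases "y = p"; cases "y = q") (auto simp: K1_def indicator_def algebra_simps)
          qed
          then have "(LINT y|lborel. \<beta> y * K1 y z) = (B q - B z) - N z * (B q - B p)"
            using FT[OF zq(1)] FT[OF zq(2)] by simp
          also have "\<dots> = - bb z + M * (1 - (H q - H p))" by (simp add: bb_def N_def M_def algebra_simps)
          finally show ?thesis using \<eta>(3) by simp
        qed
        \<comment> \<open>K2 does not depend on y inside the interval, so only the mass M of \<beta>
          enters.\<close>
        have R2: "(LINT y|lborel. \<beta> y * K2 y z) = - M * deriv \<eta> z" if z: "z \<in> ?J" for z
        proof -
          have "(\<lambda>y. \<beta> y * K2 y z) = (\<lambda>y. (- deriv \<eta> z) * (\<beta> y * indicator {p..q} y))"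
          proof
            fix y show "\<beta> y * K2 y z = (- deriv \<eta> z) * (\<beta> y * indicator {p..q} y)"
              using z \<beta>pq by (cases "y = p"; cases "y = q") (auto simp: K2_def indicator_def)
          qed
          then have "(LINT y|lborel. \<beta> y * K2 y z) = (- deriv \<eta> z) * (LINT y|lborel. \<beta> y * indicator {p..q} y)"
            by (simp only: Bochner_Integration.integral_mult_right_zero)
          then show ?thesis unfolding FT(1)[OF less_imp_le[OF pq]] M_def by (simp only: mult_minus_left mult.commute)
        qed
        have cg: "l2ip E f g = l2ip E f g'" if "\<And>x. x \<in> E ==> g x = g' x" for f g g'
          unfolding l2ip_def using that by (intro Bochner_Integration.integral_cong) auto
        have "l2ip E h1 (tensor \<alpha> \<beta>) = l2ip E F (\<lambda>x. (-1) * (\<alpha> (fst x) * bb (snd x)))"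
          unfolding D1 by (rule cg) (simp add: R1 E_def mem_Times_iff)
        also have "\<dots> = - l2ip E F (tensor \<alpha> bb)" by (simp add: l2ip_def)
        finally have W1: "l2ip E h1 (tensor \<alpha> \<beta>) = - l2ip E F (tensor \<alpha> bb)" .
        have "l2ip E h2 (tensor \<alpha> \<beta>) = l2ip E v (\<lambda>x. (- M) * (\<alpha> (fst x) * deriv \<eta> (snd x)) + 0 * (\<alpha> (fst x) * deriv \<eta> (snd x)))"
          unfolding D2 by (rule cg) (simp add: R2 E_def mem_Times_iff)
        also have "\<dots> = - M * l2ip E v (tensor \<alpha> (deriv \<eta>))" using L2.lin_right[OF t2D t2D v, of "-M" 0] by simp
        finally have W2: "l2ip E h2 (tensor \<alpha> \<beta>) = - M * l2ip E v (tensor \<alpha> (deriv \<eta>))" .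
        have PL: "(tensor \<alpha> \<beta>) \<in> L2 E" by (rule test_fun_L2[OF prod_test_fun[OF \<alpha> \<beta> \<alpha>0 \<beta>0 sub] ms])
        have "l2ip E (\<lambda>x. 1 * w x + (-1) * (1 * h1 x + 1 * h2 x)) (tensor \<alpha> \<beta>) = 0"
          unfolding L2.lin[OF wL L2.comb[OF h1(1) h2(1)] PL] L2.lin[OF h1(1) h2(1) PL] W W1 W2 by simp
        moreover have "(\<lambda>x. 1 * w x + (-1) * (1 * h1 x + 1 * h2 x)) = (\<lambda>x. w x - (h1 x + h2 x))" by (simp add: fun_eq_iff)
        ultimately show ?thesis by simp
      qed
    qed
    then have "l2norm E w = l2norm E (\<lambda>x. h1 x + h2 x)"
      by (intro l2norm_cong_AE wL L2.add h1 h2) simp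
    also have "\<dots> \<le> l2norm E h1 + l2norm E h2" by (rule l2norm_triangle[OF h1(1) h2(1)])
    also have "\<dots> \<le> (1 + C1) * (q - p) * l2norm E F + C2 * (q - p) * l2norm E v" by (rule add_mono[OF h1(2) h2(2)])
    also have "\<dots> \<le> C * l2norm E F + C * l2norm E v" by (intro add_mono mult_right_mono C) auto
    finally show ?thesis by (simp add: algebra_simps)
  qed
  then show ?thesis using C(1) by blast
qed

section \<open>The global virtual element space\<close>

lemma region_nonempty: "star_shaped_ball (region vs) c \<rho> ==> 0 < \<rho> ==> region vs \<noteq> {}"
  unfolding star_shaped_ball_def using centre_in_ball[of c \<rho>] by blast

locale plate_mesh =
  fixes L l \<sigma> \<gamma> :: real and k :: nat and M :: "poly2 set"
  assumes size: "0 < l" "0 < L" and \<sigma>: "0 < \<sigma>" "\<sigma> < 1" and k: "2 \<le> k"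
    and mesh: "mesh (Omega L l) M" and \<gamma>: "0 < \<gamma>" and reg: "mesh_regular \<gamma> M"

sublocale plate_mesh \<subseteq> \<Omega>: domain "Omega L l"
proof
  show "open (Omega L l)" unfolding Omega_def by (intro open_Times open_greaterThanLessThan)
  have "bounded {u<..<v}" for u v :: real by (rule bounded_subset[of "{u..v}"]) auto
  then show "bounded (Omega L l)" unfolding Omega_def by (intro bounded_Times)
  have "(L / 2, 0) \<in> Omega L l" using size by (simp add: Omega_def)
  then show "Omega L l \<noteq> {}" by blast
qed

context plate_mesh
begin

abbreviation \<Omega> :: "pt set" where "\<Omega> \<equiv> Omega L l"
abbreviation Z :: "fld set" where "Z \<equiv> Zh \<sigma> L l k M"

lemma velement_ex: "vs \<in> M ==> \<exists>c \<rho>. velement vs c \<rho> \<sigma> k"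
proof -
  assume vs: "vs \<in> M"
  obtain c \<rho> where c: "\<gamma> * diam vs < \<rho>" "star_shaped_ball (region vs) c \<rho>" using reg vs unfolding mesh_regular_def by blast
  have "0 \<le> diam vs" unfolding diam_def by (rule diameter_ge_0[OF region_bounded])
  then have "0 < \<rho>" using c(1) \<gamma> mult_nonneg_nonneg[of \<gamma> "diam vs"] by linarith
  then have "velement vs c \<rho> \<sigma> k" using c(2) mesh vs \<sigma> k unfolding mesh_def
    by (intro velement.intro element.intro velement_axioms.intro) auto
  then show ?thesis by blast
qed

lemma region_domain: "vs \<in> M ==> domain (region vs)"
proof -
  assume "vs \<in> M"
  then obtain c \<rho> where "velement vs c \<rho> \<sigma> k" using velement_ex by blast
  then have "star_shaped_ball (region vs) c \<rho>" "0 < \<rho>" by (simp_all add: velement_def element_def)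
  then have "region vs \<noteq> {}" by (rule region_nonempty)
  then show ?thesis by (intro domain.intro region_open region_bounded)
qed

lemma fin: "finite M"
  using mesh by (simp add: mesh_def)

text \<open>The mesh condition concerns closures. An open set inside the closure of a convex open
  set lies in that set.\<close>

lemma region_subset: "vs \<in> M ==> region vs \<subseteq> \<Omega>"
proof -
  assume vs: "vs \<in> M"
  have "region vs \<subseteq> closure \<Omega>" using closure_subset[of "region vs"] mesh vs unfolding mesh_def by blast
  then have "region vs \<subseteq> interior (closure \<Omega>)" using region_open by (rule interior_maximal)
  also have "convex \<Omega>" unfolding Omega_def by (intro convex_Times convex_real_interval)
  then have "interior (closure \<Omega>) = \<Omega>" using convex_interior_closure[of \<Omega>] interior_open[OF \<Omega>.op] by simp
  finally show ?thesis .
qed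

lemma region_sets: "region vs \<in> sets lebesgue"
  using region_open[of vs] by (simp add: borel_open)

lemma null_rest: "negligible (\<Omega> - (\<Union>vs\<in>M. region vs))"
proof (rule negligible_subset)
  show "negligible (\<Union>vs\<in>M. closure (region vs) - region vs)"
    using fin negligible_closure_region by (intro negligible_Union) auto
  show "\<Omega> - (\<Union>vs\<in>M. region vs) \<subseteq> (\<Union>vs\<in>M. closure (region vs) - region vs)"
  proof
    fix x assume x: "x \<in> \<Omega> - (\<Union>vs\<in>M. region vs)"
    have "(\<Union>vs\<in>M. closure (region vs)) = closure \<Omega>" using mesh by (simp add: mesh_def)
    then have "x \<in> (\<Union>vs\<in>M. closure (region vs))" using closure_subset[of \<Omega>] x by auto
    then show "x \<in> (\<Union>vs\<in>M. closure (region vs) - region vs)" using x by auto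
  qed
qed

lemma l2ip_sum:
  assumes u: "u \<in> L2 \<Omega>" and v: "v \<in> L2 \<Omega>"
  shows "l2ip \<Omega> u v = (\<Sum>vs\<in>M. l2ip (region vs) u v)"
  unfolding l2ip_def
proof (rule integral_sum_regions[OF fin \<Omega>.meas region_sets region_subset _ null_rest L2_mult[OF u v]])
  show "region vs \<inter> region ws = {}" if "vs \<in> M" "ws \<in> M" "vs \<noteq> ws" for vs ws using mesh that unfolding mesh_def by blast
qed

lemma L2_region: "vs \<in> M ==> u \<in> L2 \<Omega> ==> u \<in> L2 (region vs)"
  using L2_subset[OF _ region_subset \<Omega>.meas region_sets] by blast

lemma Hs_region: "vs \<in> M ==> u \<in> Hs s \<Omega> ==> u \<in> Hs s (region vs)"
  using Hs_subset[OF _ region_subset \<Omega>.meas region_sets] by blast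

lemma wD_region_AE: "vs \<in> M ==> u \<in> Hs s \<Omega> ==> i + j \<le> s ==> AE x in lebesgue_on (region vs). wD (region vs) i j u x = wD \<Omega> i j u x"
  by (rule wD_subset_AE[OF _ _ region_subset \<Omega>.op region_open])

lemma AE_region: "vs \<in> M ==> AE x in lebesgue_on \<Omega>. Q x ==> AE x in lebesgue_on (region vs). Q x"
  using AE_lebesgue_on_subset[OF _ region_subset \<Omega>.meas region_sets] by blast

lemma l2ip_wD_region:
  assumes vs: "vs \<in> M" and u: "u \<in> Hs s \<Omega>" "i + j \<le> s" and v: "v \<in> Hs s \<Omega>" "i' + j' \<le> s"
  shows "l2ip (region vs) (wD (region vs) i j u) (wD (region vs) i' j' v) = l2ip (region vs) (wD \<Omega> i j u) (wD \<Omega> i' j' v)"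
proof -
  note a = Hs_wD_L2[OF Hs_region[OF vs u(1)] u(2)] and b = Hs_wD_L2[OF Hs_region[OF vs v(1)] v(2)]
  note a' = L2_region[OF vs Hs_wD_L2[OF u]] and b' = L2_region[OF vs Hs_wD_L2[OF v]]
  have "l2ip (region vs) (wD (region vs) i j u) (wD (region vs) i' j' v) = l2ip (region vs) (wD \<Omega> i j u) (wD (region vs) i' j' v)"
    by (intro l2ip_cong_AE L2_measurable a b a' wD_region_AE[OF vs u])
  also have "\<dots> = l2ip (region vs) (wD (region vs) i' j' v) (wD \<Omega> i j u)" by (rule L2.sym[OF a' b])
  also have "\<dots> = l2ip (region vs) (wD \<Omega> i' j' v) (wD \<Omega> i j u)"
    by (intro l2ip_cong_AE L2_measurable a' b b' wD_region_AE[OF vs v])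
  finally show ?thesis using L2.sym[OF b' a'] by simp
qed

lemma l2ip_wD_sum:
  assumes u: "u \<in> Hs s \<Omega>" "i + j \<le> s" and v: "v \<in> Hs s \<Omega>" "i' + j' \<le> s"
  shows "l2ip \<Omega> (wD \<Omega> i j u) (wD \<Omega> i' j' v) = (\<Sum>vs\<in>M. l2ip (region vs) (wD (region vs) i j u) (wD (region vs) i' j' v))"
  unfolding l2ip_sum[OF Hs_wD_L2[OF u] Hs_wD_L2[OF v]] by (rule sum.cong[OF refl l2ip_wD_region[OF _ u v, symmetric]])

lemma Aform_sum:
  assumes u: "u \<in> Hs 2 \<Omega>" and v: "v \<in> Hs 2 \<Omega>"
  shows "Aform \<sigma> \<Omega> u v = (\<Sum>vs\<in>M. Aform \<sigma> (region vs) u v)"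
proof -
  have "(\<Sum>vs\<in>M. Aform \<sigma> (region vs) u v) = (\<Sum>vs\<in>M. l2ip (region vs) (wD (region vs) 2 0 u) (wD (region vs) 2 0 v)
      + l2ip (region vs) (wD (region vs) 0 2 u) (wD (region vs) 0 2 v)
      + \<sigma> * (l2ip (region vs) (wD (region vs) 2 0 u) (wD (region vs) 0 2 v) + l2ip (region vs) (wD (region vs) 0 2 u) (wD (region vs) 2 0 v))
      + 2 * (1 - \<sigma>) * l2ip (region vs) (wD (region vs) 1 1 u) (wD (region vs) 1 1 v))"
    by (intro sum.cong refl domain.Aform_expand[OF region_domain] Hs_region u v)
  also have "\<dots> = Aform \<sigma> \<Omega> u v"
    unfolding \<Omega>.Aform_expand[OF u v] sum.distrib sum_distrib_left[symmetric]
    by (simp add: l2ip_wD_sum[OF u _ v])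
  finally show ?thesis ..
qed

lemma H2starE: "v \<in> H2star L l ==> v \<in> Hs 2 \<Omega>"
  by (simp add: H2star_def)

lemma H2star_comb:
  assumes u: "u \<in> H2star L l" and v: "v \<in> H2star L l" shows "lc a u b v \<in> H2star L l"
proof -
  interpret H: lin_space "Hs 2 \<Omega>" by (rule Hs_lin_space[OF \<Omega>.meas])
  show ?thesis
    using u v H.comb[of u v a b] \<Omega>.edge_trace_comb[of _ _ u "\<lambda>_. 0" v "\<lambda>_. 0" a b] by (simp add: H2star_def)
qed

lemma H2star_zero: "(\<lambda>_. 0) \<in> H2star L l"
proof -
  interpret H: lin_space "Hs 2 \<Omega>" by (rule Hs_lin_space[OF \<Omega>.meas])
  show ?thesis using H.zero Hs_mono[OF _ H.zero, of 1] \<Omega>.edge_trace_smooth[OF smooth_const[of 0], of "\<lambda>_. 0"] by (simp add: H2star_def)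
qed

lemma H2star_cong:
  assumes u: "u \<in> H2star L l" and ae: "AE x in lebesgue_on \<Omega>. u x = u' x" shows "u' \<in> H2star L l"
  using u Hs_cong[OF \<Omega>.meas _ ae] \<Omega>.edge_trace_cong[OF _ ae] unfolding H2star_def by blast

lemma Z_star: "v \<in> Z ==> v \<in> H2star L l"
  by (simp add: Zh_def)

lemma Z_ZE: "v \<in> Z ==> vs \<in> M ==> v \<in> ZE \<sigma> k vs"
  by (simp add: Zh_def)

lemma Z_Hs: "v \<in> Z ==> v \<in> Hs 2 \<Omega>"
  using Z_star H2starE by blast

lemma Z_L2: "v \<in> Z ==> v \<in> L2 \<Omega>"
  using Z_Hs Hs_L2 by blast

lemma ZE_lin: "vs \<in> M ==> lin_space (ZE \<sigma> k vs)"
  using velement_ex velement.ZE_lin_space by blast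

lemma Z_lin: "lin_space Z"
proof
  show "(\<lambda>_. 0) \<in> Z" unfolding Zh_def using H2star_zero lin_space.zero[OF ZE_lin] by blast
  show "lc a u b v \<in> Z" if "u \<in> Z" "v \<in> Z" for u v a b
    unfolding Zh_def mem_Collect_eq using H2star_comb[OF Z_star Z_star] lin_space.comb[OF ZE_lin Z_ZE Z_ZE] that by blast
qed

lemma Z_cong:
  assumes u: "u \<in> Z" and ae: "AE x in lebesgue_on \<Omega>. u x = u' x" shows "u' \<in> Z"
  unfolding Zh_def mem_Collect_eq
proof (intro conjI ballI)
  show "u' \<in> H2star L l" by (rule H2star_cong[OF Z_star[OF u] ae])
  fix vs assume vs: "vs \<in> M"
  obtain c \<rho> where "velement vs c \<rho> \<sigma> k" using velement_ex[OF vs] by blast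
  then show "u' \<in> ZE \<sigma> k vs" by (rule velement.ZE_cong[OF _ Z_ZE[OF u vs] AE_region[OF vs ae]])
qed

subsection \<open>Closedness in the norm of \<open>H\<^sup>2\<close>\<close>

text \<open>Zero boundary values pass to the limit as traces on the plate, and L^2 norms over an
  element are dominated by those over the plate, so convergence restricts to every element.\<close>

lemma Z_closed:
  assumes u: "\<And>n. u n \<in> Z" and u': "u' \<in> Hs 2 \<Omega>" "\<Omega>.H2lim u u'"
  shows "u' \<in> Z"
  unfolding Zh_def mem_Collect_eq
proof (intro conjI ballI)
  note uH = Z_Hs[OF u]
  note H1 = \<Omega>.H2lim_H1lim(1)[OF uH u', unfolded \<Omega>.H1lim_def]
  have u1: "u' \<in> Hs 1 \<Omega>" by (rule Hs_mono[OF _ u'(1)]) simp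
  have "edge_trace \<Omega> a b u' (\<lambda>_. 0)" if t: "\<And>n. edge_trace \<Omega> a b (u n) (\<lambda>_. 0)" for a b
  proof (rule \<Omega>.edge_trace_limit[OF t u1])
    show "(\<lambda>s. 0) \<in> L2 {0..1::real}" by (rule L2.zero)
    show "(\<lambda>n. l2norm {0..1} (\<lambda>s::real. 0 - 0)) \<longlonglongrightarrow> 0" by (simp add: l2norm_def l2ip_def)
  qed (use H1 in auto)
  then show "u' \<in> H2star L l" using u'(1) Z_star[OF u] unfolding H2star_def by blast
  fix vs assume vs: "vs \<in> M"
  obtain c \<rho> where v: "velement vs c \<rho> \<sigma> k" using velement_ex[OF vs] by blast
  interpret R: domain "region vs" by (rule region_domain[OF vs])
  have le: "l2norm (region vs) f \<le> l2norm \<Omega> f" if f: "f \<in> L2 \<Omega>" for f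
  proof -
    have "l2ip (region vs) f f \<le> (\<Sum>vs\<in>M. l2ip (region vs) f f)"
      using fin vs by (intro member_le_sum) auto
    then show ?thesis unfolding l2norm_def l2ip_sum[OF f f] by simp
  qed
  have lim: "L2lim (region vs) f f'"
    if f: "\<And>n. f n \<in> L2 \<Omega>" "f' \<in> L2 \<Omega>" and l: "L2lim \<Omega> f f'" for f f'
  proof (rule Lim_null_comparison[OF always_eventually l], rule allI)
    show "norm (l2norm (region vs) (\<lambda>x. f n x - f' x)) \<le> l2norm \<Omega> (\<lambda>x. f n x - f' x)" for n
      using le[OF L2.diff[OF f(1)[of n] f(2)]] by simp
  qed
  have "R.H2lim u u'" unfolding R.H2lim_def
  proof (intro conjI allI impI)
    show "L2lim (region vs) u u'"
      using u'(2) by (intro lim Hs_L2[OF uH] Hs_L2[OF u'(1)]) (simp add: \<Omega>.H2lim_def)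
    fix i j :: nat assume ij: "1 \<le> i + j \<and> i + j \<le> 2"
    then have ij2: "i + j \<le> 2" by simp
    have e: "AE x in lebesgue_on (region vs). wD \<Omega> i j w x = wD (region vs) i j w x" if "w \<in> Hs 2 \<Omega>" for w
      using wD_region_AE[OF vs that ij2] by eventually_elim simp
    have "L2lim \<Omega> (\<lambda>n. wD \<Omega> i j (u n)) (wD \<Omega> i j u')" using u'(2) ij by (simp add: \<Omega>.H2lim_def)
    then have "L2lim (region vs) (\<lambda>n. wD \<Omega> i j (u n)) (wD \<Omega> i j u')"
      by (intro lim Hs_wD_L2[OF uH ij2] Hs_wD_L2[OF u'(1) ij2])
    then show "L2lim (region vs) (\<lambda>n. wD (region vs) i j (u n)) (wD (region vs) i j u')"
      by (rule R.l2norm_lim_cong[OF _ _ _ _ _ e[OF uH] e[OF u'(1)]])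
        (intro L2_region[OF vs] Hs_wD_L2[OF _ ij2] Hs_region[OF vs] uH u'(1))+
  qed
  then show "u' \<in> ZE \<sigma> k vs" by (rule velement.ZE_closed[OF v Z_ZE[OF u vs] Hs_region[OF vs u'(1)]])
qed

subsection \<open>Completeness\<close>

text \<open>Each weak derivative converges in L^2 separately; since weak differentiation is defined
  by duality, the limits are the derivatives of the limit function.\<close>

lemma Z_complete:
  assumes u: "\<And>n. u n \<in> Z"
    and cauchy: "\<And>i j e. i + j \<le> 2 ==> 0 < e ==> \<exists>N. \<forall>m\<ge>N. \<forall>n\<ge>N. l2norm \<Omega> (wD \<Omega> i j (\<lambda>x. u m x - u n x)) < e"
  shows "\<exists>u'\<in>Z. \<Omega>.H2lim u u'"
proof -
  note uH = Z_Hs[OF u]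
  have lm: "\<Omega> \<in> lmeasurable" using lmeasurable_open[OF \<Omega>.bd \<Omega>.op] .
  have "\<exists>v\<in>L2 \<Omega>. L2lim \<Omega> (\<lambda>n. wD \<Omega> i j (u n)) v" if ij: "i + j \<le> 2" for i j
  proof (rule L2_complete[OF lm Hs_wD_L2[OF uH ij]])
    show "\<exists>N. \<forall>m\<ge>N. \<forall>n\<ge>N. l2norm \<Omega> (\<lambda>x. wD \<Omega> i j (u m) x - wD \<Omega> i j (u n) x) < e" if "0 < e" for e
      using cauchy[OF ij that] unfolding \<Omega>.l2norm_wD_diff[OF uH uH ij] .
  qed
  then have "\<forall>ij. \<exists>v. fst ij + snd ij \<le> 2 --> v \<in> L2 \<Omega> \<and> L2lim \<Omega> (\<lambda>n. wD \<Omega> (fst ij) (snd ij) (u n)) v" by blast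
  then obtain w where w: "\<forall>ij. fst ij + snd ij \<le> 2 --> w ij \<in> L2 \<Omega> \<and> L2lim \<Omega> (\<lambda>n. wD \<Omega> (fst ij) (snd ij) (u n)) (w ij)"
    using choice[of "\<lambda>ij v. fst ij + snd ij \<le> 2 --> v \<in> L2 \<Omega> \<and> L2lim \<Omega> (\<lambda>n. wD \<Omega> (fst ij) (snd ij) (u n)) v"] by blast
  have wL: "w (i, j) \<in> L2 \<Omega>" and wl: "L2lim \<Omega> (\<lambda>n. wD \<Omega> i j (u n)) (w (i, j))" if "i + j \<le> 2" for i j
    using w[rule_format, of "(i, j)"] that by auto
  have e0: "AE x in lebesgue_on \<Omega>. wD \<Omega> 0 0 (u n) x = u n x" for n by (rule wD_AE[OF \<Omega>.op is_wderiv_00[OF Hs_L2[OF uH]]])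
  have l0: "L2lim \<Omega> u (w (0, 0))"
    by (rule \<Omega>.l2norm_lim_cong[OF wl[of 0 0] _ _ _ _ e0]) (auto intro: Hs_wD_L2[OF uH] wL Hs_L2[OF uH])
  have d: "is_wderiv \<Omega> i j (w (0, 0)) (w (i, j))" if ij: "i + j \<le> 2" for i j
    by (rule is_wderiv_limit[OF \<Omega>.meas Hs_wD[OF uH ij] Hs_L2[OF uH] wL[of 0 0] wL[OF ij] l0 wl[OF ij]]) simp
  have H: "w (0, 0) \<in> Hs 2 \<Omega>" by (rule Hs2I[OF wL[of 0 0] d d d d d]) simp_all
  have lim: "\<Omega>.H2lim u (w (0, 0))" unfolding \<Omega>.H2lim_def
  proof (intro conjI allI impI l0)
    fix i j :: nat assume "1 \<le> i + j \<and> i + j \<le> 2"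
    then have ij: "i + j \<le> 2" by simp
    have "AE x in lebesgue_on \<Omega>. w (i, j) x = wD \<Omega> i j (w (0, 0)) x" using wD_AE[OF \<Omega>.op d[OF ij]] by eventually_elim simp
    then show "L2lim \<Omega> (\<lambda>n. wD \<Omega> i j (u n)) (wD \<Omega> i j (w (0, 0)))"
      by (intro \<Omega>.l2norm_lim_cong[OF wl[OF ij] Hs_wD_L2[OF uH ij] wL[OF ij] Hs_wD_L2[OF uH ij] Hs_wD_L2[OF H ij]]) simp_all
  qed
  show ?thesis by (rule bexI[of _ "w (0, 0)"], rule lim, rule Z_closed[OF u H lim])
qed

text \<open>The energy controls the second derivatives with factor 1/(1-\<sigma>), and D_y v comes
  from \<open>dy_estimate\<close>. Squaring the latter by (s+t)^2 \<le> 2s^2 + 2t^2 produces the 2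
  C^2 in the constant.\<close>

lemma H2_bound:
  "\<exists>C\<ge>0. \<forall>v\<in>Hs 2 \<Omega>. \<forall>i j. i + j \<le> 2 --> (l2norm \<Omega> (wD \<Omega> i j v))\<^sup>2 \<le> C * ((l2norm \<Omega> v)\<^sup>2 + (l2norm \<Omega> (wD \<Omega> 1 0 v))\<^sup>2 + Aform \<sigma> \<Omega> v v)"
proof -
  have \<Omega>e: "\<Omega> = {0<..<L} \<times> {-l<..<l}" by (simp add: Omega_def)
  obtain C where C: "0 \<le> C" "\<And>v w F. v \<in> L2 \<Omega> ==> is_wderiv \<Omega> 0 1 v w ==> is_wderiv \<Omega> 0 1 w F ==> l2norm \<Omega> w \<le> C * (l2norm \<Omega> v + l2norm \<Omega> F)"
    using dy_estimate[of "-l" l 0 L] size(1) unfolding \<Omega>e by (auto simp: less_le_trans)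
  define D where "D = 1 / (1 - \<sigma>)"
  have D: "1 \<le> D" using \<sigma> by (simp add: D_def)
  define C' where "C' = (2 * C\<^sup>2 + 1) * D"
  have C': "1 \<le> C'" "D \<le> C'" "2 * C\<^sup>2 * D \<le> C'"
  proof -
    have e: "C' = 2 * C\<^sup>2 * D + D" by (simp add: C'_def algebra_simps)
    have "0 \<le> 2 * C\<^sup>2 * D" using D by simp
    then show "1 \<le> C'" "D \<le> C'" "2 * C\<^sup>2 * D \<le> C'" using D unfolding e by linarith+
  qed
  have "(l2norm \<Omega> (wD \<Omega> i j v))\<^sup>2 \<le> C' * ((l2norm \<Omega> v)\<^sup>2 + (l2norm \<Omega> (wD \<Omega> 1 0 v))\<^sup>2 + Aform \<sigma> \<Omega> v v)" if v: "v \<in> Hs 2 \<Omega>" and ij: "i + j \<le> 2" for v i j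
  proof -
    let ?a = "(l2norm \<Omega> v)\<^sup>2" and ?b = "(l2norm \<Omega> (wD \<Omega> 1 0 v))\<^sup>2" and ?A = "Aform \<sigma> \<Omega> v v"
    have "\<Omega>.hess v = D * ((1 - \<sigma>) * \<Omega>.hess v)" using \<sigma> by (simp add: D_def)
    also have "\<dots> \<le> D * ?A" using \<Omega>.Aform_bounds(1)[OF \<sigma> v] D by (intro mult_left_mono) auto
    finally have h: "\<Omega>.hess v \<le> D * ?A" .
    have A0: "0 \<le> ?A" by (rule psd_form.nonneg[OF \<Omega>.Aform_psd[OF \<sigma>] v])
    have pos: "0 \<le> ?a" "0 \<le> ?b" by auto
    have DA: "0 \<le> D * ?A" using D A0 by simp
    have up: "x \<le> C' * (?a + ?b + ?A)" if "x \<le> ?a \<or> x \<le> ?b \<or> x \<le> D * ?A \<or> x \<le> 2 * C\<^sup>2 * D * (?a + ?A)" for x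
    proof -
      have c: "?a \<le> C' * ?a" "?b \<le> C' * ?b" "D * ?A \<le> C' * ?A" using C' pos A0 mult_right_mono[of 1 C'] mult_right_mono[of D C' ?A] by (simp_all add: mult_right_mono)
      have c2: "2 * C\<^sup>2 * D * (?a + ?A) \<le> C' * (?a + ?A)" using C'(3) pos A0 by (intro mult_right_mono) auto
      have n: "0 \<le> C' * ?a" "0 \<le> C' * ?b" "0 \<le> C' * ?A" using C'(1) pos A0 by auto
      show ?thesis using that c c2 n unfolding distrib_left by argo
    qed
    have hs: "(l2norm \<Omega> (wD \<Omega> 2 0 v))\<^sup>2 \<le> D * ?A" "(l2norm \<Omega> (wD \<Omega> 0 2 v))\<^sup>2 \<le> D * ?A" "(l2norm \<Omega> (wD \<Omega> 1 1 v))\<^sup>2 \<le> D * ?A"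
      using h zero_le_power2[of "l2norm \<Omega> (wD \<Omega> 2 0 v)"] zero_le_power2[of "l2norm \<Omega> (wD \<Omega> 0 2 v)"] zero_le_power2[of "l2norm \<Omega> (wD \<Omega> 1 1 v)"]
      unfolding \<Omega>.hess_def by linarith+
    consider "i = 0" "j = 0" | "i = 1" "j = 0" | "i = 0" "j = 1" | "i = 2" "j = 0" | "i = 1" "j = 1" | "i = 0" "j = 2" using ij by linarith
    then show ?thesis
    proof cases
      case 1
      have "l2norm \<Omega> (wD \<Omega> 0 0 v) = l2norm \<Omega> v"
        by (rule l2norm_cong_AE[OF Hs_wD_L2[OF v] Hs_L2[OF v] wD_AE[OF \<Omega>.op is_wderiv_00[OF Hs_L2[OF v]]]]) simp
      then show ?thesis using 1 up[of ?a] by simp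
    next
      case 2 then show ?thesis using up[of ?b] by simp
    next
      case 3
      have i2: "0 + 1 \<le> (2::nat)" by simp
      have "l2norm \<Omega> (wD \<Omega> 0 1 v) \<le> C * (l2norm \<Omega> v + l2norm \<Omega> (wD \<Omega> 0 2 v))"
        by (rule C(2)[OF Hs_L2[OF v] Hs_wD[OF v i2] is_wderiv_compose(4)[OF \<Omega>.op v]])
      then have "(l2norm \<Omega> (wD \<Omega> 0 1 v))\<^sup>2 \<le> (C * (l2norm \<Omega> v + l2norm \<Omega> (wD \<Omega> 0 2 v)))\<^sup>2" by (rule power_mono) simp
      also have "\<dots> = C\<^sup>2 * (l2norm \<Omega> v + l2norm \<Omega> (wD \<Omega> 0 2 v))\<^sup>2" by (simp add: power_mult_distrib)
      also have "\<dots> \<le> C\<^sup>2 * (2 * ?a + 2 * (l2norm \<Omega> (wD \<Omega> 0 2 v))\<^sup>2)"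
        using sum_squares_bound[of "l2norm \<Omega> v" "l2norm \<Omega> (wD \<Omega> 0 2 v)"] by (intro mult_left_mono) (auto simp: power2_sum)
      also have "\<dots> \<le> C\<^sup>2 * (2 * (D * ?a) + 2 * (D * ?A))"
        using hs(2) mult_right_mono[OF D pos(1)] by (intro mult_left_mono add_mono) auto
      also have "\<dots> = 2 * C\<^sup>2 * D * (?a + ?A)" by (simp add: algebra_simps)
      finally show ?thesis using 3 up by simp
    next
      case 4 then show ?thesis using up[of "(l2norm \<Omega> (wD \<Omega> 2 0 v))\<^sup>2"] hs by simp
    next
      case 5 then show ?thesis using up[of "(l2norm \<Omega> (wD \<Omega> 1 1 v))\<^sup>2"] hs by simp
    next
      case 6 then show ?thesis using up[of "(l2norm \<Omega> (wD \<Omega> 0 2 v))\<^sup>2"] hs by simp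
    qed
  qed
  then show ?thesis using C'(1) by (intro exI[of _ C']) auto
qed

end

section \<open>The discrete forms\<close>

lemma psd_form_map:
  assumes W: "psd_form W B" and V: "lin_space V" and T: "\<And>u. u \<in> V ==> T u \<in> W"
    "\<And>u v a b. u \<in> V ==> v \<in> V ==> T (lc a u b v) = (\<lambda>x. a * T u x + b * T v x)"
  shows "psd_form V (\<lambda>u v. B (T u) (T v))"
proof -
  interpret V: lin_space V by fact
  interpret W: psd_form W B by fact
  show ?thesis by unfold_locales (simp_all add: T W.sym[of "T _" "T _"] W.lin W.nonneg)
qed

lemma psd_form_add:
  assumes "psd_form V A" "psd_form V B" shows "psd_form V (\<lambda>u v. A u v + B u v)"
proof -
  interpret A: psd_form V A by fact
  interpret B: psd_form V B by fact
  show ?thesis by unfold_locales (simp_all add: A.lin B.lin A.nonneg B.nonneg A.sym[of _ _] B.sym[of _ _] algebra_simps)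
qed

lemma psd_form_sum:
  assumes V: "lin_space V" and I: "finite I" and B: "\<And>i. i \<in> I ==> psd_form V (B i)"
  shows "psd_form V (\<lambda>u v. \<Sum>i\<in>I. B i u v)"
  using I B
proof (induction I rule: finite_induct)
  case empty
  interpret V: lin_space V by fact
  show ?case by unfold_locales simp_all
next
  case (insert i I)
  then show ?case using psd_form_add[of V "B i" "\<lambda>u v. \<Sum>i\<in>I. B i u v"] by simp
qed

lemma spd_psd_form: "lin_space V ==> spd_form E V B ==> psd_form V B"
  by (intro psd_form.intro psd_form_axioms.intro) (auto simp: spd_form_def)

context velement
begin

text \<open>A stabilising form is known to be bilinear and definite only on \<open>ZE\<close>; as
  polynomials belong to \<open>ZE\<close>, the argument it receives in \<open>AhE\<close> does
  too.\<close>

lemma PiD_diff_ZE: "u \<in> ZE \<sigma> k vs ==> (\<lambda>x. u x - PiD \<sigma> k vs u x) \<in> ZE \<sigma> k vs"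
  by (rule lin_space.diff[OF ZE_lin_space _ Pk_ZE[OF PiD_Ztilde[OF ZE_Ztilde]]])

lemma PiL_diff_ZE: "u \<in> ZE \<sigma> k vs ==> (\<lambda>x. u x - PiL k E u x) \<in> ZE \<sigma> k vs"
  by (rule lin_space.diff[OF ZE_lin_space _ Pk_ZE[OF PiL_spec(1)[OF Hs_L2[OF ZE_Hs]]]])

lemma AhE_psd:
  assumes "spd_form E (ZE \<sigma> k vs) (SD vs)" shows "psd_form (ZE \<sigma> k vs) (AhE \<sigma> k SD vs)"
proof -
  note c = PiD_Ztilde_comb[OF ZE_Ztilde ZE_Ztilde]
  have 1: "psd_form (ZE \<sigma> k vs) (\<lambda>u v. Aform \<sigma> E (PiD \<sigma> k vs u) (PiD \<sigma> k vs v))"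
    by (rule psd_form_map[OF Aform_psd[OF \<sigma>] ZE_lin_space Pk_Hs[OF PiD_Ztilde[OF ZE_Ztilde]] c])
  have 2: "psd_form (ZE \<sigma> k vs) (\<lambda>u v. SD vs (\<lambda>x. u x - PiD \<sigma> k vs u x) (\<lambda>x. v x - PiD \<sigma> k vs v x))"
    by (rule psd_form_map[OF spd_psd_form[OF ZE_lin_space assms] ZE_lin_space, where T = "\<lambda>u x. u x - PiD \<sigma> k vs u x", OF PiD_diff_ZE])
      (simp_all add: c fun_eq_iff algebra_simps)
  have "AhE \<sigma> k SD vs = (\<lambda>u v. Aform \<sigma> E (PiD \<sigma> k vs u) (PiD \<sigma> k vs v) + SD vs (\<lambda>x. u x - PiD \<sigma> k vs u x) (\<lambda>x. v x - PiD \<sigma> k vs v x))"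
    by (simp add: AhE_def fun_eq_iff)
  then show ?thesis using psd_form_add[OF 1 2] by simp
qed

lemma mhE_psd:
  assumes "spd_form E (ZE \<sigma> k vs) (Sm vs)" shows "psd_form (ZE \<sigma> k vs) (mhE k Sm vs)"
proof -
  note L = Hs_L2[OF ZE_Hs]
  note c = PiL_comb[OF L L]
  have 1: "psd_form (ZE \<sigma> k vs) (\<lambda>u v. l2ip E (PiL k E u) (PiL k E v))"
    by (rule psd_form_map[OF L2.psd_form_axioms ZE_lin_space PiL_L2[OF L] c])
  have 2: "psd_form (ZE \<sigma> k vs) (\<lambda>u v. Sm vs (\<lambda>x. u x - PiL k E u x) (\<lambda>x. v x - PiL k E v x))"
    by (rule psd_form_map[OF spd_psd_form[OF ZE_lin_space assms] ZE_lin_space, where T = "\<lambda>u x. u x - PiL k E u x", OF PiL_diff_ZE])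
      (simp_all add: c fun_eq_iff algebra_simps)
  have "mhE k Sm vs = (\<lambda>u v. l2ip E (PiL k E u) (PiL k E v) + Sm vs (\<lambda>x. u x - PiL k E u x) (\<lambda>x. v x - PiL k E v x))"
    by (simp add: mhE_def fun_eq_iff)
  then show ?thesis using psd_form_add[OF 1 2] by simp
qed

lemma PiDx_L2: "u \<in> Hs 2 E ==> PiDx k vs u \<in> L2 E"
  unfolding PiDx_def by (rule PiL_L2[OF Hs_wD_L2]) auto

lemma PiDx_comb:
  assumes u: "u \<in> Hs 2 E" and v: "v \<in> Hs 2 E"
  shows "PiDx k vs (lc a u b v) = (\<lambda>x. a * PiDx k vs u x + b * PiDx k vs v x)"
proof -
  have i: "1 + 0 \<le> (2::nat)" by simp
  note L = Hs_wD_L2[OF u i] Hs_wD_L2[OF v i] Hs_wD_L2[OF lin_space.comb[OF Hs_lin_space[OF meas] u v] i]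
  show ?thesis unfolding PiDx_def PiL_cong_AE[OF L(3) wD_comb_AE[OF op u v i]] PiL_comb[OF L(1,2)] ..
qed

lemma PiDx_psd: "psd_form (ZE \<sigma> k vs) (\<lambda>u v. l2ip E (PiDx k vs u) (PiDx k vs v))"
  by (rule psd_form_map[OF L2.psd_form_axioms ZE_lin_space PiDx_L2[OF ZE_Hs] PiDx_comb[OF ZE_Hs ZE_Hs]])

end

locale plate_scheme = plate_mesh +
  fixes SD Sm :: stab and \<alpha>l \<alpha>u \<gamma>l \<gamma>u lam1 P S :: real
  assumes stab: "stabilizers \<sigma> k M SD Sm"
    and pos: "0 < \<alpha>l" "0 < \<alpha>u" "0 < \<gamma>l" "0 < \<gamma>u" "0 < lam1"
    and eigen: "\<And>v. v \<in> H2star L l ==> lam1 * (l2norm (Omega L l) (wD (Omega L l) 1 0 v))\<^sup>2 \<le> (enorm \<sigma> L l v)\<^sup>2"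
    and equiv: "\<And>vs v. vs \<in> M ==> v \<in> ZE \<sigma> k vs ==>
         \<alpha>l * Aform \<sigma> (region vs) v v \<le> AhE \<sigma> k SD vs v v \<and> AhE \<sigma> k SD vs v v \<le> \<alpha>u * Aform \<sigma> (region vs) v v \<and>
         \<gamma>l * (l2norm (region vs) v)^2 \<le> mhE k Sm vs v v \<and> mhE k Sm vs v v \<le> \<gamma>u * (l2norm (region vs) v)^2"
    and P: "0 < P" "P < \<alpha>l * lam1 / 2" and S: "0 < S"
begin

abbreviation "m \<equiv> mh k M Sm"
abbreviation "A \<equiv> Ah \<sigma> k M SD"
abbreviation "a \<equiv> axh k M"

lemma sum_psd:
  assumes "\<And>vs c \<rho>. vs \<in> M ==> velement vs c \<rho> \<sigma> k ==> psd_form (ZE \<sigma> k vs) (B vs)"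
  shows "psd_form Z (\<lambda>u v. \<Sum>vs\<in>M. B vs u v)"
proof (rule psd_form_sum[OF Z_lin fin])
  fix vs assume vs: "vs \<in> M"
  obtain c \<rho> where "velement vs c \<rho> \<sigma> k" using velement_ex[OF vs] by blast
  then have "psd_form (ZE \<sigma> k vs) (B vs)" by (rule assms[OF vs])
  then show "psd_form Z (B vs)" by (rule psd_form_subset[OF _ Z_lin]) (use Z_ZE[OF _ vs] in blast)
qed

lemma m_psd: "psd_form Z m"
proof -
  have "m = (\<lambda>u v. \<Sum>vs\<in>M. mhE k Sm vs u v)" by (simp add: mh_def fun_eq_iff)
  then show ?thesis using sum_psd[of "mhE k Sm"] velement.mhE_psd stab by (simp add: stabilizers_def)
qed

lemma A_psd: "psd_form Z A"
proof -
  have "A = (\<lambda>u v. \<Sum>vs\<in>M. AhE \<sigma> k SD vs u v)" by (simp add: Ah_def fun_eq_iff)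
  then show ?thesis using sum_psd[of "AhE \<sigma> k SD"] velement.AhE_psd stab by (simp add: stabilizers_def)
qed

lemma a_psd: "psd_form Z a"
proof -
  have "a = (\<lambda>u v. \<Sum>vs\<in>M. l2ip (region vs) (PiDx k vs u) (PiDx k vs v))" by (simp add: axh_def fun_eq_iff)
  then show ?thesis using sum_psd[of "\<lambda>vs u v. l2ip (region vs) (PiDx k vs u) (PiDx k vs v)"] velement.PiDx_psd by simp
qed

lemma m_bounds:
  assumes v: "v \<in> Z" shows "\<gamma>l * (l2norm \<Omega> v)\<^sup>2 \<le> m v v" "m v v \<le> \<gamma>u * (l2norm \<Omega> v)\<^sup>2"
proof -
  have e: "(l2norm \<Omega> v)\<^sup>2 = (\<Sum>vs\<in>M. (l2norm (region vs) v)\<^sup>2)"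
    unfolding l2norm_sq by (rule l2ip_sum[OF Z_L2[OF v] Z_L2[OF v]])
  show "\<gamma>l * (l2norm \<Omega> v)\<^sup>2 \<le> m v v" "m v v \<le> \<gamma>u * (l2norm \<Omega> v)\<^sup>2"
    unfolding e mh_def sum_distrib_left using equiv[OF _ Z_ZE[OF v]] by (auto intro!: sum_mono)
qed

lemma A_bounds:
  assumes v: "v \<in> Z" shows "\<alpha>l * Aform \<sigma> \<Omega> v v \<le> A v v" "A v v \<le> \<alpha>u * Aform \<sigma> \<Omega> v v"
  unfolding Aform_sum[OF Z_Hs[OF v] Z_Hs[OF v]] Ah_def sum_distrib_left using equiv[OF _ Z_ZE[OF v]] by (auto intro!: sum_mono)

lemma Aform_nonneg: "v \<in> Z ==> 0 \<le> Aform \<sigma> \<Omega> v v"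
  by (rule psd_form.nonneg[OF \<Omega>.Aform_psd[OF \<sigma>] Z_Hs])

lemma Dx_bound:
  assumes v: "v \<in> Z" shows "lam1 * (l2norm \<Omega> (wD \<Omega> 1 0 v))\<^sup>2 \<le> Aform \<sigma> \<Omega> v v"
  using eigen[OF Z_star[OF v]] Aform_nonneg[OF v] by (simp add: enorm_def)

lemma a_bound:
  assumes v: "v \<in> Z" shows "lam1 * a v v \<le> Aform \<sigma> \<Omega> v v"
proof -
  have i: "1 + 0 \<le> (2::nat)" by simp
  have "a v v \<le> (\<Sum>vs\<in>M. l2ip (region vs) (wD (region vs) 1 0 v) (wD (region vs) 1 0 v))"
    unfolding axh_def PiDx_def
    by (intro sum_mono domain.PiL_norm[OF region_domain] Hs_wD_L2[OF Hs_region[OF _ Z_Hs[OF v]] i])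
  also have "\<dots> = (l2norm \<Omega> (wD \<Omega> 1 0 v))\<^sup>2" unfolding l2norm_sq l2ip_wD_sum[OF Z_Hs[OF v] i Z_Hs[OF v] i] ..
  finally have "lam1 * a v v \<le> lam1 * (l2norm \<Omega> (wD \<Omega> 1 0 v))\<^sup>2" using pos by (intro mult_left_mono) auto
  then show ?thesis using Dx_bound[OF v] by linarith
qed

definition B :: "real => fld => fld => real" where
  "B \<kappa> u v = \<kappa> * m u v + A u v - P * a u v"

text \<open>Half of the discrete energy pays for the prestress: P a(v,v) is at most \<alpha>l/2
  times lam1 a(v,v), hence at most \<alpha>l/2 times the energy. The other half remains.\<close>

lemma B_lower:
  assumes \<kappa>: "0 < \<kappa>" and v: "v \<in> Z"
  shows "\<kappa> * \<gamma>l * (l2norm \<Omega> v)\<^sup>2 + \<alpha>l / 2 * Aform \<sigma> \<Omega> v v \<le> B \<kappa> v v"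
proof -
  interpret a: psd_form Z a by (rule a_psd)
  have "P * a v v \<le> \<alpha>l * lam1 / 2 * a v v" using P a.nonneg[OF v] by (intro mult_right_mono) auto
  also have "\<dots> = \<alpha>l / 2 * (lam1 * a v v)" by simp
  also have "\<dots> \<le> \<alpha>l / 2 * Aform \<sigma> \<Omega> v v" using a_bound[OF v] pos by (intro mult_left_mono) auto
  finally have "P * a v v \<le> \<alpha>l / 2 * Aform \<sigma> \<Omega> v v" .
  moreover have "\<kappa> * (\<gamma>l * (l2norm \<Omega> v)\<^sup>2) \<le> \<kappa> * m v v" using m_bounds(1)[OF v] \<kappa> by (intro mult_left_mono) auto
  ultimately show ?thesis using A_bounds(1)[OF v] unfolding B_def by (simp add: mult.assoc)
qed

lemma B_upper:
  assumes \<kappa>: "0 < \<kappa>" and v: "v \<in> Z"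
  shows "B \<kappa> v v \<le> \<kappa> * \<gamma>u * (l2norm \<Omega> v)\<^sup>2 + \<alpha>u * Aform \<sigma> \<Omega> v v"
proof -
  interpret a: psd_form Z a by (rule a_psd)
  have "0 \<le> P * a v v" using P a.nonneg[OF v] by simp
  moreover have "\<kappa> * m v v \<le> \<kappa> * (\<gamma>u * (l2norm \<Omega> v)\<^sup>2)" using m_bounds(2)[OF v] \<kappa> by (intro mult_left_mono) auto
  ultimately show ?thesis using A_bounds(2)[OF v] unfolding B_def by (simp add: mult.assoc)
qed

lemma B_psd:
  assumes \<kappa>: "0 < \<kappa>" shows "psd_form Z (B \<kappa>)"
proof -
  interpret m: psd_form Z m by (rule m_psd)
  interpret A: psd_form Z A by (rule A_psd)
  interpret a: psd_form Z a by (rule a_psd)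
  show ?thesis
  proof
    fix u v w and r s :: real assume u: "u \<in> Z" and v: "v \<in> Z"
    show "B \<kappa> u v = B \<kappa> v u" unfolding B_def using m.sym[OF u v] A.sym[OF u v] a.sym[OF u v] by simp
    have "0 \<le> \<kappa> * \<gamma>l * (l2norm \<Omega> u)\<^sup>2 + \<alpha>l / 2 * Aform \<sigma> \<Omega> u u" using \<kappa> pos Aform_nonneg[OF u] by simp
    then show "0 \<le> B \<kappa> u u" using B_lower[OF \<kappa> u] by linarith
    assume w: "w \<in> Z"
    show "B \<kappa> (lc r u s v) w = r * B \<kappa> u w + s * B \<kappa> v w"
      unfolding B_def m.lin[OF u v w] A.lin[OF u v w] a.lin[OF u v w] by (simp add: algebra_simps)
  qed
qed

lemma B_controls:
  assumes \<kappa>: "0 < \<kappa>"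
  shows "\<exists>C\<ge>0. \<forall>v\<in>Z. (l2norm \<Omega> v)\<^sup>2 \<le> C * B \<kappa> v v \<and> Aform \<sigma> \<Omega> v v \<le> C * B \<kappa> v v \<and> (l2norm \<Omega> (wD \<Omega> 1 0 v))\<^sup>2 \<le> C * B \<kappa> v v \<and> a v v \<le> C * B \<kappa> v v"
proof -
  define c1 c2 c3 where "c1 = 1 / (\<kappa> * \<gamma>l)" and "c2 = 2 / \<alpha>l" and "c3 = 2 / \<alpha>l / lam1"
  have c: "0 \<le> c1" "0 \<le> c2" "0 \<le> c3" using \<kappa> pos by (auto simp: c1_def c2_def c3_def)
  define C where "C = c1 + c2 + c3"
  have CC: "c1 \<le> C" "c2 \<le> C" "c3 \<le> C" using c by (auto simp: C_def)
  have "(l2norm \<Omega> v)\<^sup>2 \<le> C * B \<kappa> v v \<and> Aform \<sigma> \<Omega> v v \<le> C * B \<kappa> v v \<and> (l2norm \<Omega> (wD \<Omega> 1 0 v))\<^sup>2 \<le> C * B \<kappa> v v \<and> a v v \<le> C * B \<kappa> v v" if v: "v \<in> Z" for v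
  proof -
    let ?b = "B \<kappa> v v" and ?A = "Aform \<sigma> \<Omega> v v"
    have b: "0 \<le> ?b" by (rule psd_form.nonneg[OF B_psd[OF \<kappa>] v])
    have kg: "0 < \<kappa> * \<gamma>l" "0 < \<alpha>l / 2" using \<kappa> pos by auto
    have "0 \<le> \<kappa> * \<gamma>l * (l2norm \<Omega> v)\<^sup>2" "0 \<le> \<alpha>l / 2 * ?A" using kg Aform_nonneg[OF v] by auto
    then have "\<kappa> * \<gamma>l * (l2norm \<Omega> v)\<^sup>2 \<le> ?b" "\<alpha>l / 2 * ?A \<le> ?b" using B_lower[OF \<kappa> v] by linarith+
    then have 1: "(l2norm \<Omega> v)\<^sup>2 \<le> c1 * ?b" and 2: "?A \<le> c2 * ?b" using kg by (auto simp: c1_def c2_def field_simps)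
    have up: "x \<le> c3 * ?b" if "lam1 * x \<le> ?A" for x
    proof -
      have "lam1 * x \<le> c2 * ?b" using 2 that by linarith
      then show ?thesis using pos by (simp add: c2_def c3_def field_simps)
    qed
    have w: "c1 * ?b \<le> C * ?b" "c2 * ?b \<le> C * ?b" "c3 * ?b \<le> C * ?b" using b CC by (auto intro: mult_right_mono)
    show ?thesis using 1 2 up[OF Dx_bound[OF v]] up[OF a_bound[OF v]] w by linarith
  qed
  moreover have "0 \<le> C" using c by (simp add: C_def)
  ultimately show ?thesis by blast
qed

text \<open>Coercivity transfers the Cauchy property to all derivatives up to order two, so a limit
  exists in the virtual element space; the upper bound of B by the L^2 norm and the energy transfers
  convergence back.\<close>

lemma B_complete:
  assumes \<kappa>: "0 < \<kappa>" and u: "\<And>n. u n \<in> Z"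
    and cauchy: "\<And>e. 0 < e ==> \<exists>N. \<forall>m\<ge>N. \<forall>n\<ge>N. B \<kappa> (\<lambda>x. u m x - u n x) (\<lambda>x. u m x - u n x) < e"
  shows "\<exists>w\<in>Z. (\<lambda>n. B \<kappa> (\<lambda>x. u n x - w x) (\<lambda>x. u n x - w x)) \<longlonglongrightarrow> 0"
proof -
  interpret Z: lin_space Z by (rule Z_lin)
  obtain C where C: "0 \<le> C" "\<And>v. v \<in> Z ==> (l2norm \<Omega> v)\<^sup>2 \<le> C * B \<kappa> v v \<and> Aform \<sigma> \<Omega> v v \<le> C * B \<kappa> v v \<and> (l2norm \<Omega> (wD \<Omega> 1 0 v))\<^sup>2 \<le> C * B \<kappa> v v \<and> a v v \<le> C * B \<kappa> v v"
    using B_controls[OF \<kappa>] by blast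
  obtain D where D: "0 \<le> D" "\<And>v i j. v \<in> Hs 2 \<Omega> ==> i + j \<le> 2 ==> (l2norm \<Omega> (wD \<Omega> i j v))\<^sup>2 \<le> D * ((l2norm \<Omega> v)\<^sup>2 + (l2norm \<Omega> (wD \<Omega> 1 0 v))\<^sup>2 + Aform \<sigma> \<Omega> v v)"
    using H2_bound by blast
  \<comment> \<open>D from \<open>H2_bound\<close>, multiplied by the sum of its three terms, each
    of which is at most C B(v,v).\<close>
  define K where "K = D * (3 * C)"
  have K0: "0 \<le> K" using C(1) D(1) by (simp add: K_def)
  have K: "(l2norm \<Omega> (wD \<Omega> i j v))\<^sup>2 \<le> K * B \<kappa> v v" if v: "v \<in> Z" and ij: "i + j \<le> 2" for v i j
  proof -
    have "(l2norm \<Omega> v)\<^sup>2 + (l2norm \<Omega> (wD \<Omega> 1 0 v))\<^sup>2 + Aform \<sigma> \<Omega> v v \<le> 3 * (C * B \<kappa> v v)" using C(2)[OF v] by linarith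
    then have "D * ((l2norm \<Omega> v)\<^sup>2 + (l2norm \<Omega> (wD \<Omega> 1 0 v))\<^sup>2 + Aform \<sigma> \<Omega> v v) \<le> D * (3 * (C * B \<kappa> v v))" by (rule mult_left_mono[OF _ D(1)])
    then show ?thesis using D(2)[OF Z_Hs[OF v] ij] unfolding K_def by (simp add: mult.assoc)
  qed
  have cw: "\<exists>N. \<forall>m\<ge>N. \<forall>n\<ge>N. l2norm \<Omega> (wD \<Omega> i j (\<lambda>x. u m x - u n x)) < e" if ij: "i + j \<le> 2" and e: "0 < e" for i j e
  proof -
    \<comment> \<open>K may be 0, so K + 1 serves as divisor; the square is there because B is
      quadratic.\<close>
    have e': "0 < e\<^sup>2 / (K + 1)" using e K0 by (intro divide_pos_pos) auto
    obtain N where N: "\<And>m n. N \<le> m ==> N \<le> n ==> B \<kappa> (\<lambda>x. u m x - u n x) (\<lambda>x. u m x - u n x) < e\<^sup>2 / (K + 1)" using cauchy[OF e'] by blast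
    have "l2norm \<Omega> (wD \<Omega> i j (\<lambda>x. u m x - u n x)) < e" if mn: "N \<le> m" "N \<le> n" for m n
    proof -
      let ?d = "\<lambda>x. u m x - u n x"
      have d: "?d \<in> Z" by (rule Z.diff[OF u u])
      have b: "0 \<le> B \<kappa> ?d ?d" by (rule psd_form.nonneg[OF B_psd[OF \<kappa>] d])
      have "(l2norm \<Omega> (wD \<Omega> i j ?d))\<^sup>2 \<le> (K + 1) * B \<kappa> ?d ?d" using K[OF d ij] b by (simp add: distrib_right)
      also have "\<dots> < (K + 1) * (e\<^sup>2 / (K + 1))" using N[OF mn] K0 by (intro mult_strict_left_mono) auto
      also have "\<dots> = e\<^sup>2" using K0 by simp
      finally show ?thesis by (rule power_less_imp_less_base) (use e in simp)
    qed
    then show ?thesis by blast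
  qed
  obtain w where w: "w \<in> Z" "\<Omega>.H2lim u w" using Z_complete[of u, OF u cw] by blast
  have l: "L2lim \<Omega> u w" using w(2) by (simp add: \<Omega>.H2lim_def)
  have "(\<lambda>n. \<kappa> * \<gamma>u * (l2norm \<Omega> (\<lambda>x. u n x - w x))\<^sup>2 + \<alpha>u * Aform \<sigma> \<Omega> (\<lambda>x. u n x - w x) (\<lambda>x. u n x - w x)) \<longlonglongrightarrow> \<kappa> * \<gamma>u * 0\<^sup>2 + \<alpha>u * 0"
    by (intro tendsto_intros l \<Omega>.Aform_conv[OF \<sigma> Z_Hs[OF u] Z_Hs[OF w(1)] w(2)])
  then have l2: "(\<lambda>n. \<kappa> * \<gamma>u * (l2norm \<Omega> (\<lambda>x. u n x - w x))\<^sup>2 + \<alpha>u * Aform \<sigma> \<Omega> (\<lambda>x. u n x - w x) (\<lambda>x. u n x - w x)) \<longlonglongrightarrow> 0" by simp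
  have "(\<lambda>n. B \<kappa> (\<lambda>x. u n x - w x) (\<lambda>x. u n x - w x)) \<longlonglongrightarrow> 0"
  proof (rule Lim_null_comparison[OF always_eventually l2], rule allI)
    show "norm (B \<kappa> (\<lambda>x. u n x - w x) (\<lambda>x. u n x - w x)) \<le> \<kappa> * \<gamma>u * (l2norm \<Omega> (\<lambda>x. u n x - w x))\<^sup>2 + \<alpha>u * Aform \<sigma> \<Omega> (\<lambda>x. u n x - w x) (\<lambda>x. u n x - w x)" for n
      using B_upper[OF \<kappa> Z.diff[OF u[of n] w(1)]] psd_form.nonneg[OF B_psd[OF \<kappa>] Z.diff[OF u[of n] w(1)]] by simp
  qed
  then show ?thesis using w(1) by blast
qed

lemma load_lin:
  assumes f: "f \<in> L2 \<Omega>" shows "lin_on Z (load k M f)"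
  unfolding lin_on_def load_def
proof (intro ballI allI)
  fix u v and r s :: real assume u: "u \<in> Z" and v: "v \<in> Z"
  have "l2ip (region vs) (PiL k (region vs) f) (lc r u s v) = r * l2ip (region vs) (PiL k (region vs) f) u + s * l2ip (region vs) (PiL k (region vs) f) v" if vs: "vs \<in> M" for vs
    by (rule L2.lin_right[OF L2_region[OF vs Z_L2[OF u]] L2_region[OF vs Z_L2[OF v]] domain.PiL_L2[OF region_domain[OF vs] L2_region[OF vs f]]])
  then show "(\<Sum>vs\<in>M. l2ip (region vs) (PiL k (region vs) f) (lc r u s v))
      = r * (\<Sum>vs\<in>M. l2ip (region vs) (PiL k (region vs) f) u) + s * (\<Sum>vs\<in>M. l2ip (region vs) (PiL k (region vs) f) v)"
    by (simp add: sum.distrib sum_distrib_left)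
qed

lemma load_bound:
  assumes f: "f \<in> L2 \<Omega>" shows "\<exists>C\<ge>0. \<forall>v\<in>Z. \<bar>load k M f v\<bar> \<le> C * l2norm \<Omega> v"
proof -
  let ?c = "\<Sum>vs\<in>M. l2norm (region vs) (PiL k (region vs) f)"
  have "\<bar>load k M f v\<bar> \<le> ?c * l2norm \<Omega> v" if v: "v \<in> Z" for v
  proof -
    have "\<bar>l2ip (region vs) (PiL k (region vs) f) v\<bar> \<le> l2norm (region vs) (PiL k (region vs) f) * l2norm \<Omega> v" if vs: "vs \<in> M" for vs
    proof -
      have "\<bar>l2ip (region vs) (PiL k (region vs) f) v\<bar> \<le> l2norm (region vs) (PiL k (region vs) f) * l2norm (region vs) v"
        by (rule l2ip_abs_le[OF domain.PiL_L2[OF region_domain[OF vs] L2_region[OF vs f]] L2_region[OF vs Z_L2[OF v]]])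
      also have "\<dots> \<le> l2norm (region vs) (PiL k (region vs) f) * l2norm \<Omega> v"
      proof (rule mult_left_mono)
        have "l2ip (region vs) v v \<le> (\<Sum>vs\<in>M. l2ip (region vs) v v)" using fin vs by (intro member_le_sum) auto
        then show "l2norm (region vs) v \<le> l2norm \<Omega> v" unfolding l2norm_def l2ip_sum[OF Z_L2[OF v] Z_L2[OF v]] by simp
      qed simp
      finally show ?thesis .
    qed
    then have "\<bar>load k M f v\<bar> \<le> (\<Sum>vs\<in>M. l2norm (region vs) (PiL k (region vs) f) * l2norm \<Omega> v)"
      unfolding load_def by (intro order_trans[OF sum_abs] sum_mono)
    then show ?thesis by (simp add: sum_distrib_right)
  qed
  moreover have "0 \<le> ?c" by (rule sum_nonneg) simp
  ultimately show ?thesis by blast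
qed

lemma m_bound: "u \<in> Z ==> v \<in> Z ==> \<bar>m u v\<bar> \<le> sqrt (m u u) * sqrt \<gamma>u * l2norm \<Omega> v"
proof -
  assume u: "u \<in> Z" and v: "v \<in> Z"
  interpret m: psd_form Z m by (rule m_psd)
  have "sqrt (m v v) \<le> sqrt (\<gamma>u * (l2norm \<Omega> v)\<^sup>2)" using m_bounds(2)[OF v] by simp
  also have "\<dots> = sqrt \<gamma>u * l2norm \<Omega> v" by (simp add: real_sqrt_mult)
  finally have "sqrt (m u u) * sqrt (m v v) \<le> sqrt (m u u) * (sqrt \<gamma>u * l2norm \<Omega> v)"
    using m.nonneg[OF u] by (intro mult_left_mono) auto
  then show ?thesis using m.cauchy_schwarz_abs[OF u v] by (simp add: mult.assoc)
qed

subsection \<open>One time step\<close>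

context
  fixes \<tau> \<delta> :: real
  assumes \<tau>: "0 < \<tau>" and \<delta>: "0 < \<delta>"
begin

definition step :: "fld => fld => fld => fld => bool" where
  "step f u u' u'' \<longleftrightarrow> (\<forall>v \<in> Z.
     m (\<lambda>x. (u x - 2 * u' x + u'' x) / \<tau>^2) v + \<delta> * m (\<lambda>x. (u x - u'' x) / (2 * \<tau>)) v
       + A u v + Ch S P k M u * a u v = load k M f v)"

definition \<kappa> :: real where "\<kappa> = 1 / \<tau>\<^sup>2 + \<delta> / (2 * \<tau>)"

text \<open>All terms of the scheme that involve the two known iterates. The second difference and
  the centred damping difference contribute to u'' with opposite signs.\<close>

definition rhs :: "fld => fld => fld => fld => real" where
  "rhs f u' u'' v = load k M f v + 2 / \<tau>\<^sup>2 * m u' v + (\<delta> / (2 * \<tau>) - 1 / \<tau>\<^sup>2) * m u'' v"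

lemma \<kappa>_pos: "0 < \<kappa>"
  unfolding \<kappa>_def using \<tau> \<delta> by (intro add_pos_pos divide_pos_pos) auto

lemma step_iff:
  assumes u: "u \<in> Z" "u' \<in> Z" "u'' \<in> Z"
  shows "step f u u' u'' \<longleftrightarrow> (\<forall>v\<in>Z. B \<kappa> u v + S * a u u * a u v = rhs f u' u'' v)"
proof -
  interpret m: psd_form Z m by (rule m_psd)
  have "m (\<lambda>x. (u x - 2 * u' x + u'' x) / \<tau>^2) v + \<delta> * m (\<lambda>x. (u x - u'' x) / (2 * \<tau>)) v
       + A u v + Ch S P k M u * a u v = load k M f v \<longleftrightarrow> B \<kappa> u v + S * a u u * a u v = rhs f u' u'' v" if v: "v \<in> Z" for v
  proof -
    have e1: "(\<lambda>x. (u x - 2 * u' x + u'' x) / \<tau>^2) = (\<lambda>x. 1 * (1 / \<tau>\<^sup>2 * u x + (- 2 / \<tau>\<^sup>2) * u' x) + 1 / \<tau>\<^sup>2 * u'' x)"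
      by (simp add: fun_eq_iff add_divide_distrib diff_divide_distrib)
    have e2: "(\<lambda>x. (u x - u'' x) / (2 * \<tau>)) = (\<lambda>x. 1 / (2 * \<tau>) * u x + (- 1 / (2 * \<tau>)) * u'' x)"
      by (simp add: fun_eq_iff diff_divide_distrib)
    have c: "Ch S P k M u = S * a u u - P" by (simp add: Ch_def axh_def l2norm_sq)
    have m1: "m (\<lambda>x. (u x - 2 * u' x + u'' x) / \<tau>^2) v = 1 * (1 / \<tau>\<^sup>2 * m u v + (- 2 / \<tau>\<^sup>2) * m u' v) + 1 / \<tau>\<^sup>2 * m u'' v"
      unfolding e1 m.lin[OF m.comb[OF u(1,2)] u(3) v] m.lin[OF u(1,2) v] ..
    have m2: "m (\<lambda>x. (u x - u'' x) / (2 * \<tau>)) v = 1 / (2 * \<tau>) * m u v + (- 1 / (2 * \<tau>)) * m u'' v"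
      unfolding e2 m.lin[OF u(1,3) v] ..
    show ?thesis unfolding m1 m2 c B_def \<kappa>_def rhs_def by (simp add: algebra_simps)
  qed
  then show ?thesis unfolding step_def by blast
qed

lemma step_exists:
  assumes u: "u' \<in> Z" "u'' \<in> Z" and f: "f \<in> L2 \<Omega>"
  shows "\<exists>u\<in>Z. step f u u' u''"
proof -
  interpret m: psd_form Z m by (rule m_psd)
  interpret B: psd_form Z "B \<kappa>" by (rule B_psd[OF \<kappa>_pos])
  obtain C where C: "0 \<le> C" "\<And>v. v \<in> Z ==> (l2norm \<Omega> v)\<^sup>2 \<le> C * B \<kappa> v v \<and> Aform \<sigma> \<Omega> v v \<le> C * B \<kappa> v v \<and> (l2norm \<Omega> (wD \<Omega> 1 0 v))\<^sup>2 \<le> C * B \<kappa> v v \<and> a v v \<le> C * B \<kappa> v v"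
    using B_controls[OF \<kappa>_pos] by blast
  obtain c where c: "0 \<le> c" "\<And>v. v \<in> Z ==> \<bar>load k M f v\<bar> \<le> c * l2norm \<Omega> v" using load_bound[OF f] by blast
  let ?r = "2 / \<tau>\<^sup>2" and ?s = "\<delta> / (2 * \<tau>) - 1 / \<tau>\<^sup>2"
  \<comment> \<open>The load and the two mass terms are each bounded by a multiple of the L^2 norm;
    c' is the sum of the three factors.\<close>
  define c' where "c' = c + \<bar>?r\<bar> * (sqrt (m u' u') * sqrt \<gamma>u) + \<bar>?s\<bar> * (sqrt (m u'' u'') * sqrt \<gamma>u)"
  have lin: "lin_on Z (rhs f u' u'')"
    unfolding lin_on_def rhs_def using lin_onD[OF load_lin[OF f]] u by (simp add: m.lin_right algebra_simps)
  have bound: "(rhs f u' u'' v)\<^sup>2 \<le> (c'\<^sup>2 * C) * B \<kappa> v v" if v: "v \<in> Z" for v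
  proof -
    have "\<bar>rhs f u' u'' v\<bar> \<le> \<bar>load k M f v\<bar> + \<bar>?r * m u' v\<bar> + \<bar>?s * m u'' v\<bar>" unfolding rhs_def by (intro order_trans[OF abs_triangle_ineq] add_mono abs_triangle_ineq order_refl)
    also have "\<dots> \<le> c * l2norm \<Omega> v + \<bar>?r\<bar> * (sqrt (m u' u') * sqrt \<gamma>u * l2norm \<Omega> v) + \<bar>?s\<bar> * (sqrt (m u'' u'') * sqrt \<gamma>u * l2norm \<Omega> v)"
      unfolding abs_mult by (intro add_mono mult_left_mono c(2) m_bound u v) auto
    also have "\<dots> = c' * l2norm \<Omega> v" by (simp add: c'_def distrib_right mult.assoc)
    finally have "\<bar>rhs f u' u'' v\<bar>\<^sup>2 \<le> (c' * l2norm \<Omega> v)\<^sup>2" by (rule power_mono) simp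
    also have "\<dots> \<le> c'\<^sup>2 * (C * B \<kappa> v v)" unfolding power_mult_distrib using C(2)[OF v] by (intro mult_left_mono) auto
    finally show ?thesis by (simp add: mult.assoc)
  qed
  have "\<exists>u\<in>Z. \<forall>v\<in>Z. B \<kappa> u v + S * a u u * a u v = rhs f u' u'' v"
  proof (rule B.quartic_problem[OF a_psd _ lin bound, of C])
    show "a v v \<le> C * B \<kappa> v v" if "v \<in> Z" for v using C(2)[OF that] by blast
    show "0 \<le> S" using S by simp
    fix w :: "nat => fld"
    assume "\<And>n. w n \<in> Z" "\<And>e. 0 < e ==> \<exists>N. \<forall>m\<ge>N. \<forall>n\<ge>N. B \<kappa> (\<lambda>x. w m x - w n x) (\<lambda>x. w m x - w n x) < e"
    then show "\<exists>z\<in>Z. (\<lambda>n. B \<kappa> (\<lambda>x. w n x - z x) (\<lambda>x. w n x - z x)) \<longlonglongrightarrow> 0" by (rule B_complete[OF \<kappa>_pos])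
  qed
  then show ?thesis using step_iff u by blast
qed

text \<open>The preceding iterates agree only almost everywhere. As \<open>m\<close> is dominated by
  the L^2 norm, their difference is a null vector of \<open>m\<close>, so both solutions satisfy one
  and the same variational equation.\<close>

lemma step_unique:
  assumes u: "u \<in> Z" "u' \<in> Z" "u'' \<in> Z" "step f u u' u''" and v: "v \<in> Z" "v' \<in> Z" "v'' \<in> Z" "step f v v' v''"
    and e: "eq_ae \<Omega> u' v'" "eq_ae \<Omega> u'' v''"
  shows "eq_ae \<Omega> u v"
proof -
  interpret m: psd_form Z m by (rule m_psd)
  interpret B: psd_form Z "B \<kappa>" by (rule B_psd[OF \<kappa>_pos])
  have me: "m p z = m q z" if pq: "p \<in> Z" "q \<in> Z" "eq_ae \<Omega> p q" and z: "z \<in> Z" for p q z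
  proof -
    have d: "(\<lambda>x. p x - q x) \<in> Z" by (rule m.diff[OF pq(1,2)])
    have "AE x in lebesgue_on \<Omega>. p x - q x = 0" using pq(3) unfolding eq_ae_def by eventually_elim simp
    then have "l2norm \<Omega> (\<lambda>x. p x - q x) = 0" using l2norm_eq_0_iff[OF Z_L2[OF d]] by blast
    then have "m (\<lambda>x. p x - q x) (\<lambda>x. p x - q x) = 0" using m_bounds(2)[OF d] m.nonneg[OF d] by simp
    then have "m (\<lambda>x. p x - q x) z = 0" by (rule m.null_left[OF d z])
    then show ?thesis using lin_on_diff[OF m.lin_on_left[OF z] pq(1,2)] by simp
  qed
  have eu: "B \<kappa> u z + S * a u u * a u z = rhs f u' u'' z" if "z \<in> Z" for z using u(4) step_iff[OF u(1-3)] that by blast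
  have ev: "B \<kappa> v z + S * a v v * a v z = rhs f u' u'' z" if z: "z \<in> Z" for z
  proof -
    have "B \<kappa> v z + S * a v v * a v z = rhs f v' v'' z" using v(4) step_iff[OF v(1-3)] z by blast
    also have "\<dots> = rhs f u' u'' z" unfolding rhs_def me[OF u(2) v(2) e(1) z] me[OF u(3) v(3) e(2) z] ..
    finally show ?thesis .
  qed
  have d: "(\<lambda>x. u x - v x) \<in> Z" by (rule m.diff[OF u(1) v(1)])
  have "B \<kappa> (\<lambda>x. u x - v x) (\<lambda>x. u x - v x) = 0"
    by (rule B.quartic_unique[OF a_psd less_imp_le[OF S] u(1) v(1) eu ev])
  moreover have "0 \<le> \<alpha>l / 2 * Aform \<sigma> \<Omega> (\<lambda>x. u x - v x) (\<lambda>x. u x - v x)" using Aform_nonneg[OF d] pos by simp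
  ultimately have "\<kappa> * \<gamma>l * (l2norm \<Omega> (\<lambda>x. u x - v x))\<^sup>2 \<le> 0" using B_lower[OF \<kappa>_pos d] by linarith
  moreover have "0 < \<kappa> * \<gamma>l" using \<kappa>_pos pos by simp
  ultimately have "\<not> 0 < (l2norm \<Omega> (\<lambda>x. u x - v x))\<^sup>2" using mult_pos_pos[of "\<kappa> * \<gamma>l" "(l2norm \<Omega> (\<lambda>x. u x - v x))\<^sup>2"] by linarith
  then have "l2norm \<Omega> (\<lambda>x. u x - v x) = 0" by simp
  then have "AE x in lebesgue_on \<Omega>. u x - v x = 0" using l2norm_eq_0_iff[OF Z_L2[OF d]] by blast
  then show ?thesis unfolding eq_ae_def by eventually_elim simp
qed

end

end


section \<open>The time-stepping scheme\<close>

lemma (in plate_scheme) scheme_iff: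
  assumes \<tau>: "0 < T" "0 < N" and \<delta>: "0 < \<delta>"
  shows "scheme_solution \<sigma> L l \<delta> S P k M SD Sm I u0 w0 g T N U \<longleftrightarrow>
    eq_ae \<Omega> (U 0) (I u0) \<and> eq_ae \<Omega> (U 1) (\<lambda>x. U 0 x + T / real N * I w0 x) \<and>
    (\<forall>n\<in>{2..N}. U n \<in> Z \<and> step (T / real N) \<delta> (g (real n * (T / real N))) (U n) (U (n - 1)) (U (n - 2)))"
  using \<tau> \<delta> unfolding scheme_solution_def Let_def by (simp add: step_def)

text \<open>The starting values are given up to null sets and lie in the space because it is closed
  under such changes.\<close>

lemma (in plate_scheme) scheme_start:
  assumes \<tau>: "0 < T" "0 < N" and \<delta>: "0 < \<delta>" and I: "I u0 \<in> Z" "I w0 \<in> Z"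
    and U: "scheme_solution \<sigma> L l \<delta> S P k M SD Sm I u0 w0 g T N U"
  shows "U 0 \<in> Z" "U 1 \<in> Z" "n \<le> N ==> U n \<in> Z"
proof -
  note s = U[unfolded scheme_iff[OF \<tau> \<delta>]]
  have "AE x in lebesgue_on \<Omega>. I u0 x = U 0 x" using s unfolding eq_ae_def by (auto elim: eventually_mono)
  then show 0: "U 0 \<in> Z" by (rule Z_cong[OF I(1)])
  have "(\<lambda>x. 1 * U 0 x + T / real N * I w0 x) \<in> Z" by (rule lin_space.comb[OF Z_lin 0 I(2)])
  moreover have "AE x in lebesgue_on \<Omega>. 1 * U 0 x + T / real N * I w0 x = U 1 x" using s unfolding eq_ae_def by (auto elim: eventually_mono)
  ultimately show 1: "U 1 \<in> Z" by (rule Z_cong)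
  assume n: "n \<le> N"
  consider "n = 0" | "n = 1" | "n \<in> {2..N}" using n unfolding atLeastAtMost_iff by linarith
  then show "U n \<in> Z" using 0 1 s by cases auto
qed

text \<open>A two-step recursion run by dependent choice on pairs of consecutive iterates, so that
  each new state depends on one predecessor only.\<close>

lemma (in plate_scheme) scheme_exists:
  assumes \<tau>: "0 < T" "0 < N" and \<delta>: "0 < \<delta>" and I: "I u0 \<in> Z" "I w0 \<in> Z" and g: "\<And>t. t \<in> {0..T} ==> g t \<in> L2 \<Omega>"
  shows "\<exists>U. scheme_solution \<sigma> L l \<delta> S P k M SD Sm I u0 w0 g T N U"
proof -
  let ?t = "T / real N"
  have t: "0 < ?t" using \<tau> by simp
  \<comment> \<open>The pair at index n holds the iterates n and n + 1. The step equation is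
    demanded only while n + 2 \<le> N, where the load is evaluated inside the time interval.\<close>
  define Q where "Q n x y \<longleftrightarrow> fst y = snd x \<and> (n + 2 \<le> N --> step ?t \<delta> (g (real (n + 2) * ?t)) (snd y) (snd x) (fst x))" for n and x y :: "fld \<times> fld"
  define R where "R n x \<longleftrightarrow> fst x \<in> Z \<and> snd x \<in> Z \<and> (n = 0 --> x = (I u0, \<lambda>x. 1 * I u0 x + ?t * I w0 x))" for n :: nat and x :: "fld \<times> fld"
  have "\<exists>f. \<forall>n. R n (f n) \<and> Q n (f n) (f (Suc n))"
  proof (rule dependent_nat_choice)
    have "R 0 (I u0, \<lambda>x. 1 * I u0 x + ?t * I w0 x)"
      unfolding R_def using I lin_space.comb[OF Z_lin I, of 1 ?t] by simp
    then show "\<exists>x. R 0 x" by blast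
  next
    fix x n assume x: "R n x"
    then have xZ: "snd x \<in> Z" "fst x \<in> Z" by (auto simp: R_def)
    show "\<exists>y. R (Suc n) y \<and> Q n x y"
    proof (cases "n + 2 \<le> N")
      case True
      have "real (n + 2) * ?t \<le> real N * ?t" using True t by (intro mult_right_mono) auto
      then have "real (n + 2) * ?t \<in> {0..T}" using \<tau> by simp
      then obtain y where y: "y \<in> Z" "step ?t \<delta> (g (real (n + 2) * ?t)) y (snd x) (fst x)" using step_exists[OF t \<delta> xZ g] by blast
      have "R (Suc n) (snd x, y) \<and> Q n x (snd x, y)" unfolding R_def Q_def using xZ y by simp
      then show ?thesis by (rule exI)
    next
      \<comment> \<open>Past the final time the last iterate is simply repeated.\<close>
      case False
      have "R (Suc n) (snd x, snd x) \<and> Q n x (snd x, snd x)" unfolding R_def Q_def using xZ False by simp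
      then show ?thesis by (rule exI)
    qed
  qed
  then obtain f where f: "\<forall>n. R n (f n) \<and> Q n (f n) (f (Suc n))" by (rule exE)
  have fZ: "fst (f n) \<in> Z" and fs: "fst (f (Suc n)) = snd (f n)" for n using f[rule_format, of n] by (auto simp: R_def Q_def)
  have f0: "f 0 = (I u0, \<lambda>x. 1 * I u0 x + ?t * I w0 x)" using f[rule_format, of 0] by (simp add: R_def)
  have "scheme_solution \<sigma> L l \<delta> S P k M SD Sm I u0 w0 g T N (\<lambda>n. fst (f n))"
    unfolding scheme_iff[OF \<tau> \<delta>]
  proof (intro conjI ballI fZ)
    show "eq_ae \<Omega> (fst (f 0)) (I u0)" by (simp add: f0 eq_ae_def)
    have "fst (f 1) = snd (f 0)" using fs[of 0] by (simp add: One_nat_def)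
    then show "eq_ae \<Omega> (fst (f 1)) (\<lambda>x. fst (f 0) x + ?t * I w0 x)" by (simp add: f0 eq_ae_def)
    fix n assume n: "n \<in> {2..N}"
    then have "n = Suc (Suc (n - 2))" unfolding atLeastAtMost_iff by linarith
    then obtain j where j: "n = Suc (Suc j)" by blast
    have "step ?t \<delta> (g (real (j + 2) * ?t)) (snd (f (Suc j))) (snd (f j)) (fst (f j))"
      using f[rule_format, of j] n j fs unfolding Q_def by auto
    moreover have "Suc (Suc j) - 1 = Suc j" "Suc (Suc j) - 2 = j" "j + 2 = Suc (Suc j)" by simp_all
    ultimately show "step ?t \<delta> (g (real n * ?t)) (fst (f n)) (fst (f (n - 1))) (fst (f (n - 2)))"
      unfolding j by (simp only: fs)
  qed
  then show ?thesis by (rule exI[of _ "\<lambda>n. fst (f n)"])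
qed

text \<open>Strong induction, since a step depends on the two iterates before it.\<close>

lemma (in plate_scheme) scheme_unique:
  assumes \<tau>: "0 < T" "0 < N" and \<delta>: "0 < \<delta>" and I: "I u0 \<in> Z" "I w0 \<in> Z"
    and U: "scheme_solution \<sigma> L l \<delta> S P k M SD Sm I u0 w0 g T N U" and V: "scheme_solution \<sigma> L l \<delta> S P k M SD Sm I u0 w0 g T N V"
  shows "j \<le> N ==> eq_ae \<Omega> (U j) (V j)"
proof (induction j rule: less_induct)
  case (less j)
  have t: "0 < T / real N" using \<tau> by simp
  note sU = U[unfolded scheme_iff[OF \<tau> \<delta>]] and sV = V[unfolded scheme_iff[OF \<tau> \<delta>]]
  note ZU = scheme_start(3)[OF \<tau> \<delta> I U] and ZV = scheme_start(3)[OF \<tau> \<delta> I V]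
  have e0: "AE x in lebesgue_on \<Omega>. U 0 x = I u0 x" "AE x in lebesgue_on \<Omega>. V 0 x = I u0 x" using sU sV by (auto simp: eq_ae_def)
  consider "j = 0" | "j = 1" | "j \<in> {2..N}" using less.prems unfolding atLeastAtMost_iff by linarith
  then show ?case
  proof cases
    case 1
    show ?thesis unfolding eq_ae_def 1 using e0 by eventually_elim simp
  next
    case 2
    have "AE x in lebesgue_on \<Omega>. U 1 x = U 0 x + T / real N * I w0 x" "AE x in lebesgue_on \<Omega>. V 1 x = V 0 x + T / real N * I w0 x"
      using sU sV by (auto simp: eq_ae_def)
    then show ?thesis unfolding eq_ae_def 2 using e0 by eventually_elim simp
  next
    case 3
    have le: "j - 1 < j" "j - 2 < j" "j - 1 \<le> N" "j - 2 \<le> N" using 3 by auto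
    show ?thesis
      using step_unique[OF t \<delta> ZU[OF less.prems] ZU[OF le(3)] ZU[OF le(4)] _ ZV[OF less.prems] ZV[OF le(3)] ZV[OF le(4)] _ less.IH[OF le(1,3)] less.IH[OF le(2,4)]]
        sU sV 3 by blast
  qed
qed

theorem theorem3p1:
  shows "\<exists>(C1 :: real \<Rightarrow> real \<Rightarrow> real \<Rightarrow> real) (C2 :: real \<Rightarrow> real \<Rightarrow> real) (C3 :: real \<Rightarrow> real \<Rightarrow> real).
    (\<forall>a b c. C1 a b c > 0) \<and> (\<forall>a b. C2 a b > 0) \<and> (\<forall>a b. C3 a b > 0) \<and>
    (\<forall>(L::real) (l::real) (\<sigma>::real) (\<delta>::real) (S::real) (P::real) (T::real) (lam1::real)
      (g :: real \<Rightarrow> fld) (u0::fld) (\<omega>0::fld)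
      (k::nat) (M :: poly2 set) (\<gamma>::real) (I :: fld \<Rightarrow> fld) (SD::stab) (Sm::stab)
      (\<alpha>l::real) (\<alpha>u::real) (\<gamma>l::real) (\<gamma>u::real) (N::nat).
      0 < l \<and> l < L \<and> 0 < \<sigma> \<and> \<sigma> < 1 \<and> 0 < \<delta> \<and> 0 < S \<and> 0 < T \<and> 0 < N \<and> 2 \<le> k \<longrightarrow>
      C0_L2 T (Omega L l) g \<longrightarrow> u0 \<in> H2star L l \<longrightarrow> \<omega>0 \<in> H2star L l \<longrightarrow>
      0 < lam1 \<longrightarrow> least_plate_eigenvalue \<sigma> L l lam1 \<longrightarrow>
      (\<forall>v \<in> H2star L l.
         l2norm (Omega L l) v \<le> l2norm (Omega L l) (wD (Omega L l) 1 0 v) \<and>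
         lam1 * (l2norm (Omega L l) v)^2 \<le> (enorm \<sigma> L l v)^2 \<and>
         lam1 * (l2norm (Omega L l) (wD (Omega L l) 1 0 v))^2 \<le> (enorm \<sigma> L l v)^2) \<longrightarrow>
      mesh (Omega L l) M \<longrightarrow> 0 < \<gamma> \<longrightarrow> mesh_regular \<gamma> M \<longrightarrow>
      interpolation_op \<sigma> L l k M I \<longrightarrow>
      stabilizers \<sigma> k M SD Sm \<longrightarrow>
      0 < \<alpha>l \<and> 0 < \<alpha>u \<and> 0 < \<gamma>l \<and> 0 < \<gamma>u \<longrightarrow>
      (\<forall>vs \<in> M. \<forall>v \<in> ZE \<sigma> k vs.
         \<alpha>l * Aform \<sigma> (region vs) v v \<le> AhE \<sigma> k SD vs v v \<and>
         AhE \<sigma> k SD vs v v \<le> \<alpha>u * Aform \<sigma> (region vs) v v \<and>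
         \<gamma>l * (l2norm (region vs) v)^2 \<le> mhE k Sm vs v v \<and>
         mhE k Sm vs v v \<le> \<gamma>u * (l2norm (region vs) v)^2) \<longrightarrow>
      0 < P \<and> P < \<alpha>l * lam1 / 2 \<longrightarrow>
      (let \<Delta>t = T / real N;
           sol = scheme_solution \<sigma> L l \<delta> S P k M SD Sm I u0 \<omega>0 g T N;
           d = (\<lambda>m0 n. sqrt (C1 \<alpha>l \<alpha>u m0 * (enorm \<sigma> L l u0)^2 + C2 \<gamma>l \<gamma>u * (enorm \<sigma> L l \<omega>0)^2
                 + \<Delta>t * C3 \<delta> \<gamma>l * (LinfL2 (real n * \<Delta>t) (Omega L l) g)^2))
       in (\<exists>U. sol U) \<and>
          (\<forall>m0. (\<forall>U. sol U \<longrightarrow> (\<forall>n\<le>N. \<bar>Ch S P k M (U n)\<bar> \<le> m0)) \<longrightarrow>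
             (\<forall>n \<in> {2..N}. d m0 n = 0 \<or> S \<le> (\<alpha>l * lam1 - P) / (2 * d m0 n) \<longrightarrow>
                (\<forall>U V. sol U \<and> sol V \<longrightarrow> (\<forall>j\<le>n. eq_ae (Omega L l) (U j) (V j)))))))"
proof (intro exI[of _ "\<lambda>_ _ _. 1"] exI[of _ "\<lambda>_ _. 1"] conjI allI impI, goal_cases)
  \<comment> \<open>The three constants are instantiated by functions identically 1; the first three
    goals state their positivity and go to the closing \<open>simp_all\<close>.\<close>
  case (4 L l \<sigma> \<delta> S P T lam1 g u0 \<omega>0 k M \<gamma> I SD Sm \<alpha>l \<alpha>u \<gamma>l \<gamma>u N)
  note prem = 4
  interpret plate_scheme L l \<sigma> \<gamma> k M SD Sm \<alpha>l \<alpha>u \<gamma>l \<gamma>u lam1 P S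
    by unfold_locales (use prem in auto)
  have IZ: "I u0 \<in> Z" "I \<omega>0 \<in> Z" using prem(3,4,11) by (auto simp: interpolation_op_def)
  have gL: "g t \<in> L2 \<Omega>" if "t \<in> {0..T}" for t using prem(2) that by (simp add: C0_L2_def)
  have p: "0 < T" "0 < N" "0 < \<delta>" using prem(1) by auto
  let ?sol = "scheme_solution \<sigma> L l \<delta> S P k M SD Sm I u0 \<omega>0 g T N"
  have ex: "\<exists>U. ?sol U" by (rule scheme_exists) (use p IZ gL in auto)
  have "eq_ae \<Omega> (U j) (V j)" if "?sol U \<and> ?sol V" "n \<in> {2..N}" "j \<le> n" for U V n j
    by (rule scheme_unique[OF _ _ _ _ _ conjunct1[OF that(1)] conjunct2[OF that(1)]]) (use that p IZ in auto)
  then show ?case unfolding Let_def using ex by blast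
qed simp_all

end
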